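(* Let $A$ be a finite dimensional algebra over a field $k$ which is $g$-finite, $n:=|A|$, and $(h_0,\ldots,h_n)$ the $h$-vector of $\Delta(A)$. Then \[{\rm Ehr}_A(x)=\frac{\sum_{i=0}^nh_ix^i}{(1-x)^{n+1}};\] equivalently, for each $\ell\ge0$, $\#\mathrm{2\text{-}psilt}_\oplus^{\le\ell}A=\sum_{j=0}^n\binom{n+\ell-j}{n}h_j$.
   Context: $|X|$: number of isomorphism classes of indecomposable direct summands. A 2-term presilting complex is $T\in\mathsf{K}^{\rm b}(\operatorname{proj}A)$ concentrated in degrees $-1,0$ with $\operatorname{Hom}(T,T[\ell])=0$ for $\ell>0$; it is silting if also its thick closure is the whole category. $A$ is $g$-finite if there are finitely many isomorphism classes of basic 2-term silting complexes. $\mathrm{2\text{-}psilt}^jA$: isomorphism classes of basic 2-term presilting $T$ with $|T|=j$. $\Delta(A)$ is the simplicial complex whose $(j-1)$-simplices are the elements of $\mathrm{2\text{-}psilt}^jA$; $f_{-1}=1$, $f_{j-1}=\#\mathrm{2\text{-}psilt}^jA$, $h_j=\sum_{i=0}^j(-1)^{j-i}\binom{n-i}{j-i}f_{i-1}$. $\mathrm{2\text{-}psilt}_\oplus^{\le\ell}A$ is the set of isomorphism classes of (not necessarily basic) 2-term presilting complexes having at most $\ell$ indecomposable direct summands counted with multiplicity, and ${\rm Ehr}_A(x):=1+\sum_{\ell\ge1}\#(\mathrm{2\text{-}psilt}_\oplus^{\le\ell}A)x^\ell$. *)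

theory Defs
  imports "Jordan_Normal_Form.Matrix"
begin

text \<open>The algebra A is the ambient type 'a (a unital ring), made into a k-algebra
  by a scalar multiplication scale; finite dimensionality = finite spanning set.\<close>

definition fd_algebra :: "('k::field \<Rightarrow> 'a::ring_1 \<Rightarrow> 'a) \<Rightarrow> bool" where
  "fd_algebra scale \<longleftrightarrow>
     (\<forall>c x y. scale c (x + y) = scale c x + scale c y) \<and>
     (\<forall>c d x. scale (c + d) x = scale c x + scale d x) \<and>
     (\<forall>c d x. scale (c * d) x = scale c (scale d x)) \<and>
     (\<forall>x. scale 1 x = x) \<and>
     (\<forall>c x y. scale c (x * y) = scale c x * y) \<and>
     (\<forall>c x y. scale c (x * y) = x * scale c y) \<and>
     (\<exists>B. finite B \<and> (\<forall>x. \<exists>c. x = (\<Sum>b\<in>B. scale (c b) b)))"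

text \<open>A projective object is a pair (m, e) with e an idempotent m x m matrix over A;
  it stands for the module e A^m. Morphisms (m,e) -> (m',e') are matrices f with f = e' f e.\<close>

type_synonym 'a pobj = "nat \<times> 'a mat"

definition proj_obj :: "'a::ring_1 pobj \<Rightarrow> bool" where
  "proj_obj P \<longleftrightarrow> snd P \<in> carrier_mat (fst P) (fst P) \<and> snd P * snd P = snd P"

definition phom :: "'a::ring_1 pobj \<Rightarrow> 'a pobj \<Rightarrow> 'a mat set" where
  "phom P Q = {f. f \<in> carrier_mat (fst Q) (fst P) \<and> snd Q * f * snd P = f}"

type_synonym 'a cplx = "(int \<Rightarrow> 'a pobj) \<times> (int \<Rightarrow> 'a mat)"

definition cobj :: "'a cplx \<Rightarrow> int \<Rightarrow> 'a pobj" where "cobj X = fst X"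
definition cdif :: "'a cplx \<Rightarrow> int \<Rightarrow> 'a mat" where "cdif X = snd X"

definition is_complex :: "'a::ring_1 cplx \<Rightarrow> bool" where
  "is_complex X \<longleftrightarrow>
     (\<forall>i. proj_obj (cobj X i)) \<and>
     (\<forall>i. cdif X i \<in> phom (cobj X i) (cobj X (i + 1))) \<and>
     (\<forall>i. cdif X (i + 1) * cdif X i = 0\<^sub>m (fst (cobj X (i + 2))) (fst (cobj X i))) \<and>
     (\<exists>N::nat. \<forall>i. \<bar>i\<bar> > int N \<longrightarrow> snd (cobj X i) = 0\<^sub>m (fst (cobj X i)) (fst (cobj X i)))"

definition chain_map :: "'a::ring_1 cplx \<Rightarrow> 'a cplx \<Rightarrow> (int \<Rightarrow> 'a mat) \<Rightarrow> bool" where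
  "chain_map X Y f \<longleftrightarrow>
     (\<forall>i. f i \<in> phom (cobj X i) (cobj Y i)) \<and>
     (\<forall>i. cdif Y i * f i = f (i + 1) * cdif X i)"

definition null_homotopic :: "'a::ring_1 cplx \<Rightarrow> 'a cplx \<Rightarrow> (int \<Rightarrow> 'a mat) \<Rightarrow> bool" where
  "null_homotopic X Y f \<longleftrightarrow>
     (\<exists>h. (\<forall>i. h i \<in> phom (cobj X i) (cobj Y (i - 1))) \<and>
          (\<forall>i. f i = cdif Y (i - 1) * h i + h (i + 1) * cdif X i))"

definition id_cmap :: "'a::ring_1 cplx \<Rightarrow> int \<Rightarrow> 'a mat" where
  "id_cmap X i = snd (cobj X i)"

text \<open>Isomorphism in K^b(proj A) = homotopy equivalence.\<close>

definition htpy_equiv :: "'a::ring_1 cplx \<Rightarrow> 'a cplx \<Rightarrow> bool" (infix \<open>\<simeq>\<^sub>K\<close> 50) where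
  "X \<simeq>\<^sub>K Y \<longleftrightarrow> is_complex X \<and> is_complex Y \<and>
     (\<exists>f g. chain_map X Y f \<and> chain_map Y X g \<and>
        null_homotopic X X (\<lambda>i. g i * f i - id_cmap X i) \<and>
        null_homotopic Y Y (\<lambda>i. f i * g i - id_cmap Y i))"

definition zero_cplx :: "'a::ring_1 cplx" where
  "zero_cplx = ((\<lambda>i. (0, 0\<^sub>m 0 0)), (\<lambda>i. 0\<^sub>m 0 0))"

definition pobj_sum :: "'a::ring_1 pobj \<Rightarrow> 'a pobj \<Rightarrow> 'a pobj" where
  "pobj_sum P Q = (fst P + fst Q,
     four_block_mat (snd P) (0\<^sub>m (fst P) (fst Q)) (0\<^sub>m (fst Q) (fst P)) (snd Q))"

definition dsum :: "'a::ring_1 cplx \<Rightarrow> 'a cplx \<Rightarrow> 'a cplx" (infixr \<open>\<oplus>\<^sub>K\<close> 65) where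
  "X \<oplus>\<^sub>K Y = ((\<lambda>i. pobj_sum (cobj X i) (cobj Y i)),
     (\<lambda>i. four_block_mat (cdif X i) (0\<^sub>m (fst (cobj X (i + 1))) (fst (cobj Y i)))
                         (0\<^sub>m (fst (cobj Y (i + 1))) (fst (cobj X i))) (cdif Y i)))"

fun dsum_list :: "'a::ring_1 cplx list \<Rightarrow> 'a cplx" where
  "dsum_list [] = zero_cplx"
| "dsum_list (X # Xs) = X \<oplus>\<^sub>K dsum_list Xs"

definition shift :: "int \<Rightarrow> 'a::ring_1 cplx \<Rightarrow> 'a cplx" where
  "shift k X = ((\<lambda>i. cobj X (i + k)),
     (\<lambda>i. if even k then cdif X (i + k) else - cdif X (i + k)))"

definition cone :: "'a::ring_1 cplx \<Rightarrow> 'a cplx \<Rightarrow> (int \<Rightarrow> 'a mat) \<Rightarrow> 'a cplx" where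
  "cone X Y f = ((\<lambda>i. pobj_sum (cobj X (i + 1)) (cobj Y i)),
     (\<lambda>i. four_block_mat (- cdif X (i + 1)) (0\<^sub>m (fst (cobj X (i + 2))) (fst (cobj Y i)))
                         (f (i + 1)) (cdif Y i)))"

inductive_set thick :: "'a::ring_1 cplx set \<Rightarrow> 'a cplx set" for S where
  base: "X \<in> S \<Longrightarrow> is_complex X \<Longrightarrow> X \<in> thick S"
| zero: "zero_cplx \<in> thick S"
| iso: "X \<in> thick S \<Longrightarrow> X \<simeq>\<^sub>K Y \<Longrightarrow> Y \<in> thick S"
| shft: "X \<in> thick S \<Longrightarrow> shift k X \<in> thick S"
| cne: "X \<in> thick S \<Longrightarrow> Y \<in> thick S \<Longrightarrow> chain_map X Y f \<Longrightarrow> cone X Y f \<in> thick S"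
| summand: "X \<oplus>\<^sub>K Y \<in> thick S \<Longrightarrow> is_complex X \<Longrightarrow> is_complex Y \<Longrightarrow> X \<in> thick S"

definition indec :: "'a::ring_1 cplx \<Rightarrow> bool" where
  "indec X \<longleftrightarrow> is_complex X \<and> \<not> X \<simeq>\<^sub>K zero_cplx \<and>
     (\<forall>Y Z. is_complex Y \<longrightarrow> is_complex Z \<longrightarrow> X \<simeq>\<^sub>K Y \<oplus>\<^sub>K Z \<longrightarrow>
        Y \<simeq>\<^sub>K zero_cplx \<or> Z \<simeq>\<^sub>K zero_cplx)"

definition iso_class :: "'a::ring_1 cplx \<Rightarrow> 'a cplx set" where
  "iso_class X = {Y. Y \<simeq>\<^sub>K X}"

definition num_summands :: "'a::ring_1 cplx \<Rightarrow> nat" where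
  "num_summands X = card (iso_class ` {Y. indec Y \<and> (\<exists>Z. is_complex Z \<and> X \<simeq>\<^sub>K Y \<oplus>\<^sub>K Z)})"

definition basic :: "'a::ring_1 cplx \<Rightarrow> bool" where
  "basic X \<longleftrightarrow> (\<exists>Ts. X \<simeq>\<^sub>K dsum_list Ts \<and> (\<forall>Y\<in>set Ts. indec Y) \<and>
      (\<forall>i j. i < j \<longrightarrow> j < length Ts \<longrightarrow> \<not> Ts ! i \<simeq>\<^sub>K Ts ! j))"

definition two_term :: "'a::ring_1 cplx \<Rightarrow> bool" where
  "two_term X \<longleftrightarrow> is_complex X \<and>
     (\<forall>i. i \<noteq> -1 \<and> i \<noteq> 0 \<longrightarrow> snd (cobj X i) = 0\<^sub>m (fst (cobj X i)) (fst (cobj X i)))"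

definition presilting :: "'a::ring_1 cplx \<Rightarrow> bool" where
  "presilting T \<longleftrightarrow> is_complex T \<and>
     (\<forall>l::nat. l > 0 \<longrightarrow> (\<forall>f. chain_map T (shift (int l) T) f \<longrightarrow>
                               null_homotopic T (shift (int l) T) f))"

definition silting :: "'a::ring_1 cplx \<Rightarrow> bool" where
  "silting T \<longleftrightarrow> presilting T \<and> (\<forall>X. is_complex X \<longrightarrow> X \<in> thick {T})"

definition alg_cplx :: "'a::ring_1 cplx" where
  "alg_cplx = ((\<lambda>i. if i = 0 then (1, 1\<^sub>m 1) else (0, 0\<^sub>m 0 0)),
               (\<lambda>i. if i = 0 then 0\<^sub>m 0 1 else if i = -1 then 0\<^sub>m 1 0 else 0\<^sub>m 0 0))"

definition g_finite :: "'a::ring_1 itself \<Rightarrow> bool" where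
  "g_finite _ \<longleftrightarrow> finite (iso_class ` {T :: 'a cplx. two_term T \<and> silting T \<and> basic T})"

definition psilt_count :: "'a::ring_1 itself \<Rightarrow> nat \<Rightarrow> nat" where
  "psilt_count _ j = card (iso_class `
      {T :: 'a cplx. two_term T \<and> presilting T \<and> basic T \<and> num_summands T = j})"

text \<open>f_(i-1) of Delta(A), with f_(-1) = 1.\<close>

definition fvec :: "'a::ring_1 itself \<Rightarrow> nat \<Rightarrow> int" where
  "fvec a i = (if i = 0 then 1 else int (psilt_count a i))"

definition hvec :: "'a::ring_1 itself \<Rightarrow> nat \<Rightarrow> nat \<Rightarrow> int" where
  "hvec a n j = (\<Sum>i = 0..j. (-1) ^ (j - i) * int ((n - i) choose (j - i)) * fvec a i)"

definition psilt_oplus_le_count :: "'a::ring_1 itself \<Rightarrow> nat \<Rightarrow> nat" where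
  "psilt_oplus_le_count _ l = card (iso_class `
      {T :: 'a cplx. two_term T \<and> presilting T \<and>
         (\<exists>Ts. length Ts \<le> l \<and> (\<forall>Y\<in>set Ts. indec Y) \<and> T \<simeq>\<^sub>K dsum_list Ts)})"

end

theory Submission
  imports Defs "HOL-Library.Multiset"
begin

text \<open>
  By the Krull-Schmidt theorem in the homotopy category, two-term presilting complexes correspond to
  multisets of indecomposable two-term classes whose support is a face of \<open>\<Delta>(A)\<close>. A face with \<open>i\<close>
  vertices supports \<open>l choose i\<close> multisets of size at most \<open>l\<close>, so the counting function is
  \<open>\<Sum>i. f_(i-1) * (l choose i)\<close>, and repeated differences turn the \<open>f\<close>-vector into the \<open>h\<close>-vector.

  Two facts make the sum meaningful. There are finitely many vertices, since the Bongartz completion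
  places every presilting complex inside one of the finitely many silting ones. A face has at most
  \<open>n = |A|\<close> vertices: otherwise there is a linear relation between their \<open>g\<close>-vectors, that is, there
  are presilting \<open>X\<close> and \<open>Y\<close> without common summands whose terms agree after adding contractible
  complexes, so that they are maps \<open>d, d' : P \<rightarrow> Q\<close>. As \<open>X\<close> has no self-extensions, \<open>Hom(P, Q)\<close> is
  \<open>End(Q) d + d End(P)\<close>, and similarly for \<open>d'\<close>; comparing dimensions, \<open>coker d\<close> is generated by its
  image under endomorphisms of \<open>X\<close> factoring through \<open>Y\<close>. These are radical, hence \<open>d\<close> is a split
  surjection by Nakayama's lemma; likewise \<open>d'\<close>, and cancellation gives \<open>X \<simeq> Y\<close>.
\<close>

section \<open>Idempotents in a ring\<close>

text \<open>An idempotent \<open>P\<close> plays the role of a projective module; \<open>corner P Q\<close> is the group of maps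
  from \<open>P\<close> to \<open>Q\<close>.\<close>

definition corner :: "'r::ring \<Rightarrow> 'r \<Rightarrow> 'r set" where
  "corner P Q = {x. Q * x = x \<and> x * P = x}"

lemma cornerI: "Q * x = x \<Longrightarrow> x * P = x \<Longrightarrow> x \<in> corner P Q"
  and corner_left: "x \<in> corner P Q \<Longrightarrow> Q * x = x"
  and corner_right: "x \<in> corner P Q \<Longrightarrow> x * P = x"
  unfolding corner_def by auto

lemma corner_left_assoc: "x \<in> corner P Q \<Longrightarrow> Q * (x * y) = x * y"
  and corner_right_assoc: "x \<in> corner P Q \<Longrightarrow> x * (P * y) = x * y"
  by (simp_all add: corner_left corner_right flip: mult.assoc)

lemma corner_mult:
  assumes "y \<in> corner Q R" "x \<in> corner P Q" shows "y * x \<in> corner P R"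
  using assms by (intro cornerI) (simp_all add: corner_left_assoc corner_right mult.assoc)

lemma corner_zero: "0 \<in> corner P Q"
  and corner_add: "x \<in> corner P Q \<Longrightarrow> y \<in> corner P Q \<Longrightarrow> x + y \<in> corner P Q"
  and corner_uminus: "x \<in> corner P Q \<Longrightarrow> - x \<in> corner P Q"
  and corner_diff: "x \<in> corner P Q \<Longrightarrow> y \<in> corner P Q \<Longrightarrow> x - y \<in> corner P Q"
  unfolding corner_def by (auto simp: algebra_simps)

lemma corner_self: "P * P = P \<Longrightarrow> P \<in> corner P P"
  by (simp add: cornerI)

lemma corner_orthogonal:
  assumes "x \<in> corner Q R" "y \<in> corner A B" "Q * B = 0" shows "x * y = 0"
proof -
  have "x * y = x * (Q * B) * y"
    using assms(1,2) by (simp add: corner_left corner_right mult.assoc corner_right_assoc)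
  then show ?thesis using assms(3) by simp
qed

locale inverse_maps =
  fixes P Q u v :: "'r::ring"
  assumes map: "u \<in> corner P Q" and inverse_map: "v \<in> corner Q P"
    and left_inverse: "v * u = P" and right_inverse: "u * v = Q"
begin

lemma left_inverse_assoc: "v * (u * x) = P * x"
  and right_inverse_assoc: "u * (v * x) = Q * x"
  by (simp_all add: left_inverse right_inverse flip: mult.assoc)

lemmas map_simps = left_inverse right_inverse left_inverse_assoc right_inverse_assoc
  corner_left[OF map] corner_left[OF inverse_map] corner_right[OF map] corner_right[OF inverse_map]
  corner_left_assoc[OF map] corner_left_assoc[OF inverse_map]
  corner_right_assoc[OF map] corner_right_assoc[OF inverse_map]

lemma swap: "inverse_maps Q P v u"
  by unfold_locales (fact map inverse_map left_inverse right_inverse)+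

lemma trans:
  assumes "inverse_maps Q R w w'" shows "inverse_maps P R (w * u) (v * w')"
proof -
  interpret w: inverse_maps Q R w w' by fact
  show ?thesis
    by unfold_locales
      (simp_all add: corner_mult[OF w.map map] corner_mult[OF inverse_map w.inverse_map]
        mult.assoc map_simps w.map_simps)
qed

end

locale ring_biproduct =
  fixes B Y Z i1 i2 p1 p2 :: "'r::ring"
  assumes incl1: "i1 \<in> corner Y B" and incl2: "i2 \<in> corner Z B"
    and proj1: "p1 \<in> corner B Y" and proj2: "p2 \<in> corner B Z"
    and proj1_incl1: "p1 * i1 = Y" and proj2_incl2: "p2 * i2 = Z"
    and proj1_incl2: "p1 * i2 = 0" and proj2_incl1: "p2 * i1 = 0"
    and incl_proj_sum: "i1 * p1 + i2 * p2 = B"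
begin

lemma proj_incl_assoc:
  "p1 * (i1 * x) = Y * x" "p2 * (i2 * x) = Z * x" "p1 * (i2 * x) = 0" "p2 * (i1 * x) = 0"
  by (simp_all add: proj1_incl1 proj2_incl2 proj1_incl2 proj2_incl1 flip: mult.assoc)

lemmas biprod_simps =
  proj1_incl1 proj2_incl2 proj1_incl2 proj2_incl1 proj_incl_assoc
  corner_left[OF incl1] corner_left[OF incl2] corner_left[OF proj1] corner_left[OF proj2]
  corner_right[OF incl1] corner_right[OF incl2] corner_right[OF proj1] corner_right[OF proj2]
  corner_left_assoc[OF incl1] corner_left_assoc[OF incl2]
  corner_left_assoc[OF proj1] corner_left_assoc[OF proj2]
  corner_right_assoc[OF incl1] corner_right_assoc[OF incl2]
  corner_right_assoc[OF proj1] corner_right_assoc[OF proj2]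

lemma idem1: "Y * Y = Y" and idem2: "Z * Z = Z" and idem_sum: "B * B = B"
proof -
  have "(p1 * i1) * Y = p1 * i1" "(p2 * i2) * Z = p2 * i2"
    by (simp_all only: mult.assoc corner_right[OF incl1] corner_right[OF incl2])
  then show "Y * Y = Y" "Z * Z = Z" by (simp_all only: proj1_incl1 proj2_incl2)
  have "B * (i1 * p1 + i2 * p2) = i1 * p1 + i2 * p2" by (simp add: distrib_left biprod_simps)
  then show "B * B = B" by (simp only: incl_proj_sum)
qed

lemma swap: "ring_biproduct B Z Y i2 i1 p2 p1"
  using incl_proj_sum
  by unfold_locales (simp_all add: incl1 incl2 proj1 proj2 biprod_simps add.commute)

lemma precompose_left:
  assumes "inverse_maps W Y u v" shows "ring_biproduct B W Z (i1 * u) i2 (v * p1) p2"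
proof -
  interpret u: inverse_maps W Y u v by fact
  show ?thesis
    by unfold_locales
      (simp_all add: corner_mult[OF incl1 u.map] corner_mult[OF u.inverse_map proj1] incl2 proj2
        mult.assoc biprod_simps u.map_simps incl_proj_sum)
qed

lemma transport:
  assumes "inverse_maps B C t s" shows "ring_biproduct C Y Z (t * i1) (t * i2) (p1 * s) (p2 * s)"
proof -
  interpret t: inverse_maps B C t s by fact
  have "t * (i1 * (p1 * s)) + t * (i2 * (p2 * s)) = t * ((i1 * p1 + i2 * p2) * s)"
    by (simp add: distrib_left distrib_right mult.assoc)
  also have "\<dots> = C" by (simp add: incl_proj_sum t.map_simps)
  finally show ?thesis
    by unfold_locales
      (simp_all add: corner_mult[OF t.map incl1] corner_mult[OF t.map incl2]
        corner_mult[OF proj1 t.inverse_map] corner_mult[OF proj2 t.inverse_map]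
        mult.assoc t.map_simps biprod_simps)
qed

lemma restrict:
  assumes y: "y \<in> corner Y Y" "y * y = y" and z: "z \<in> corner Z Z" "z * z = z"
  shows "ring_biproduct (i1 * y * p1 + i2 * z * p2) y z (i1 * y) (i2 * z) (y * p1) (z * p2)"
proof -
  have "y * (y * x) = y * x" "z * (z * x) = z * x" for x by (simp_all add: y z flip: mult.assoc)
  then show ?thesis
    by unfold_locales
      (simp_all add: corner_def distrib_left distrib_right mult.assoc biprod_simps y(2) z(2)
        corner_left[OF y(1)] corner_right[OF y(1)] corner_left_assoc[OF y(1)]
        corner_left[OF z(1)] corner_right[OF z(1)] corner_left_assoc[OF z(1)])
qed

lemma unique_up_to_inverse_maps:
  assumes "ring_biproduct C Y Z j1 j2 q1 q2"
  shows "inverse_maps B C (j1 * p1 + j2 * p2) (i1 * q1 + i2 * q2)"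
proof -
  interpret C: ring_biproduct C Y Z j1 j2 q1 q2 by fact
  show ?thesis
    by unfold_locales
      (simp_all add: corner_add corner_mult[OF C.incl1 proj1] corner_mult[OF C.incl2 proj2]
        corner_mult[OF incl1 C.proj1] corner_mult[OF incl2 C.proj2] distrib_left distrib_right
        mult.assoc biprod_simps C.biprod_simps incl_proj_sum C.incl_proj_sum)
qed

end

lemma ring_biproduct_complement:
  assumes "E * E = E" "g \<in> corner E E" "g * g = g"
  shows "ring_biproduct E g (E - g) g (E - g) g (E - g)"
  using assms(1,3) corner_left[OF assms(2)] corner_right[OF assms(2)]
  by unfold_locales (simp_all add: corner_def algebra_simps)

section \<open>Finite dimensional subspaces\<close>

text \<open>Definitions in \<open>vector_space\<close> itself would be shadowed by its interpretation \<open>real_vector\<close>.\<close>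

locale linear_space = vector_space scale
  for scale :: "'k::field \<Rightarrow> 'b::ab_group_add \<Rightarrow> 'b"
begin

definition finite_dim :: "'b set \<Rightarrow> bool" where
  "finite_dim V \<longleftrightarrow> (\<exists>B. finite B \<and> V \<subseteq> span B)"

lemma finite_dim_subset: "finite_dim V \<Longrightarrow> W \<subseteq> V \<Longrightarrow> finite_dim W"
  unfolding finite_dim_def by blast

lemma finite_independent_subset:
  assumes "finite_dim V" "C \<subseteq> V" "independent C" shows "finite C"
  using assms independent_span_bound unfolding finite_dim_def by (meson subset_trans)

lemma finite_dim_basis:
  assumes "finite_dim V"
  obtains B where "B \<subseteq> V" "independent B" "V \<subseteq> span B" "finite B" "card B = dim V"
proof -
  obtain B where B: "B \<subseteq> V" "independent B" "V \<subseteq> span B" "card B = dim V" by (rule basis_exists)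
  then show thesis using that finite_independent_subset[OF assms B(1,2)] by blast
qed

lemma extend_basis:
  assumes "finite_dim V" "C \<subseteq> V" "independent C"
  obtains D where "C \<inter> D = {}" "D \<subseteq> V" "independent (C \<union> D)" "V \<subseteq> span (C \<union> D)"
    "finite D" "card C + card D = dim V"
proof -
  obtain B where B: "C \<subseteq> B" "B \<subseteq> V" "independent B" "V \<subseteq> span B"
    using maximal_independent_subset_extend[OF assms(2,3)] by blast
  have finite: "finite B" by (rule finite_independent_subset[OF assms(1) B(2,3)])
  have "card C + card (B - C) = card B"
    using card_Diff_subset[of C B] card_mono[OF finite B(1)] finite_subset[OF B(1) finite] B(1) by simp
  moreover have "card B = dim V" by (rule basis_card_eq_dim[OF B(2,4,3)])
  moreover have "C \<union> (B - C) = B" using B(1) by blast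
  ultimately show thesis using that[of "B - C"] B finite by auto
qed

lemma dim_subspace_less:
  assumes "finite_dim T" "subspace S" "S \<subset> T" shows "dim S < dim T"
proof -
  have "finite_dim S" using finite_dim_subset[OF assms(1)] assms(3) by blast
  then obtain C where C: "C \<subseteq> S" "independent C" "S \<subseteq> span C" "finite C" "card C = dim S"
    by (rule finite_dim_basis)
  have "C \<subseteq> T" using C(1) assms(3) by blast
  then obtain D where D: "C \<inter> D = {}" "D \<subseteq> T" "independent (C \<union> D)" "T \<subseteq> span (C \<union> D)"
    "finite D" "card C + card D = dim T" by (rule extend_basis[OF assms(1) _ C(2)])
  have "span C \<subseteq> S" using C(1) assms(2) by (rule span_minimal)
  then have "D \<noteq> {}" using D(4) assms(3) by (metis psubsetE subset_trans sup_bot_right)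
  then have "0 < card D" using D(5) by (simp add: card_gt_0_iff)
  then show ?thesis using C(5) D(6) by linarith
qed

lemma dim_mono_finite_dim:
  assumes "finite_dim T" "S \<subseteq> T" shows "dim S \<le> dim T"
proof -
  obtain C where C: "C \<subseteq> S" "independent C" "S \<subseteq> span C" "finite C" "card C = dim S"
    by (rule finite_dim_basis[OF finite_dim_subset[OF assms]])
  obtain D where "C \<inter> D = {}" "D \<subseteq> T" "independent (C \<union> D)" "T \<subseteq> span (C \<union> D)"
    "finite D" "card C + card D = dim T"
    by (rule extend_basis[OF assms(1) subset_trans[OF C(1) assms(2)] C(2)])
  then show ?thesis using C(5) by linarith
qed

lemma descending_chain_stable:
  assumes "\<And>n. subspace (K n)" "\<And>n. K (Suc n) \<subseteq> K n" "finite_dim (K 0)"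
  shows "\<exists>n::nat. K (Suc n) = K n"
proof -
  obtain n where "\<forall>m. dim (K n) \<le> dim (K m)"
    using ex_has_least_nat[of "\<lambda>_. True" _ "\<lambda>n. dim (K n)"] by blast
  then have minimal: "dim (K n) \<le> dim (K (Suc n))" by blast
  have "K n \<subseteq> K 0" by (rule lift_Suc_antimono_le[of K]) (use assms(2) in auto)
  then have "finite_dim (K n)" by (rule finite_dim_subset[OF assms(3)])
  then have "\<not> K (Suc n) \<subset> K n" using dim_subspace_less[OF _ assms(1)] minimal by (meson not_less)
  then show ?thesis using assms(2) by blast
qed

lemma maximal_subspace:
  assumes "finite_dim V" "\<And>W. A W \<Longrightarrow> subspace W \<and> W \<subseteq> V" "A W\<^sub>0"
  obtains W where "A W" "\<And>W'. A W' \<Longrightarrow> W \<subseteq> W' \<Longrightarrow> W' = W"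
proof -
  have "\<forall>W. A W \<longrightarrow> dim W < Suc (dim V)"
    using assms(1,2) dim_mono_finite_dim by (meson le_imp_less_Suc)
  from ex_has_greatest_nat[OF assms(3) this] obtain W where W: "A W" "\<forall>W'. A W' \<longrightarrow> dim W' \<le> dim W"
    by blast
  have "W' = W" if "A W'" "W \<subseteq> W'" for W'
  proof (rule ccontr)
    assume "W' \<noteq> W"
    then have "dim W < dim W'"
      using that assms(2) W(1) finite_dim_subset[OF assms(1)] by (intro dim_subspace_less) blast+
    then show False using W(2) that(1) by (meson not_less)
  qed
  then show thesis using that W(1) by blast
qed

lemma independent_Un_image:
  assumes E: "finite E" "independent E" and "finite D"
    and "\<And>d F. F \<subseteq> D \<Longrightarrow> d \<in> D \<Longrightarrow> d \<notin> F \<Longrightarrow> g d \<notin> span (E \<union> g ` F)"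
  shows "independent (E \<union> g ` D) \<and> card (E \<union> g ` D) = card E + card D"
  using assms(3,4)
proof (induction D rule: finite_induct)
  case (insert d D)
  have new: "g d \<notin> span (E \<union> g ` D)" using insert.prems insert.hyps(2) by blast
  then have "g d \<notin> E \<union> g ` D" using span_superset[of "E \<union> g ` D"] by blast
  moreover have IH: "independent (E \<union> g ` D) \<and> card (E \<union> g ` D) = card E + card D"
    using insert.prems by (intro insert.IH) blast
  then have "independent (insert (g d) (E \<union> g ` D))" using independent_insertI[OF new] by blast
  ultimately show ?case using IH insert.hyps E(1) by (simp add: card_insert_if)
qed (simp add: E(2))

text \<open>The next two lemmas compare \<open>dim (V\<^sub>1/W\<^sub>1)\<close> with \<open>dim (V\<^sub>2/W\<^sub>2)\<close> without forming quotients.\<close>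

lemma dim_quotient_le_of_surjective:
  assumes sub: "subspace W\<^sub>1" "W\<^sub>1 \<subseteq> V\<^sub>1" "W\<^sub>2 \<subseteq> V\<^sub>2" and fin: "finite_dim V\<^sub>1" "finite_dim V\<^sub>2"
    and f: "Vector_Spaces.linear scale scale f" "f ` W\<^sub>1 \<subseteq> W\<^sub>2"
    and surj: "\<And>y. y \<in> V\<^sub>2 \<Longrightarrow> \<exists>x\<in>V\<^sub>1. y - f x \<in> W\<^sub>2"
  shows "dim V\<^sub>2 + dim W\<^sub>1 \<le> dim V\<^sub>1 + dim W\<^sub>2"
proof -
  interpret f: Vector_Spaces.linear scale scale f by (fact f(1))
  obtain C where C: "C \<subseteq> W\<^sub>1" "independent C" "W\<^sub>1 \<subseteq> span C" "finite C" "card C = dim W\<^sub>1"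
    by (rule finite_dim_basis[OF finite_dim_subset[OF fin(1) sub(2)]])
  obtain D where D: "C \<inter> D = {}" "D \<subseteq> V\<^sub>1" "independent (C \<union> D)" "V\<^sub>1 \<subseteq> span (C \<union> D)"
    "finite D" "card C + card D = dim V\<^sub>1"
    by (rule extend_basis[OF fin(1) subset_trans[OF C(1) sub(2)] C(2)])
  obtain E where E: "E \<subseteq> W\<^sub>2" "independent E" "W\<^sub>2 \<subseteq> span E" "finite E" "card E = dim W\<^sub>2"
    by (rule finite_dim_basis[OF finite_dim_subset[OF fin(2) sub(3)]])
  have "V\<^sub>2 \<subseteq> span (E \<union> f ` D)"
  proof
    fix y assume "y \<in> V\<^sub>2"
    then obtain x where x: "x \<in> V\<^sub>1" "y - f x \<in> W\<^sub>2" using surj by blast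
    obtain c d where cd: "x = c + d" "c \<in> span C" "d \<in> span D"
      using x(1) D(4) unfolding span_Un by blast
    have "span C \<subseteq> W\<^sub>1" using C(1) sub(1) by (rule span_minimal)
    then have "f c \<in> span E" using cd(2) f(2) E(3) by blast
    then have "(y - f x) + f c \<in> span E" using x(2) E(3) by (intro span_add) auto
    moreover have "f d \<in> span (f ` D)" using cd(3) by (simp add: f.span_image)
    moreover have "y = (y - f x + f c) + f d" by (simp add: cd(1) f.add)
    ultimately show "y \<in> span (E \<union> f ` D)" unfolding span_Un by blast
  qed
  then have "dim V\<^sub>2 \<le> card (E \<union> f ` D)" using E(4) D(5) by (intro dim_le_card) auto
  also have "\<dots> \<le> dim W\<^sub>2 + card D"
    using card_Un_le[of E "f ` D"] card_image_le[OF D(5), of f] E(5) by linarith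
  finally show ?thesis using C(5) D(6) by linarith
qed

lemma dim_quotient_le_of_injective:
  assumes sub: "subspace V\<^sub>1" "W\<^sub>1 \<subseteq> V\<^sub>1" "subspace W\<^sub>2" "W\<^sub>2 \<subseteq> V\<^sub>2"
    and fin: "finite_dim V\<^sub>1" "finite_dim V\<^sub>2"
    and g: "Vector_Spaces.linear scale scale g" "g ` V\<^sub>1 \<subseteq> V\<^sub>2"
    and inj: "\<And>x. x \<in> V\<^sub>1 \<Longrightarrow> g x \<in> W\<^sub>2 \<Longrightarrow> x \<in> W\<^sub>1"
  shows "dim V\<^sub>1 + dim W\<^sub>2 \<le> dim V\<^sub>2 + dim W\<^sub>1"
proof -
  interpret g: Vector_Spaces.linear scale scale g by (fact g(1))
  obtain C where C: "C \<subseteq> W\<^sub>1" "independent C" "W\<^sub>1 \<subseteq> span C" "finite C" "card C = dim W\<^sub>1"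
    by (rule finite_dim_basis[OF finite_dim_subset[OF fin(1) sub(2)]])
  obtain D where D: "C \<inter> D = {}" "D \<subseteq> V\<^sub>1" "independent (C \<union> D)" "V\<^sub>1 \<subseteq> span (C \<union> D)"
    "finite D" "card C + card D = dim V\<^sub>1"
    by (rule extend_basis[OF fin(1) subset_trans[OF C(1) sub(2)] C(2)])
  obtain E where E: "E \<subseteq> W\<^sub>2" "independent E" "W\<^sub>2 \<subseteq> span E" "finite E" "card E = dim W\<^sub>2"
    by (rule finite_dim_basis[OF finite_dim_subset[OF fin(2) sub(4)]])
  have "independent (E \<union> g ` D) \<and> card (E \<union> g ` D) = card E + card D"
  proof (rule independent_Un_image[OF E(4,2) D(5)])
    fix d F assume F: "F \<subseteq> D" "d \<in> D" "d \<notin> F"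
    show "g d \<notin> span (E \<union> g ` F)"
    proof
      assume "g d \<in> span (E \<union> g ` F)"
      then obtain w x where wx: "g d = w + g x" "w \<in> span E" "x \<in> span F"
        unfolding span_Un g.span_image by blast
      have "span E \<subseteq> W\<^sub>2" "span F \<subseteq> V\<^sub>1"
        using E(1) sub(1,3) F(1) D(2) by (intro span_minimal; blast)+
      then have "d - x \<in> V\<^sub>1" "g (d - x) \<in> W\<^sub>2"
        using wx F(2) D(2) subspace_diff[OF sub(1), of d x] by (blast, simp add: g.diff) blast
      then have "d - x \<in> span C" using inj C(3) by blast
      then have "d \<in> span (C \<union> F)" unfolding span_Un using wx(3) by force
      then have "d \<in> span (C \<union> D - {d})"
        using F D(1) by (elim subsetD[OF span_mono, rotated]) auto
      then show False using D(3) F(2) unfolding dependent_def by blast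
    qed
  qed
  then have "independent (E \<union> g ` D)" "card (E \<union> g ` D) = card E + card D" by simp_all
  moreover have "E \<union> g ` D \<subseteq> V\<^sub>2" using E(1) sub(4) g(2) D(2) by blast
  ultimately have "card E + card D \<le> dim V\<^sub>2"
    using basis_card_eq_dim[OF _ span_superset, of "E \<union> g ` D"] dim_mono_finite_dim[OF fin(2)]
    by (metis dim_eq_card_independent)
  then show ?thesis using C(5) D(6) E(5) by linarith
qed

lemma injective_of_surjective_quotient:
  assumes sub: "subspace V\<^sub>1" "subspace W\<^sub>1" "W\<^sub>1 \<subseteq> V\<^sub>1" "subspace W\<^sub>2" "W\<^sub>2 \<subseteq> V\<^sub>2"
    and fin: "finite_dim V\<^sub>1" "finite_dim V\<^sub>2"
    and f: "Vector_Spaces.linear scale scale f" "f ` W\<^sub>1 \<subseteq> W\<^sub>2" "\<And>y. y \<in> V\<^sub>2 \<Longrightarrow> \<exists>x\<in>V\<^sub>1. y - f x \<in> W\<^sub>2"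
    and g: "Vector_Spaces.linear scale scale g" "g ` V\<^sub>1 \<subseteq> V\<^sub>2" "\<And>x. x \<in> V\<^sub>1 \<Longrightarrow> g x \<in> W\<^sub>2 \<Longrightarrow> x \<in> W\<^sub>1"
    and x: "x \<in> V\<^sub>1" "f x \<in> W\<^sub>2"
  shows "x \<in> W\<^sub>1"
proof (rule ccontr)
  assume "x \<notin> W\<^sub>1"
  interpret f: Vector_Spaces.linear scale scale f by (fact f(1))
  define W where "W = span (insert x W\<^sub>1)"
  have W: "W \<subseteq> V\<^sub>1" unfolding W_def using sub(1,3) x(1) by (intro span_minimal) auto
  have "f ` W \<subseteq> W\<^sub>2"
    unfolding W_def f.span_image[symmetric] using sub(4) f(2) x(2) by (intro span_minimal) auto
  then have "dim V\<^sub>2 + dim W \<le> dim V\<^sub>1 + dim W\<^sub>2"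
    using W sub fin f unfolding W_def by (intro dim_quotient_le_of_surjective) auto
  moreover have "dim V\<^sub>1 + dim W\<^sub>2 \<le> dim V\<^sub>2 + dim W\<^sub>1"
    using sub fin g by (intro dim_quotient_le_of_injective) auto
  moreover have "W\<^sub>1 \<subset> W" unfolding W_def using \<open>x \<notin> W\<^sub>1\<close> span_base by blast
  then have "dim W\<^sub>1 < dim W" using finite_dim_subset[OF fin(1) W] sub(2) by (intro dim_subspace_less)
  ultimately show False by linarith
qed

end

section \<open>Algebras over a field\<close>

locale assoc_algebra = linear_space scale
  for scale :: "'k::field \<Rightarrow> 'r::ring \<Rightarrow> 'r" +
  assumes scale_mult_left: "scale c x * y = scale c (x * y)"
    and scale_mult_right: "x * scale c y = scale c (x * y)"
begin

lemma linear_mult_left: "Vector_Spaces.linear scale scale ((*) a)"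
  by unfold_locales (simp_all add: distrib_left scale_mult_right)

lemma linear_mult_right: "Vector_Spaces.linear scale scale (\<lambda>x. x * a)"
  by unfold_locales (simp_all add: distrib_right scale_mult_left)

lemma subspace_corner: "subspace (corner P Q)"
  unfolding corner_def
  by (rule subspaceI) (auto simp: distrib_left distrib_right scale_mult_left scale_mult_right)

lemma subspace_mult_image: "subspace V \<Longrightarrow> subspace ((*) a ` V)"
proof -
  interpret mult: Vector_Spaces.linear scale scale "(*) a" by (rule linear_mult_left)
  show "subspace V \<Longrightarrow> subspace ((*) a ` V)" by (rule mult.subspace_image)
qed

definition mult_span :: "'r set \<Rightarrow> 'r set \<Rightarrow> 'r set" where
  "mult_span A B = span {a * b | a b. a \<in> A \<and> b \<in> B}"

lemma mult_span_base: "a \<in> A \<Longrightarrow> b \<in> B \<Longrightarrow> a * b \<in> mult_span A B"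
  unfolding mult_span_def by (rule span_base) blast

lemma subspace_mult_span: "subspace (mult_span A B)"
  unfolding mult_span_def by (rule subspace_span)

lemma mult_span_minimal:
  "subspace V \<Longrightarrow> (\<And>a b. a \<in> A \<Longrightarrow> b \<in> B \<Longrightarrow> a * b \<in> V) \<Longrightarrow> mult_span A B \<subseteq> V"
  unfolding mult_span_def by (rule span_minimal) blast

lemma mult_span_left_mult:
  assumes "\<And>a. a \<in> A \<Longrightarrow> c * a \<in> A'" "x \<in> mult_span A B" shows "c * x \<in> mult_span A' B"
proof -
  interpret mult: Vector_Spaces.linear scale scale "(*) c" by (rule linear_mult_left)
  have "mult_span A B \<subseteq> {x. c * x \<in> mult_span A' B}"
  proof (rule mult_span_minimal[OF mult.subspace_linear_preimage[OF subspace_mult_span]])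
    fix a b assume "a \<in> A" "b \<in> B"
    then have "(c * a) * b \<in> mult_span A' B" using assms(1) by (intro mult_span_base)
    then show "a * b \<in> {x. c * x \<in> mult_span A' B}" by (simp add: mult.assoc)
  qed
  then show ?thesis using assms(2) by blast
qed

lemma mult_span_right_mult:
  assumes "\<And>b. b \<in> B \<Longrightarrow> b * c \<in> B'" "x \<in> mult_span A B" shows "x * c \<in> mult_span A B'"
proof -
  interpret mult: Vector_Spaces.linear scale scale "\<lambda>x. x * c" by (rule linear_mult_right)
  have "mult_span A B \<subseteq> {x. x * c \<in> mult_span A B'}"
  proof (rule mult_span_minimal[OF mult.subspace_linear_preimage[OF subspace_mult_span]])
    fix a b assume "a \<in> A" "b \<in> B"
    then have "a * (b * c) \<in> mult_span A B'" using assms(1) by (intro mult_span_base)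
    then show "a * b \<in> {x. x * c \<in> mult_span A B'}" by (simp add: mult.assoc)
  qed
  then show ?thesis using assms(2) by blast
qed

end

subsection \<open>Fitting's lemma\<close>

locale corner_endo =
  fixes e f :: "'r::ring"
  assumes idem: "e * e = e" and endo: "f \<in> corner e e"
begin

definition pow :: "nat \<Rightarrow> 'r" where
  "pow n = ((*) f ^^ n) e"

lemma pow_0 [simp]: "pow 0 = e"
  and pow_Suc: "pow (Suc n) = f * pow n"
  by (simp_all add: pow_def)

lemma pow_corner: "pow n \<in> corner e e"
  by (induction n) (simp_all add: corner_self idem pow_Suc corner_mult[OF endo])

lemma pow_add: "pow (m + n) = pow m * pow n"
  by (induction m) (simp_all add: corner_left[OF pow_corner] pow_Suc mult.assoc)

lemma commute_pow:
  assumes "x \<in> corner e e" "x * f = f * x" shows "x * pow n = pow n * x"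
proof (induction n)
  case (Suc n)
  have "x * pow (Suc n) = f * (x * pow n)" by (simp add: pow_Suc assms(2) flip: mult.assoc)
  then show ?case by (simp add: Suc pow_Suc mult.assoc)
qed (simp add: corner_left[OF assms(1)] corner_right[OF assms(1)])

lemma telescope: "(\<Sum>i<n. pow i) * (e - f) = e - pow n"
proof (induction n)
  case (Suc n)
  have "pow n * f = pow (Suc n)" using commute_pow[OF endo, of n] by (simp add: pow_Suc)
  then have "pow n * (e - f) = pow n - pow (Suc n)"
    by (simp add: right_diff_distrib corner_right[OF pow_corner])
  then show ?case using Suc by (simp add: distrib_right)
qed simp

end

text \<open>The idempotent of the Fitting decomposition is \<open>f\<^sup>n w\<^sup>n\<close>, where \<open>w\<close> inverts \<open>f\<close> on the
  image of \<open>f\<^sup>n\<close>.\<close>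

locale stable_pow = corner_endo e f + w: corner_endo e w for e f w :: "'r::ring" +
  fixes n :: nat
  assumes commute: "w * f = f * w" and stable: "pow n = pow (Suc n) * w"
begin

lemma wpow_pow_commute: "w.pow m * pow k = pow k * w.pow m"
  using w.commute_pow[OF pow_corner] commute_pow[OF w.endo commute] by metis

lemma pow_absorb: "pow (n + m) * w.pow m = pow n"
proof (induction m)
  case (Suc m)
  have "pow (n + Suc m) * w.pow (Suc m) = pow m * (pow (Suc n) * w) * w.pow m"
    by (simp add: w.pow_Suc mult.assoc add.commute flip: pow_add)
      (metis add_Suc_right pow_add mult.assoc)
  also have "\<dots> = pow (n + m) * w.pow m" by (simp add: add.commute flip: stable pow_add)
  finally show ?case using Suc by simp
qed (simp add: corner_right[OF pow_corner])

definition fitting_idem :: 'r where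
  "fitting_idem = pow n * w.pow n"

lemma fitting_idem_corner: "fitting_idem \<in> corner e e"
  unfolding fitting_idem_def by (rule corner_mult[OF pow_corner w.pow_corner])

lemma fitting_idem_pow: "fitting_idem * pow n = pow n"
  using pow_absorb[of n] unfolding fitting_idem_def by (simp add: wpow_pow_commute pow_add mult.assoc)

lemma fitting_idem_idem: "fitting_idem * fitting_idem = fitting_idem"
  using fitting_idem_pow unfolding fitting_idem_def by (metis mult.assoc)

lemma fitting_idem_commute: "f * fitting_idem = fitting_idem * f"
  using commute_pow[OF endo refl, of n] w.commute_pow[OF endo, of n] commute
  unfolding fitting_idem_def by (metis mult.assoc)

lemma fitting_inverse: "f * (fitting_idem * w) = fitting_idem" "(fitting_idem * w) * f = fitting_idem"
proof -
  have "f * (fitting_idem * w) = pow (Suc n) * w * w.pow n"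
    using w.commute_pow[OF w.endo refl, of n] by (simp add: fitting_idem_def pow_Suc mult.assoc)
  then show "f * (fitting_idem * w) = fitting_idem" by (simp add: fitting_idem_def flip: stable)
  then show "(fitting_idem * w) * f = fitting_idem"
    by (simp add: commute mult.assoc) (simp add: fitting_idem_commute flip: mult.assoc)
qed

lemma fitting_quasi_inverse:
  "(e - f) * ((e - fitting_idem) * (\<Sum>i<n. pow i)) = e - fitting_idem"
  "((e - fitting_idem) * (\<Sum>i<n. pow i)) * (e - f) = e - fitting_idem"
proof -
  let ?g = fitting_idem and ?r = "\<Sum>i<n. pow i"
  have r: "?r * (e - f) = e - pow n" by (rule telescope)
  have "f * ?r = ?r * f" "e * ?r = ?r * e"
    by (simp_all add: sum_distrib_left sum_distrib_right commute_pow[OF endo refl]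
        corner_left[OF pow_corner] corner_right[OF pow_corner])
  then have r': "(e - f) * ?r = e - pow n" using r by (simp add: left_diff_distrib right_diff_distrib)
  have remainder: "(e - ?g) * (e - pow n) = e - ?g"
    by (simp add: left_diff_distrib right_diff_distrib idem corner_right[OF fitting_idem_corner]
        corner_left[OF pow_corner] fitting_idem_pow)
  then show "((e - ?g) * ?r) * (e - f) = e - ?g" by (simp add: mult.assoc r)
  have "(e - f) * ((e - ?g) * ?r) = (e - ?g) * ((e - f) * ?r)"
    using fitting_idem_commute corner_left[OF fitting_idem_corner] corner_right[OF fitting_idem_corner]
      corner_left[OF endo] corner_right[OF endo]
    by (simp add: left_diff_distrib right_diff_distrib flip: mult.assoc)
  then show "(e - f) * ((e - ?g) * ?r) = e - ?g" by (simp only: r' remainder)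
qed

end

context assoc_algebra
begin

lemma pow_stabilizes:
  assumes "corner_endo e f" "finite_dim (corner e e)"
  obtains n w where "w \<in> span (range (corner_endo.pow e f))"
    "corner_endo.pow e f n = corner_endo.pow e f (Suc n) * w"
proof -
  interpret corner_endo e f by fact
  define K where "K n = span (pow ` {n..})" for n
  have "K 0 \<subseteq> corner e e"
    unfolding K_def using pow_corner by (intro span_minimal[OF _ subspace_corner]) blast
  then have "\<exists>n. K (Suc n) = K n"
    using finite_dim_subset[OF assms(2)] unfolding K_def
    by (intro descending_chain_stable) (auto intro!: span_mono image_mono)
  then obtain n where "K (Suc n) = K n" by blast
  moreover have "pow n \<in> K n" unfolding K_def by (rule span_base) auto
  moreover have "K (Suc n) = (*) (pow (Suc n)) ` span (range pow)"
  proof -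
    interpret mult: Vector_Spaces.linear scale scale "(*) (pow (Suc n))" by (rule linear_mult_left)
    have "{Suc n..} = range ((+) (Suc n))" by (auto simp: image_iff le_iff_add)
    then have "pow ` {Suc n..} = (*) (pow (Suc n)) ` range pow"
      by (simp add: image_image pow_add del: add_Suc)
    then show ?thesis unfolding K_def by (simp add: mult.span_image)
  qed
  ultimately show thesis using that by blast
qed

lemma fitting:
  assumes "corner_endo e f" "finite_dim (corner e e)"
    and S: "subspace S" "\<And>x y. x \<in> S \<Longrightarrow> y \<in> S \<Longrightarrow> x * y \<in> S" "e \<in> S" "f \<in> S"
  obtains g u v where "g \<in> S" "u \<in> S" "v \<in> S" "g \<in> corner e e" "g * g = g"
    "f * u = g" "u * f = g" "(e - f) * v = e - g" "v * (e - f) = e - g"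
proof -
  interpret corner_endo e f by fact
  obtain n w where w: "w \<in> span (range pow)" "pow n = pow (Suc n) * w"
    by (rule pow_stabilizes[OF assms(1,2)])
  have pow_S: "pow m \<in> S" for m by (induction m) (simp_all add: S pow_Suc)
  have w_S: "w \<in> S" using w(1) span_minimal[OF _ S(1), of "range pow"] pow_S by blast
  have w_corner: "w \<in> corner e e"
    using w(1) span_minimal[OF _ subspace_corner, of "range pow"] pow_corner by blast
  have "w * f = f * w"
    using w(1)
  proof (induction rule: span_induct_alt)
    case (step c x y)
    then show ?case
      using commute_pow[OF endo refl]
      by (auto simp: distrib_left distrib_right scale_mult_left scale_mult_right)
  qed simp
  then interpret stable_pow e f w n using w(2) idem w_corner by unfold_locales
  have wpow_S: "w.pow m \<in> S" for m by (induction m) (simp_all add: S(2,3) w_S w.pow_Suc)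
  have "fitting_idem \<in> S" unfolding fitting_idem_def by (intro S(2) pow_S wpow_S)
  moreover have "(\<Sum>i<n. pow i) \<in> S" by (intro subspace_sum[OF S(1)] pow_S)
  ultimately show thesis
    using that[OF _ _ _ fitting_idem_corner fitting_idem_idem fitting_inverse fitting_quasi_inverse]
      S(2) w_S subspace_diff[OF S(1,3)] by blast
qed

subsection \<open>Nakayama's lemma\<close>

lemma maximal_submodule_generator:
  assumes V: "subspace V" "\<And>z x. z \<in> Z \<Longrightarrow> x \<in> V \<Longrightarrow> z * x \<in> V"
    and N: "subspace N" "N \<subseteq> V" "\<And>z x. z \<in> Z \<Longrightarrow> x \<in> N \<Longrightarrow> z * x \<in> N"
    and maximal: "\<And>N'. subspace N' \<Longrightarrow> N \<subseteq> N' \<Longrightarrow> N' \<subseteq> V \<Longrightarrow> \<forall>z\<in>Z. \<forall>x\<in>N'. z * x \<in> N' \<Longrightarrow> N' = N \<or> N' = V"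
    and I: "subspace I" "I \<subseteq> Z" "\<And>z a. z \<in> Z \<Longrightarrow> a \<in> I \<Longrightarrow> z * a \<in> I"
    and s: "s \<in> V" "a \<in> I" "a * s \<notin> N"
  shows "\<exists>m\<in>N. \<exists>b\<in>I. s = m + b * s"
proof -
  interpret mult: Vector_Spaces.linear scale scale "\<lambda>x. x * s" by (rule linear_mult_right)
  define N' where "N' = {x + y | x y. x \<in> N \<and> y \<in> (\<lambda>b. b * s) ` I}"
  have N'_cases: thesis if "x \<in> N'" "\<And>m b. m \<in> N \<Longrightarrow> b \<in> I \<Longrightarrow> x = m + b * s \<Longrightarrow> thesis" for x thesis
    using that unfolding N'_def by blast
  have "subspace N'"
    unfolding N'_def by (rule subspace_sums[OF N(1) mult.subspace_image[OF I(1)]])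
  moreover have "N \<subseteq> N'" and "a * s \<in> N'"
    using subspace_0[OF I(1)] subspace_0[OF N(1)] s(2) unfolding N'_def by force+
  moreover have "N' \<subseteq> V"
    unfolding N'_def using N(2) I(2) s(1) V by (auto intro!: subspace_add[OF V(1)])
  moreover have "z * x \<in> N'" if "z \<in> Z" "x \<in> N'" for z x
  proof -
    obtain y b where "y \<in> N" "b \<in> I" "x = y + b * s" by (rule N'_cases[OF \<open>x \<in> N'\<close>])
    then have "z * x = z * y + (z * b) * s" "z * y \<in> N" "z * b \<in> I"
      using N(3) I(3) \<open>z \<in> Z\<close> by (auto simp: distrib_left mult.assoc)
    then show ?thesis unfolding N'_def by blast
  qed
  ultimately have "N' = V" using maximal[of N'] s(3) by blast
  then have "s \<in> N'" using s(1) by blast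
  then show ?thesis by (rule N'_cases) blast
qed

text \<open>\<open>V/M\<close> is a module over \<open>Z\<close> with \<open>V = M + I V\<close>, and \<open>1 - a\<close> acts invertibly for every \<open>a\<close> in
  the left ideal \<open>I\<close>. On a simple quotient of \<open>V/M\<close> some \<open>a\<close> in \<open>I\<close> would fix a generator.\<close>

lemma nakayama:
  assumes fin: "finite_dim V" and V: "subspace V" "\<And>z x. z \<in> Z \<Longrightarrow> x \<in> V \<Longrightarrow> z * x \<in> V"
    and M: "subspace M" "M \<subseteq> V" "\<And>z x. z \<in> Z \<Longrightarrow> x \<in> M \<Longrightarrow> z * x \<in> M"
    and I: "subspace I" "I \<subseteq> Z" "\<And>z a. z \<in> Z \<Longrightarrow> a \<in> I \<Longrightarrow> z * a \<in> I"
    and gen: "\<And>x. x \<in> V \<Longrightarrow> \<exists>m\<in>M. \<exists>y\<in>mult_span I V. x = m + y"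
    and inv: "\<And>a. a \<in> I \<Longrightarrow> \<exists>v\<in>Z. \<forall>x\<in>V. v * (x - a * x) - x \<in> M"
  shows "V = M"
proof (rule ccontr)
  assume "V \<noteq> M"
  define submodule where
    "submodule N \<longleftrightarrow> subspace N \<and> M \<subseteq> N \<and> N \<subseteq> V \<and> N \<noteq> V \<and> (\<forall>z\<in>Z. \<forall>x\<in>N. z * x \<in> N)" for N
  have "submodule M" using M \<open>V \<noteq> M\<close> unfolding submodule_def by blast
  then obtain N where N: "submodule N" and maximal: "\<And>N'. submodule N' \<Longrightarrow> N \<subseteq> N' \<Longrightarrow> N' = N"
    by (rule maximal_subspace[OF fin, rotated]) (auto simp: submodule_def)
  then have N_sub: "subspace N" "M \<subseteq> N" "N \<subseteq> V" "N \<noteq> V" "\<And>z x. z \<in> Z \<Longrightarrow> x \<in> N \<Longrightarrow> z * x \<in> N"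
    unfolding submodule_def by blast+
  have "\<exists>a\<in>I. \<exists>s\<in>V. a * s \<notin> N"
  proof (rule ccontr)
    assume "\<not> ?thesis"
    then have "mult_span I V \<subseteq> N" using N_sub(1) by (intro mult_span_minimal) blast+
    then have "V \<subseteq> N" using gen N_sub(1,2) subspace_add by blast
    then show False using N_sub(3,4) by blast
  qed
  then obtain a s where as: "a \<in> I" "s \<in> V" "a * s \<notin> N" by blast
  have "\<exists>m\<in>N. \<exists>b\<in>I. s = m + b * s"
  proof (rule maximal_submodule_generator[where V = V and Z = Z])
    show "N' = N \<or> N' = V"
      if "subspace N'" "N \<subseteq> N'" "N' \<subseteq> V" "\<forall>z\<in>Z. \<forall>x\<in>N'. z * x \<in> N'" for N'
      using maximal[of N'] that N_sub(2) unfolding submodule_def by blast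
  qed (fact V N_sub I as)+
  then obtain m b where mb: "m \<in> N" "b \<in> I" "s = m + b * s" by blast
  obtain v where v: "v \<in> Z" "v * (s - b * s) - s \<in> M" using inv[OF mb(2)] as(2) by blast
  have "v * m - s \<in> N" using v(2) mb(3) N_sub(2) by (metis add_diff_cancel_right' subsetD)
  then have "s \<in> N" using subspace_diff[OF N_sub(1) N_sub(5)[OF v(1) mb(1)]] by fastforce
  then have "a * s \<in> N" using N_sub(5) I(2) as(1) by blast
  then show False using as(3) by blast
qed

end

subsection \<open>Maps between two idempotents without extensions\<close>

text \<open>For maps \<open>d\<^sub>1, d\<^sub>2 : P \<rightarrow> Q\<close>, regarded as two-term complexes, \<open>square_maps P Q d\<^sub>1 d\<^sub>2\<close> consists of
  the degree zero components of chain maps, and \<open>jointly_generate\<close> says that \<open>d\<^sub>1\<close> has no extensions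
  by \<open>d\<^sub>2\<close>.\<close>

definition square_maps :: "'r::ring \<Rightarrow> 'r \<Rightarrow> 'r \<Rightarrow> 'r \<Rightarrow> 'r set" where
  "square_maps P Q d\<^sub>1 d\<^sub>2 = {\<phi> \<in> corner Q Q. \<exists>\<rho>\<in>corner P P. \<phi> * d\<^sub>1 = d\<^sub>2 * \<rho>}"

lemma square_maps_corner: "\<phi> \<in> square_maps P Q d\<^sub>1 d\<^sub>2 \<Longrightarrow> \<phi> \<in> corner Q Q"
  and square_maps_lift: "\<phi> \<in> square_maps P Q d\<^sub>1 d\<^sub>2 \<Longrightarrow> \<exists>\<rho>\<in>corner P P. \<phi> * d\<^sub>1 = d\<^sub>2 * \<rho>"
  unfolding square_maps_def by auto

lemma square_maps_mult:
  assumes "\<psi> \<in> square_maps P Q d\<^sub>2 d\<^sub>3" "\<phi> \<in> square_maps P Q d\<^sub>1 d\<^sub>2"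
  shows "\<psi> * \<phi> \<in> square_maps P Q d\<^sub>1 d\<^sub>3"
proof -
  obtain \<rho> \<sigma> where "\<rho> \<in> corner P P" "\<phi> * d\<^sub>1 = d\<^sub>2 * \<rho>" "\<sigma> \<in> corner P P" "\<psi> * d\<^sub>2 = d\<^sub>3 * \<sigma>"
    using assms square_maps_lift by metis
  then have "\<psi> * \<phi> * d\<^sub>1 = d\<^sub>3 * (\<sigma> * \<rho>)" "\<sigma> * \<rho> \<in> corner P P"
    by (simp_all add: mult.assoc corner_mult) (simp flip: mult.assoc)
  then show ?thesis
    using assms corner_mult unfolding square_maps_def by blast
qed

definition jointly_generate :: "'r::ring \<Rightarrow> 'r \<Rightarrow> 'r \<Rightarrow> 'r \<Rightarrow> bool" where
  "jointly_generate P Q d\<^sub>1 d\<^sub>2 \<longleftrightarrow>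
    (\<forall>b\<in>corner P Q. \<exists>h\<in>corner P P. \<exists>k\<in>corner Q Q. b = k * d\<^sub>1 + d\<^sub>2 * h)"

lemma jointly_generateE:
  assumes "jointly_generate P Q d\<^sub>1 d\<^sub>2" "b \<in> corner P Q"
  obtains h k where "h \<in> corner P P" "k \<in> corner Q Q" "b = k * d\<^sub>1 + d\<^sub>2 * h"
  using assms that unfolding jointly_generate_def by metis

context assoc_algebra
begin

lemma subspace_square_maps: "subspace (square_maps P Q d\<^sub>1 d\<^sub>2)"
proof -
  interpret mult: Vector_Spaces.linear scale scale "\<lambda>x. x * d\<^sub>1" by (rule linear_mult_right)
  have "square_maps P Q d\<^sub>1 d\<^sub>2 = corner Q Q \<inter> {\<phi>. \<phi> * d\<^sub>1 \<in> (*) d\<^sub>2 ` corner P P}"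
    unfolding square_maps_def by auto
  then show ?thesis
    by (simp add: subspace_inter subspace_corner subspace_mult_image
        mult.subspace_linear_preimage[of "(*) d\<^sub>2 ` corner P P"])
qed

definition generated_maps :: "'r \<Rightarrow> 'r \<Rightarrow> 'r \<Rightarrow> 'r set \<Rightarrow> 'r \<Rightarrow> 'r set" where
  "generated_maps P Q d J U = {x + y | x y. x \<in> (*) d ` corner U P \<and> y \<in> mult_span J (corner U Q)}"

lemma subspace_generated_maps: "subspace (generated_maps P Q d J U)"
  unfolding generated_maps_def
  by (intro subspace_sums subspace_mult_image subspace_corner subspace_mult_span)

lemma generated_maps_mult_span: "y \<in> mult_span J (corner U Q) \<Longrightarrow> y \<in> generated_maps P Q d J U"
  and generated_maps_image: "c \<in> corner U P \<Longrightarrow> d * c \<in> generated_maps P Q d J U"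
  using corner_zero subspace_0[OF subspace_mult_span] unfolding generated_maps_def by force+

lemma generated_maps_subset:
  assumes "d \<in> corner P Q" "J \<subseteq> corner Q Q" shows "generated_maps P Q d J U \<subseteq> corner U Q"
proof -
  have "mult_span J (corner U Q) \<subseteq> corner U Q"
    using assms(2) corner_mult by (intro mult_span_minimal[OF subspace_corner]) blast
  then show ?thesis
    unfolding generated_maps_def using assms(1) by (auto intro!: corner_add corner_mult)
qed

lemma generated_maps_right_mult:
  assumes "x \<in> generated_maps P Q d J U" "y \<in> corner U' U"
  shows "x * y \<in> generated_maps P Q d J U'"
proof -
  obtain c z where cz: "x = d * c + z" "c \<in> corner U P" "z \<in> mult_span J (corner U Q)"
    using assms(1) unfolding generated_maps_def by blast
  have "z * y \<in> mult_span J (corner U' Q)"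
    using cz(3) by (rule mult_span_right_mult[rotated]) (rule corner_mult[OF _ assms(2)])
  moreover have "x * y = d * (c * y) + z * y" by (simp add: cz(1) distrib_right mult.assoc)
  ultimately show ?thesis
    unfolding generated_maps_def using corner_mult[OF cz(2) assms(2)] by blast
qed

lemma square_span_decompose:
  assumes "jointly_generate P Q d' d'" "z \<in> mult_span (square_maps P Q d' d) (corner P Q)"
  shows "\<exists>r\<in>corner P P. \<exists>w\<in>mult_span (square_maps P Q d' d) (corner Q Q). z = d * r + w * d'"
proof -
  let ?J = "square_maps P Q d' d"
  interpret mult: Vector_Spaces.linear scale scale "\<lambda>x. x * d'" by (rule linear_mult_right)
  let ?T = "{x + y | x y. x \<in> (*) d ` corner P P \<and> y \<in> (\<lambda>w. w * d') ` mult_span ?J (corner Q Q)}"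
  have "mult_span ?J (corner P Q) \<subseteq> ?T"
  proof (rule mult_span_minimal)
    show "subspace ?T"
      by (intro subspace_sums subspace_mult_image mult.subspace_image subspace_corner subspace_mult_span)
    fix a b assume ab: "a \<in> ?J" "b \<in> corner P Q"
    obtain h k where b: "h \<in> corner P P" "k \<in> corner Q Q" "b = k * d' + d' * h"
      using assms(1) ab(2) by (rule jointly_generateE)
    obtain s where s: "s \<in> corner P P" "a * d' = d * s" using square_maps_lift[OF ab(1)] by blast
    have "a * b = a * k * d' + a * d' * h" by (simp add: b(3) distrib_left mult.assoc)
    also have "\<dots> = d * (s * h) + (a * k) * d'" by (simp add: s(2) mult.assoc add.commute)
    finally show "a * b \<in> ?T" using corner_mult[OF s(1) b(1)] mult_span_base[OF ab(1) b(2)] by blast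
  qed
  then show ?thesis using assms(2) by blast
qed

text \<open>Right multiplication by \<open>d\<close> is surjective and by \<open>d'\<close> injective as a map from \<open>End(Q)\<close> to
  \<open>Hom(P, Q)\<close> modulo generated maps, and \<open>Q * d\<close> is generated.\<close>

lemma identity_generated_by_squares:
  assumes P: "P * P = P" and Q: "Q * Q = Q" and d: "d \<in> corner P Q" "d' \<in> corner P Q"
    and gen: "jointly_generate P Q d d" "jointly_generate P Q d' d'"
    and fin: "finite_dim (corner Q Q)" "finite_dim (corner P Q)"
  shows "Q \<in> generated_maps P Q d (square_maps P Q d' d) Q"
proof -
  let ?J = "square_maps P Q d' d"
  let ?W = "generated_maps P Q d ?J"
  have J: "?J \<subseteq> corner Q Q" using square_maps_corner by blast
  have surj: "\<exists>x\<in>corner Q Q. y - x * d \<in> ?W P" if y: "y \<in> corner P Q" for y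
  proof -
    obtain h k where "h \<in> corner P P" "k \<in> corner Q Q" "y = k * d + d * h"
      using gen(1) y by (rule jointly_generateE)
    then show ?thesis using generated_maps_image[of h P P d Q ?J] by (intro bexI[of _ k]) simp_all
  qed
  have inj: "x \<in> ?W Q" if x: "x \<in> corner Q Q" "x * d' \<in> ?W P" for x
  proof -
    obtain r z where rz: "x * d' = d * r + z" "r \<in> corner P P" "z \<in> mult_span ?J (corner P Q)"
      using x(2) unfolding generated_maps_def by blast
    obtain s w where sw: "s \<in> corner P P" "w \<in> mult_span ?J (corner Q Q)" "z = d * s + w * d'"
      using square_span_decompose[OF gen(2) rz(3)] by blast
    have "w \<in> corner Q Q"
      using sw(2) generated_maps_mult_span generated_maps_subset[OF d(1) J] by blast
    moreover have "(x - w) * d' = d * (r + s)"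
      using rz(1) sw(3) by (simp add: left_diff_distrib distrib_left)
    ultimately have "x - w \<in> ?J"
      unfolding square_maps_def using corner_diff[OF x(1)] corner_add[OF rz(2) sw(1)] by blast
    then have "(x - w) * Q \<in> mult_span ?J (corner Q Q)" by (rule mult_span_base[OF _ corner_self[OF Q]])
    moreover have "(x - w) * Q = x - w" using \<open>x - w \<in> ?J\<close> J corner_right by blast
    ultimately have "(x - w) + w \<in> mult_span ?J (corner Q Q)"
      using sw(2) subspace_add[OF subspace_mult_span] by metis
    then show ?thesis using generated_maps_mult_span by simp
  qed
  show ?thesis
  proof (rule injective_of_surjective_quotient[of "corner Q Q" "?W Q" "?W P" "corner P Q"
        "\<lambda>x. x * d" "\<lambda>x. x * d'"])
    show "(\<lambda>x. x * d) ` ?W Q \<subseteq> ?W P" using generated_maps_right_mult[OF _ d(1)] by blast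
    show "(\<lambda>x. x * d') ` corner Q Q \<subseteq> corner P Q" using corner_mult[OF _ d(2)] by blast
    have "Q * d = d * P" using d(1) by (simp add: corner_left corner_right)
    then show "Q * d \<in> ?W P" using generated_maps_image[OF corner_self[OF P]] by simp
  qed (use J surj inj fin d(1) Q in \<open>simp_all add: subspace_corner subspace_generated_maps
        generated_maps_subset linear_mult_right corner_self\<close>)
qed

lemma corner_generated_by_loops:
  assumes P: "P * P = P" and Q: "Q * Q = Q" and d: "d \<in> corner P Q" "d' \<in> corner P Q"
    and gen: "jointly_generate P Q d d" "jointly_generate P Q d' d'"
    and fin: "finite_dim (corner Q Q)" "finite_dim (corner P Q)" and s: "s \<in> corner Q Q"
  shows "s \<in> generated_maps P Q d (mult_span (square_maps P Q d' d) (square_maps P Q d d')) Q"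
proof -
  let ?J = "square_maps P Q d' d" and ?J' = "square_maps P Q d d'"
  let ?W = "generated_maps P Q d (mult_span ?J ?J') Q"
  have "Q \<in> generated_maps P Q d' ?J' Q"
    by (rule identity_generated_by_squares[OF P Q d(2,1) gen(2,1) fin])
  then obtain c x where cx: "Q = d' * c + x" "c \<in> corner Q P" "x \<in> mult_span ?J' (corner Q Q)"
    unfolding generated_maps_def by blast
  have "mult_span ?J (corner Q Q) \<subseteq> ?W"
  proof (rule mult_span_minimal[OF subspace_generated_maps])
    fix a b assume ab: "a \<in> ?J" "b \<in> corner Q Q"
    obtain \<rho> where \<rho>: "\<rho> \<in> corner P P" "a * d' = d * \<rho>" using square_maps_lift[OF ab(1)] by blast
    have "a * b = a * ((d' * c + x) * b)" using corner_left[OF ab(2)] cx(1) by simp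
    also have "\<dots> = a * d' * (c * b) + a * (x * b)" by (simp add: distrib_left distrib_right mult.assoc)
    finally have "a * b = d * (\<rho> * (c * b)) + a * (x * b)" by (simp add: \<rho>(2) mult.assoc)
    moreover have "\<rho> * (c * b) \<in> corner Q P" by (intro corner_mult[OF \<rho>(1)] corner_mult[OF cx(2) ab(2)])
    moreover have "x * b \<in> mult_span ?J' (corner Q Q)"
      using cx(3) by (rule mult_span_right_mult[rotated]) (rule corner_mult[OF _ ab(2)])
    then have "a * (x * b) \<in> mult_span (mult_span ?J ?J') (corner Q Q)"
      by (rule mult_span_left_mult[rotated]) (rule mult_span_base[OF ab(1)])
    ultimately show "a * b \<in> ?W" unfolding generated_maps_def by blast
  qed
  moreover obtain c' x' where c'x': "Q = d * c' + x'" "c' \<in> corner Q P" "x' \<in> mult_span ?J (corner Q Q)"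
    using identity_generated_by_squares[OF P Q d gen fin] unfolding generated_maps_def by blast
  ultimately have "d * c' + x' \<in> ?W"
    by (intro subspace_add[OF subspace_generated_maps] generated_maps_image) auto
  then have "Q \<in> ?W" by (simp only: flip: c'x'(1))
  then have "Q * s \<in> ?W" by (rule generated_maps_right_mult[OF _ s])
  then show ?thesis by (simp add: corner_left[OF s])
qed

proposition split_surjection_of_radical_loops:
  assumes P: "P * P = P" and Q: "Q * Q = Q" and d: "d \<in> corner P Q" "d' \<in> corner P Q"
    and gen: "jointly_generate P Q d d" "jointly_generate P Q d' d'"
    and fin: "finite_dim (corner Q Q)" "finite_dim (corner P Q)"
    and inv: "\<And>a. a \<in> mult_span (square_maps P Q d' d) (square_maps P Q d d') \<Longrightarrow>
      \<exists>v\<in>square_maps P Q d d. \<exists>c\<in>corner Q P. v * (Q - a) - Q = d * c"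
  shows "\<exists>c\<in>corner Q P. Q = d * c"
proof -
  let ?I = "mult_span (square_maps P Q d' d) (square_maps P Q d d')" and ?Z = "square_maps P Q d d"
  have "corner Q Q = (*) d ` corner Q P"
  proof (rule nakayama[of _ ?Z _ ?I])
    show "(*) d ` corner Q P \<subseteq> corner Q Q" using corner_mult[OF d(1)] by blast
    show "z * x \<in> corner Q Q" if "z \<in> ?Z" "x \<in> corner Q Q" for z x
      using square_maps_corner[OF that(1)] that(2) by (rule corner_mult)
    show "z * x \<in> (*) d ` corner Q P" if zx: "z \<in> ?Z" "x \<in> (*) d ` corner Q P" for z x
    proof -
      obtain c where c: "x = d * c" "c \<in> corner Q P" using zx(2) by blast
      obtain \<rho> where \<rho>: "\<rho> \<in> corner P P" "z * d = d * \<rho>" using square_maps_lift[OF zx(1)] by blast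
      have "z * x = d * (\<rho> * c)" using c(1) \<rho>(2) by (simp flip: mult.assoc)
      then show ?thesis using corner_mult[OF \<rho>(1) c(2)] by blast
    qed
    show "?I \<subseteq> ?Z" by (intro mult_span_minimal subspace_square_maps) (rule square_maps_mult)
    show "z * a \<in> ?I" if "z \<in> ?Z" "a \<in> ?I" for z a
      using that(2) by (rule mult_span_left_mult[rotated]) (rule square_maps_mult[OF that(1)])
    show "\<exists>m\<in>(*) d ` corner Q P. \<exists>y\<in>mult_span ?I (corner Q Q). x = m + y" if "x \<in> corner Q Q" for x
      using corner_generated_by_loops[OF P Q d gen fin that] unfolding generated_maps_def by blast
    show "\<exists>v\<in>?Z. \<forall>x\<in>corner Q Q. v * (x - a * x) - x \<in> (*) d ` corner Q P" if a: "a \<in> ?I" for a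
    proof -
      obtain v c where v: "v \<in> ?Z" "c \<in> corner Q P" "v * (Q - a) - Q = d * c" using inv[OF a] by blast
      have "v * (x - a * x) - x = d * (c * x)" if "x \<in> corner Q Q" for x
      proof -
        have "v * (x - a * x) - x = (v * (Q - a) - Q) * x"
          by (simp add: left_diff_distrib mult.assoc corner_left[OF that])
        then show ?thesis by (simp add: v(3) mult.assoc)
      qed
      then show ?thesis using v(1) corner_mult[OF v(2)] by blast
    qed
  qed (simp_all add: fin subspace_corner subspace_mult_image subspace_mult_span)
  then show ?thesis using corner_self[OF Q] by blast
qed

end

section \<open>Matrices with finite support\<close>

definition finite_support :: "('i \<Rightarrow> 'i \<Rightarrow> 'a::zero) \<Rightarrow> bool" where
  "finite_support f \<longleftrightarrow> (\<exists>I. finite I \<and> (\<forall>u v. f u v \<noteq> 0 \<longrightarrow> u \<in> I \<and> v \<in> I))"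

lemma finite_supportI:
  "finite I \<Longrightarrow> (\<And>u v. f u v \<noteq> 0 \<Longrightarrow> u \<in> I \<and> v \<in> I) \<Longrightarrow> finite_support f"
  unfolding finite_support_def by blast

lemma finite_support_zero: "finite_support (\<lambda>_ _. 0)"
  unfolding finite_support_def by auto

lemma finite_support_combine:
  assumes "finite_support f" "finite_support g" "\<And>u v. f u v = 0 \<Longrightarrow> g u v = 0 \<Longrightarrow> h u v = 0"
  shows "finite_support h"
proof -
  obtain I J where "finite I" "\<forall>u v. f u v \<noteq> 0 \<longrightarrow> u \<in> I \<and> v \<in> I" "finite J" "\<forall>u v. g u v \<noteq> 0 \<longrightarrow> u \<in> J \<and> v \<in> J"
    using assms unfolding finite_support_def by blast
  moreover have "f u v \<noteq> 0 \<or> g u v \<noteq> 0" if "h u v \<noteq> 0" for u v using assms(3) that by blast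
  ultimately show ?thesis by (intro finite_supportI[of "I \<union> J"]) blast+
qed

typedef (overloaded) ('i, 'a) fmat = "{f :: 'i \<Rightarrow> 'i \<Rightarrow> 'a::zero. finite_support f}"
  morphisms entry fmat_of
  using finite_support_zero by blast

setup_lifting type_definition_fmat

lemma entry_fmat_of: "finite_support f \<Longrightarrow> entry (fmat_of f) = f"
  by (simp add: fmat_of_inverse)

lemma fmat_eqI: "(\<And>u v. entry x u v = entry y u v) \<Longrightarrow> x = y"
  by (simp add: entry_inject[symmetric] fun_eq_iff)

definition support :: "('i, 'a::zero) fmat \<Rightarrow> 'i set" where
  "support x = {u. \<exists>v. entry x u v \<noteq> 0 \<or> entry x v u \<noteq> 0}"

lemma support_entry: "entry x u v \<noteq> 0 \<Longrightarrow> u \<in> support x \<and> v \<in> support x"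
  unfolding support_def by blast

lemma finite_support_entry: "finite (support x)"
proof -
  obtain I where "finite I" "\<forall>u v. entry x u v \<noteq> 0 \<longrightarrow> u \<in> I \<and> v \<in> I"
    using entry[of x] unfolding finite_support_def by blast
  moreover from this(2) have "support x \<subseteq> I" unfolding support_def by blast
  ultimately show ?thesis by (meson finite_subset)
qed

lemma support_subsetI: "(\<And>u v. entry x u v \<noteq> 0 \<Longrightarrow> u \<in> I \<and> v \<in> I) \<Longrightarrow> support x \<subseteq> I"
  unfolding support_def by blast

subsection \<open>The ring of matrices\<close>

instantiation fmat :: (type, ring) ring
begin

lift_definition zero_fmat :: "('a, 'b) fmat" is "\<lambda>_ _. 0"
  by (rule finite_support_zero)

lift_definition plus_fmat :: "('a, 'b) fmat \<Rightarrow> ('a, 'b) fmat \<Rightarrow> ('a, 'b) fmat"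
  is "\<lambda>x y u v. x u v + y u v"
  by (erule (1) finite_support_combine) simp

lift_definition uminus_fmat :: "('a, 'b) fmat \<Rightarrow> ('a, 'b) fmat" is "\<lambda>x u v. - x u v"
  unfolding finite_support_def by simp

lift_definition minus_fmat :: "('a, 'b) fmat \<Rightarrow> ('a, 'b) fmat \<Rightarrow> ('a, 'b) fmat"
  is "\<lambda>x y u v. x u v - y u v"
  by (erule (1) finite_support_combine) simp

lift_definition times_fmat :: "('a, 'b) fmat \<Rightarrow> ('a, 'b) fmat \<Rightarrow> ('a, 'b) fmat"
  is "\<lambda>x y u v. \<Sum>w | x u w \<noteq> 0. x u w * y w v"
proof -
  fix x y :: "'a \<Rightarrow> 'a \<Rightarrow> 'b" assume "finite_support x" "finite_support y"
  then obtain I J where IJ: "finite I" "\<forall>u v. x u v \<noteq> 0 \<longrightarrow> u \<in> I \<and> v \<in> I"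
    "finite J" "\<forall>u v. y u v \<noteq> 0 \<longrightarrow> u \<in> J \<and> v \<in> J" unfolding finite_support_def by blast
  show "finite_support (\<lambda>u v. \<Sum>w | x u w \<noteq> 0. x u w * y w v)"
  proof (rule finite_supportI[of "I \<union> J"])
    fix u v assume nz: "(\<Sum>w | x u w \<noteq> 0. x u w * y w v) \<noteq> 0"
    obtain w where "x u w * y w v \<noteq> 0" by (rule sum.not_neutral_contains_not_neutral[OF nz])
    then have "x u w \<noteq> 0" "y w v \<noteq> 0" by auto
    then show "u \<in> I \<union> J \<and> v \<in> I \<union> J" using IJ by blast
  qed (use IJ in simp)
qed

lemma entry_zero [simp]: "entry (0 :: ('a, 'b) fmat) u v = 0"
  and entry_add [simp]: "entry (x + y :: ('a, 'b) fmat) u v = entry x u v + entry y u v"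
  and entry_uminus [simp]: "entry (- x :: ('a, 'b) fmat) u v = - entry x u v"
  and entry_diff [simp]: "entry (x - y :: ('a, 'b) fmat) u v = entry x u v - entry y u v"
  by (transfer, simp)+

lemma entry_mult:
  fixes x y :: "('a, 'b) fmat"
  assumes "finite I" "\<And>w. w \<notin> I \<Longrightarrow> entry x u w = 0 \<or> entry y w v = 0"
  shows "entry (x * y) u v = (\<Sum>w\<in>I. entry x u w * entry y w v)"
proof -
  have "finite {w. entry x u w \<noteq> 0}"
    by (rule finite_subset[OF _ finite_support_entry[of x]]) (auto simp: support_entry)
  then have "(\<Sum>w | entry x u w \<noteq> 0. entry x u w * entry y w v) =
      (\<Sum>w\<in>{w. entry x u w \<noteq> 0} \<union> I. entry x u w * entry y w v)"
    using assms by (intro sum.mono_neutral_left) auto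
  also have "\<dots> = (\<Sum>w\<in>I. entry x u w * entry y w v)"
    proof (rule sum.mono_neutral_right)
    show "\<forall>w\<in>{w. entry x u w \<noteq> 0} \<union> I - I. entry x u w * entry y w v = 0"
      using assms(2) by fastforce
  qed (use assms(1) \<open>finite {w. entry x u w \<noteq> 0}\<close> in auto)
  finally show ?thesis by (simp add: times_fmat.rep_eq)
qed

lemma entry_mult_left_support:
  "finite I \<Longrightarrow> support x \<subseteq> I \<Longrightarrow> entry (x * y :: ('a, 'b) fmat) u v = (\<Sum>w\<in>I. entry x u w * entry y w v)"
proof (rule entry_mult)
  fix w assume "support x \<subseteq> I" "w \<notin> I"
  then have "entry x u w = 0" using support_entry[of x u w] by auto
  then show "entry x u w = 0 \<or> entry y w v = 0" ..
qed

lemma entry_mult_nonzeroE: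
  fixes x y :: "('a, 'b) fmat"
  assumes "entry (x * y) u v \<noteq> 0"
  obtains w where "entry x u w \<noteq> 0" "entry y w v \<noteq> 0"
proof (rule ccontr)
  assume "\<not> thesis"
  then have "entry (x * y) u v = (\<Sum>w\<in>{}. entry x u w * entry y w v)"
    using that by (intro entry_mult) auto
  then show False using assms by simp
qed

lemma support_zero [simp]: "support (0 :: ('a, 'b) fmat) = {}"
  by (simp add: support_def)

lemma support_mult: "support (x * y :: ('a, 'b) fmat) \<subseteq> support x \<union> support y"
proof (rule support_subsetI)
  fix u v assume "entry (x * y) u v \<noteq> 0"
  then obtain w where "entry x u w \<noteq> 0" "entry y w v \<noteq> 0" by (rule entry_mult_nonzeroE)
  then show "u \<in> support x \<union> support y \<and> v \<in> support x \<union> support y"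
    using support_entry[of x u w] support_entry[of y w v] by simp
qed

instance
proof
  fix x y z :: "('a, 'b) fmat"
  show "x + y + z = x + (y + z)" "x + y = y + x" "0 + x = x" "- x + x = 0" "x - y = x + - y"
    by (rule fmat_eqI, simp add: algebra_simps)+
  define I where "I = support x \<union> support y \<union> support z"
  have I: "finite I" "support x \<subseteq> I" "support y \<subseteq> I" "support z \<subseteq> I"
    unfolding I_def by (auto simp: finite_support_entry)
  have "u \<in> I \<and> v \<in> I" if "entry (x + y) u v \<noteq> 0" for u v
    using that support_entry[of x u v] support_entry[of y u v] I(2,3)
    by (cases "entry x u v = 0") auto
  then have xy: "support (x + y) \<subseteq> I" "support (x * y) \<subseteq> I"
    using support_subsetI[of "x + y" I] support_mult[of x y] I by blast+
  show "(x + y) * z = x * z + y * z" "x * (y + z) = x * y + x * z"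
    by (rule fmat_eqI, simp add: entry_mult_left_support[OF I(1)]
      I xy distrib_right distrib_left sum.distrib)+
  show "x * y * z = x * (y * z)"
  proof (rule fmat_eqI)
    fix u v
    have "entry (x * y * z) u v = (\<Sum>w\<in>I. \<Sum>w'\<in>I. entry x u w' * entry y w' w * entry z w v)"
      by (simp add: entry_mult_left_support[OF I(1)] I xy sum_distrib_right)
    also have "\<dots> = (\<Sum>w'\<in>I. \<Sum>w\<in>I. entry x u w' * entry y w' w * entry z w v)"
      by (rule sum.swap)
    also have "\<dots> = entry (x * (y * z)) u v"
      by (simp add: entry_mult_left_support[OF I(1)] I sum_distrib_left mult.assoc)
    finally show "entry (x * y * z) u v = entry (x * (y * z)) u v" .
  qed
qed

end

lemma corner_entry:
  assumes "x \<in> corner e f" "entry (x :: ('i, 'a::ring) fmat) u v \<noteq> 0" shows "u \<in> support f" "v \<in> support e"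
proof -
  have "entry (f * x) u v \<noteq> 0" "entry (x * e) u v \<noteq> 0"
    using assms by (simp_all add: corner_left corner_right)
  then show "u \<in> support f" "v \<in> support e"
    using support_entry[of f u] support_entry[of e _ v] by (auto elim!: entry_mult_nonzeroE)
qed

lemma support_corner:
  assumes "x \<in> corner e f" shows "support (x :: ('i, 'a::ring) fmat) \<subseteq> support e \<union> support f"
  by (rule support_subsetI) (simp add: corner_entry[OF assms])

lemma entry_sum: "entry (sum F A :: ('i, 'a::ring) fmat) u v = (\<Sum>i\<in>A. entry (F i) u v)"
  by (induction A rule: infinite_finite_induct) auto

subsection \<open>Inclusions and projections\<close>

lift_definition single :: "'i \<Rightarrow> 'i \<Rightarrow> 'a::zero \<Rightarrow> ('i, 'a) fmat"
  is "\<lambda>u v a x y. if x = u \<and> y = v then a else 0"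
  by (rule_tac I = "{u, v}" for u v in finite_supportI) (auto split: if_splits)

lemma single_mult_single: "single u v a * single v w b = (single u w (a * b) :: ('i, 'a::ring) fmat)"
proof (rule fmat_eqI)
  fix x y
  have "entry (single u v a * single v w b :: ('i, 'a) fmat) x y =
      (\<Sum>z\<in>{v}. entry (single u v a) x z * entry (single v w b) z y)"
    by (rule entry_mult) (auto simp: single.rep_eq)
  then show "entry (single u v a * single v w b :: ('i, 'a) fmat) x y = entry (single u w (a * b)) x y"
    by (simp add: single.rep_eq)
qed

lemma fmat_eq_sum_single:
  assumes "finite I" "support x \<subseteq> I"
  shows "x = (\<Sum>u\<in>I. \<Sum>v\<in>I. single u v (entry x u v) :: ('i, 'a::ring) fmat)"
proof (rule fmat_eqI)
  fix u v
  have "(\<Sum>u'\<in>I. \<Sum>v'\<in>I. entry (single u' v' (entry x u' v')) u v) =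
      (\<Sum>u'\<in>I. if u' = u then \<Sum>v'\<in>I. if v' = v then entry x u v' else 0 else 0)"
    by (intro sum.cong refl) (auto simp: single.rep_eq intro!: sum.cong)
  also have "\<dots> = entry x u v" using assms support_entry[of x u v] by auto
  finally show "entry x u v = entry (\<Sum>u\<in>I. \<Sum>v\<in>I. single u v (entry x u v)) u v"
    by (simp add: entry_sum)
qed

definition incl :: "'i set \<Rightarrow> ('i \<Rightarrow> 'i) \<Rightarrow> ('i, 'a::ring_1) fmat" where
  "incl S \<phi> = (\<Sum>u\<in>S. single (\<phi> u) u 1)"

definition proj :: "'i set \<Rightarrow> ('i \<Rightarrow> 'i) \<Rightarrow> ('i, 'a::ring_1) fmat" where
  "proj S \<phi> = (\<Sum>u\<in>S. single u (\<phi> u) 1)"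

definition diag :: "'i set \<Rightarrow> ('i, 'a::ring_1) fmat" where
  "diag S = (\<Sum>u\<in>S. single u u 1)"

lemma entry_incl:
    "finite S \<Longrightarrow> entry (incl S \<phi> :: ('i, 'a::ring_1) fmat) x u = (if u \<in> S \<and> x = \<phi> u then 1 else 0)"
  and entry_proj:
    "finite S \<Longrightarrow> entry (proj S \<phi> :: ('i, 'a::ring_1) fmat) u x = (if u \<in> S \<and> x = \<phi> u then 1 else 0)"
proof -
  have delta: "(\<Sum>v\<in>S. if x = \<phi> v \<and> u = v then 1 else 0 :: 'a) =
      (\<Sum>v\<in>S. if u = v then (if x = \<phi> u then 1 else 0) else 0)"
    by (intro sum.cong) auto
  show "finite S \<Longrightarrow> entry (incl S \<phi> :: ('i, 'a) fmat) x u = (if u \<in> S \<and> x = \<phi> u then 1 else 0)"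
    unfolding incl_def entry_sum single.rep_eq delta by simp
  show "finite S \<Longrightarrow> entry (proj S \<phi> :: ('i, 'a) fmat) u x = (if u \<in> S \<and> x = \<phi> u then 1 else 0)"
    unfolding proj_def entry_sum single.rep_eq conj_commute[of "u = _"] delta by simp
qed

lemma diag_eq_incl: "diag S = incl S id"
  by (simp add: diag_def incl_def)

lemma entry_diag: "finite S \<Longrightarrow> entry (diag S) u v = (if u = v \<and> v \<in> S then 1 else 0)"
  by (auto simp: diag_eq_incl entry_incl)

lemma entry_incl_mult:
  assumes "finite S" "inj \<phi>"
  shows "entry (incl S \<phi> * x) (\<phi> u) v = (if u \<in> S then entry x u v else 0)"
    and "entry (x * proj S \<phi>) v (\<phi> u) = (if u \<in> S then entry x v u else 0)"
proof -
  have "entry (incl S \<phi> * x) (\<phi> u) v = (\<Sum>w\<in>{u}. entry (incl S \<phi>) (\<phi> u) w * entry x w v)"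
    using assms by (intro entry_mult) (auto simp: entry_incl inj_eq)
  then show "entry (incl S \<phi> * x) (\<phi> u) v = (if u \<in> S then entry x u v else 0)"
    by (simp add: entry_incl assms(1))
  have "entry (x * proj S \<phi>) v (\<phi> u) = (\<Sum>w\<in>{u}. entry x v w * entry (proj S \<phi>) w (\<phi> u))"
    using assms by (intro entry_mult) (auto simp: entry_proj inj_eq)
  then show "entry (x * proj S \<phi>) v (\<phi> u) = (if u \<in> S then entry x v u else 0)"
    by (simp add: entry_proj assms(1))
qed

lemma entry_incl_mult_outside:
  assumes "finite S" "y \<notin> range \<phi>"
  shows "entry (incl S \<phi> * x) y v = 0" and "entry (x * proj S \<phi>) v y = 0"
proof -
  have "entry (incl S \<phi> * x) y v = (\<Sum>w\<in>{}. entry (incl S \<phi>) y w * entry x w v)"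
    using assms by (intro entry_mult) (auto simp: entry_incl)
  then show "entry (incl S \<phi> * x) y v = 0" by simp
  have "entry (x * proj S \<phi>) v y = (\<Sum>w\<in>{}. entry x v w * entry (proj S \<phi>) w y)"
    using assms by (intro entry_mult) (auto simp: entry_proj)
  then show "entry (x * proj S \<phi>) v y = 0" by simp
qed

lemma diag_mult: "finite S \<Longrightarrow> support x \<subseteq> S \<Longrightarrow> diag S * x = x"
  and mult_diag: "finite S \<Longrightarrow> support x \<subseteq> S \<Longrightarrow> x * diag S = x"
proof -
  show "diag S * x = x" if "finite S" "support x \<subseteq> S"
    using entry_incl_mult(1)[OF that(1) inj_on_id, of x] support_entry[of x] that
    unfolding diag_eq_incl by (intro fmat_eqI) (fastforce split: if_splits)
  show "x * diag S = x" if "finite S" "support x \<subseteq> S"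
  proof (rule fmat_eqI)
    fix u v
    have "entry (x * diag S) u v = (\<Sum>w\<in>S. entry x u w * entry (diag S) w v)"
      by (rule entry_mult_left_support[OF that])
    also have "\<dots> = (\<Sum>w\<in>S. if w = v then entry x u v else 0)"
      by (intro sum.cong) (auto simp: entry_diag that(1))
    also have "\<dots> = entry x u v" using support_entry[of x u v] that by auto
    finally show "entry (x * diag S) u v = entry x u v" .
  qed
qed

lemma support_diag: "finite S \<Longrightarrow> support (diag S) \<subseteq> S"
  by (rule support_subsetI) (auto simp: entry_diag split: if_splits)

lemma diag_idem: "finite S \<Longrightarrow> diag S * diag S = diag S"
  by (simp add: diag_mult support_diag)

lemma entry_proj_mult:
  assumes "finite S" shows "entry (proj S \<phi> * y) u v = (if u \<in> S then entry y (\<phi> u) v else 0)"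
proof -
  have "entry (proj S \<phi> * y) u v = (\<Sum>w\<in>{\<phi> u}. entry (proj S \<phi>) u w * entry y w v)"
    using assms by (intro entry_mult) (auto simp: entry_proj)
  then show ?thesis by (simp add: entry_proj assms)
qed

lemma proj_mult_incl: "finite S \<Longrightarrow> inj_on \<phi> S \<Longrightarrow> proj S \<phi> * incl S \<phi> = diag S"
  and proj_mult_incl_disjoint:
    "finite S \<Longrightarrow> finite T \<Longrightarrow> \<phi> ` S \<inter> \<psi> ` T = {} \<Longrightarrow> proj S \<phi> * incl T \<psi> = 0"
  by (rule fmat_eqI; auto simp: entry_proj_mult entry_incl entry_diag inj_on_eq_iff)+

section \<open>Graded matrices\<close>

text \<open>All terms of a complex are recorded in one matrix, whose rows and columns are indexed by a
  degree and a position. A separate datatype keeps quantifiers over indices from being split.\<close>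

datatype index = Ix (degree: int) (position: nat)

type_synonym 'a gmat = "(index, 'a) fmat"

lemma finite_index_bound:
  assumes "finite I" shows "\<exists>N::nat. \<forall>u\<in>I. \<bar>degree u\<bar> \<le> int N \<and> position u < N"
  using assms
proof (induction I rule: finite_induct)
  case (insert u I)
  then obtain N where "\<forall>u\<in>I. \<bar>degree u\<bar> \<le> int N \<and> position u < N" by blast
  then show ?case
    by (intro exI[of _ "N + nat \<bar>degree u\<bar> + Suc (position u)"]) fastforce
qed simp

definition homogeneous :: "int \<Rightarrow> 'a::zero gmat \<Rightarrow> bool" where
  "homogeneous k x \<longleftrightarrow> (\<forall>u v. entry x u v \<noteq> 0 \<longrightarrow> degree u = degree v + k)"

definition in_block :: "int \<Rightarrow> int \<Rightarrow> 'a::zero gmat \<Rightarrow> bool" where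
  "in_block s t x \<longleftrightarrow> (\<forall>u v. entry x u v \<noteq> 0 \<longrightarrow> degree u = s \<and> degree v = t)"

lemma homogeneous_entry: "homogeneous k x \<Longrightarrow> degree u \<noteq> degree v + k \<Longrightarrow> entry x u v = 0"
  unfolding homogeneous_def by blast

lemma homogeneous_zero [simp]: "homogeneous k (0 :: 'a::ring gmat)"
  and homogeneous_add: "homogeneous k x \<Longrightarrow> homogeneous k y \<Longrightarrow> homogeneous k (x + y :: 'a::ring gmat)"
  and homogeneous_uminus: "homogeneous k x \<Longrightarrow> homogeneous k (- x :: 'a::ring gmat)"
  unfolding homogeneous_def by (simp_all, metis add.right_neutral)

lemma homogeneous_diff: "homogeneous k x \<Longrightarrow> homogeneous k y \<Longrightarrow> homogeneous k (x - y :: 'a::ring gmat)"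
  using homogeneous_add[of k x "- y"] homogeneous_uminus[of k y] by simp

lemma homogeneous_mult:
  "homogeneous k x \<Longrightarrow> homogeneous l y \<Longrightarrow> homogeneous (k + l) (x * y :: 'a::ring gmat)"
  unfolding homogeneous_def by (fastforce elim: entry_mult_nonzeroE)

lemma homogeneous_mult_degree_0:
  "homogeneous 0 x \<Longrightarrow> homogeneous l y \<Longrightarrow> homogeneous l (x * y :: 'a::ring gmat)"
  "homogeneous l x \<Longrightarrow> homogeneous 0 y \<Longrightarrow> homogeneous l (x * y :: 'a::ring gmat)"
  using homogeneous_mult[of 0 x l y] homogeneous_mult[of l x 0 y] by simp_all

lemma in_block_homogeneous: "in_block s t x \<Longrightarrow> homogeneous (s - t) x"
  unfolding in_block_def homogeneous_def by force

lemma in_block_mult_zero: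
  assumes "in_block s t x" "in_block t' r y" "t \<noteq> t'"
  shows "x * y = (0 :: 'a::ring gmat)"
proof (rule fmat_eqI, rule ccontr)
  fix u v assume "entry (x * y) u v \<noteq> entry 0 u v"
  then obtain w where "entry x u w \<noteq> 0" "entry y w v \<noteq> 0"
    unfolding entry_zero by (rule entry_mult_nonzeroE)
  then show False using assms unfolding in_block_def by blast
qed

lemma in_block_corner:
  assumes "in_block s s P" "in_block t t Q" "x \<in> corner P Q"
  shows "in_block t s (x :: 'a::ring gmat)"
  unfolding in_block_def
proof (intro allI impI)
  fix u v assume "entry x u v \<noteq> 0"
  then have "entry (Q * x) u v \<noteq> 0" "entry (x * P) u v \<noteq> 0"
    using assms(3) by (simp_all add: corner_left corner_right)
  then show "degree u = t \<and> degree v = s"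
    using assms(1,2) unfolding in_block_def by (auto elim!: entry_mult_nonzeroE)
qed

lemma in_block_homogeneous_left:
  "homogeneous k x \<Longrightarrow> in_block s t y \<Longrightarrow> in_block (s + k) t (x * y :: 'a::ring gmat)"
  and in_block_homogeneous_right:
  "in_block s t y \<Longrightarrow> homogeneous k x \<Longrightarrow> in_block s (t - k) (y * x :: 'a::ring gmat)"
  unfolding in_block_def homogeneous_def by (fastforce elim: entry_mult_nonzeroE)+

lemma in_block_mult_homogeneous_zero:
  assumes "in_block s s p" "in_block t t q" "homogeneous k f" "s \<noteq> t + k"
  shows "p * f * q = (0 :: 'a::ring gmat)"
proof -
  have "in_block (t + k) t (f * q)" by (rule in_block_homogeneous_left[OF assms(3,2)])
  then show ?thesis using in_block_mult_zero[OF assms(1)] assms(4) by (simp add: mult.assoc)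
qed

lift_definition degree_part :: "int \<Rightarrow> 'a::zero gmat \<Rightarrow> 'a gmat"
  is "\<lambda>t x u v. if degree u = t then x u v else 0"
  unfolding finite_support_def by (metis (full_types))

lemma degree_part_add: "degree_part t (x + y) = degree_part t x + degree_part t (y :: 'a::ring gmat)"
  by (rule fmat_eqI) (simp add: degree_part.rep_eq)

lemma degree_part_mult: "degree_part t (x * y) = degree_part t x * (y :: 'a::ring gmat)"
proof (rule fmat_eqI)
  fix u v
  have "support (degree_part t x) \<subseteq> support x"
    unfolding support_def by (auto simp: degree_part.rep_eq split: if_splits)
  then show "entry (degree_part t (x * y)) u v = entry (degree_part t x * y) u v"
    by (simp add: degree_part.rep_eq entry_mult_left_support[OF finite_support_entry[of x]])
qed

lemma mult_degree_part:
  assumes "homogeneous 0 x" shows "x * degree_part t y = degree_part t (x * y :: 'a::ring gmat)"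
proof (rule fmat_eqI)
  fix u v
  have "entry x u w * entry (degree_part t y) w v =
    (if degree u = t then entry x u w * entry y w v else 0)" for w
    using homogeneous_entry[OF assms, of u w] by (auto simp: degree_part.rep_eq)
  then show "entry (x * degree_part t y) u v = entry (degree_part t (x * y)) u v"
    by (simp add: degree_part.rep_eq entry_mult_left_support[OF finite_support_entry[of x]])
qed

lemma degree_part_corner:
  assumes "homogeneous 0 e" "e * e = (e :: 'a::ring gmat)"
  shows "degree_part t e \<in> corner e e" and "degree_part t e * degree_part t e = degree_part t e"
    and "in_block t t (degree_part t e)"
proof -
  show "degree_part t e \<in> corner e e"
    by (rule cornerI) (simp_all add: mult_degree_part[OF assms(1)] assms(2) flip: degree_part_mult)
  have "degree_part t (degree_part t e) = degree_part t e"
    by (rule fmat_eqI) (simp add: degree_part.rep_eq)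
  then show "degree_part t e * degree_part t e = degree_part t e"
    by (simp add: mult_degree_part[OF assms(1)] assms(2) flip: degree_part_mult)
  show "in_block t t (degree_part t e)"
    using assms(1) by (auto simp: in_block_def homogeneous_def degree_part.rep_eq split: if_splits)
qed

section \<open>Finite dimensional algebras\<close>

locale fd_algebra_over =
  fixes scale :: "'k::field \<Rightarrow> 'a::ring_1 \<Rightarrow> 'a"
  assumes fd_algebra: "fd_algebra scale"
begin

lemma scale_simps:
  "scale c (x + y) = scale c x + scale c y" "scale (c + d) x = scale c x + scale d x"
  "scale (c * d) x = scale c (scale d x)" "scale 1 x = x"
  "scale c (x * y) = scale c x * y" "x * scale c y = scale c x * y"
  using fd_algebra unfolding fd_algebra_def by simp_all (metis)

lemma scale_zero [simp]: "scale c 0 = 0"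
  using scale_simps(1)[of c 0 0] by simp

lemma scale_sum: "scale c (sum f A) = (\<Sum>i\<in>A. scale c (f i))"
  by (induction A rule: infinite_finite_induct) (auto simp: scale_simps(1))

definition scale_mat :: "'k \<Rightarrow> 'a gmat \<Rightarrow> 'a gmat" where
  "scale_mat c x = fmat_of (\<lambda>u v. scale c (entry x u v))"

lemma entry_scale_mat [simp]: "entry (scale_mat c x) u v = scale c (entry x u v)"
proof -
  have "finite_support (\<lambda>u v. scale c (entry x u v))"
    by (rule finite_supportI[OF finite_support_entry[of x]]) (metis scale_zero support_entry)
  then show ?thesis unfolding scale_mat_def by (simp add: entry_fmat_of)
qed

sublocale mat: assoc_algebra scale_mat
proof
  fix c d and x y :: "'a gmat"
  show "scale_mat c (x + y) = scale_mat c x + scale_mat c y"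
    "scale_mat (c + d) x = scale_mat c x + scale_mat d x"
    "scale_mat c (scale_mat d x) = scale_mat (c * d) x" "scale_mat 1 x = x"
    by (rule fmat_eqI, simp add: scale_simps)+
  have "support (scale_mat c x) \<subseteq> support x"
    by (rule support_subsetI) (metis entry_scale_mat scale_zero support_entry)
  then show "scale_mat c x * y = scale_mat c (x * y)" "x * scale_mat c y = scale_mat c (x * y)"
    by (rule_tac [!] fmat_eqI) (simp_all add: entry_mult_left_support[OF finite_support_entry[of x]]
        scale_sum scale_simps(5,6))
qed

lemma finite_dim_support:
  assumes "finite I" shows "mat.finite_dim {x. support x \<subseteq> I}"
proof -
  obtain B where B: "finite B" "\<And>x. \<exists>c. x = (\<Sum>b\<in>B. scale (c b) b)"
    using fd_algebra unfolding fd_algebra_def by auto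
  let ?E = "(\<lambda>(u, v, b). single u v b) ` (I \<times> I \<times> B)"
  have "single u v a \<in> mat.span ?E" if "u \<in> I" "v \<in> I" for u v a
  proof -
    obtain c where c: "a = (\<Sum>b\<in>B. scale (c b) b)" using B(2) by blast
    have "single u v a = (\<Sum>b\<in>B. scale_mat (c b) (single u v b))"
      by (rule fmat_eqI) (auto simp: single.rep_eq entry_sum c)
    also have "\<dots> \<in> mat.span ?E"
      using that by (intro mat.span_sum mat.span_scale mat.span_base) force
    finally show ?thesis .
  qed
  then have sum: "(\<Sum>u\<in>I. \<Sum>v\<in>I. single u v (entry x u v)) \<in> mat.span ?E" for x :: "'a gmat"
    by (intro mat.span_sum)
  have "x \<in> mat.span ?E" if "support x \<subseteq> I" for x
    using sum[of x] unfolding fmat_eq_sum_single[OF assms that, symmetric] .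
  moreover have "finite ?E" using assms B(1) by simp
  ultimately show ?thesis unfolding mat.finite_dim_def
    by (intro exI[of _ ?E]) auto
qed

lemma finite_dim_corner: "mat.finite_dim (corner e f)"
  by (rule mat.finite_dim_subset[OF finite_dim_support[of "support e \<union> support f"]])
    (auto simp: finite_support_entry dest: support_corner)

end

section \<open>Complexes as pairs of matrices\<close>

text \<open>The first component is the idempotent cutting out all terms at once, the second one the total
  differential.\<close>

type_synonym 'a gcplx = "'a gmat \<times> 'a gmat"

abbreviation idem :: "'a::zero gcplx \<Rightarrow> 'a gmat" where "idem \<equiv> fst"
abbreviation dif :: "'a::zero gcplx \<Rightarrow> 'a gmat" where "dif \<equiv> snd"

locale graded_complex =
  fixes X :: "'a::ring gcplx"
  assumes homogeneous_idem: "homogeneous 0 (idem X)" and homogeneous_dif: "homogeneous 1 (dif X)"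
    and idem_idem: "idem X * idem X = idem X" and idem_dif: "idem X * dif X = dif X"
    and dif_idem: "dif X * idem X = dif X" and dif_dif: "dif X * dif X = 0"
begin

lemma complex_assoc:
  "idem X * (idem X * y) = idem X * y" "idem X * (dif X * y) = dif X * y"
  "dif X * (idem X * y) = dif X * y" "dif X * (dif X * y) = 0"
  by (simp_all add: idem_idem idem_dif dif_idem dif_dif flip: mult.assoc)

lemmas complex_simps = idem_idem idem_dif dif_idem dif_dif complex_assoc

end

definition koszul :: "int \<Rightarrow> 'r::ring \<Rightarrow> 'r" where
  "koszul k x = (if even k then x else - x)"

lemma koszul_add: "koszul k (x + y) = koszul k x + koszul k y"
  and koszul_uminus: "koszul k (- x) = - koszul k x"
  and koszul_mult_left: "koszul k x * y = koszul k (x * y)"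
  and koszul_mult_right: "x * koszul k y = koszul k (x * y)"
  and koszul_koszul: "koszul k (koszul l x) = koszul (k + l) x"
  and koszul_0 [simp]: "koszul 0 x = x"
  and koszul_1 [simp]: "koszul 1 x = - x"
  and koszul_zero [simp]: "koszul k 0 = 0"
  unfolding koszul_def by auto

definition homs :: "int \<Rightarrow> 'a::ring gcplx \<Rightarrow> 'a gcplx \<Rightarrow> 'a gmat set" where
  "homs k X Y = {f \<in> corner (idem X) (idem Y). homogeneous k f}"

definition cocycles :: "int \<Rightarrow> 'a::ring gcplx \<Rightarrow> 'a gcplx \<Rightarrow> 'a gmat set" where
  "cocycles k X Y = {f \<in> homs k X Y. koszul k (dif Y * f) = f * dif X}"

definition coboundaries :: "int \<Rightarrow> 'a::ring gcplx \<Rightarrow> 'a gcplx \<Rightarrow> 'a gmat set" where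
  "coboundaries k X Y = {koszul k (dif Y * h) + h * dif X | h. h \<in> homs (k - 1) X Y}"

lemma homsI: "f \<in> corner (idem X) (idem Y) \<Longrightarrow> homogeneous k f \<Longrightarrow> f \<in> homs k X Y"
  and homs_homogeneous: "f \<in> homs k X Y \<Longrightarrow> homogeneous k f"
  and homs_corner: "f \<in> homs k X Y \<Longrightarrow> f \<in> corner (idem X) (idem Y)"
  unfolding homs_def by auto

lemma cocyclesI: "f \<in> homs k X Y \<Longrightarrow> koszul k (dif Y * f) = f * dif X \<Longrightarrow> f \<in> cocycles k X Y"
  and cocycles_homs: "f \<in> cocycles k X Y \<Longrightarrow> f \<in> homs k X Y"
  and cocycles_dif: "f \<in> cocycles k X Y \<Longrightarrow> koszul k (dif Y * f) = f * dif X"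
  unfolding cocycles_def by auto

lemma chain_mapI: "f \<in> homs 0 X Y \<Longrightarrow> dif Y * f = f * dif X \<Longrightarrow> f \<in> cocycles 0 X Y"
  and chain_map_dif: "f \<in> cocycles 0 X Y \<Longrightarrow> dif Y * f = f * dif X"
  unfolding cocycles_def by auto

lemmas cocycles_corner = homs_corner[OF cocycles_homs]

lemma coboundariesI: "h \<in> homs (k - 1) X Y \<Longrightarrow> koszul k (dif Y * h) + h * dif X \<in> coboundaries k X Y"
  unfolding coboundaries_def by blast

lemma coboundariesE:
  assumes "f \<in> coboundaries k X Y"
  obtains h where "h \<in> homs (k - 1) X Y" "f = koszul k (dif Y * h) + h * dif X"
  using assms unfolding coboundaries_def by blast

lemma homs_zero [simp]: "0 \<in> homs k X Y" and cocycles_zero [simp]: "0 \<in> cocycles k X Y"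
  unfolding homs_def cocycles_def by (auto simp: corner_zero)

lemma coboundaries_zero [simp]: "0 \<in> coboundaries k X Y"
  using coboundariesI[OF homs_zero] by simp

lemma homs_add: "f \<in> homs k X Y \<Longrightarrow> g \<in> homs k X Y \<Longrightarrow> f + g \<in> homs k X Y"
  and homs_uminus: "f \<in> homs k X Y \<Longrightarrow> - f \<in> homs k X Y"
  and homs_diff: "f \<in> homs k X Y \<Longrightarrow> g \<in> homs k X Y \<Longrightarrow> f - g \<in> homs k X Y"
  unfolding homs_def
  by (auto simp: homogeneous_add homogeneous_uminus homogeneous_diff corner_add corner_uminus corner_diff)

lemma homs_koszul: "f \<in> homs k X Y \<Longrightarrow> koszul l f \<in> homs k X Y"
  by (simp add: koszul_def homs_uminus)

lemma homs_mult: "g \<in> homs l Y W \<Longrightarrow> f \<in> homs k X Y \<Longrightarrow> g * f \<in> homs (k + l) X W"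
  unfolding homs_def using homogeneous_mult[of l g k f] by (auto simp: corner_mult add.commute)

lemma cocycles_add: "f \<in> cocycles k X Y \<Longrightarrow> g \<in> cocycles k X Y \<Longrightarrow> f + g \<in> cocycles k X Y"
  and cocycles_uminus: "f \<in> cocycles k X Y \<Longrightarrow> - f \<in> cocycles k X Y"
  unfolding cocycles_def
  by (auto simp: homs_add homs_uminus distrib_left distrib_right koszul_add koszul_uminus)

lemma cocycles_diff: "f \<in> cocycles k X Y \<Longrightarrow> g \<in> cocycles k X Y \<Longrightarrow> f - g \<in> cocycles k X Y"
  using cocycles_add[of f k X Y "- g"] cocycles_uminus[of g k X Y] by simp

lemma coboundaries_add:
  assumes "f \<in> coboundaries k X Y" "g \<in> coboundaries k X Y" shows "f + g \<in> coboundaries k X Y"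
proof -
  obtain h where h: "h \<in> homs (k - 1) X Y" "f = koszul k (dif Y * h) + h * dif X"
    using assms(1) by (rule coboundariesE)
  obtain h' where h': "h' \<in> homs (k - 1) X Y" "g = koszul k (dif Y * h') + h' * dif X"
    using assms(2) by (rule coboundariesE)
  show ?thesis
    using coboundariesI[OF homs_add[OF h(1) h'(1)]] by (simp add: h(2) h'(2) algebra_simps koszul_add)
qed

lemma coboundaries_uminus: "f \<in> coboundaries k X Y \<Longrightarrow> - f \<in> coboundaries k X Y"
  by (elim coboundariesE) (use coboundariesI[OF homs_uminus] in \<open>fastforce simp: koszul_uminus\<close>)

lemma coboundaries_diff:
  "f \<in> coboundaries k X Y \<Longrightarrow> g \<in> coboundaries k X Y \<Longrightarrow> f - g \<in> coboundaries k X Y"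
  using coboundaries_add[of f k X Y "- g"] coboundaries_uminus[of g k X Y] by simp

lemma cocycles_mult:
  assumes "g \<in> cocycles l Y W" "f \<in> cocycles k X Y" shows "g * f \<in> cocycles (k + l) X W"
proof (rule cocyclesI)
  show "g * f \<in> homs (k + l) X W" using assms by (intro homs_mult cocycles_homs)
  have "koszul (k + l) (dif W * (g * f)) = koszul k (koszul l (dif W * g) * f)"
    by (simp add: koszul_koszul koszul_mult_left mult.assoc)
  also have "\<dots> = g * koszul k (dif Y * f)"
    by (simp add: cocycles_dif[OF assms(1)] koszul_mult_right mult.assoc)
  also have "\<dots> = g * f * dif X" by (simp add: cocycles_dif[OF assms(2)] mult.assoc)
  finally show "koszul (k + l) (dif W * (g * f)) = g * f * dif X" .
qed

lemma coboundaries_mult_left: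
  assumes "g \<in> cocycles l Y W" "f \<in> coboundaries k X Y" shows "g * f \<in> coboundaries (k + l) X W"
proof -
  obtain h where h: "h \<in> homs (k - 1) X Y" "f = koszul k (dif Y * h) + h * dif X"
    using assms(2) by (rule coboundariesE)
  have "g * f = koszul k (g * dif Y * h) + g * h * dif X"
    by (simp add: h(2) distrib_left koszul_mult_right mult.assoc)
  also have "koszul k (g * dif Y * h) = koszul (k + l) (dif W * (g * h))"
    unfolding cocycles_dif[OF assms(1), symmetric]
    by (simp add: koszul_koszul koszul_mult_left mult.assoc)
  finally show ?thesis
    using coboundariesI[of "g * h" "k + l"] homs_mult[OF cocycles_homs[OF assms(1)] h(1)]
    by (simp add: algebra_simps)
qed

lemma coboundaries_mult_right:
  assumes "g \<in> coboundaries l Y W" "f \<in> cocycles k X Y" shows "g * f \<in> coboundaries (k + l) X W"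
proof -
  obtain h where h: "h \<in> homs (l - 1) Y W" "g = koszul l (dif W * h) + h * dif Y"
    using assms(1) by (rule coboundariesE)
  have "dif Y * f = koszul k (koszul k (dif Y * f))" by (simp add: koszul_def)
  also have "\<dots> = koszul k (f * dif X)" by (simp add: cocycles_dif[OF assms(2)])
  finally have "g * f = koszul l (dif W * h * f) + h * koszul k (f * dif X)"
    by (simp add: h(2) distrib_right koszul_mult_left mult.assoc)
  also have "\<dots> = koszul (k + l) (dif W * koszul k (h * f)) + koszul k (h * f) * dif X"
    by (simp add: koszul_def mult.assoc)
  finally show ?thesis
    using coboundariesI[of "koszul k (h * f)" "k + l"]
      homs_koszul[OF homs_mult[OF h(1) cocycles_homs[OF assms(2)]], of k] by (simp add: algebra_simps)
qed

lemma (in graded_complex) idem_cocycle: "idem X \<in> cocycles 0 X X"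
  by (intro chain_mapI homsI corner_self) (simp_all add: complex_simps homogeneous_idem)

definition htpy_iso :: "'a::ring gcplx \<Rightarrow> 'a gcplx \<Rightarrow> bool" where
  "htpy_iso X Y \<longleftrightarrow> (\<exists>f\<in>cocycles 0 X Y. \<exists>g\<in>cocycles 0 Y X.
     g * f - idem X \<in> coboundaries 0 X X \<and> f * g - idem Y \<in> coboundaries 0 Y Y)"

definition no_positive_ext :: "'a::ring gcplx \<Rightarrow> 'a gcplx \<Rightarrow> bool" where
  "no_positive_ext X Y \<longleftrightarrow> (\<forall>l::nat. l > 0 \<longrightarrow> cocycles (int l) X Y \<subseteq> coboundaries (int l) X Y)"

section \<open>Assembling a bounded complex into a pair of matrices\<close>

definition bounded_family ::
  "int \<Rightarrow> (int \<Rightarrow> nat) \<Rightarrow> (int \<Rightarrow> nat) \<Rightarrow> (int \<Rightarrow> 'a::zero mat) \<Rightarrow> bool" where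
  "bounded_family k v u f \<longleftrightarrow> (\<forall>i. f i \<in> carrier_mat (v (i + k)) (u i)) \<and>
     (\<exists>N. \<forall>i. \<bar>i\<bar> > N \<longrightarrow> f i = 0\<^sub>m (v (i + k)) (u i))"

definition assemble :: "int \<Rightarrow> (int \<Rightarrow> nat) \<Rightarrow> (int \<Rightarrow> nat) \<Rightarrow> (int \<Rightarrow> 'a::zero mat) \<Rightarrow> 'a gmat" where
  "assemble k v u f = fmat_of (\<lambda>x y.
     if degree x = degree y + k \<and> position x < v (degree x) \<and> position y < u (degree y)
     then f (degree y) $$ (position x, position y) else 0)"

lemma bounded_family_carrier: "bounded_family k v u f \<Longrightarrow> f i \<in> carrier_mat (v (i + k)) (u i)"
  unfolding bounded_family_def by blast

lemma bounded_familyE: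
  assumes "bounded_family k v u f"
  obtains N where "\<forall>i. \<bar>i\<bar> > N \<longrightarrow> f i = 0\<^sub>m (v (i + k)) (u i)"
  using assms unfolding bounded_family_def by blast

lemma entry_assemble:
  assumes "bounded_family k v u f"
  shows "entry (assemble k v u f) x y =
    (if degree x = degree y + k \<and> position x < v (degree x) \<and> position y < u (degree y)
     then f (degree y) $$ (position x, position y) else 0)" (is "_ = ?f x y")
proof -
  obtain N where N: "\<forall>i. \<bar>i\<bar> > N \<longrightarrow> f i = 0\<^sub>m (v (i + k)) (u i)"
    using assms by (rule bounded_familyE)
  define R where "R = \<bar>N\<bar> + \<bar>k\<bar>"
  define I where "I = (\<lambda>(i, a). Ix i a) ` (SIGMA i:{-R..R}. {..<v i + u i})"
  have I: "x \<in> I" if "\<bar>degree x\<bar> \<le> R" "position x < v (degree x) + u (degree x)" for x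
    using that unfolding I_def by (intro image_eqI[of _ _ "(degree x, position x)"]) auto
  have "finite_support ?f"
  proof (rule finite_supportI[of I])
    show "finite I" unfolding I_def by auto
    fix x y assume "?f x y \<noteq> 0"
    then have xy: "degree x = degree y + k" "position x < v (degree x)" "position y < u (degree y)"
      "f (degree y) $$ (position x, position y) \<noteq> 0" by (auto split: if_splits)
    then have "\<not> \<bar>degree y\<bar> > N" using N by auto
    then have "\<bar>degree x\<bar> \<le> R" "\<bar>degree y\<bar> \<le> R" unfolding R_def using xy(1) by linarith+
    then show "x \<in> I \<and> y \<in> I" using xy(2,3) by (simp add: I)
  qed
  then show ?thesis unfolding assemble_def by (simp add: entry_fmat_of)
qed

lemma homogeneous_assemble: "bounded_family k v u f \<Longrightarrow> homogeneous k (assemble k v u f)"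
  unfolding homogeneous_def by (auto simp: entry_assemble split: if_splits)

lemma entry_assemble_mult:
  fixes g :: "int \<Rightarrow> 'a::ring_1 mat"
  assumes f: "bounded_family k v u f"
  shows "entry (assemble l w v g * assemble k v u f) x y =
    (\<Sum>c = 0..<v (degree y + k). entry (assemble l w v g) x (Ix (degree y + k) c) *
      entry (assemble k v u f) (Ix (degree y + k) c) y)"
proof -
  let ?I = "Ix (degree y + k) ` {0..<v (degree y + k)}"
  have "entry (assemble l w v g * assemble k v u f) x y =
    (\<Sum>z\<in>?I. entry (assemble l w v g) x z * entry (assemble k v u f) z y)"
  proof (rule entry_mult)
    fix z assume "z \<notin> ?I"
    then have "degree z \<noteq> degree y + k \<or> \<not> position z < v (degree z)"
      by (metis atLeastLessThan_iff image_eqI index.collapse le0)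
    then show "entry (assemble l w v g) x z = 0 \<or> entry (assemble k v u f) z y = 0"
      by (auto simp: entry_assemble[OF f])
  qed simp
  then show ?thesis by (simp add: sum.reindex inj_on_def)
qed

lemma assemble_mult:
  fixes g :: "int \<Rightarrow> 'a::ring_1 mat"
  assumes g: "bounded_family l w v g" and f: "bounded_family k v u f"
  shows bounded_family_mult: "bounded_family (k + l) w u (\<lambda>i. g (i + k) * f i)"
    and "assemble l w v g * assemble k v u f = assemble (k + l) w u (\<lambda>i. g (i + k) * f i)"
proof -
  note carrier = bounded_family_carrier[OF g] bounded_family_carrier[OF f]
  obtain N where N: "\<forall>i. \<bar>i\<bar> > N \<longrightarrow> f i = 0\<^sub>m (v (i + k)) (u i)"
    using f by (rule bounded_familyE)
  have "g (i + k) * f i = 0\<^sub>m (w (i + (k + l))) (u i)" if "\<bar>i\<bar> > N" for i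
    using N that carrier(1)[of "i + k"] by (simp add: add.assoc)
  then show gf: "bounded_family (k + l) w u (\<lambda>i. g (i + k) * f i)"
    unfolding bounded_family_def using carrier by (metis add.assoc mult_carrier_mat)
  show "assemble l w v g * assemble k v u f = assemble (k + l) w u (\<lambda>i. g (i + k) * f i)"
  proof (rule fmat_eqI)
    fix x y
    let ?j = "degree y"
    have "entry (assemble l w v g * assemble k v u f) x y = (\<Sum>c = 0..<v (?j + k).
        entry (assemble l w v g) x (Ix (?j + k) c) * entry (assemble k v u f) (Ix (?j + k) c) y)"
      by (rule entry_assemble_mult[OF f])
    also have "\<dots> = entry (assemble (k + l) w u (\<lambda>i. g (i + k) * f i)) x y"
    proof (cases "degree x = ?j + (k + l) \<and> position x < w (degree x) \<and> position y < u ?j")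
      case True
      then have "(g (?j + k) * f ?j) $$ (position x, position y) =
          (\<Sum>c = 0..<v (?j + k). g (?j + k) $$ (position x, c) * f ?j $$ (c, position y))"
        using carrier(1)[of "?j + k"] carrier(2)[of ?j]
        by (auto simp: scalar_prod_def add.assoc intro!: sum.cong)
      then show ?thesis
        using True by (simp add: entry_assemble[OF f] entry_assemble[OF g] entry_assemble[OF gf] add.assoc)
    next
      case False
      then show ?thesis
        by (auto simp: entry_assemble[OF f] entry_assemble[OF g] entry_assemble[OF gf] add.assoc
            intro!: sum.neutral)
    qed
    finally show "entry (assemble l w v g * assemble k v u f) x y =
      entry (assemble (k + l) w u (\<lambda>i. g (i + k) * f i)) x y" .
  qed
qed

lemma assemble_add:
  fixes f g :: "int \<Rightarrow> 'a::ring_1 mat"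
  assumes f: "bounded_family k v u f" and g: "bounded_family k v u g"
  shows bounded_family_add: "bounded_family k v u (\<lambda>i. f i + g i)"
    and "assemble k v u (\<lambda>i. f i + g i) = assemble k v u f + assemble k v u g"
proof -
  note carrier = bounded_family_carrier[OF f] bounded_family_carrier[OF g]
  obtain N where N: "\<forall>i. \<bar>i\<bar> > N \<longrightarrow> f i = 0\<^sub>m (v (i + k)) (u i)"
    using f by (rule bounded_familyE)
  obtain N' where N': "\<forall>i. \<bar>i\<bar> > N' \<longrightarrow> g i = 0\<^sub>m (v (i + k)) (u i)"
    using g by (rule bounded_familyE)
  have "\<forall>i. \<bar>i\<bar> > max N N' \<longrightarrow> f i + g i = 0\<^sub>m (v (i + k)) (u i)" using N N' by auto
  then show fg: "bounded_family k v u (\<lambda>i. f i + g i)"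
    unfolding bounded_family_def using carrier by (meson add_carrier_mat)
  have "(f j + g j) $$ (a, b) = f j $$ (a, b) + g j $$ (a, b)" if "a < v (j + k)" "b < u j" for a j b
    using carrier(1)[of j] carrier(2)[of j] that by simp
  then show "assemble k v u (\<lambda>i. f i + g i) = assemble k v u f + assemble k v u g"
    by (intro fmat_eqI) (auto simp: entry_assemble[OF f] entry_assemble[OF g] entry_assemble[OF fg])
qed

lemma assemble_uminus:
  fixes f :: "int \<Rightarrow> 'a::ring_1 mat"
  assumes f: "bounded_family k v u f"
  shows bounded_family_uminus: "bounded_family k v u (\<lambda>i. - f i)"
    and "assemble k v u (\<lambda>i. - f i) = - assemble k v u f"
proof -
  obtain N where N: "\<forall>i. \<bar>i\<bar> > N \<longrightarrow> f i = 0\<^sub>m (v (i + k)) (u i)"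
    using f by (rule bounded_familyE)
  have "\<forall>i. \<bar>i\<bar> > N \<longrightarrow> - f i = 0\<^sub>m (v (i + k)) (u i)" using N by auto
  then show minus_f: "bounded_family k v u (\<lambda>i. - f i)"
    unfolding bounded_family_def using bounded_family_carrier[OF f] by (meson uminus_carrier_mat)
  have "(- f j) $$ (a, b) = - f j $$ (a, b)" if "a < v (j + k)" "b < u j" for a j b
    using bounded_family_carrier[OF f, of j] that by simp
  then show "assemble k v u (\<lambda>i. - f i) = - assemble k v u f"
    by (intro fmat_eqI) (auto simp: entry_assemble[OF f] entry_assemble[OF minus_f])
qed

lemma assemble_diff:
  fixes f g :: "int \<Rightarrow> 'a::ring_1 mat"
  assumes f: "bounded_family k v u f" and g: "bounded_family k v u g"
  shows "bounded_family k v u (\<lambda>i. f i - g i)"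
    and "assemble k v u (\<lambda>i. f i - g i) = assemble k v u f - assemble k v u g"
proof -
  have diff_as_add: "(\<lambda>i. f i - g i) = (\<lambda>i. f i + - g i)"
    using bounded_family_carrier[OF f] bounded_family_carrier[OF g]
    by (auto simp: fun_eq_iff minus_add_uminus_mat)
  note minus_g = bounded_family_uminus[OF g]
  show "bounded_family k v u (\<lambda>i. f i - g i)" unfolding diff_as_add by (rule bounded_family_add[OF f minus_g])
  show "assemble k v u (\<lambda>i. f i - g i) = assemble k v u f - assemble k v u g"
    unfolding diff_as_add by (simp add: assemble_add(2)[OF f minus_g] assemble_uminus(2)[OF g])
qed

lemma bounded_family_zero: "bounded_family k v u (\<lambda>i. 0\<^sub>m (v (i + k)) (u i))"
  unfolding bounded_family_def by auto

lemma assemble_zero: "assemble k v u (\<lambda>i. 0\<^sub>m (v (i + k)) (u i)) = (0 :: 'a::ring_1 gmat)"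
  by (rule fmat_eqI) (auto simp: entry_assemble[OF bounded_family_zero])

lemma assemble_inject:
  fixes f g :: "int \<Rightarrow> 'a::ring_1 mat"
  assumes f: "bounded_family k v u f" and g: "bounded_family k v u g"
  shows "assemble k v u f = assemble k v u g \<longleftrightarrow> f = g"
proof
  assume eq: "assemble k v u f = assemble k v u g"
  show "f = g"
  proof (rule ext, rule eq_matI)
    fix i a b assume "a < dim_row (g i)" "b < dim_col (g i)"
    then have "a < v (i + k)" "b < u i" using bounded_family_carrier[OF g, of i] by auto
    then show "f i $$ (a, b) = g i $$ (a, b)"
      using arg_cong[OF eq, of "\<lambda>x. entry x (Ix (i + k) a) (Ix i b)"]
      by (simp add: entry_assemble[OF f] entry_assemble[OF g])
  next
    fix i show "dim_row (f i) = dim_row (g i)" "dim_col (f i) = dim_col (g i)"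
      using bounded_family_carrier[OF f, of i] bounded_family_carrier[OF g, of i] by auto
  qed
qed simp

lemma assemble_surj:
  fixes x :: "'a::ring_1 gmat"
  assumes "homogeneous k x"
    and sizes: "\<And>s t. entry x s t \<noteq> 0 \<Longrightarrow> position s < v (degree s) \<and> position t < u (degree t)"
  defines "f \<equiv> \<lambda>i. mat (v (i + k)) (u i) (\<lambda>(a, b). entry x (Ix (i + k) a) (Ix i b))"
  shows "bounded_family k v u f" "assemble k v u f = x"
proof -
  obtain N where N: "\<forall>s\<in>support x. \<bar>degree s\<bar> \<le> int N \<and> position s < N"
    using finite_index_bound[OF finite_support_entry[of x]] by blast
  have "f i = 0\<^sub>m (v (i + k)) (u i)" if "\<bar>i\<bar> > int N" for i
  proof -
    have "Ix i b \<notin> support x" for b using N that by (metis index.sel(1) not_le)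
    then show ?thesis unfolding f_def using support_entry[of x] by (intro eq_matI) auto
  qed
  then show f: "bounded_family k v u f" unfolding bounded_family_def f_def by auto
  show "assemble k v u f = x"
  proof (rule fmat_eqI)
    fix s t
    show "entry (assemble k v u f) s t = entry x s t"
    proof (cases "entry x s t = 0")
      case True
      moreover have "Ix (degree t + k) (position s) = s" if "degree s = degree t + k"
        unfolding that[symmetric] by simp
      ultimately show ?thesis unfolding entry_assemble[OF f] unfolding f_def by auto
    next
      case False
      then have "degree s = degree t + k" using assms(1) unfolding homogeneous_def by blast
      moreover from this have "Ix (degree t + k) (position s) = s" by (metis index.collapse)
      ultimately show ?thesis
        unfolding entry_assemble[OF f] unfolding f_def using sizes[OF False] by simp
    qed
  qed
qed

subsection \<open>The pair of matrices of a complex\<close>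

definition msize :: "'a cplx \<Rightarrow> int \<Rightarrow> nat" where
  "msize X i = fst (cobj X i)"

definition tot :: "'a::ring_1 cplx \<Rightarrow> 'a gcplx" where
  "tot X = (assemble 0 (msize X) (msize X) (id_cmap X), assemble 1 (msize X) (msize X) (cdif X))"

definition hom_families :: "int \<Rightarrow> 'a::ring_1 cplx \<Rightarrow> 'a cplx \<Rightarrow> (int \<Rightarrow> 'a mat) set" where
  "hom_families k X Y = {f. \<forall>i. f i \<in> phom (cobj X i) (cobj Y (i + k))}"

definition tot_map :: "int \<Rightarrow> 'a::ring_1 cplx \<Rightarrow> 'a cplx \<Rightarrow> (int \<Rightarrow> 'a mat) \<Rightarrow> 'a gmat" where
  "tot_map k X Y f = assemble k (msize Y) (msize X) f"

lemma phom_iff: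
  assumes "proj_obj P" "proj_obj Q"
  shows "f \<in> phom P Q \<longleftrightarrow> f \<in> carrier_mat (fst Q) (fst P) \<and> snd Q * f = f \<and> f * snd P = f"
proof (cases "f \<in> carrier_mat (fst Q) (fst P)")
  case True
  have P: "snd P \<in> carrier_mat (fst P) (fst P)" "snd P * snd P = snd P"
    and Q: "snd Q \<in> carrier_mat (fst Q) (fst Q)" "snd Q * snd Q = snd Q"
    using assms unfolding proj_obj_def by auto
  have "snd Q * (snd Q * f * snd P) = snd Q * f * snd P"
    using assoc_mult_mat[OF Q(1) mult_carrier_mat[OF Q(1) True] P(1)] assoc_mult_mat[OF Q(1) Q(1) True]
    by (simp add: Q(2))
  moreover have "snd Q * f * snd P * snd P = snd Q * f * snd P"
    using assoc_mult_mat[OF mult_carrier_mat[OF Q(1) True] P(1) P(1)] by (simp add: P(2))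
  ultimately show ?thesis using True unfolding phom_def by auto
qed (auto simp: phom_def)

lemma is_complexD:
  assumes "is_complex X"
  shows proj_obj_cobj: "proj_obj (cobj X i)" and cdif_phom: "cdif X i \<in> phom (cobj X i) (cobj X (i + 1))"
    and cdif_cdif: "cdif X (i + 1) * cdif X i = 0\<^sub>m (msize X (i + 2)) (msize X i)"
  using assms unfolding is_complex_def msize_def by auto

lemma hom_families_carrier: "f \<in> hom_families k X Y \<Longrightarrow> f i \<in> carrier_mat (msize Y (i + k)) (msize X i)"
  unfolding hom_families_def phom_def msize_def by auto

lemma hom_families_iff:
  assumes "is_complex X" "is_complex Y"
  shows "f \<in> hom_families k X Y \<longleftrightarrow> (\<forall>i. f i \<in> carrier_mat (msize Y (i + k)) (msize X i)) \<and>
    (\<lambda>i. id_cmap Y (i + k) * f i) = f \<and> (\<lambda>i. f i * id_cmap X i) = f"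
  unfolding hom_families_def mem_Collect_eq phom_iff[OF proj_obj_cobj[OF assms(1)] proj_obj_cobj[OF assms(2)]]
  by (auto simp: fun_eq_iff msize_def id_cmap_def)

lemma id_cmap_families: "is_complex X \<Longrightarrow> id_cmap X \<in> hom_families 0 X X"
  and cdif_families: "is_complex X \<Longrightarrow> cdif X \<in> hom_families 1 X X"
  using proj_obj_cobj[of X] cdif_phom[of X]
  by (auto simp: hom_families_def id_cmap_def phom_iff proj_obj_def)

lemma bounded_hom_families:
  assumes X: "is_complex X" and Y: "is_complex Y" and f: "f \<in> hom_families k X Y"
  shows "bounded_family k (msize Y) (msize X) f"
proof -
  obtain N where N: "\<And>i. \<bar>i\<bar> > int N \<Longrightarrow> id_cmap X i = 0\<^sub>m (msize X i) (msize X i)"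
    using X unfolding is_complex_def msize_def id_cmap_def by blast
  have "f i = 0\<^sub>m (msize Y (i + k)) (msize X i)" if "\<bar>i\<bar> > int N" for i
  proof -
    have "f i = f i * id_cmap X i" using f unfolding hom_families_iff[OF X Y] by metis
    then show ?thesis using N[OF that] right_mult_zero_mat[OF hom_families_carrier[OF f, of i]] by simp
  qed
  then show ?thesis unfolding bounded_family_def using hom_families_carrier[OF f] by blast
qed

lemma bounded_id_cmap: "is_complex X \<Longrightarrow> bounded_family 0 (msize X) (msize X) (id_cmap X)"
  and bounded_cdif: "is_complex X \<Longrightarrow> bounded_family 1 (msize X) (msize X) (cdif X)"
  by (auto intro: bounded_hom_families id_cmap_families cdif_families)

lemma graded_complex_tot:
  assumes X: "is_complex X" shows "graded_complex (tot X)"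
proof -
  note id = bounded_id_cmap[OF X] and d = bounded_cdif[OF X]
  have "(\<lambda>i. id_cmap X i * id_cmap X i) = id_cmap X" "(\<lambda>i. id_cmap X (i + 1) * cdif X i) = cdif X"
    "(\<lambda>i. cdif X i * id_cmap X i) = cdif X"
    using id_cmap_families[OF X] cdif_families[OF X] by (simp_all add: hom_families_iff[OF X X])
  moreover have "(\<lambda>i. cdif X (i + 1) * cdif X i) = (\<lambda>i. 0\<^sub>m (msize X (i + (1 + 1))) (msize X i))"
    using cdif_cdif[OF X] by (simp add: fun_eq_iff)
  ultimately show ?thesis
    unfolding graded_complex_def tot_def fst_conv snd_conv
    by (simp add: homogeneous_assemble[OF id] homogeneous_assemble[OF d] assemble_mult(2)[OF id id]
        assemble_mult(2)[OF id d] assemble_mult(2)[OF d id] assemble_mult(2)[OF d d]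
        assemble_zero[of 2, simplified])
qed

lemma is_complexI:
  assumes id: "bounded_family 0 (msize X) (msize X) (id_cmap X)"
    and d: "bounded_family 1 (msize X) (msize X) (cdif X)" and "graded_complex (tot X)"
  shows "is_complex X"
proof -
  interpret graded_complex "tot X" by fact
  note tot_simps = complex_simps[unfolded tot_def fst_conv snd_conv]
  have "(\<lambda>i. id_cmap X i * id_cmap X i) = id_cmap X"
    using assemble_inject[OF bounded_family_mult[OF id id, simplified] id]
      assemble_mult(2)[OF id id] tot_simps(1) by simp
  moreover have "(\<lambda>i. id_cmap X (i + 1) * cdif X i) = cdif X"
    using assemble_inject[OF bounded_family_mult[OF id d, simplified] d]
      assemble_mult(2)[OF id d] tot_simps(2) by simp
  moreover have "(\<lambda>i. cdif X i * id_cmap X i) = cdif X"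
    using assemble_inject[OF bounded_family_mult[OF d id, simplified] d]
      assemble_mult(2)[OF d id] tot_simps(3) by simp
  moreover have "(\<lambda>i. cdif X (i + 1) * cdif X i) = (\<lambda>i. 0\<^sub>m (msize X (i + (1 + 1))) (msize X i))"
    using assemble_inject[OF bounded_family_mult[OF d d] bounded_family_zero]
      assemble_mult(2)[OF d d] tot_simps(4) by (simp add: assemble_zero)
  moreover obtain N where "\<forall>i. \<bar>i\<bar> > N \<longrightarrow> id_cmap X i = 0\<^sub>m (msize X (i + 0)) (msize X i)"
    using id by (rule bounded_familyE)
  then have "\<forall>i. \<bar>i\<bar> > int (nat N) \<longrightarrow> snd (cobj X i) = 0\<^sub>m (fst (cobj X i)) (fst (cobj X i))"
    unfolding id_cmap_def msize_def by auto
  then have "\<exists>N::nat. \<forall>i. \<bar>i\<bar> > int N \<longrightarrow> snd (cobj X i) = 0\<^sub>m (fst (cobj X i)) (fst (cobj X i))" by blast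
  ultimately show ?thesis
    using bounded_family_carrier[OF id] bounded_family_carrier[OF d]
    unfolding is_complex_def by (simp add: fun_eq_iff phom_iff proj_obj_def id_cmap_def msize_def)
qed

lemma tot_map_homs_iff:
  assumes X: "is_complex X" and Y: "is_complex Y" and f: "bounded_family k (msize Y) (msize X) f"
  shows "tot_map k X Y f \<in> homs k (tot X) (tot Y) \<longleftrightarrow> f \<in> hom_families k X Y"
proof -
  note left = assemble_mult[OF bounded_id_cmap[OF Y] f, simplified]
    and right = assemble_mult[OF f bounded_id_cmap[OF X], simplified]
  show ?thesis
    unfolding hom_families_iff[OF X Y] homs_def corner_def tot_map_def tot_def
    using homogeneous_assemble[OF f] bounded_family_carrier[OF f]
    by (simp add: left(2) right(2) assemble_inject[OF left(1) f] assemble_inject[OF right(1) f])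
qed

lemma tot_map_homs:
  assumes "is_complex X" "is_complex Y" "f \<in> hom_families k X Y"
  shows "tot_map k X Y f \<in> homs k (tot X) (tot Y)"
  using tot_map_homs_iff[OF assms(1,2) bounded_hom_families[OF assms]] assms(3) by blast

lemma support_idem_tot:
  assumes "is_complex X" "u \<in> support (idem (tot X))" shows "position u < msize X (degree u)"
  using assms(2) unfolding support_def tot_def
  by (auto simp: entry_assemble[OF bounded_id_cmap[OF assms(1)]] split: if_splits)

lemma tot_map_surj:
  assumes X: "is_complex X" and Y: "is_complex Y" and F: "F \<in> homs k (tot X) (tot Y)"
  obtains f where "f \<in> hom_families k X Y" "tot_map k X Y f = F"
proof -
  have "position s < msize Y (degree s) \<and> position t < msize X (degree t)" if nz: "entry F s t \<noteq> 0" for s t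
    using corner_entry[OF homs_corner[OF F] nz] support_idem_tot X Y by blast
  note fam = assemble_surj[OF homs_homogeneous[OF F] this]
  have "tot_map k X Y (\<lambda>i. mat (msize Y (i + k)) (msize X i) (\<lambda>(a, b). entry F (Ix (i + k) a) (Ix i b))) = F"
    unfolding tot_map_def by (rule fam(2))
  then show thesis using tot_map_homs_iff[OF X Y fam(1)] F by (intro that) simp_all
qed

lemma tot_map_image:
  assumes "is_complex X" "is_complex Y"
  shows "tot_map k X Y ` hom_families k X Y = homs k (tot X) (tot Y)"
  using tot_map_homs[OF assms] by (auto intro: tot_map_surj[OF assms])

subsection \<open>Chain maps and homotopies\<close>

lemma cobj_shift: "cobj (shift k X) i = cobj X (i + k)"
  and cdif_shift: "cdif (shift k X) i = (if even k then cdif X (i + k) else - cdif X (i + k))"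
  unfolding shift_def cobj_def cdif_def by auto

lemma shift_0 [simp]: "shift 0 X = X"
  unfolding shift_def cobj_def cdif_def by simp

lemma assemble_shift_dif:
  assumes Y: "is_complex Y" and f: "bounded_family k (msize Y) u f"
  shows "bounded_family (k + 1) (msize Y) u (\<lambda>i. cdif (shift l Y) (i + k - l) * f i)"
    and "assemble (k + 1) (msize Y) u (\<lambda>i. cdif (shift l Y) (i + k - l) * f i) =
      koszul l (dif (tot Y) * assemble k (msize Y) u f)"
proof -
  note df = assemble_mult[OF bounded_cdif[OF Y] f]
  have "- cdif Y (i + k) * f i = - (cdif Y (i + k) * f i)" for i
    using bounded_family_carrier[OF bounded_cdif[OF Y], of "i + k"] bounded_family_carrier[OF f, of i]
    by (intro uminus_mult_left_mat) auto
  then have "(\<lambda>i. cdif (shift l Y) (i + k - l) * f i) =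
      (if even l then (\<lambda>i. cdif Y (i + k) * f i) else (\<lambda>i. - (cdif Y (i + k) * f i)))"
    by (simp add: cdif_shift fun_eq_iff)
  then show "bounded_family (k + 1) (msize Y) u (\<lambda>i. cdif (shift l Y) (i + k - l) * f i)"
    "assemble (k + 1) (msize Y) u (\<lambda>i. cdif (shift l Y) (i + k - l) * f i) =
      koszul l (dif (tot Y) * assemble k (msize Y) u f)"
    using df assemble_uminus[OF df(1)] by (simp_all add: koszul_def tot_def)
qed

lemma chain_map_iff:
  assumes X: "is_complex X" and Y: "is_complex Y"
  shows "chain_map X (shift l Y) f \<longleftrightarrow>
    f \<in> hom_families l X Y \<and> tot_map l X Y f \<in> cocycles l (tot X) (tot Y)"
proof (cases "f \<in> hom_families l X Y")
  case True
  note f = bounded_hom_families[OF X Y True]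
  note df = assemble_shift_dif[OF Y f, of l, simplified]
    and fd = assemble_mult[OF f bounded_cdif[OF X], unfolded add.commute[of 1 l]]
  have "chain_map X (shift l Y) f \<longleftrightarrow> (\<lambda>i. cdif (shift l Y) i * f i) = (\<lambda>i. f (i + 1) * cdif X i)"
    using True unfolding chain_map_def hom_families_def by (auto simp: cobj_shift fun_eq_iff)
  also have "\<dots> \<longleftrightarrow> koszul l (dif (tot Y) * tot_map l X Y f) = tot_map l X Y f * dif (tot X)"
    unfolding assemble_inject[OF df(1) fd(1), symmetric] df(2) fd(2)[symmetric]
    by (simp add: tot_map_def tot_def)
  finally show ?thesis using True tot_map_homs[OF X Y True] unfolding cocycles_def by auto
next
  case False
  then show ?thesis unfolding chain_map_def hom_families_def by (auto simp: cobj_shift)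
qed

lemma null_homotopic_iff:
  assumes X: "is_complex X" and Y: "is_complex Y" and f: "bounded_family l (msize Y) (msize X) f"
  shows "null_homotopic X (shift l Y) f \<longleftrightarrow> tot_map l X Y f \<in> coboundaries l (tot X) (tot Y)"
proof -
  have homotopy_iff: "(\<forall>i. f i = cdif (shift l Y) (i - 1) * h i + h (i + 1) * cdif X i) \<longleftrightarrow>
      tot_map l X Y f = koszul l (dif (tot Y) * tot_map (l - 1) X Y h) + tot_map (l - 1) X Y h * dif (tot X)"
    if h: "h \<in> hom_families (l - 1) X Y" for h
  proof -
    note bh = bounded_hom_families[OF X Y h]
    note dh = assemble_shift_dif[OF Y bh, of l, simplified]
      and hd = assemble_mult[OF bh bounded_cdif[OF X], simplified]
    have "assemble l (msize Y) (msize X) (\<lambda>i. cdif (shift l Y) (i - 1) * h i + h (i + 1) * cdif X i) =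
        koszul l (dif (tot Y) * tot_map (l - 1) X Y h) + tot_map (l - 1) X Y h * dif (tot X)"
      unfolding assemble_add(2)[OF dh(1) hd(1)] dh(2) hd(2)[symmetric] by (simp add: tot_map_def tot_def)
    then show ?thesis
      using assemble_inject[OF f bounded_family_add[OF dh(1) hd(1)]]
      unfolding tot_map_def by (auto simp: fun_eq_iff)
  qed
  have "null_homotopic X (shift l Y) f \<longleftrightarrow>
    (\<exists>h\<in>hom_families (l - 1) X Y. \<forall>i. f i = cdif (shift l Y) (i - 1) * h i + h (i + 1) * cdif X i)"
    unfolding null_homotopic_def hom_families_def by (simp add: cobj_shift algebra_simps)
  also have "\<dots> \<longleftrightarrow> (\<exists>H\<in>homs (l - 1) (tot X) (tot Y).
      tot_map l X Y f = koszul l (dif (tot Y) * H) + H * dif (tot X))"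
    using homotopy_iff by (simp flip: tot_map_image[OF X Y])
  also have "\<dots> \<longleftrightarrow> tot_map l X Y f \<in> coboundaries l (tot X) (tot Y)"
    unfolding coboundaries_def by blast
  finally show ?thesis .
qed

lemma null_homotopic_composite_iff:
  assumes X: "is_complex X" and Y: "is_complex Y" and f: "f \<in> hom_families 0 X Y"
    and g: "g \<in> hom_families 0 Y X"
  shows "null_homotopic X X (\<lambda>i. g i * f i - id_cmap X i) \<longleftrightarrow>
    tot_map 0 Y X g * tot_map 0 X Y f - idem (tot X) \<in> coboundaries 0 (tot X) (tot X)"
proof -
  note gf = assemble_mult[OF bounded_hom_families[OF Y X g] bounded_hom_families[OF X Y f], simplified]
  note diff = assemble_diff[OF gf(1) bounded_id_cmap[OF X]]
  show ?thesis
    using null_homotopic_iff[OF X X diff(1)] by (simp add: tot_map_def tot_def diff(2) gf(2))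
qed

lemma htpy_equiv_iff:
  "X \<simeq>\<^sub>K Y \<longleftrightarrow> is_complex X \<and> is_complex Y \<and> htpy_iso (tot X) (tot Y)"
proof -
  have chain: "chain_map X Y f \<longleftrightarrow> f \<in> hom_families 0 X Y \<and> tot_map 0 X Y f \<in> cocycles 0 (tot X) (tot Y)"
    if "is_complex X" "is_complex Y" for X Y and f :: "int \<Rightarrow> 'a mat"
    using chain_map_iff[OF that, of 0] by simp
  have "(\<exists>f g. chain_map X Y f \<and> chain_map Y X g \<and>
        null_homotopic X X (\<lambda>i. g i * f i - id_cmap X i) \<and>
        null_homotopic Y Y (\<lambda>i. f i * g i - id_cmap Y i)) \<longleftrightarrow> htpy_iso (tot X) (tot Y)"
    if X: "is_complex X" and Y: "is_complex Y"
  proof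
    assume "\<exists>f g. chain_map X Y f \<and> chain_map Y X g \<and>
        null_homotopic X X (\<lambda>i. g i * f i - id_cmap X i) \<and>
        null_homotopic Y Y (\<lambda>i. f i * g i - id_cmap Y i)"
    then show "htpy_iso (tot X) (tot Y)"
      unfolding htpy_iso_def chain[OF X Y] chain[OF Y X]
      using null_homotopic_composite_iff[OF X Y] null_homotopic_composite_iff[OF Y X] by blast
  next
    assume "htpy_iso (tot X) (tot Y)"
    then obtain F G where FG: "F \<in> cocycles 0 (tot X) (tot Y)" "G \<in> cocycles 0 (tot Y) (tot X)"
      "G * F - idem (tot X) \<in> coboundaries 0 (tot X) (tot X)"
      "F * G - idem (tot Y) \<in> coboundaries 0 (tot Y) (tot Y)"
      unfolding htpy_iso_def by blast
    obtain f where f: "f \<in> hom_families 0 X Y" "tot_map 0 X Y f = F"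
      by (rule tot_map_surj[OF X Y cocycles_homs[OF FG(1)]])
    obtain g where g: "g \<in> hom_families 0 Y X" "tot_map 0 Y X g = G"
      by (rule tot_map_surj[OF Y X cocycles_homs[OF FG(2)]])
    show "\<exists>f g. chain_map X Y f \<and> chain_map Y X g \<and>
        null_homotopic X X (\<lambda>i. g i * f i - id_cmap X i) \<and>
        null_homotopic Y Y (\<lambda>i. f i * g i - id_cmap Y i)"
      using FG f g chain[OF X Y, of f] chain[OF Y X, of g] null_homotopic_composite_iff[OF X Y f(1) g(1)]
        null_homotopic_composite_iff[OF Y X g(1) f(1)]
      by (intro exI[of _ f] exI[of _ g]) simp
  qed
  then show ?thesis unfolding htpy_equiv_def by blast
qed

lemma presilting_iff: "presilting T \<longleftrightarrow> is_complex T \<and> no_positive_ext (tot T) (tot T)"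
proof -
  have "(\<forall>f. chain_map T (shift l T) f \<longrightarrow> null_homotopic T (shift l T) f) \<longleftrightarrow>
      cocycles l (tot T) (tot T) \<subseteq> coboundaries l (tot T) (tot T)" if T: "is_complex T" for l
  proof -
    have "(\<forall>f. chain_map T (shift l T) f \<longrightarrow> null_homotopic T (shift l T) f) \<longleftrightarrow>
      (\<forall>f\<in>hom_families l T T. tot_map l T T f \<in> cocycles l (tot T) (tot T) \<longrightarrow>
        tot_map l T T f \<in> coboundaries l (tot T) (tot T))"
      unfolding chain_map_iff[OF T T] by (auto simp: null_homotopic_iff[OF T T bounded_hom_families[OF T T]])
    also have "\<dots> \<longleftrightarrow> (\<forall>F\<in>homs l (tot T) (tot T). F \<in> cocycles l (tot T) (tot T) \<longrightarrow>
        F \<in> coboundaries l (tot T) (tot T))"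
      by (simp flip: tot_map_image[OF T T])
    also have "\<dots> \<longleftrightarrow> cocycles l (tot T) (tot T) \<subseteq> coboundaries l (tot T) (tot T)"
      using cocycles_homs by blast
    finally show ?thesis .
  qed
  then show ?thesis unfolding presilting_def no_positive_ext_def by blast
qed

lemma complex_realization:
  fixes e d :: "'a::ring_1 gmat"
  assumes "graded_complex (e, d)" obtains X where "is_complex X" "tot X = (e, d)"
proof -
  interpret graded_complex "(e, d)" by fact
  obtain n where n: "\<forall>u\<in>support e \<union> support d. \<bar>degree u\<bar> \<le> int n \<and> position u < n"
    using finite_index_bound[of "support e \<union> support d"] by (auto simp: finite_support_entry)
  define X where "X = ((\<lambda>i. (n, mat n n (\<lambda>(a, b). entry e (Ix (i + 0) a) (Ix i b)))),
     (\<lambda>i. mat n n (\<lambda>(a, b). entry d (Ix (i + 1) a) (Ix i b))))"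
  have X_simps: "msize X = (\<lambda>_. n)"
    "id_cmap X = (\<lambda>i. mat n n (\<lambda>(a, b). entry e (Ix (i + 0) a) (Ix i b)))"
    "cdif X = (\<lambda>i. mat n n (\<lambda>(a, b). entry d (Ix (i + 1) a) (Ix i b)))"
    by (simp_all add: X_def msize_def fun_eq_iff cobj_def id_cmap_def cdif_def)
  have size: "position s < n \<and> position t < n" if "entry e s t \<noteq> 0 \<or> entry d s t \<noteq> 0" for s t
    using that n support_entry[of e s t] support_entry[of d s t] by auto
  note e = assemble_surj[of 0 e "\<lambda>_. n" "\<lambda>_. n", OF homogeneous_idem[simplified] size]
    and d = assemble_surj[of 1 d "\<lambda>_. n" "\<lambda>_. n", OF homogeneous_dif[simplified] size]
  have "tot X = (e, d)" unfolding tot_def X_simps using e(2) d(2) by simp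
  moreover have "is_complex X"
    by (rule is_complexI) (use e(1) d(1) assms \<open>tot X = (e, d)\<close> in \<open>simp_all add: X_simps\<close>)
  ultimately show thesis by (rule that[rotated])
qed

section \<open>The Krull-Schmidt theorem\<close>

text \<open>Morphisms are elements of a ring; those in \<open>Null\<close> form an ideal and are regarded as zero.\<close>

locale quotient_category =
  fixes ob :: "'o \<Rightarrow> bool" and Hom Null :: "'o \<Rightarrow> 'o \<Rightarrow> 'm::ring set" and ident :: "'o \<Rightarrow> 'm"
  assumes Hom_zero: "0 \<in> Hom X Y"
    and Hom_add: "f \<in> Hom X Y \<Longrightarrow> g \<in> Hom X Y \<Longrightarrow> f + g \<in> Hom X Y"
    and Hom_uminus: "f \<in> Hom X Y \<Longrightarrow> - f \<in> Hom X Y"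
    and Hom_mult: "g \<in> Hom Y W \<Longrightarrow> f \<in> Hom X Y \<Longrightarrow> g * f \<in> Hom X W"
    and ident_Hom: "ob X \<Longrightarrow> ident X \<in> Hom X X"
    and ident_left: "f \<in> Hom X Y \<Longrightarrow> ident Y * f = f"
    and ident_right: "f \<in> Hom X Y \<Longrightarrow> f * ident X = f"
    and Null_zero: "0 \<in> Null X Y"
    and Null_add: "f \<in> Null X Y \<Longrightarrow> g \<in> Null X Y \<Longrightarrow> f + g \<in> Null X Y"
    and Null_uminus: "f \<in> Null X Y \<Longrightarrow> - f \<in> Null X Y"
    and Null_left: "g \<in> Hom Y W \<Longrightarrow> f \<in> Null X Y \<Longrightarrow> g * f \<in> Null X W"
    and Null_right: "g \<in> Null Y W \<Longrightarrow> f \<in> Hom X Y \<Longrightarrow> g * f \<in> Null X W"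
begin

lemma Hom_diff: "f \<in> Hom X Y \<Longrightarrow> g \<in> Hom X Y \<Longrightarrow> f - g \<in> Hom X Y"
  using Hom_add[of f X Y "- g"] Hom_uminus[of g X Y] by simp

lemma Null_diff: "f \<in> Null X Y \<Longrightarrow> g \<in> Null X Y \<Longrightarrow> f - g \<in> Null X Y"
  using Null_add[of f X Y "- g"] Null_uminus[of g X Y] by simp

lemma Null_mid: "x \<in> Null A B \<Longrightarrow> g \<in> Hom B C \<Longrightarrow> f \<in> Hom D A \<Longrightarrow> g * x * f \<in> Null D C"
  using Null_left Null_right by blast

lemma Null_cong: "f - g \<in> Null X Y \<Longrightarrow> g \<in> Null X Y \<Longrightarrow> f \<in> Null X Y"
  using Null_add[of "f - g" X Y g] by simp

lemma Null_trans: "f - g \<in> Null X Y \<Longrightarrow> g - h \<in> Null X Y \<Longrightarrow> f - h \<in> Null X Y"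
  using Null_add[of "f - g" X Y "g - h"] by simp

lemma Null_sym: "f - g \<in> Null X Y \<Longrightarrow> g - f \<in> Null X Y"
  using Null_uminus[of "f - g" X Y] by simp

lemma Null_factor:
  assumes "ident Y \<in> Null Y Y" "i \<in> Hom Y X" "p \<in> Hom W Y" shows "i * p \<in> Null W X"
  using Null_mid[OF assms] ident_right[OF assms(2)] by simp

subsection \<open>Retracts and isomorphisms\<close>

definition retract :: "'o \<Rightarrow> 'o \<Rightarrow> 'm \<Rightarrow> 'm \<Rightarrow> bool" where
  "retract Y X f g \<longleftrightarrow> ob Y \<and> ob X \<and> f \<in> Hom Y X \<and> g \<in> Hom X Y \<and> g * f - ident Y \<in> Null Y Y"

lemma retractD:
  assumes "retract Y X f g"
  shows retract_ob: "ob Y" "ob X" and retract_incl: "f \<in> Hom Y X" and retract_proj: "g \<in> Hom X Y"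
    and retract_null: "g * f - ident Y \<in> Null Y Y"
  using assms unfolding retract_def by auto

lemma retract_trans:
  assumes "retract X Y f g" "retract Y W f' g'" shows "retract X W (f' * f) (g * g')"
proof -
  note X = retractD[OF assms(1)] and Y = retractD[OF assms(2)]
  have "(g * g') * (f' * f) - ident X = g * (g' * f' - ident Y) * f + (g * f - ident X)"
    using ident_left[OF X(3)] by (simp add: algebra_simps)
  also have "\<dots> \<in> Null X X" by (intro Null_add Null_mid[OF Y(5) X(4,3)] X(5))
  finally show ?thesis using X Y Hom_mult unfolding retract_def by blast
qed

lemma retract_idempotent:
  assumes "retract Y X f g" shows "f * g * (f * g) - f * g \<in> Null X X"
proof -
  note fg = retractD[OF assms]
  have "f * g * (f * g) - f * g = f * (g * f - ident Y) * g"
    using ident_left[OF fg(4)] by (simp add: algebra_simps)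
  then show ?thesis using Null_mid[OF fg(5,3,4)] by simp
qed

definition iso :: "'o \<Rightarrow> 'o \<Rightarrow> bool" where
  "iso X Y \<longleftrightarrow> (\<exists>f g. retract X Y f g \<and> retract Y X g f)"

lemma iso_ob: "iso X Y \<Longrightarrow> ob X" "iso X Y \<Longrightarrow> ob Y"
  unfolding iso_def retract_def by auto

lemma retract_refl: "ob X \<Longrightarrow> retract X X (ident X) (ident X)"
  unfolding retract_def by (simp add: ident_Hom ident_left[OF ident_Hom] Null_zero)

lemma iso_refl: "ob X \<Longrightarrow> iso X X"
  unfolding iso_def using retract_refl by blast

lemma iso_sym: "iso X Y \<Longrightarrow> iso Y X"
  unfolding iso_def by blast

lemma iso_trans: "iso X Y \<Longrightarrow> iso Y W \<Longrightarrow> iso X W"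
  unfolding iso_def using retract_trans by blast

lemma retract_unique:
  assumes "retract Y X f g" "retract Z X f' g'" "f' * g' - f * g \<in> Null X X" shows "iso Y Z"
proof -
  have inverse: "g * f' * (g' * f) - ident Y \<in> Null Y Y"
    if retract: "retract Y X f g" and d: "f' * g' - f * g \<in> Null X X" for Y f g f' g'
  proof -
    note fg = retractD[OF retract]
    have "g * f' * (g' * f) - ident Y =
        g * (f' * g' - f * g) * f + (g * f) * (g * f - ident Y) + (g * f - ident Y)"
      using ident_right[OF fg(3)] by (simp add: algebra_simps)
    also have "\<dots> \<in> Null Y Y"
      by (intro Null_add Null_mid[OF d fg(4,3)] Null_left[OF Hom_mult[OF fg(4,3)] fg(5)] fg(5))
    finally show ?thesis .
  qed
  show ?thesis
    using inverse[OF assms(1,3)] inverse[OF assms(2) Null_sym[OF assms(3)]] retractD[OF assms(1)]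
      retractD[OF assms(2)] Hom_mult unfolding iso_def retract_def by blast
qed

definition iso_class_of :: "'o \<Rightarrow> 'o set" where
  "iso_class_of X = {Y. iso Y X}"

lemma iso_class_of_eq_iff:
  assumes "ob X" shows "iso_class_of X = iso_class_of Y \<longleftrightarrow> iso X Y"
proof
  assume "iso_class_of X = iso_class_of Y"
  then show "iso X Y" using iso_refl[OF assms] unfolding iso_class_of_def by blast
next
  assume "iso X Y"
  then show "iso_class_of X = iso_class_of Y" unfolding iso_class_of_def using iso_trans iso_sym by blast
qed

subsection \<open>Biproducts\<close>

definition biprod :: "'o \<Rightarrow> 'o \<Rightarrow> 'o \<Rightarrow> 'm \<Rightarrow> 'm \<Rightarrow> 'm \<Rightarrow> 'm \<Rightarrow> bool" where
  "biprod B Y Z i1 i2 p1 p2 \<longleftrightarrow> ob B \<and> ob Y \<and> ob Z \<and>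
     i1 \<in> Hom Y B \<and> i2 \<in> Hom Z B \<and> p1 \<in> Hom B Y \<and> p2 \<in> Hom B Z \<and>
     p1 * i1 - ident Y \<in> Null Y Y \<and> p2 * i2 - ident Z \<in> Null Z Z \<and> p1 * i2 \<in> Null Z Y \<and> p2 * i1 \<in> Null Y Z \<and>
     i1 * p1 + i2 * p2 - ident B \<in> Null B B"

lemma biprodD:
  assumes "biprod B Y Z i1 i2 p1 p2"
  shows biprod_ob: "ob B" "ob Y" "ob Z"
    and biprod_incl: "i1 \<in> Hom Y B" "i2 \<in> Hom Z B" and biprod_proj: "p1 \<in> Hom B Y" "p2 \<in> Hom B Z"
    and biprod_split: "p1 * i1 - ident Y \<in> Null Y Y" "p2 * i2 - ident Z \<in> Null Z Z"
    and biprod_orth: "p1 * i2 \<in> Null Z Y" "p2 * i1 \<in> Null Y Z"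
    and biprod_sum: "i1 * p1 + i2 * p2 - ident B \<in> Null B B"
  using assms unfolding biprod_def by auto

lemma biprod_swap: "biprod B Y Z i1 i2 p1 p2 \<Longrightarrow> biprod B Z Y i2 i1 p2 p1"
  unfolding biprod_def by (auto simp: add.commute)

lemma biprod_retract: "biprod B Y Z i1 i2 p1 p2 \<Longrightarrow> retract Y B i1 p1"
  unfolding biprod_def retract_def by blast

lemma biprod_incl_proj_null:
  assumes "biprod B Y Z i1 i2 p1 p2" "i1 * p1 \<in> Null B B" shows "ident Y \<in> Null Y Y"
proof -
  note incl = biprod_incl(1)[OF assms(1)] and proj = biprod_proj(1)[OF assms(1)]
    and split = biprod_split(1)[OF assms(1)]
  have "ident Y = p1 * (i1 * p1) * i1 - (p1 * i1) * (p1 * i1 - ident Y) - (p1 * i1 - ident Y)"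
    using ident_right[OF incl] by (simp add: algebra_simps)
  also have "\<dots> \<in> Null Y Y"
    by (intro Null_diff split Null_mid[OF assms(2) proj incl] Null_left[OF Hom_mult[OF proj incl] split])
  finally show ?thesis .
qed

lemma biprod_map_retract:
  assumes BYZ: "biprod B Y Z i1 i2 p1 p2" and B'Y'Z': "biprod B' Y' Z' j1 j2 q1 q2"
    and Y: "retract Y Y' a a'" and Z: "retract Z Z' d d'"
  shows "retract B B' (j1 * a * p1 + j2 * d * p2) (i1 * a' * q1 + i2 * d' * q2)"
proof -
  note incl = biprod_incl[OF BYZ] and proj = biprod_proj[OF BYZ]
    and incl' = biprod_incl[OF B'Y'Z'] and proj' = biprod_proj[OF B'Y'Z']
    and a = retract_incl[OF Y] and a' = retract_proj[OF Y]
    and d = retract_incl[OF Z] and d' = retract_proj[OF Z]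
  have "(i1 * a' * q1 + i2 * d' * q2) * (j1 * a * p1 + j2 * d * p2) - ident B
    = (i1 * a') * (q1 * j1 - ident Y') * (a * p1) + (i1 * a') * (q1 * j2) * (d * p2)
      + (i2 * d') * (q2 * j1) * (a * p1) + (i2 * d') * (q2 * j2 - ident Z') * (d * p2)
      + i1 * (a' * a - ident Y) * p1 + i2 * (d' * d - ident Z) * p2 + (i1 * p1 + i2 * p2 - ident B)"
    using ident_left[OF a] ident_left[OF d] ident_left[OF proj(1)] ident_left[OF proj(2)]
      ident_right[OF a'] ident_right[OF d'] ident_left[OF Hom_mult[OF a proj(1)]]
      ident_left[OF Hom_mult[OF d proj(2)]]
    by (simp add: algebra_simps)
  also have "\<dots> \<in> Null B B"
    by (intro Null_add biprod_sum[OF BYZ]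
        Null_mid[OF biprod_split(1)[OF B'Y'Z'] Hom_mult[OF incl(1) a'] Hom_mult[OF a proj(1)]]
        Null_mid[OF biprod_orth(1)[OF B'Y'Z'] Hom_mult[OF incl(1) a'] Hom_mult[OF d proj(2)]]
        Null_mid[OF biprod_orth(2)[OF B'Y'Z'] Hom_mult[OF incl(2) d'] Hom_mult[OF a proj(1)]]
        Null_mid[OF biprod_split(2)[OF B'Y'Z'] Hom_mult[OF incl(2) d'] Hom_mult[OF d proj(2)]]
        Null_mid[OF retract_null[OF Y] incl(1) proj(1)] Null_mid[OF retract_null[OF Z] incl(2) proj(2)])
  finally show ?thesis
    using biprod_ob(1)[OF BYZ] biprod_ob(1)[OF B'Y'Z'] incl proj incl' proj' a a' d d'
    unfolding retract_def by (auto intro!: Hom_add Hom_mult)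
qed

lemma biprod_cong:
  assumes "biprod B Y Z i1 i2 p1 p2" "biprod B' Y' Z' j1 j2 q1 q2" "iso Y Y'" "iso Z Z'"
  shows "iso B B'"
  using assms biprod_map_retract unfolding iso_def by meson

lemma biprod_transport:
  assumes BYZ: "biprod B Y Z j1 j2 q1 q2" and "retract X B f g" "retract B X g f"
  shows "biprod X Y Z (g * j1) (g * j2) (q1 * f) (q2 * f)"
proof -
  note X = retractD[OF assms(2)] and B = retractD[OF assms(3)]
  have inner: "q * f * (g * j) - q * j \<in> Null A C" if "q \<in> Hom B C" "j \<in> Hom A B" for q j A C
  proof -
    have "q * f * (g * j) - q * j = q * (f * g - ident B) * j"
      using ident_left[OF that(2)] by (simp add: algebra_simps)
    then show ?thesis using Null_mid[OF B(5) that] by simp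
  qed
  have "g * j1 * (q1 * f) + g * j2 * (q2 * f) - ident X =
    g * (j1 * q1 + j2 * q2 - ident B) * f + (g * f - ident X)"
    using ident_left[OF X(3)] by (simp add: algebra_simps)
  also have "\<dots> \<in> Null X X" by (intro Null_add X(5) Null_mid[OF biprod_sum[OF BYZ] X(4,3)])
  finally have "g * j1 * (q1 * f) + g * j2 * (q2 * f) - ident X \<in> Null X X" .
  then show ?thesis
    using X biprodD[OF BYZ] Null_trans[OF inner] Null_cong[OF inner] unfolding biprod_def
    by (intro conjI Hom_mult) blast+
qed

lemma biprod_regroup_retract:
  assumes BXW: "biprod B X W j1 j2 q1 q2" and WYW': "biprod W Y W' f i g p"
    and VXW': "biprod V X W' k1 k2 r1 r2"
  shows "retract V B (j1 * r1 + j2 * i * r2) (k1 * q1 + k2 * p * q2)"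
proof -
  note B = biprodD[OF BXW] and W = biprodD[OF WYW'] and V = biprodD[OF VXW']
  have "(k1 * q1 + k2 * p * q2) * (j1 * r1 + j2 * i * r2) - ident V =
    k1 * (q1 * j1 - ident X) * r1 + k1 * (q1 * j2) * (i * r2) + (k2 * p) * (q2 * j1) * r1
    + (k2 * p) * (q2 * j2 - ident W) * (i * r2) + k2 * (p * i - ident W')
      * r2 + (k1 * r1 + k2 * r2 - ident V)"
    using ident_left[OF W(5)] ident_left[OF V(6)] ident_left[OF V(7)] ident_left[OF Hom_mult[OF W(5) V(7)]]
    by (simp add: algebra_simps)
  also have "\<dots> \<in> Null V V"
    by (intro Null_add biprod_sum[OF VXW']
        Null_mid[OF biprod_split(1)[OF BXW] V(4,6)]
          Null_mid[OF biprod_orth(1)[OF BXW] V(4) Hom_mult[OF W(5) V(7)]]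
        Null_mid[OF biprod_orth(2)[OF BXW] Hom_mult[OF V(5) W(7)] V(6)]
        Null_mid[OF biprod_split(2)[OF BXW] Hom_mult[OF V(5) W(7)] Hom_mult[OF W(5) V(7)]]
        Null_mid[OF biprod_split(2)[OF WYW'] V(5,7)])
  finally show ?thesis using B W V unfolding retract_def by (auto intro!: Hom_add Hom_mult)
qed

lemma biprod_regroup_sum:
  assumes BXW: "biprod B X W j1 j2 q1 q2" and WYW': "biprod W Y W' f i g p"
    and VXW': "biprod V X W' k1 k2 r1 r2"
  shows "j2 * f * (g * q2) + (j1 * r1 + j2 * i * r2) * (k1 * q1 + k2 * p * q2) - ident B \<in> Null B B"
proof -
  note B = biprodD[OF BXW] and W = biprodD[OF WYW']
  have "j2 * f * (g * q2) + (j1 * r1 + j2 * i * r2) * (k1 * q1 + k2 * p * q2) - ident B =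
    j1 * (r1 * k1 - ident X) * q1 + j1 * (r1 * k2) * (p * q2) + (j2 * i) * (r2 * k1) * q1
    + (j2 * i) * (r2 * k2 - ident W') * (p * q2) + j2 * (f * g + i * p - ident W) * q2
    + (j1 * q1 + j2 * q2 - ident B)"
    using ident_left[OF W(7)] ident_left[OF B(6)] ident_left[OF B(7)] ident_left[OF Hom_mult[OF W(7) B(7)]]
    by (simp add: algebra_simps)
  also have "\<dots> \<in> Null B B"
    by (intro Null_add biprod_sum[OF BXW]
        Null_mid[OF biprod_split(1)[OF VXW'] B(4,6)]
          Null_mid[OF biprod_orth(1)[OF VXW'] B(4) Hom_mult[OF W(7) B(7)]]
        Null_mid[OF biprod_orth(2)[OF VXW'] Hom_mult[OF B(5) W(5)] B(6)]
        Null_mid[OF biprod_split(2)[OF VXW'] Hom_mult[OF B(5) W(5)] Hom_mult[OF W(7) B(7)]]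
        Null_mid[OF biprod_sum[OF WYW'] B(5,7)])
  finally show ?thesis .
qed

lemma biprod_regroup:
  assumes BXW: "biprod B X W j1 j2 q1 q2" and WYW': "biprod W Y W' f i g p"
    and VXW': "biprod V X W' k1 k2 r1 r2"
  shows "biprod B Y V (j2 * f) (j1 * r1 + j2 * i * r2) (g * q2) (k1 * q1 + k2 * p * q2)"
proof -
  note B = biprodD[OF BXW] and W = biprodD[OF WYW'] and V = biprodD[OF VXW']
  have Y: "retract Y B (j2 * f) (g * q2)"
    by (rule retract_trans[OF biprod_retract[OF WYW'] biprod_retract[OF biprod_swap[OF BXW]]])
  note V' = biprod_regroup_retract[OF assms]
  have "g * q2 * (j1 * r1 + j2 * i * r2) = g * (q2 * j1) * r1 + g * (q2 * j2 - ident W) * (i * r2) +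
    (g * i) * r2"
    using ident_left[OF W(5)] ident_left[OF Hom_mult[OF W(5) V(7)]] by (simp add: algebra_simps)
  also have "\<dots> \<in> Null V Y"
    by (intro Null_add Null_mid[OF biprod_orth(2)[OF BXW] W(6) V(6)]
        Null_mid[OF biprod_split(2)[OF BXW] W(6) Hom_mult[OF W(5) V(7)]]
          Null_right[OF biprod_orth(1)[OF WYW'] V(7)])
  finally have orth1: "g * q2 * (j1 * r1 + j2 * i * r2) \<in> Null V Y" .
  have "(k1 * q1 + k2 * p * q2) * (j2 * f) =
    k1 * (q1 * j2) * f + (k2 * p) * (q2 * j2 - ident W) * f + k2 * (p * f)"
    using ident_left[OF W(4)] by (simp add: algebra_simps)
  also have "\<dots> \<in> Null Y V"
    by (intro Null_add Null_mid[OF biprod_orth(1)[OF BXW] V(4) W(4)]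
        Null_mid[OF biprod_split(2)[OF BXW] Hom_mult[OF V(5) W(7)] W(4)]
          Null_left[OF V(5) biprod_orth(2)[OF WYW']])
  finally have orth2: "(k1 * q1 + k2 * p * q2) * (j2 * f) \<in> Null Y V" .
  show ?thesis
    using Y V' orth1 orth2 biprod_regroup_sum[OF assms] unfolding retract_def biprod_def by blast
qed

text \<open>If the component \<open>X \<rightarrow> Y\<close> of the identity between two decompositions of \<open>B\<close> is invertible, its
  Schur complement is an isomorphism between the other two summands.\<close>

lemma schur_complement_left_inverse:
  assumes BYZ: "biprod B Y Z i1 i2 p1 p2" and BXW: "biprod B X W j1 j2 q1 q2"
    and a: "a \<in> Hom X Y" "q1 * i1 * a - ident X \<in> Null X X"
  shows "(p2 * j2) * (q2 * i2 - q2 * i1 * a * q1 * i2) - ident Z \<in> Null Z Z"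
proof -
  note incl = biprod_incl[OF BYZ] and proj = biprod_proj[OF BYZ]
    and incl' = biprod_incl[OF BXW] and proj' = biprod_proj[OF BXW] and sum' = biprod_sum[OF BXW]
  have "(p2 * j2) * (q2 * i2 - q2 * i1 * a * q1 * i2) - ident Z =
    (p2 * i2 - ident Z) + p2 * (j1 * q1 + j2 * q2 - ident B) * i2 - (p2 * i1) * (a * q1 * i2)
    - p2 * (j1 * q1 + j2 * q2 - ident B) * (i1 * a * q1 * i2) + (p2 * j1) * (q1 * i1 * a - ident X)
      * (q1 * i2)"
    using ident_left[OF incl(2)] ident_left[OF incl(1)] ident_left[OF proj'(1)]
      ident_left[OF Hom_mult[OF proj'(1) incl(2)]]
      ident_left[OF Hom_mult[OF incl(1) Hom_mult[OF a(1) Hom_mult[OF proj'(1) incl(2)]]]]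
    by (simp add: algebra_simps)
  also have "\<dots> \<in> Null Z Z"
    by (intro Null_add Null_diff biprod_split(2)[OF BYZ] Null_mid[OF sum' proj(2) incl(2)]
        Null_right[OF biprod_orth(2)[OF BYZ] Hom_mult[OF Hom_mult[OF a(1) proj'(1)] incl(2)]]
        Null_mid[OF sum' proj(2) Hom_mult[OF Hom_mult[OF Hom_mult[OF incl(1) a(1)] proj'(1)] incl(2)]]
        Null_mid[OF a(2) Hom_mult[OF proj(2) incl'(1)] Hom_mult[OF proj'(1) incl(2)]])
  finally show ?thesis .
qed

lemma schur_complement_right_inverse:
  assumes BYZ: "biprod B Y Z i1 i2 p1 p2" and BXW: "biprod B X W j1 j2 q1 q2"
    and a: "a \<in> Hom X Y" "a * (q1 * i1) - ident Y \<in> Null Y Y"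
  shows "(q2 * i2 - q2 * i1 * a * q1 * i2) * (p2 * j2) - ident W \<in> Null W W"
proof -
  note incl = biprod_incl[OF BYZ] and proj = biprod_proj[OF BYZ] and sum = biprod_sum[OF BYZ]
    and incl' = biprod_incl[OF BXW] and proj' = biprod_proj[OF BXW]
  have "(q2 * i2 - q2 * i1 * a * q1 * i2) * (p2 * j2) - ident W =
    (q2 * j2 - ident W) + q2 * (i1 * p1 + i2 * p2 - ident B) * j2 - (q2 * i1 * a) * (q1 * j2)
    - (q2 * i1 * a * q1) * (i1 * p1 + i2 * p2 - ident B) * j2 + (q2 * i1)
      * (a * (q1 * i1) - ident Y) * (p1 * j2)"
    using ident_left[OF proj(1)] ident_left[OF incl'(2)] ident_left[OF Hom_mult[OF proj(1) incl'(2)]]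
    by (simp add: algebra_simps)
  also have "\<dots> \<in> Null W W"
    by (intro Null_add Null_diff biprod_split(2)[OF BXW] Null_mid[OF sum proj'(2) incl'(2)]
        Null_left[OF Hom_mult[OF Hom_mult[OF proj'(2) incl(1)] a(1)] biprod_orth(1)[OF BXW]]
        Null_mid[OF sum Hom_mult[OF Hom_mult[OF Hom_mult[OF proj'(2) incl(1)] a(1)] proj'(1)] incl'(2)]
        Null_mid[OF a(2) Hom_mult[OF proj'(2) incl(1)] Hom_mult[OF proj(1) incl'(2)]])
  finally show ?thesis .
qed

lemma schur_complement_iso:
  assumes BYZ: "biprod B Y Z i1 i2 p1 p2" and BXW: "biprod B X W j1 j2 q1 q2"
    and a: "a \<in> Hom X Y" "a * (q1 * i1) - ident Y \<in> Null Y Y" "q1 * i1 * a - ident X \<in> Null X X"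
  shows "iso Z W"
  using schur_complement_left_inverse[OF BYZ BXW a(1,3)] schur_complement_right_inverse[OF BYZ BXW a(1,2)]
    biprodD[OF BYZ] biprodD[OF BXW] a(1) unfolding iso_def retract_def
  by (intro exI[of _ "q2 * i2 - q2 * i1 * a * q1 * i2"] exI[of _ "p2 * j2"])
    (auto intro!: Hom_diff Hom_mult)

end

text \<open>The assumption \<open>exchange\<close> says that endomorphism rings modulo \<open>Null\<close> are exchange rings;
  \<open>osize\<close> bounds the number of summands.\<close>

locale krull_schmidt_category = quotient_category ob Hom Null ident
  for ob :: "'o \<Rightarrow> bool" and Hom Null :: "'o \<Rightarrow> 'o \<Rightarrow> 'm::ring set" and ident :: "'o \<Rightarrow> 'm" +
  fixes osum :: "'o \<Rightarrow> 'o \<Rightarrow> 'o" and ozero :: 'o and osize :: "'o \<Rightarrow> nat"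
  assumes ob_zero: "ob ozero" and ident_zero: "ident ozero = 0"
    and sum_biprod: "ob X \<Longrightarrow> ob Y \<Longrightarrow> \<exists>i1 i2 p1 p2. biprod (osum X Y) X Y i1 i2 p1 p2"
    and exchange: "ob X \<Longrightarrow> f \<in> Hom X X \<Longrightarrow> \<exists>e\<in>Hom X X. \<exists>u\<in>Hom X X. \<exists>v\<in>Hom X X. e * e - e \<in> Null X X \<and>
      f * u - e \<in> Null X X \<and> u * f - e \<in> Null X X \<and>
      (ident X - f) * v - (ident X - e) \<in> Null X X \<and> v * (ident X - f) - (ident X - e) \<in> Null X X"
    and splitting: "ob X \<Longrightarrow> f \<in> Hom X X \<Longrightarrow> f * f - f \<in> Null X X \<Longrightarrow>
      \<exists>Y Z i1 i2 p1 p2. biprod X Y Z i1 i2 p1 p2 \<and> i1 * p1 - f \<in> Null X X \<and>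
        (f \<notin> Null X X \<longrightarrow> ident X - f \<notin> Null X X \<longrightarrow> osize Y < osize X \<and> osize Z < osize X)"
begin

lemma ob_sum: "ob X \<Longrightarrow> ob Y \<Longrightarrow> ob (osum X Y)"
  using sum_biprod biprod_ob(1) by metis

lemma biprod_iso_sum: "biprod B Y Z i1 i2 p1 p2 \<Longrightarrow> iso B (osum Y Z)"
  using sum_biprod[of Y Z] biprod_cong iso_refl biprod_ob(2,3) by metis

lemma sum_cong: "iso X X' \<Longrightarrow> iso Y Y' \<Longrightarrow> iso (osum X Y) (osum X' Y')"
  using sum_biprod[of X Y] sum_biprod[of X' Y'] biprod_cong iso_ob by metis

lemma sum_commute: "ob X \<Longrightarrow> ob Y \<Longrightarrow> iso (osum X Y) (osum Y X)"
  using sum_biprod[of X Y] biprod_swap biprod_iso_sum by metis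

lemma sum_left_commute: "ob X \<Longrightarrow> ob Y \<Longrightarrow> ob Z \<Longrightarrow> iso (osum X (osum Y Z)) (osum Y (osum X Z))"
  using sum_biprod[of X "osum Y Z"] sum_biprod[of Y Z] sum_biprod[of X Z] biprod_regroup
    biprod_iso_sum ob_sum by metis

lemma sum_assoc:
  assumes "ob X" "ob Y" "ob Z" shows "iso (osum (osum X Y) Z) (osum X (osum Y Z))"
proof -
  have "iso (osum (osum X Y) Z) (osum Z (osum X Y))" using assms by (intro sum_commute ob_sum)
  moreover have "iso (osum Z (osum X Y)) (osum X (osum Z Y))" using assms by (intro sum_left_commute)
  moreover have "iso (osum X (osum Z Y)) (osum X (osum Y Z))"
    using assms by (intro sum_cong iso_refl sum_commute)
  ultimately show ?thesis using iso_trans by blast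
qed

lemma iso_sum_biprod:
  assumes "iso B (osum Y Z)" "ob Y" "ob Z" shows "\<exists>i1 i2 p1 p2. biprod B Y Z i1 i2 p1 p2"
  using assms(1) sum_biprod[OF assms(2,3)] biprod_transport unfolding iso_def by blast

lemma iso_zero_iff: "ob X \<Longrightarrow> iso X ozero \<longleftrightarrow> ident X \<in> Null X X"
proof
  assume "ob X" "ident X \<in> Null X X"
  then show "iso X ozero"
    unfolding iso_def retract_def using Null_uminus
    by (intro exI[of _ 0]) (simp add: ob_zero Hom_zero ident_zero Null_zero)
next
  assume "iso X ozero"
  then obtain f g where f: "f \<in> Hom X ozero" "g * f - ident X \<in> Null X X"
    unfolding iso_def retract_def by blast
  have "f = 0" using ident_left[OF f(1)] ident_zero by simp
  then show "ident X \<in> Null X X" using Null_uminus[OF f(2)] by simp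
qed

lemma sum_zero:
  assumes "ob X" shows "iso (osum X ozero) X"
proof -
  have "biprod X X ozero (ident X) 0 (ident X) 0"
    unfolding biprod_def using assms
    by (simp add: ident_Hom ident_left[OF ident_Hom] ob_zero Hom_zero Null_zero ident_zero)
  then show ?thesis using biprod_iso_sum iso_sym by blast
qed

lemma biprod_zero:
  assumes "biprod B Y Z i1 i2 p1 p2" "iso B ozero" shows "iso Y ozero"
proof -
  note B = biprodD[OF assms(1)]
  have "i1 * p1 \<in> Null B B"
    using assms(2) iso_zero_iff[OF B(1)] ident_left[OF Hom_mult[OF B(4,6)]]
      Null_right[OF _ Hom_mult[OF B(4,6)]] by metis
  then show ?thesis using biprod_incl_proj_null[OF assms(1)] iso_zero_iff[OF B(2)] by blast
qed

lemma sum_zeroD: "ob Y \<Longrightarrow> ob Z \<Longrightarrow> iso (osum Y Z) ozero \<Longrightarrow> iso Y ozero"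
  using sum_biprod biprod_zero by metis

lemma split_retract:
  assumes "retract Y W f g" shows "\<exists>W' i p. biprod W Y W' f i g p"
proof -
  note fg = retractD[OF assms]
  obtain Y' Z i1 i2 p1 p2 where WY'Z: "biprod W Y' Z i1 i2 p1 p2" "i1 * p1 - f * g \<in> Null W W"
    using splitting[OF fg(2) Hom_mult[OF fg(3,4)] retract_idempotent[OF assms]] by blast
  note B = biprodD[OF WY'Z(1)]
  have "p2 * f = - (p2 * (i1 * p1 - f * g) * f) - (p2 * f) * (g * f - ident Y) + (p2 * i1) * (p1 * f)"
    using ident_right[OF fg(3)] by (simp add: algebra_simps)
  also have "\<dots> \<in> Null Y Z"
    by (intro Null_add Null_uminus Null_diff Null_mid[OF WY'Z(2) B(7) fg(3)]
        Null_left[OF Hom_mult[OF B(7) fg(3)] fg(5)] Null_right[OF B(11) Hom_mult[OF B(6) fg(3)]])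
  finally have orth2: "p2 * f \<in> Null Y Z" .
  have "g * i2 = - (g * (i1 * p1 - f * g) * i2) - (g * f - ident Y) * (g * i2) + (g * i1) * (p1 * i2)"
    using ident_left[OF fg(4)] ident_left[OF Hom_mult[OF fg(4) B(5)]] by (simp add: algebra_simps)
  also have "\<dots> \<in> Null Z Y"
    by (intro Null_add Null_uminus Null_diff Null_mid[OF WY'Z(2) fg(4) B(5)]
        Null_right[OF fg(5) Hom_mult[OF fg(4) B(5)]] Null_left[OF Hom_mult[OF fg(4) B(4)] B(10)])
  finally have orth1: "g * i2 \<in> Null Z Y" .
  have "f * g + i2 * p2 - ident W = (i1 * p1 + i2 * p2 - ident W) - (i1 * p1 - f * g)" by simp
  also have "\<dots> \<in> Null W W" by (rule Null_diff[OF B(12) WY'Z(2)])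
  finally have "biprod W Y Z f i2 g p2" unfolding biprod_def using fg B orth1 orth2 by blast
  then show ?thesis by blast
qed

subsection \<open>Indecomposable objects\<close>

definition indec :: "'o \<Rightarrow> bool" where
  "indec X \<longleftrightarrow> ob X \<and> \<not> iso X ozero \<and>
     (\<forall>Y Z. ob Y \<longrightarrow> ob Z \<longrightarrow> iso X (osum Y Z) \<longrightarrow> iso Y ozero \<or> iso Z ozero)"

lemma indec_ob: "indec X \<Longrightarrow> ob X" and indec_ident: "indec X \<Longrightarrow> ident X \<notin> Null X X"
  unfolding indec_def using iso_zero_iff by blast+

lemma indec_idempotent:
  assumes X: "indec X" and e: "e \<in> Hom X X" "e * e - e \<in> Null X X"
  shows "e \<in> Null X X \<or> e - ident X \<in> Null X X"
proof -
  obtain Y Z i1 i2 p1 p2 where XYZ: "biprod X Y Z i1 i2 p1 p2" and e': "i1 * p1 - e \<in> Null X X"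
    using splitting[OF indec_ob[OF X] e] by blast
  note B = biprodD[OF XYZ]
  have "iso Y ozero \<or> iso Z ozero" using X biprod_iso_sum[OF XYZ] B(2,3) unfolding indec_def by blast
  then show ?thesis
  proof
    assume "iso Y ozero"
    then have "i1 * p1 \<in> Null X X" using Null_factor[OF _ B(4,6)] iso_zero_iff[OF B(2)] by blast
    then show ?thesis using Null_cong[OF Null_sym[OF e']] by blast
  next
    assume "iso Z ozero"
    then have "i2 * p2 \<in> Null X X" using Null_factor[OF _ B(5,7)] iso_zero_iff[OF B(3)] by blast
    then have "i1 * p1 - ident X \<in> Null X X" using Null_diff[OF B(12)] by fastforce
    then show ?thesis using Null_trans[OF Null_sym[OF e']] by blast
  qed
qed

lemma indec_local:
  assumes X: "indec X" and f: "f \<in> Hom X X"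
  obtains (invertible) u where "u \<in> Hom X X" "u * f - ident X \<in> Null X X"
  | (quasi_invertible) v where "v \<in> Hom X X" "v * (ident X - f) - ident X \<in> Null X X"
proof -
  obtain e u v where e: "e \<in> Hom X X" "u \<in> Hom X X" "v \<in> Hom X X" "e * e - e \<in> Null X X"
    "u * f - e \<in> Null X X" "v * (ident X - f) - (ident X - e) \<in> Null X X"
    using exchange[OF indec_ob[OF X] f] by blast
  from indec_idempotent[OF X e(1,4)] show thesis
  proof
    assume "e \<in> Null X X"
    then have "v * (ident X - f) - ident X \<in> Null X X" using Null_diff[OF e(6)] by fastforce
    then show thesis by (rule quasi_invertible[OF e(3)])
  next
    assume "e - ident X \<in> Null X X"
    then show thesis using Null_trans[OF e(5)] invertible[OF e(2)] by blast
  qed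
qed

lemma retract_of_indec:
  assumes X: "indec X" and Y: "ident Y \<notin> Null Y Y" and retract: "retract Y X f g"
  shows "f * g - ident X \<in> Null X X"
proof -
  note fg = retractD[OF retract]
  have fgH: "f * g \<in> Hom X X" by (rule Hom_mult[OF fg(3,4)])
  from X fgH show ?thesis
  proof (cases rule: indec_local)
    case (invertible u)
    have "f * g - ident X =
      - ((u * (f * g) - ident X) * (f * g)) + u * (f * g * (f * g) - f * g) + (u * (f * g) - ident X)"
      using ident_left[OF fgH] by (simp add: algebra_simps)
    also have "\<dots> \<in> Null X X"
      by (intro Null_add Null_uminus invertible(2) Null_right[OF invertible(2) fgH]
          Null_left[OF invertible(1) retract_idempotent[OF retract]])
    finally show ?thesis .
  next
    case (quasi_invertible v)
    have "ident Y = - (g * f - ident Y)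
      + (- (g * (v * (ident X - f * g) - ident X) * f) - g * v * f * (g * f - ident Y))"
      using ident_right[OF fg(3)] ident_left[OF fg(3)] by (simp add: algebra_simps)
    also have "\<dots> \<in> Null Y Y"
      by (intro Null_add Null_uminus Null_diff fg(5) Null_mid[OF quasi_invertible(2) fg(4,3)]
          Null_left[OF Hom_mult[OF Hom_mult[OF fg(4) quasi_invertible(1)] fg(3)] fg(5)])
    finally show ?thesis using Y by blast
  qed
qed

subsection \<open>Sums of lists\<close>

definition list_sum :: "'o list \<Rightarrow> 'o" where
  "list_sum Xs = foldr osum Xs ozero"

lemma list_sum_simps [simp]: "list_sum [] = ozero" "list_sum (X # Xs) = osum X (list_sum Xs)"
  unfolding list_sum_def by auto

lemma ob_list_sum: "(\<forall>X\<in>set Xs. ob X) \<Longrightarrow> ob (list_sum Xs)"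
  by (induction Xs) (auto simp: ob_zero ob_sum)

lemma list_sum_remove:
  "\<forall>Y\<in>set (as @ X # bs). ob Y \<Longrightarrow> iso (list_sum (as @ X # bs)) (osum X (list_sum (as @ bs)))"
proof (induction as)
  case Nil
  then show ?case using ob_list_sum[of "X # bs"] by (auto intro!: iso_refl)
next
  case (Cons a as)
  then have "iso (list_sum ((a # as) @ X # bs)) (osum a (osum X (list_sum (as @ bs))))"
    by (auto intro!: sum_cong iso_refl)
  moreover have "iso (osum a (osum X (list_sum (as @ bs)))) (osum X (osum a (list_sum (as @ bs))))"
    using Cons.prems ob_list_sum[of "as @ bs"] by (intro sum_left_commute) auto
  ultimately show ?case using iso_trans by simp
qed

lemma list_sum_append:
  "\<forall>Y\<in>set (xs @ ys). ob Y \<Longrightarrow> iso (osum (list_sum xs) (list_sum ys)) (list_sum (xs @ ys))"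
proof (induction xs)
  case Nil
  then have "ob (list_sum ys)" using ob_list_sum by auto
  then show ?case using iso_trans[OF sum_commute[OF ob_zero] sum_zero] by simp
next
  case (Cons x xs)
  have obs: "ob x" "ob (list_sum xs)" "ob (list_sum ys)" using Cons.prems ob_list_sum by auto
  have "iso (osum (list_sum (x # xs)) (list_sum ys)) (osum x (osum (list_sum xs) (list_sum ys)))"
    using sum_assoc[OF obs] by simp
  moreover have "iso (osum x (osum (list_sum xs) (list_sum ys))) (list_sum ((x # xs) @ ys))"
    using Cons obs by (auto intro!: sum_cong iso_refl)
  ultimately show ?case by (rule iso_trans)
qed

lemma list_sum_cong:
  "mset (map iso_class_of Xs) = mset (map iso_class_of Ys) \<Longrightarrow> \<forall>X\<in>set Xs. ob X \<Longrightarrow> \<forall>X\<in>set Ys. ob X \<Longrightarrow>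
    iso (list_sum Xs) (list_sum Ys)"
proof (induction Xs arbitrary: Ys)
  case Nil
  then show ?case using iso_refl[OF ob_zero] by simp
next
  case (Cons X Xs)
  have "iso_class_of X \<in># mset (map iso_class_of Ys)" using Cons.prems(1)
    by (metis list.simps(9) list.set_intros(1) set_mset_mset)
  then obtain Y where Y: "Y \<in> set Ys" "iso_class_of Y = iso_class_of X" by auto
  then obtain as bs where Ys: "Ys = as @ Y # bs" by (meson split_list)
  have "iso X Y" using Y(2) iso_class_of_eq_iff[of X Y] Cons.prems by auto
  moreover have "mset (map iso_class_of Xs) = mset (map iso_class_of (as @ bs))"
    using Cons.prems(1) Y(2) unfolding Ys by simp
  then have "iso (list_sum Xs) (list_sum (as @ bs))" using Cons.IH[of "as @ bs"] Cons.prems Ys by auto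
  ultimately have "iso (list_sum (X # Xs)) (osum Y (list_sum (as @ bs)))" by (simp add: sum_cong)
  moreover have "iso (osum Y (list_sum (as @ bs))) (list_sum Ys)"
    using list_sum_remove[of as Y bs] Cons.prems(3) Ys iso_sym by blast
  ultimately show ?case by (rule iso_trans)
qed

subsection \<open>Uniqueness of decompositions\<close>

lemma cancel_indec_invertible:
  assumes X: "indec X" and Y: "indec Y"
    and BYZ: "biprod B Y Z i1 i2 p1 p2" and BXW: "biprod B X W j1 j2 q1 q2"
    and u: "u \<in> Hom Y Y" "u * (p1 * j1 * (q1 * i1)) - ident Y \<in> Null Y Y"
  shows "iso Y X" "iso Z W"
proof -
  define g where "g = u * (p1 * j1)"
  have retract: "retract Y X (q1 * i1) g"
    using u indec_ob[OF X] indec_ob[OF Y] biprodD[OF BYZ] biprodD[OF BXW]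
    unfolding retract_def g_def by (auto intro!: Hom_mult simp: mult.assoc)
  have "q1 * i1 * g - ident X \<in> Null X X" by (rule retract_of_indec[OF X indec_ident[OF Y] retract])
  then show "iso Y X" "iso Z W"
    using retract schur_complement_iso[OF BYZ BXW retract_proj[OF retract] retract_null[OF retract]]
    unfolding iso_def retract_def by blast+
qed

lemma cancel_indec_complement:
  assumes BYZ: "biprod B Y Z i1 i2 p1 p2" and BXW: "biprod B X W j1 j2 q1 q2"
    and retract: "retract Y W (q2 * i1) g"
  obtains W' where "ob W'" "iso W (osum Y W')" "iso Z (osum X W')"
proof -
  obtain W' i p where WYW': "biprod W Y W' (q2 * i1) i g p" using split_retract[OF retract] by blast
  have "ob X" "ob W'" using biprod_ob[OF BXW] biprod_ob[OF WYW'] by blast+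
  then obtain k1 k2 r1 r2 where sum_XW': "biprod (osum X W') X W' k1 k2 r1 r2" using sum_biprod by blast
  note gH = retract_proj[OF retract] and fH = retract_incl[OF retract]
  have "iso Z (osum X W')"
  proof (rule schur_complement_iso[OF BYZ biprod_regroup[OF BXW WYW' sum_XW']])
    show "ident Y \<in> Hom Y Y" by (rule ident_Hom[OF retract_ob(1)[OF retract]])
    show "ident Y * (g * q2 * i1) - ident Y \<in> Null Y Y" "g * q2 * i1 * ident Y - ident Y \<in> Null Y Y"
      using retract_null[OF retract] ident_left[OF Hom_mult[OF gH fH]] ident_right[OF Hom_mult[OF gH fH]]
      by (simp_all add: mult.assoc)
  qed
  then show thesis using that \<open>ob W'\<close> biprod_iso_sum[OF WYW'] by blast
qed

lemma biprod_components_sum: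
  assumes BYZ: "biprod B Y Z i1 i2 p1 p2" and BXW: "biprod B X W j1 j2 q1 q2"
  shows "p1 * j2 * (q2 * i1) - (ident Y - p1 * j1 * (q1 * i1)) \<in> Null Y Y"
proof -
  note B = biprodD[OF BYZ] and C = biprodD[OF BXW]
  have "p1 * (j1 * q1 + j2 * q2 - ident B) * i1 + (p1 * i1 - ident Y) \<in> Null Y Y"
    by (intro Null_add B(8) Null_mid[OF C(12) B(6,4)])
  then show ?thesis using ident_left[OF B(4)] by (simp add: algebra_simps)
qed

lemma indec_summand_exchange:
  assumes X: "indec X" and Y: "indec Y" and BYZ: "biprod B Y Z i1 i2 p1 p2"
    and BXW: "biprod B X W j1 j2 q1 q2"
  obtains (iso) "iso Y X" "iso Z W"
  | (complement) W' where "ob W'" "iso W (osum Y W')" "iso Z (osum X W')"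
proof -
  note B = biprodD[OF BYZ] and C = biprodD[OF BXW]
  define through_X where "through_X = p1 * j1 * (q1 * i1)"
  define through_W where "through_W = p1 * j2 * (q2 * i1)"
  have through_W: "through_W - (ident Y - through_X) \<in> Null Y Y"
    unfolding through_X_def through_W_def by (rule biprod_components_sum[OF BYZ BXW])
  have "through_X \<in> Hom Y Y"
    unfolding through_X_def using B C by (intro Hom_mult[of _ X] Hom_mult[of _ B])
  with Y show thesis
  proof (cases rule: indec_local)
    case (invertible u)
    then show thesis
      using cancel_indec_invertible[OF X Y BYZ BXW] unfolding through_X_def by (intro iso) simp_all
  next
    case (quasi_invertible v)
    have "v * through_W - v * (ident Y - through_X) \<in> Null Y Y"
      using Null_left[OF quasi_invertible(1) through_W] by (simp add: right_diff_distrib)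
    from Null_trans[OF this quasi_invertible(2)]
    have "retract Y W (q2 * i1) (v * (p1 * j2))"
      using quasi_invertible(1) B C unfolding retract_def through_W_def
      by (auto intro!: Hom_mult simp: mult.assoc)
    then show thesis using complement by (rule cancel_indec_complement[OF BYZ BXW])
  qed
qed

lemma indec_exchange:
  "\<forall>X\<in>set Xs. indec X \<Longrightarrow> indec Y \<Longrightarrow> ob Z \<Longrightarrow> iso (osum Y Z) (list_sum Xs) \<Longrightarrow>
   \<exists>as X bs. Xs = as @ X # bs \<and> iso Y X \<and> iso Z (list_sum (as @ bs))"
proof (induction Xs arbitrary: Z)
  case Nil
  then show ?case using sum_zeroD[of Y Z] unfolding indec_def by auto
next
  case (Cons X Xs)
  let ?W = "list_sum Xs"
  have obs: "ob X" "ob ?W" "ob Y" using Cons.prems ob_list_sum[of Xs] indec_ob by auto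
  obtain i1 i2 p1 p2 where YZ: "biprod (osum Y Z) Y Z i1 i2 p1 p2"
    using sum_biprod[OF obs(3) Cons.prems(3)] by blast
  obtain j1 j2 q1 q2 where XW: "biprod (osum Y Z) X ?W j1 j2 q1 q2"
    using iso_sum_biprod[OF _ obs(1,2)] Cons.prems(4) by fastforce
  have "indec X" using Cons.prems(1) by simp
  then show ?case
    using Cons.prems(2) YZ XW
  proof (cases rule: indec_summand_exchange)
    case iso
    then show ?thesis by (intro exI[of _ "[]"] exI[of _ X] exI[of _ Xs]) simp
  next
    case (complement W')
    then obtain as X' bs where IH: "Xs = as @ X' # bs" "iso Y X'" "iso W' (list_sum (as @ bs))"
      using Cons.IH[of W'] Cons.prems iso_sym by auto
    have "iso (osum X W') (list_sum ((X # as) @ bs))" using IH(3) obs by (simp add: sum_cong iso_refl)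
    with complement(3) have "iso Z (list_sum ((X # as) @ bs))" by (rule iso_trans)
    then show ?thesis using IH by (intro exI[of _ "X # as"] exI[of _ X'] exI[of _ bs]) simp
  qed
qed

theorem krull_schmidt:
  "\<forall>X\<in>set Xs. indec X \<Longrightarrow> \<forall>X\<in>set Ys. indec X \<Longrightarrow> iso (list_sum Xs) (list_sum Ys) \<Longrightarrow>
   mset (map iso_class_of Xs) = mset (map iso_class_of Ys)"
proof (induction Xs arbitrary: Ys)
  case Nil
  show ?case
  proof (cases Ys)
    case (Cons Y Ys')
    then have "iso (osum Y (list_sum Ys')) ozero" using Nil iso_sym by auto
    then have "iso Y ozero" using sum_zeroD[of Y "list_sum Ys'"] Nil Cons ob_list_sum[of Ys'] indec_ob by auto
    then show ?thesis using Nil Cons unfolding indec_def by auto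
  qed simp
next
  case (Cons X Xs)
  have "ob (list_sum Xs)" using Cons.prems ob_list_sum indec_ob by auto
  then obtain as Y bs where Y: "Ys = as @ Y # bs" "iso X Y" "iso (list_sum Xs) (list_sum (as @ bs))"
    using indec_exchange[of Ys X "list_sum Xs"] Cons.prems by auto
  have "mset (map iso_class_of Xs) = mset (map iso_class_of (as @ bs))"
    using Cons.IH[of "as @ bs"] Cons.prems Y by auto
  moreover have "iso_class_of X = iso_class_of Y" using Y(2) iso_class_of_eq_iff iso_ob by blast
  ultimately show ?case using Y(1) by simp
qed

lemma split_decomposable:
  assumes "ob X" "\<not> iso X ozero" "\<not> indec X"
  obtains Y Z where "ob Y" "ob Z" "iso X (osum Y Z)" "osize Y < osize X" "osize Z < osize X"
proof -
  obtain Y Z where YZ: "ob Y" "ob Z" "iso X (osum Y Z)" "\<not> iso Y ozero" "\<not> iso Z ozero"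
    using assms unfolding indec_def by blast
  then obtain i1 i2 p1 p2 where XYZ: "biprod X Y Z i1 i2 p1 p2" using iso_sum_biprod by blast
  note B = biprodD[OF XYZ]
  have not_null: "i1 * p1 \<notin> Null X X"
    using biprod_incl_proj_null[OF XYZ] YZ(4) iso_zero_iff[OF YZ(1)] by blast
  have not_ident: "ident X - i1 * p1 \<notin> Null X X"
  proof
    assume "ident X - i1 * p1 \<in> Null X X"
    from Null_add[OF B(12) this] have "i2 * p2 \<in> Null X X" by (simp add: algebra_simps)
    then show False using biprod_incl_proj_null[OF biprod_swap[OF XYZ]] YZ(5) iso_zero_iff[OF YZ(2)] by blast
  qed
  obtain Y' Z' j1 j2 q1 q2 where XY'Z': "biprod X Y' Z' j1 j2 q1 q2" "osize Y' < osize X" "osize Z' < osize X"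
    using splitting[OF assms(1) Hom_mult[OF B(4,6)] retract_idempotent[OF biprod_retract[OF XYZ]]]
      not_null not_ident by blast
  show thesis by (rule that[OF biprod_ob(2,3)[OF XY'Z'(1)] biprod_iso_sum[OF XY'Z'(1)] XY'Z'(2,3)])
qed

lemma decomposition_exists: "ob X \<Longrightarrow> \<exists>Xs. (\<forall>Y\<in>set Xs. indec Y) \<and> iso X (list_sum Xs)"
proof (induction "osize X" arbitrary: X rule: less_induct)
  case less
  consider "iso X ozero" | "indec X" | "\<not> iso X ozero" "\<not> indec X" by blast
  then show ?case
  proof cases
    case 1
    then show ?thesis by (intro exI[of _ "[]"]) simp
  next
    case 2
    then show ?thesis using iso_sym[OF sum_zero[OF less.prems]] by (intro exI[of _ "[X]"]) simp
  next
    case 3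
    then obtain Y Z where YZ: "ob Y" "ob Z" "iso X (osum Y Z)" "osize Y < osize X" "osize Z < osize X"
      using split_decomposable[OF less.prems] by blast
    then obtain Ys Zs where Ys: "\<forall>Y\<in>set Ys. indec Y" "iso Y (list_sum Ys)"
      and Zs: "\<forall>Z\<in>set Zs. indec Z" "iso Z (list_sum Zs)" using less.hyps by meson
    have "iso (osum (list_sum Ys) (list_sum Zs)) (list_sum (Ys @ Zs))"
      using Ys(1) Zs(1) indec_ob by (intro list_sum_append) auto
    then have "iso X (list_sum (Ys @ Zs))"
      using YZ(3) sum_cong[OF Ys(2) Zs(2)] iso_trans by blast
    then show ?thesis using Ys(1) Zs(1) by (intro exI[of _ "Ys @ Zs"]) auto
  qed
qed

subsection \<open>The multiset of indecomposable summands\<close>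

definition summands :: "'o \<Rightarrow> 'o set multiset" where
  "summands X = (SOME M. \<exists>Xs. (\<forall>Y\<in>set Xs. indec Y) \<and> iso X (list_sum Xs) \<and> M = mset (map iso_class_of Xs))"

lemma summands_eqI:
  assumes "\<forall>Y\<in>set Xs. indec Y" "iso X (list_sum Xs)" shows "summands X = mset (map iso_class_of Xs)"
proof -
  have "\<exists>M. \<exists>Xs. (\<forall>Y\<in>set Xs. indec Y) \<and> iso X (list_sum Xs) \<and> M = mset (map iso_class_of Xs)"
    using assms by blast
  from someI_ex[OF this] obtain Ys
    where "\<forall>Y\<in>set Ys. indec Y" "iso X (list_sum Ys)" "summands X = mset (map iso_class_of Ys)"
    unfolding summands_def by blast
  then show ?thesis using krull_schmidt[OF assms(1) _ iso_trans[OF iso_sym[OF assms(2)]], of Ys] by simp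
qed

lemma decompositionE:
  assumes "ob X"
  obtains Xs where "\<forall>Y\<in>set Xs. indec Y" "iso X (list_sum Xs)" "summands X = mset (map iso_class_of Xs)"
  using decomposition_exists[OF assms] summands_eqI by blast

lemma summands_sum:
  assumes "ob X" "ob Y" shows "summands (osum X Y) = summands X + summands Y"
proof -
  obtain Xs where Xs: "\<forall>Y\<in>set Xs. indec Y" "iso X (list_sum Xs)" "summands X = mset (map iso_class_of Xs)"
    by (rule decompositionE[OF assms(1)])
  obtain Ys where Ys: "\<forall>Y\<in>set Ys. indec Y" "iso Y (list_sum Ys)" "summands Y = mset (map iso_class_of Ys)"
    by (rule decompositionE[OF assms(2)])
  have "iso (osum (list_sum Xs) (list_sum Ys)) (list_sum (Xs @ Ys))"
    using Xs(1) Ys(1) indec_ob by (intro list_sum_append) auto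
  with sum_cong[OF Xs(2) Ys(2)] have "iso (osum X Y) (list_sum (Xs @ Ys))" by (rule iso_trans)
  then show ?thesis using summands_eqI[of "Xs @ Ys"] Xs Ys by auto
qed

lemma summands_iso: "iso X Y \<Longrightarrow> summands X = summands Y"
  using decompositionE[OF iso_ob(2)] summands_eqI[OF _ iso_trans] by metis

lemma iso_iff_summands: "ob X \<Longrightarrow> ob Y \<Longrightarrow> iso X Y \<longleftrightarrow> summands X = summands Y"
proof
  assume obs: "ob X" "ob Y" and eq: "summands X = summands Y"
  obtain Xs where Xs: "\<forall>Y\<in>set Xs. indec Y" "iso X (list_sum Xs)" "summands X = mset (map iso_class_of Xs)"
    by (rule decompositionE[OF obs(1)])
  obtain Ys where Ys: "\<forall>Y\<in>set Ys. indec Y" "iso Y (list_sum Ys)" "summands Y = mset (map iso_class_of Ys)"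
    by (rule decompositionE[OF obs(2)])
  have "iso (list_sum Xs) (list_sum Ys)" using list_sum_cong[of Xs Ys] Xs Ys eq indec_ob by auto
  then show "iso X Y" by (rule iso_trans[OF Xs(2) iso_trans[OF _ iso_sym[OF Ys(2)]]])
qed (rule summands_iso)

lemma summands_zero: "summands ozero = {#}"
  using summands_eqI[of "[]" ozero] iso_refl[OF ob_zero] by simp

lemma summands_empty_iff: "ob X \<Longrightarrow> summands X = {#} \<longleftrightarrow> ident X \<in> Null X X"
  using iso_iff_summands[OF _ ob_zero] summands_zero iso_zero_iff by simp

lemma summands_indec: "indec X \<Longrightarrow> summands X = {#iso_class_of X#}"
  using summands_eqI[of "[X]" X] iso_sym[OF sum_zero] indec_ob by simp

lemma summandsE:
  assumes "ob X" "c \<in># summands X" obtains Y where "indec Y" "c = iso_class_of Y"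
proof -
  obtain Xs where "\<forall>Y\<in>set Xs. indec Y" "summands X = mset (map iso_class_of Xs)"
    using decompositionE[OF assms(1)] by metis
  then show thesis using assms(2) that by auto
qed

lemma summands_surj:
  "(\<forall>c\<in>#M. \<exists>Y. indec Y \<and> c = iso_class_of Y) \<Longrightarrow> \<exists>X. ob X \<and> summands X = M"
proof (induction M)
  case empty
  then show ?case using ob_zero summands_zero by blast
next
  case (add c M)
  then obtain Y X where "indec Y" "c = iso_class_of Y" "ob X" "summands X = M" by auto
  then show ?case
    using summands_sum[of Y X] summands_indec ob_sum indec_ob by (intro exI[of _ "osum Y X"]) auto
qed

lemma summands_biprod: "biprod B Y Z i1 i2 p1 p2 \<Longrightarrow> summands B = summands Y + summands Z"
  using summands_iso[OF biprod_iso_sum] summands_sum[OF biprod_ob(2,3)] by metis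

lemma summands_retract: "retract Y W f g \<Longrightarrow> summands Y \<subseteq># summands W"
  using split_retract summands_biprod by (metis mset_subset_eq_add_left)

lemma iso_class_of_in_summands_iff:
  assumes "ob X" "indec Y" shows "iso_class_of Y \<in># summands X \<longleftrightarrow> (\<exists>Z. ob Z \<and> iso X (osum Y Z))"
proof
  assume Y: "iso_class_of Y \<in># summands X"
  have "\<forall>c\<in>#summands X - {#iso_class_of Y#}. \<exists>Y. indec Y \<and> c = iso_class_of Y"
    using summandsE[OF assms(1)] in_diffD by metis
  from summands_surj[OF this] obtain Z where Z: "ob Z" "summands Z = summands X - {#iso_class_of Y#}" by blast
  then have "summands (osum Y Z) = summands X"
    using summands_sum[of Y Z] summands_indec[OF assms(2)] indec_ob[OF assms(2)] Y by simp
  then show "\<exists>Z. ob Z \<and> iso X (osum Y Z)"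
    using iso_iff_summands[OF assms(1)] ob_sum indec_ob[OF assms(2)] Z(1) by metis
next
  assume "\<exists>Z. ob Z \<and> iso X (osum Y Z)"
  then obtain Z where "ob Z" "iso X (osum Y Z)" by blast
  then have "summands X = {#iso_class_of Y#} + summands Z"
    using summands_iso summands_sum summands_indec assms indec_ob by metis
  then show "iso_class_of Y \<in># summands X" by simp
qed

text \<open>Endomorphisms factoring through an object without common summands are radical: the idempotent
  that the exchange property attaches to one of them splits off a common summand.\<close>

lemma factoring_endo_quasi_invertible:
  assumes obs: "ob X" "ob W" and disjoint: "set_mset (summands X) \<inter> set_mset (summands W) = {}"
    and F: "F \<in> Hom W X" and G: "G \<in> Hom X W"
  shows "\<exists>v\<in>Hom X X. v * (ident X - F * G) - ident X \<in> Null X X"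
proof -
  obtain e u v where e: "e \<in> Hom X X" "u \<in> Hom X X" "v \<in> Hom X X" "e * e - e \<in> Null X X"
    "F * G * u - e \<in> Null X X" "v * (ident X - F * G) - (ident X - e) \<in> Null X X"
    using exchange[OF obs(1) Hom_mult[OF F G]] by blast
  obtain Y Z i1 i2 p1 p2 where XYZ: "biprod X Y Z i1 i2 p1 p2" "i1 * p1 - e \<in> Null X X"
    using splitting[OF obs(1) e(1,4)] by blast
  note B = biprodD[OF XYZ(1)]
  have "(p1 * F) * (G * u * i1) - ident Y = p1 * (F * G * u - e) * i1 - p1 * (i1 * p1 - e) * i1
      + (p1 * i1) * (p1 * i1 - ident Y) + (p1 * i1 - ident Y)"
    using ident_right[OF B(4)] by (simp add: algebra_simps)
  also have "\<dots> \<in> Null Y Y"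
    by (intro Null_add Null_diff Null_mid[OF e(5) B(6,4)] Null_mid[OF XYZ(2) B(6,4)] B(8)
        Null_left[OF Hom_mult[OF B(6,4)] B(8)])
  finally have "retract Y W (G * u * i1) (p1 * F)"
    using B(2,4,6) obs(2) e(2) F G unfolding retract_def by (blast intro: Hom_mult)
  then have "set_mset (summands Y) \<subseteq> set_mset (summands W)" by (intro set_mset_mono summands_retract)
  moreover have "set_mset (summands Y) \<subseteq> set_mset (summands X)" by (simp add: summands_biprod[OF XYZ(1)])
  ultimately have "summands Y = {#}" using disjoint
    by (simp add: subset_empty flip: set_mset_eq_empty_iff) blast
  then have "i1 * p1 \<in> Null X X" using summands_empty_iff[OF B(2)] Null_factor[OF _ B(4,6)] by blast
  then have "e \<in> Null X X" by (rule Null_cong[OF Null_sym[OF XYZ(2)]])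
  then have "v * (ident X - F * G) - (ident X - e) - e \<in> Null X X" by (rule Null_diff[OF e(6)])
  then show ?thesis using e(3) by (intro bexI[of _ v]) (simp_all add: algebra_simps)
qed

end

section \<open>Extensions, direct sums and cones\<close>

text \<open>\<open>B\<close> is the extension of \<open>X\<close> by its subcomplex \<open>Y\<close> classified by \<open>F\<close>.\<close>

locale extension =
  X: graded_complex X + Y: graded_complex Y + ring_biproduct "idem B" "idem X" "idem Y" i1 i2 p1 p2
  for B X Y :: "'a::ring gcplx" and F i1 i2 p1 p2 :: "'a gmat" +
  assumes homogeneous_incl: "homogeneous 0 i1" "homogeneous 0 i2"
    and homogeneous_proj: "homogeneous 0 p1" "homogeneous 0 p2"
    and cocycle: "F \<in> cocycles 1 X Y"
    and dif_eq: "dif B = i1 * dif X * p1 + i2 * F * p1 + i2 * dif Y * p2"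
begin

lemma incl_homs: "i1 \<in> homs 0 X B" "i2 \<in> homs 0 Y B"
  and proj_homs: "p1 \<in> homs 0 B X" "p2 \<in> homs 0 B Y"
  by (auto intro!: homsI incl1 incl2 proj1 proj2 homogeneous_incl homogeneous_proj)

lemmas cocycle_simps = corner_left[OF cocycles_corner[OF cocycle]]
  corner_right[OF cocycles_corner[OF cocycle]]
  corner_left_assoc[OF cocycles_corner[OF cocycle]] corner_right_assoc[OF cocycles_corner[OF cocycle]]

lemma cocycle_dif: "F * dif X = - (dif Y * F)"
  using cocycles_dif[OF cocycle] by simp

lemma cocycle_dif_assoc: "F * (dif X * y) = - (dif Y * (F * y))"
  using arg_cong[OF cocycle_dif, of "\<lambda>z. z * y"] by (simp add: mult.assoc)

lemma dif_incl1: "dif B * i1 = i1 * dif X + i2 * F" and dif_incl2: "dif B * i2 = i2 * dif Y"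
  and proj1_dif: "p1 * dif B = dif X * p1" and proj2_dif: "p2 * dif B = F * p1 + dif Y * p2"
  unfolding dif_eq
  by (simp_all add: distrib_left distrib_right mult.assoc biprod_simps X.complex_simps Y.complex_simps
    cocycle_simps)

sublocale graded_complex B
proof
  show "homogeneous 0 (idem B)"
    using homogeneous_mult_degree_0(1)[OF homogeneous_incl(1) homogeneous_proj(1)]
      homogeneous_mult_degree_0(1)[OF homogeneous_incl(2) homogeneous_proj(2)]
    by (simp add: homogeneous_add flip: incl_proj_sum)
  show "homogeneous 1 (dif B)"
    unfolding dif_eq using homogeneous_incl homogeneous_proj cocycles_homs[OF cocycle, THEN homs_homogeneous]
    by (intro homogeneous_add homogeneous_mult_degree_0 X.homogeneous_dif Y.homogeneous_dif)
  show "idem B * idem B = idem B" by (rule idem_sum)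
  show "idem B * dif B = dif B" "dif B * idem B = dif B"
    by (simp_all add: dif_eq distrib_left distrib_right mult.assoc biprod_simps)
  have "dif B * dif B = dif B * i1 * dif X * p1 + dif B * i2 * F * p1 + dif B * i2 * dif Y * p2"
    by (subst (2) dif_eq) (simp add: distrib_left mult.assoc)
  then show "dif B * dif B = 0"
    unfolding dif_incl1 dif_incl2
    by (simp add: distrib_right mult.assoc X.complex_simps Y.complex_simps cocycle_dif_assoc)
qed

lemma incl2_cocycle: "i2 \<in> cocycles 0 Y B" and proj1_cocycle: "p1 \<in> cocycles 0 B X"
  by (auto intro!: chain_mapI incl_homs proj_homs simp: dif_incl2 proj1_dif)

lemma split_cocycles:
  assumes "F = 0" shows "i1 \<in> cocycles 0 X B" and "p2 \<in> cocycles 0 B Y"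
  by (auto intro!: chain_mapI incl_homs proj_homs simp: dif_incl1 proj2_dif assms)

lemma comparison_cocycle:
  assumes "extension C X Y F j1 j2 q1 q2" shows "j1 * p1 + j2 * p2 \<in> cocycles 0 B C"
proof (rule chain_mapI)
  interpret C: extension C X Y F j1 j2 q1 q2 by fact
  show "j1 * p1 + j2 * p2 \<in> homs 0 B C"
    using homs_mult[OF C.incl_homs(1) proj_homs(1)] homs_mult[OF C.incl_homs(2) proj_homs(2)]
    by (auto intro: homs_add)
  have "dif C * (j1 * p1 + j2 * p2) = j1 * dif X * p1 + j2 * F * p1 + j2 * dif Y * p2"
    by (simp add: distrib_left distrib_right C.dif_incl1 C.dif_incl2 flip: mult.assoc)
  also have "\<dots> = (j1 * p1 + j2 * p2) * dif B"
    by (simp add: distrib_left distrib_right mult.assoc proj1_dif proj2_dif)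
  finally show "dif C * (j1 * p1 + j2 * p2) = (j1 * p1 + j2 * p2) * dif B" .
qed

lemma unique_up_to_htpy_iso:
  assumes "extension C X Y F j1 j2 q1 q2" shows "htpy_iso B C"
proof -
  interpret C: extension C X Y F j1 j2 q1 q2 by fact
  interpret u: inverse_maps "idem B" "idem C" "j1 * p1 + j2 * p2" "i1 * q1 + i2 * q2"
    by (rule unique_up_to_inverse_maps) unfold_locales
  show ?thesis
    unfolding htpy_iso_def
    by (intro bexI[OF _ comparison_cocycle[OF assms]] bexI[OF _ C.comparison_cocycle[OF extension_axioms]])
      (simp add: u.left_inverse u.right_inverse)
qed
end

text \<open>\<open>V\<close> is the shifted mapping cone of the projection \<open>B \<rightarrow> X\<close>, written as an extension of \<open>B\<close> by the
  shift \<open>X'\<close> of \<open>X\<close>.\<close>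

locale shifted_cone = extension B X Y F i1 i2 p1 p2 + V: extension V B X' "s * p1" j1 j2 q1 q2
  for B X Y F i1 i2 p1 p2 V X' s j1 j2 q1 q2 +
  fixes t
  assumes s: "s \<in> cocycles 1 X X'" and t: "t \<in> cocycles (- 1) X' X"
    and t_mult_s: "t * s = idem X" and s_mult_t: "s * t = idem X'"
begin

definition "kernel_incl = j1 * i2"
definition "kernel_proj = p2 * q1 - F * t * q2"
definition "contraction = - (j1 * i1 * t * q2)"

lemma t_dif: "t * dif X' = - (dif X * t)"
  using cocycles_dif[OF t] by (simp add: koszul_def)

lemmas shift_simps = t_dif t_mult_s s_mult_t
  corner_left[OF cocycles_corner[OF s]] corner_left[OF cocycles_corner[OF t]]
  corner_right[OF cocycles_corner[OF s]] corner_right[OF cocycles_corner[OF t]]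

lemma kernel_incl_cocycle: "kernel_incl \<in> cocycles 0 Y V"
proof (rule chain_mapI)
  show "kernel_incl \<in> homs 0 Y V"
    unfolding kernel_incl_def using homs_mult[OF V.incl_homs(1) incl_homs(2)] by simp
  have "dif V * kernel_incl = j1 * (dif B * i2) + j2 * s * (p1 * i2)"
    unfolding kernel_incl_def by (simp add: V.dif_incl1 distrib_right flip: mult.assoc)
  then show "dif V * kernel_incl = kernel_incl * dif Y"
    by (simp add: kernel_incl_def dif_incl2 proj1_incl2 mult.assoc)
qed

lemma kernel_proj_incl: "kernel_proj * kernel_incl = idem Y"
  unfolding kernel_incl_def kernel_proj_def
  by (simp add: left_diff_distrib mult.assoc biprod_simps V.biprod_simps)

lemma dif_contraction:
  "dif V * contraction = - (j1 * i1 * dif X * t * q2) - j1 * i2 * F * t * q2 - j2 * q2"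
proof -
  have "dif V * contraction = - ((dif V * j1) * i1 * t * q2)" by (simp add: contraction_def mult.assoc)
  also have "\<dots> = - (j1 * (dif B * i1) * t * q2 + j2 * s * (p1 * i1) * t * q2)"
    by (simp add: V.dif_incl1 distrib_right mult.assoc)
  also have "\<dots> = - (j1 * i1 * dif X * t * q2) - j1 * i2 * F * t * q2 - j2 * (s * t) * q2"
    by (simp add: dif_incl1 proj1_incl1 distrib_left distrib_right mult.assoc)
      (simp add: shift_simps flip: mult.assoc)
  finally show ?thesis by (simp add: shift_simps V.biprod_simps mult.assoc)
qed

lemma contraction_dif: "contraction * dif V = j1 * i1 * dif X * t * q2 - j1 * i1 * p1 * q1"
proof -
  have "contraction * dif V = - (j1 * i1 * t * (q2 * dif V))" by (simp add: contraction_def mult.assoc)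
  also have "\<dots> = - (j1 * i1 * (t * s) * p1 * q1) - j1 * i1 * (t * dif X') * q2"
    by (simp add: V.proj2_dif distrib_left mult.assoc)
  finally show ?thesis by (simp add: shift_simps biprod_simps mult.assoc)
qed

lemma kernel_homotopy: "kernel_incl * kernel_proj - idem V = dif V * contraction + contraction * dif V"
proof -
  have "idem V = j1 * (i1 * p1 + i2 * p2) * q1 + j2 * q2"
    by (simp add: incl_proj_sum V.biprod_simps V.incl_proj_sum mult.assoc)
  then show ?thesis
    unfolding dif_contraction contraction_dif kernel_incl_def kernel_proj_def by (simp add: algebra_simps)
qed

lemma kernel_proj_cocycle: "kernel_proj \<in> cocycles 0 V Y"
proof (rule chain_mapI)
  show "kernel_proj \<in> homs 0 V Y"
    unfolding kernel_proj_def
    using homs_mult[OF proj_homs(2) V.proj_homs(1)]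
      homs_mult[OF homs_mult[OF cocycles_homs[OF cocycle] cocycles_homs[OF t]] V.proj_homs(2)]
    by (intro homs_diff) simp_all
  let ?f = kernel_incl and ?g = kernel_proj
  have "?f * ?g = idem V + (dif V * contraction + contraction * dif V)"
    using kernel_homotopy by (simp add: algebra_simps)
  then have "dif V * (?f * ?g) = ?f * ?g * dif V"
    by (simp add: distrib_left distrib_right mult.assoc V.complex_simps)
  then have "?g * (?f * dif Y * ?g) = ?g * (?f * ?g * dif V)"
    by (simp add: mult.assoc flip: chain_map_dif[OF kernel_incl_cocycle])
  moreover have "idem Y * ?g = ?g"
    unfolding kernel_proj_def by (simp add: right_diff_distrib biprod_simps cocycle_simps flip: mult.assoc)
  ultimately show "dif Y * ?g = ?g * dif V"
    by (simp add: kernel_proj_incl Y.complex_simps flip: mult.assoc)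
qed

lemma kernel_htpy_iso: "htpy_iso Y V"
proof -
  have "contraction \<in> homs (0 - 1) V V"
    unfolding contraction_def
    using homs_mult[OF homs_mult[OF homs_mult[OF V.incl_homs(1) incl_homs(1)] cocycles_homs[OF t]]
      V.proj_homs(2)]
    by (intro homs_uminus) simp
  from coboundariesI[OF this] have "kernel_incl * kernel_proj - idem V \<in> coboundaries 0 V V"
    by (simp add: kernel_homotopy)
  then show ?thesis
    unfolding htpy_iso_def using kernel_proj_incl
    by (intro bexI[OF _ kernel_incl_cocycle] bexI[OF _ kernel_proj_cocycle]) simp
qed

end

subsection \<open>The block matrix construction\<close>

definition move_index :: "(int \<Rightarrow> nat) \<Rightarrow> index \<Rightarrow> index" where
  "move_index m u = Ix (degree u) (position u + m (degree u))"

lemma inj_move_index: "inj (move_index m)"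
  by (rule injI) (auto simp: move_index_def intro: index.expand)

lemma move_index_diff:
  "m (degree u) \<le> position u \<Longrightarrow> move_index m (Ix (degree u) (position u - m (degree u))) = u"
  by (simp add: move_index_def)

lemma range_move_index: "u \<in> range (move_index m) \<longleftrightarrow> m (degree u) \<le> position u"
proof
  assume "m (degree u) \<le> position u"
  then have "u = move_index m (Ix (degree u) (position u - m (degree u)))" by (simp add: move_index_diff)
  then show "u \<in> range (move_index m)" by (rule range_eqI)
qed (auto simp: move_index_def)

lemma homogeneous_incl_move: "finite S \<Longrightarrow> homogeneous 0 (incl S (move_index m))"
  and homogeneous_proj_move: "finite S \<Longrightarrow> homogeneous 0 (proj S (move_index m))"
  by (auto simp: homogeneous_def entry_incl entry_proj move_index_def)

lemma entry_incl_move_mult: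
  assumes "finite S" "\<forall>u v. entry x u v \<noteq> 0 \<longrightarrow> u \<in> S"
  shows "entry (incl S (move_index m) * x) u v =
    (if position u < m (degree u) then 0 else entry x (Ix (degree u) (position u - m (degree u))) v)"
proof -
  have "entry x w v = 0" if "w \<notin> S" for w using assms(2) that by blast
  then show ?thesis
    using entry_incl_mult(1)[OF assms(1) inj_move_index,
        of m x "Ix (degree u) (position u - m (degree u))" v]
      entry_incl_mult_outside(1)[OF assms(1), of u "move_index m" x v]
    by (auto simp: range_move_index move_index_diff)
qed

lemma entry_mult_proj_move:
  assumes "finite S" "\<forall>u v. entry x u v \<noteq> 0 \<longrightarrow> v \<in> S"
  shows "entry (x * proj S (move_index m)) v u =
    (if position u < m (degree u) then 0 else entry x v (Ix (degree u) (position u - m (degree u))))"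
proof -
  have "entry x v w = 0" if "w \<notin> S" for w using assms(2) that by blast
  then show ?thesis
    using entry_incl_mult(2)[OF assms(1) inj_move_index,
        of x m v "Ix (degree u) (position u - m (degree u))"]
      entry_incl_mult_outside(2)[OF assms(1), of u "move_index m" x v]
    by (auto simp: range_move_index move_index_diff)
qed

lemma bounded_four_block:
  fixes A C D :: "int \<Rightarrow> 'a::ring_1 mat"
  assumes A: "bounded_family k m m A" and C: "bounded_family k n m C" and D: "bounded_family k n n D"
  shows "bounded_family k (\<lambda>i. m i + n i) (\<lambda>i. m i + n i)
    (\<lambda>i. four_block_mat (A i) (0\<^sub>m (m (i + k)) (n i)) (C i) (D i))"
proof -
  obtain N1 where A_zero: "\<forall>i. \<bar>i\<bar> > N1 \<longrightarrow> A i = 0\<^sub>m (m (i + k)) (m i)" using A by (rule bounded_familyE)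
  obtain N2 where C_zero: "\<forall>i. \<bar>i\<bar> > N2 \<longrightarrow> C i = 0\<^sub>m (n (i + k)) (m i)" using C by (rule bounded_familyE)
  obtain N3 where D_zero: "\<forall>i. \<bar>i\<bar> > N3 \<longrightarrow> D i = 0\<^sub>m (n (i + k)) (n i)" using D by (rule bounded_familyE)
  have "four_block_mat (A i) (0\<^sub>m (m (i + k)) (n i)) (C i) (D i) = 0\<^sub>m (m (i + k) + n (i + k)) (m i + n i)"
    if "\<bar>i\<bar> > max N1 (max N2 N3)" for i
  proof -
    have "\<bar>i\<bar> > N1" "\<bar>i\<bar> > N2" "\<bar>i\<bar> > N3" using that by auto
    then show ?thesis using A_zero C_zero D_zero by (intro eq_matI) auto
  qed
  then show ?thesis
    unfolding bounded_family_def using bounded_family_carrier[OF A] bounded_family_carrier[OF D]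
    by (meson four_block_carrier_mat)
qed

lemma assemble_four_block:
  fixes A C D :: "int \<Rightarrow> 'a::ring_1 mat"
  assumes A: "bounded_family k m m A" and C: "bounded_family k n m C" and D: "bounded_family k n n D"
    and S: "finite S" "support (assemble k n m C) \<subseteq> S" "support (assemble k n n D) \<subseteq> S"
  shows "assemble k (\<lambda>i. m i + n i) (\<lambda>i. m i + n i)
      (\<lambda>i. four_block_mat (A i) (0\<^sub>m (m (i + k)) (n i)) (C i) (D i)) =
    assemble k m m A + incl S (move_index m) * assemble k n m C +
    incl S (move_index m) * assemble k n n D * proj S (move_index m)"
    (is "?B = _ + ?i * ?C + ?i * ?D * ?p")
proof (rule fmat_eqI)
  fix x y
  note carrier = bounded_family_carrier[OF A] bounded_family_carrier[OF C] bounded_family_carrier[OF D]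
  have block: "four_block_mat (A j) (0\<^sub>m (m (j + k)) (n j)) (C j) (D j) $$ (a, b) =
      (if a < m (j + k) then if b < m j then A j $$ (a, b) else 0
       else if b < m j then C j $$ (a - m (j + k), b) else D j $$ (a - m (j + k), b - m j))"
    if "a < m (j + k) + n (j + k)" "b < m j + n j" for j a b
    using that carrier(1)[of j] carrier(2)[of j] carrier(3)[of j] by auto
  have rows: "\<forall>u v. entry ?C u v \<noteq> 0 \<longrightarrow> u \<in> S" "\<forall>u v. entry ?D u v \<noteq> 0 \<longrightarrow> u \<in> S"
    and columns: "\<forall>u v. entry ?D u v \<noteq> 0 \<longrightarrow> v \<in> S"
    using S(2,3) support_entry[of ?C] support_entry[of ?D] by blast+
  have rows': "\<forall>u v. entry (?D * ?p) u v \<noteq> 0 \<longrightarrow> u \<in> S"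
    using rows(2) by (blast elim: entry_mult_nonzeroE)
  show "entry ?B x y = entry (assemble k m m A + ?i * ?C + ?i * ?D * ?p) x y"
    unfolding entry_add mult.assoc
    by (cases "position x < m (degree x)"; cases "position y < m (degree y)"; cases "degree x = degree y + k")
      (auto simp: entry_incl_move_mult[OF S(1) rows(1)] entry_incl_move_mult[OF S(1) rows']
        entry_mult_proj_move[OF S(1) columns]
        entry_assemble[OF bounded_four_block[OF A C D]] entry_assemble[OF A] entry_assemble[OF C]
        entry_assemble[OF D] block)
qed

definition ext_cplx :: "'a::ring_1 cplx \<Rightarrow> 'a cplx \<Rightarrow> (int \<Rightarrow> 'a mat) \<Rightarrow> 'a cplx" where
  "ext_cplx X Y C = (\<lambda>i. pobj_sum (cobj X i) (cobj Y i),
     \<lambda>i. four_block_mat (cdif X i) (0\<^sub>m (msize X (i + 1)) (msize Y i)) (C i) (cdif Y i))"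

lemma idem_incl_move_zero:
  fixes X :: "'a::ring_1 cplx"
  assumes X: "is_complex X" and S: "finite S"
  shows "idem (tot X) * incl S (move_index (msize X)) = 0" "proj S (move_index (msize X)) * idem (tot X) = 0"
proof -
  let ?T = "support (idem (tot X))" and ?\<phi> = "move_index (msize X)"
  have disjoint: "id ` ?T \<inter> ?\<phi> ` S = {}" "?\<phi> ` S \<inter> id ` ?T = {}"
    using support_idem_tot[OF X] by (auto simp: move_index_def) fastforce+
  have diag: "diag ?T = (proj ?T id :: 'a gmat)" "diag ?T = (incl ?T id :: 'a gmat)"
    by (simp_all add: diag_def proj_def incl_def)
  have "diag ?T * incl S ?\<phi> = (0 :: 'a gmat)" "proj S ?\<phi> * diag ?T = (0 :: 'a gmat)"
    using proj_mult_incl_disjoint[OF finite_support_entry S disjoint(1)]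
      proj_mult_incl_disjoint[OF S finite_support_entry disjoint(2)] diag by metis+
  then have "idem (tot X) * (diag ?T * incl S ?\<phi>) = 0" "proj S ?\<phi> * diag ?T * idem (tot X) = 0"
    by simp_all
  then show "idem (tot X) * incl S ?\<phi> = 0" "proj S ?\<phi> * idem (tot X) = 0"
    by (simp_all add: mult.assoc diag_mult finite_support_entry)
      (simp add: mult_diag finite_support_entry flip: mult.assoc)
qed

lemma tot_ext_cplx:
  assumes X: "is_complex X" and Y: "is_complex Y" and C: "C \<in> hom_families 1 X Y"
  defines "S \<equiv> support (idem (tot X)) \<union> support (idem (tot Y))"
  defines "i \<equiv> incl S (move_index (msize X))" and "p \<equiv> proj S (move_index (msize X))"
  shows "idem (tot (ext_cplx X Y C)) = idem (tot X) + i * idem (tot Y) * p"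
    "dif (tot (ext_cplx X Y C)) = dif (tot X) + i * tot_map 1 X Y C + i * dif (tot Y) * p"
    "bounded_family 0 (msize (ext_cplx X Y C)) (msize (ext_cplx X Y C)) (id_cmap (ext_cplx X Y C))"
    "bounded_family 1 (msize (ext_cplx X Y C)) (msize (ext_cplx X Y C)) (cdif (ext_cplx X Y C))"
proof -
  interpret X: graded_complex "tot X" by (rule graded_complex_tot[OF X])
  interpret Y: graded_complex "tot Y" by (rule graded_complex_tot[OF Y])
  have S: "finite S" unfolding S_def by (simp add: finite_support_entry)
  have "tot_map 1 X Y C \<in> corner (idem (tot X)) (idem (tot Y))"
    "dif (tot Y) \<in> corner (idem (tot Y)) (idem (tot Y))"
    using homs_corner[OF tot_map_homs[OF X Y C]] by (auto intro: cornerI Y.idem_dif Y.dif_idem)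
  then have support: "support (tot_map 1 X Y C) \<subseteq> S" "support (dif (tot Y)) \<subseteq> S" "support (idem (tot Y)) \<subseteq> S"
    unfolding S_def using support_corner by blast+
  let ?B = "ext_cplx X Y C" and ?Z = "\<lambda>i. 0\<^sub>m (msize Y (i + 0)) (msize X i) :: 'a mat"
  have sizes: "msize ?B = (\<lambda>i. msize X i + msize Y i)"
    by (simp add: fun_eq_iff msize_def ext_cplx_def cobj_def pobj_sum_def)
  have id: "id_cmap ?B = (\<lambda>i. four_block_mat (id_cmap X i) (0\<^sub>m (msize X (i + 0)) (msize Y i)) (?Z i)
    (id_cmap Y i))"
    by (simp add: fun_eq_iff msize_def ext_cplx_def cobj_def pobj_sum_def id_cmap_def)
  have d: "cdif ?B = (\<lambda>i. four_block_mat (cdif X i) (0\<^sub>m (msize X (i + 1)) (msize Y i)) (C i) (cdif Y i))"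
    by (simp add: fun_eq_iff ext_cplx_def cdif_def)
  note bounded_id = bounded_id_cmap[OF X] bounded_family_zero bounded_id_cmap[OF Y]
    and bounded_dif = bounded_cdif[OF X] bounded_hom_families[OF X Y C] bounded_cdif[OF Y]
  show "bounded_family 0 (msize ?B) (msize ?B) (id_cmap ?B)"
    "bounded_family 1 (msize ?B) (msize ?B) (cdif ?B)"
    unfolding sizes id d by (rule bounded_four_block[OF bounded_id] bounded_four_block[OF bounded_dif])+
  show "idem (tot ?B) = idem (tot X) + i * idem (tot Y) * p"
    using assemble_four_block[OF bounded_id S] support unfolding i_def p_def tot_def sizes id
    by (simp add: assemble_zero[of 0, simplified])
  show "dif (tot ?B) = dif (tot X) + i * tot_map 1 X Y C + i * dif (tot Y) * p"
    using assemble_four_block[OF bounded_dif S] support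
    unfolding i_def p_def tot_def tot_map_def sizes d by simp
qed

proposition ext_cplx_extension:
  assumes X: "is_complex X" and Y: "is_complex Y" and C: "C \<in> hom_families 1 X Y"
    and cocycle: "tot_map 1 X Y C \<in> cocycles 1 (tot X) (tot Y)"
  shows "is_complex (ext_cplx X Y C)"
    and "\<exists>i1 i2 p1 p2. extension (tot (ext_cplx X Y C)) (tot X) (tot Y) (tot_map 1 X Y C) i1 i2 p1 p2"
proof -
  interpret X: graded_complex "tot X" by (rule graded_complex_tot[OF X])
  interpret Y: graded_complex "tot Y" by (rule graded_complex_tot[OF Y])
  define S where "S = support (idem (tot X)) \<union> support (idem (tot Y))"
  define i where "i = (incl S (move_index (msize X)) :: 'a gmat)"
  define p where "p = (proj S (move_index (msize X)) :: 'a gmat)"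
  let ?F = "tot_map 1 X Y C"
  note tot = tot_ext_cplx[OF X Y C, folded S_def, folded i_def p_def]
  have S: "finite S" unfolding S_def by (simp add: finite_support_entry)
  have zero: "idem (tot X) * i = 0" "p * idem (tot X) = 0" "idem (tot X) * (i * y) = 0"
    "p * (idem (tot X) * y) = 0" for y
    using idem_incl_move_zero[OF X S] by (simp_all add: i_def p_def flip: mult.assoc)
  have "p * i = diag S" unfolding i_def p_def
    by (rule proj_mult_incl[OF S inj_on_subset[OF inj_move_index subset_UNIV]])
  then have "p * (i * idem (tot Y)) = diag S * idem (tot Y)" by (simp flip: mult.assoc)
  also have "\<dots> = idem (tot Y)" by (rule diag_mult[OF S]) (simp add: S_def)
  finally have inverse: "p * (i * idem (tot Y)) = idem (tot Y)"
    "p * (i * (idem (tot Y) * y)) = idem (tot Y) * y" for y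
    by (simp_all flip: mult.assoc)
  note F = corner_left[OF cocycles_corner[OF cocycle]] corner_right[OF cocycles_corner[OF cocycle]]
    corner_left_assoc[OF cocycles_corner[OF cocycle]] corner_right_assoc[OF cocycles_corner[OF cocycle]]
  have ext: "extension (tot (ext_cplx X Y C)) (tot X) (tot Y) ?F
      (idem (tot X)) (i * idem (tot Y)) (idem (tot X)) (idem (tot Y) * p)"
  proof unfold_locales
    show "homogeneous 0 (i * idem (tot Y))" "homogeneous 0 (idem (tot Y) * p)"
      unfolding i_def p_def using S
      by (auto intro!: homogeneous_mult_degree_0 homogeneous_incl_move homogeneous_proj_move
        Y.homogeneous_idem)
  qed (simp_all add: tot corner_def distrib_left distrib_right mult.assoc zero inverse X.complex_simps
        Y.complex_simps X.homogeneous_idem cocycle F)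
  then show "\<exists>i1 i2 p1 p2. extension (tot (ext_cplx X Y C)) (tot X) (tot Y) ?F i1 i2 p1 p2" by blast
  interpret extension "tot (ext_cplx X Y C)" "tot X" "tot Y" ?F
    "idem (tot X)" "i * idem (tot Y)" "idem (tot X)" "idem (tot Y) * p" by (fact ext)
  show "is_complex (ext_cplx X Y C)" by (rule is_complexI[OF tot(3,4)]) unfold_locales
qed

lemma zero_hom_families:
  assumes "is_complex X" "is_complex Y" shows "(\<lambda>i. 0\<^sub>m (msize Y (i + k)) (msize X i)) \<in> hom_families k X Y"
proof -
  have "id_cmap Y (i + k) \<in> carrier_mat (msize Y (i + k)) (msize Y (i + k))"
    "id_cmap X i \<in> carrier_mat (msize X i) (msize X i)" for i
    using assms[THEN bounded_id_cmap, THEN bounded_family_carrier] by simp_all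
  then show ?thesis
    unfolding hom_families_iff[OF assms] by (auto simp: right_mult_zero_mat left_mult_zero_mat fun_eq_iff)
qed

lemma dsum_extension:
  assumes "is_complex X" "is_complex Y"
  shows "is_complex (X \<oplus>\<^sub>K Y)"
    and "\<exists>i1 i2 p1 p2. extension (tot (X \<oplus>\<^sub>K Y)) (tot X) (tot Y) 0 i1 i2 p1 p2"
proof -
  let ?Z = "\<lambda>i. 0\<^sub>m (msize Y (i + 1)) (msize X i)"
  have "X \<oplus>\<^sub>K Y = ext_cplx X Y ?Z" by (simp add: dsum_def ext_cplx_def msize_def)
  moreover have "tot_map 1 X Y ?Z = 0" unfolding tot_map_def by (rule assemble_zero)
  ultimately show "is_complex (X \<oplus>\<^sub>K Y)"
    "\<exists>i1 i2 p1 p2. extension (tot (X \<oplus>\<^sub>K Y)) (tot X) (tot Y) 0 i1 i2 p1 p2"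
    using ext_cplx_extension[OF assms zero_hom_families[OF assms]] by simp_all
qed

lemma extension_exists:
  assumes X: "is_complex X" and Y: "is_complex Y" and F: "F \<in> cocycles 1 (tot X) (tot Y)"
  obtains C i1 i2 p1 p2 where "chain_map X (shift 1 Y) C" "is_complex (ext_cplx X Y C)"
    "extension (tot (ext_cplx X Y C)) (tot X) (tot Y) F i1 i2 p1 p2"
proof -
  obtain C where C: "C \<in> hom_families 1 X Y" "tot_map 1 X Y C = F"
    by (rule tot_map_surj[OF X Y cocycles_homs[OF F]])
  then show thesis
    using that ext_cplx_extension[OF X Y C(1)] F chain_map_iff[OF X Y, of 1 C] by auto
qed

subsection \<open>Shifts and cones\<close>

lemma shift_shift: "shift (- k) (shift k X) = X"
  unfolding shift_def cobj_def cdif_def by (cases X) (auto simp: fun_eq_iff uminus_uminus_mat)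

lemma phom_uminus: "f \<in> phom P Q \<Longrightarrow> proj_obj P \<Longrightarrow> proj_obj Q \<Longrightarrow> - f \<in> phom P Q"
  by (auto simp: phom_iff proj_obj_def)

lemma is_complex_shift:
  assumes X: "is_complex X" shows "is_complex (shift k X)"
proof -
  have carrier: "cdif X i \<in> carrier_mat (msize X (i + 1)) (msize X i)" for i
    using bounded_family_carrier[OF bounded_cdif[OF X]] .
  have reindex: "i + 1 + k = i + k + 1" "i + 2 + k = i + k + 2" for i by simp_all
  obtain N where "\<forall>i. \<bar>i\<bar> > int N \<longrightarrow> snd (cobj X i) = 0\<^sub>m (fst (cobj X i)) (fst (cobj X i))"
    using X unfolding is_complex_def by blast
  then have "\<forall>i. int (N + nat \<bar>k\<bar>) < \<bar>i\<bar> \<longrightarrow> snd (cobj X (i + k)) = 0\<^sub>m (fst (cobj X (i + k)))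
    (fst (cobj X (i + k)))"
    by auto
  then have "\<exists>N. \<forall>i. int N < \<bar>i\<bar> \<longrightarrow> snd (cobj X (i + k)) = 0\<^sub>m (fst (cobj X (i + k))) (fst (cobj X (i + k)))"
    by (rule exI)
  moreover have "- cdif X (i + 1) * - cdif X i = 0\<^sub>m (msize X (i + 2)) (msize X i)" for i
    using carrier[of i] carrier[of "i + 1"] cdif_cdif[OF X] by (simp add: uminus_uminus_mat)
  ultimately show ?thesis
    unfolding is_complex_def cobj_shift cdif_shift reindex
    using proj_obj_cobj[OF X] cdif_phom[OF X] cdif_cdif[OF X]
    by (auto simp: phom_uminus msize_def)
qed

lemma chain_map_id_cmap:
  assumes X: "is_complex X" shows "chain_map X X (id_cmap X)"
proof -
  have "\<forall>i. id_cmap X i \<in> phom (cobj X i) (cobj X i)"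
    using id_cmap_families[OF X] by (simp add: hom_families_def)
  moreover have "\<forall>i. cdif X i * id_cmap X i = id_cmap X (i + 1) * cdif X i"
    using cdif_families[OF X] unfolding hom_families_iff[OF X X] by (simp add: fun_eq_iff)
  ultimately show ?thesis unfolding chain_map_def by blast
qed

lemma shift_inverse_cocycles:
  assumes X: "is_complex X"
  obtains s t where "s \<in> cocycles (- k) (tot X) (tot (shift k X))" "t \<in> cocycles k (tot (shift k X)) (tot X)"
    "t * s = idem (tot X)" "s * t = idem (tot (shift k X))"
proof -
  let ?X = "shift k X"
  have id: "id_cmap ?X = (\<lambda>i. id_cmap X (i + k))" by (simp add: id_cmap_def cobj_shift fun_eq_iff)
  have X': "is_complex ?X" by (rule is_complex_shift[OF X])
  interpret graded_complex "tot X" by (rule graded_complex_tot[OF X])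
  interpret X': graded_complex "tot ?X" by (rule graded_complex_tot[OF X'])
  have s: "id_cmap X \<in> hom_families (- k) X ?X"
    "tot_map (- k) X ?X (id_cmap X) \<in> cocycles (- k) (tot X) (tot ?X)"
    using chain_map_iff[OF X X', of "- k"] chain_map_id_cmap[OF X] by (simp_all add: shift_shift)
  have t: "id_cmap ?X \<in> hom_families k ?X X" "tot_map k ?X X (id_cmap ?X) \<in> cocycles k (tot ?X) (tot X)"
    using chain_map_iff[OF X' X, of k] chain_map_id_cmap[OF X'] by simp_all
  show thesis
  proof (rule that[OF s(2) t(2)])
    show "tot_map k ?X X (id_cmap ?X) * tot_map (- k) X ?X (id_cmap X) = idem (tot X)"
      using assemble_mult(2)[OF bounded_hom_families[OF X' X t(1)] bounded_hom_families[OF X X' s(1)]]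
        assemble_mult(2)[OF bounded_id_cmap[OF X] bounded_id_cmap[OF X]] idem_idem
      by (simp add: tot_map_def tot_def id)
    show "tot_map (- k) X ?X (id_cmap X) * tot_map k ?X X (id_cmap ?X) = idem (tot ?X)"
      using assemble_mult(2)[OF bounded_hom_families[OF X X' s(1)] bounded_hom_families[OF X' X t(1)]]
        assemble_mult(2)[OF bounded_id_cmap[OF X'] bounded_id_cmap[OF X']] X'.idem_idem
      by (simp add: tot_map_def tot_def id)
  qed
qed

lemma chain_map_shift:
  assumes "is_complex X" "is_complex Y"
  shows "chain_map (shift 1 X) (shift 1 Y) (\<lambda>i. f (i + 1)) \<longleftrightarrow> chain_map X Y f"
proof -
  have all_shift: "(\<forall>i. P (i + 1)) \<longleftrightarrow> (\<forall>i. P i)" for P :: "int \<Rightarrow> bool" by (metis diff_add_cancel)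
  have signs: "- cdif Y (i + 1) * f (i + 1) = f (i + 1 + 1) * - cdif X (i + 1) \<longleftrightarrow>
      cdif Y (i + 1) * f (i + 1) = f (i + 1 + 1) * cdif X (i + 1)"
    if f: "\<forall>i. f i \<in> phom (cobj X i) (cobj Y i)" for i
  proof -
    have "f j \<in> carrier_mat (msize Y j) (msize X j)" for j using f by (auto simp: phom_def msize_def)
    then have "dim_row (f (i + 1)) = msize Y (i + 1)" "dim_col (f (i + 1 + 1)) = msize X (i + 1 + 1)" by auto
    moreover have "dim_col (cdif Y (i + 1)) = msize Y (i + 1)"
      "dim_row (cdif X (i + 1)) = msize X (i + 1 + 1)"
      using bounded_family_carrier[OF bounded_cdif] assms by blast+
    ultimately show ?thesis by simp
  qed
  have "chain_map (shift 1 X) (shift 1 Y) (\<lambda>i. f (i + 1)) \<longleftrightarrow>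
      (\<forall>i. f (i + 1) \<in> phom (cobj X (i + 1)) (cobj Y (i + 1))) \<and>
      (\<forall>i. - cdif Y (i + 1) * f (i + 1) = f (i + 1 + 1) * - cdif X (i + 1))"
    unfolding chain_map_def cobj_shift cdif_shift by simp
  also have "\<dots> \<longleftrightarrow> (\<forall>i. f i \<in> phom (cobj X i) (cobj Y i)) \<and>
      (\<forall>i. cdif Y (i + 1) * f (i + 1) = f (i + 1 + 1) * cdif X (i + 1))"
    unfolding all_shift[of "\<lambda>i. f i \<in> phom (cobj X i) (cobj Y i)"] using signs by blast
  also have "\<dots> \<longleftrightarrow> chain_map X Y f"
    unfolding all_shift[of "\<lambda>i. cdif Y i * f i = f (i + 1) * cdif X i"] chain_map_def ..
  finally show ?thesis .
qed

lemma cone_eq_ext_cplx: "cone X Y f = ext_cplx (shift 1 X) Y (\<lambda>i. f (i + 1))"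
  by (simp add: cone_def ext_cplx_def cobj_shift cdif_shift msize_def add.assoc)

lemma is_complex_cone:
  assumes X: "is_complex X" and Y: "is_complex Y" and f: "chain_map X Y f"
  shows "is_complex (cone X Y f)"
  using ext_cplx_extension(1)[OF is_complex_shift[OF X] Y] f
    chain_map_iff[OF is_complex_shift[OF X, of 1] Y, of 1] chain_map_shift[OF X Y]
  unfolding cone_eq_ext_cplx by auto

lemma ext_cplx_eq_cone:
  assumes X: "is_complex X" and Y: "is_complex Y" and C: "chain_map X (shift 1 Y) C"
  obtains f where "chain_map (shift (- 1) X) Y f" "ext_cplx X Y C = cone (shift (- 1) X) Y f"
proof -
  have "shift 1 (shift (- 1) X) = X" using shift_shift[of "- 1" X] by simp
  then show thesis
    using that[of "\<lambda>i. C (i - 1)"] C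
    unfolding chain_map_shift[OF is_complex_shift[OF X] Y, symmetric] cone_eq_ext_cplx by simp
qed

lemma is_complex_zero: "is_complex (zero_cplx :: 'a::ring_1 cplx)"
  unfolding is_complex_def zero_cplx_def proj_obj_def phom_def cobj_def cdif_def by auto

lemma idem_tot_zero: "idem (tot (zero_cplx :: 'a::ring_1 cplx)) = 0"
proof -
  have "msize (zero_cplx :: 'a cplx) = (\<lambda>_. 0)" "id_cmap (zero_cplx :: 'a cplx) = (\<lambda>_. 0\<^sub>m 0 0)"
    by (simp_all add: fun_eq_iff zero_cplx_def msize_def cobj_def id_cmap_def)
  then show ?thesis using assemble_zero[of 0 "\<lambda>_. 0" "\<lambda>_. 0"] by (simp add: tot_def)
qed

section \<open>Krull-Schmidt decompositions of complexes\<close>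

context fd_algebra_over
begin

lemma koszul_scale: "koszul k (scale_mat c x) = scale_mat c (koszul k x)"
  by (simp add: koszul_def)

lemma subspace_cocycles: "mat.subspace (cocycles k X Y)"
proof (rule mat.subspaceI)
  fix c f assume f: "f \<in> cocycles k X Y"
  have "scale_mat c f \<in> corner (idem X) (idem Y)"
    by (rule mat.subspace_scale[OF mat.subspace_corner cocycles_corner[OF f]])
  moreover have "homogeneous k (scale_mat c f)"
    using cocycles_homs[OF f, THEN homs_homogeneous] unfolding homogeneous_def
    by (metis entry_scale_mat scale_zero)
  ultimately show "scale_mat c f \<in> cocycles k X Y"
    using cocycles_dif[OF f] by (intro cocyclesI homsI)
      (simp_all add: koszul_scale mat.scale_mult_left mat.scale_mult_right)
qed (auto intro: cocycles_add)

lemma fitting_cocycles: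
  fixes X :: "'a gcplx"
  assumes X: "graded_complex X" and f: "f \<in> cocycles 0 X X"
  obtains g u v where "g \<in> cocycles 0 X X" "u \<in> cocycles 0 X X" "v \<in> cocycles 0 X X" "g * g = g"
    "f * u = g" "u * f = g" "(idem X - f) * v = idem X - g" "v * (idem X - f) = idem X - g"
proof -
  interpret graded_complex X by (rule X)
  have "corner_endo (idem X) f" using idem_idem cocycles_corner[OF f] by unfold_locales
  then show thesis
  proof (rule mat.fitting)
    show "x * y \<in> cocycles 0 X X" if "x \<in> cocycles 0 X X" "y \<in> cocycles 0 X X" for x y
      using cocycles_mult[OF that] by simp
  qed (use finite_dim_corner subspace_cocycles idem_cocycle f that in auto)
qed

lemma strict_idempotent:
  fixes X :: "'a gcplx"
  assumes X: "graded_complex X" and f: "f \<in> cocycles 0 X X" "f * f - f \<in> coboundaries 0 X X"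
  obtains g where "g \<in> cocycles 0 X X" "g * g = g" "g - f \<in> coboundaries 0 X X"
proof -
  obtain g u v where g: "g \<in> cocycles 0 X X" "u \<in> cocycles 0 X X" "v \<in> cocycles 0 X X" "g * g = g"
    "f * u = g" "u * f = g" "(idem X - f) * v = idem X - g" "v * (idem X - f) = idem X - g"
    by (rule fitting_cocycles[OF X f(1)])
  have unit: "f * idem X = f" by (rule corner_right[OF cocycles_corner[OF f(1)]])
  have "f * (idem X - g) = f * (idem X - f) * v" using g(7) by (simp add: mult.assoc)
  then have "f - f * g = - ((f * f - f) * v)"
    using unit by (simp add: left_diff_distrib right_diff_distrib mult.assoc)
  moreover have "f * g - g = (f * f - f) * u" using g(5) by (simp add: left_diff_distrib mult.assoc)
  moreover have "g - f = - (f - f * g) - (f * g - g)" by simp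
  ultimately have "g - f = (f * f - f) * v - (f * f - f) * u" by simp
  also have "\<dots> \<in> coboundaries 0 X X"
    using coboundaries_mult_right[OF f(2) g(2)] coboundaries_mult_right[OF f(2) g(3)]
    by (simp add: coboundaries_diff)
  finally show thesis using that g(1,4) by blast
qed

end

lemma (in graded_complex) image_complex:
  assumes g: "g \<in> cocycles 0 X X" "g * g = g"
  shows "graded_complex (g, g * dif X)"
    and "g \<in> cocycles 0 (g, g * dif X) X" and "g \<in> cocycles 0 X (g, g * dif X)"
proof -
  note g_homs = cocycles_homs[OF g(1)]
  have g_simps: "g * (g * y) = g * y" "dif X * g = g * dif X" "dif X * (g * y) = g * (dif X * y)" for y
    using g(2) chain_map_dif[OF g(1)] by (simp_all flip: mult.assoc)
  note simps = g(2) g_simps complex_simps corner_left[OF homs_corner[OF g_homs]]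
    corner_right[OF homs_corner[OF g_homs]]
  show "graded_complex (g, g * dif X)"
    by unfold_locales (simp_all add: mult.assoc simps homs_homogeneous[OF g_homs]
        homogeneous_mult_degree_0(1)[OF homs_homogeneous[OF g_homs] homogeneous_dif])
  show "g \<in> cocycles 0 (g, g * dif X) X"
    using homs_homogeneous[OF g_homs] by (auto intro!: chain_mapI homsI cornerI simp: mult.assoc simps)
  show "g \<in> cocycles 0 X (g, g * dif X)"
    using homs_homogeneous[OF g_homs] by (auto intro!: chain_mapI homsI cornerI simp: mult.assoc simps)
qed

context fd_algebra_over
begin

sublocale K: quotient_category "is_complex :: 'a cplx \<Rightarrow> bool" "\<lambda>X Y. cocycles 0 (tot X) (tot Y)"
  "\<lambda>X Y. coboundaries 0 (tot X) (tot Y)" "\<lambda>X. idem (tot X)"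
proof
  fix X Y W :: "'a cplx" and f g :: "'a gmat"
  show "idem (tot X) \<in> cocycles 0 (tot X) (tot X)" if "is_complex X"
    by (rule graded_complex.idem_cocycle[OF graded_complex_tot[OF that]])
  show "idem (tot Y) * f = f" "f * idem (tot X) = f" if "f \<in> cocycles 0 (tot X) (tot Y)"
    using cocycles_corner[OF that] by (simp_all add: corner_left corner_right)
  show "g * f \<in> cocycles 0 (tot X) (tot W)"
    if "g \<in> cocycles 0 (tot Y) (tot W)" "f \<in> cocycles 0 (tot X) (tot Y)"
    using cocycles_mult[OF that] by simp
  show "g * f \<in> coboundaries 0 (tot X) (tot W)"
    if "g \<in> cocycles 0 (tot Y) (tot W)" "f \<in> coboundaries 0 (tot X) (tot Y)"
    using coboundaries_mult_left[OF that] by simp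
  show "g * f \<in> coboundaries 0 (tot X) (tot W)"
    if "g \<in> coboundaries 0 (tot Y) (tot W)" "f \<in> cocycles 0 (tot X) (tot Y)"
    using coboundaries_mult_right[OF that] by simp
qed (simp_all add: cocycles_add cocycles_uminus coboundaries_add coboundaries_uminus)

lemma biprod_of_cocycles:
  assumes "is_complex B" "is_complex Y" "is_complex Z"
    and "ring_biproduct (idem (tot B)) (idem (tot Y)) (idem (tot Z)) i1 i2 p1 p2"
    and "i1 \<in> cocycles 0 (tot Y) (tot B)" "i2 \<in> cocycles 0 (tot Z) (tot B)"
      "p1 \<in> cocycles 0 (tot B) (tot Y)" "p2 \<in> cocycles 0 (tot B) (tot Z)"
  shows "K.biprod B Y Z i1 i2 p1 p2"
proof -
  interpret ring_biproduct "idem (tot B)" "idem (tot Y)" "idem (tot Z)" i1 i2 p1 p2 by fact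
  show ?thesis unfolding K.biprod_def using assms by (simp add: biprod_simps incl_proj_sum)
qed

lemma split_extension_biprod:
  assumes "is_complex B" "is_complex Y" "is_complex Z" "extension (tot B) (tot Y) (tot Z) 0 i1 i2 p1 p2"
  shows "K.biprod B Y Z i1 i2 p1 p2"
proof -
  interpret extension "tot B" "tot Y" "tot Z" 0 i1 i2 p1 p2 by fact
  show ?thesis
    using split_cocycles incl2_cocycle proj1_cocycle assms(1-3) ring_biproduct_axioms
    by (intro biprod_of_cocycles) auto
qed

lemma dsum_biprod:
  assumes "is_complex X" "is_complex Y"
  shows "\<exists>i1 i2 p1 p2. K.biprod (X \<oplus>\<^sub>K Y) X Y i1 i2 p1 p2"
  using dsum_extension[OF assms] split_extension_biprod assms by blast

lemma split_idempotent:
  assumes X: "is_complex X" and g: "g \<in> cocycles 0 (tot X) (tot X)" "g * g = g"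
  obtains Y Z where "idem (tot Y) = g" "idem (tot Z) = idem (tot X) - g"
    "K.biprod X Y Z g (idem (tot X) - g) g (idem (tot X) - g)"
proof -
  interpret graded_complex "tot X" by (rule graded_complex_tot[OF X])
  let ?e = "idem (tot X)"
  have e_g: "?e * g = g" "g * ?e = g" using cocycles_corner[OF g(1)]
    by (simp_all add: corner_left corner_right)
  have g': "?e - g \<in> cocycles 0 (tot X) (tot X)" "(?e - g) * (?e - g) = ?e - g"
    using cocycles_diff[OF idem_cocycle g(1)] by (simp_all add: algebra_simps idem_idem g(2) e_g)
  obtain Y where Y: "is_complex Y" "tot Y = (g, g * dif (tot X))"
    by (rule complex_realization[OF image_complex(1)[OF g]])
  obtain Z where Z: "is_complex Z" "tot Z = (?e - g, (?e - g) * dif (tot X))"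
    by (rule complex_realization[OF image_complex(1)[OF g']])
  have "K.biprod X Y Z g (?e - g) g (?e - g)"
  proof (rule biprod_of_cocycles[OF X Y(1) Z(1)])
    show "ring_biproduct ?e (idem (tot Y)) (idem (tot Z)) g (?e - g) g (?e - g)"
      using ring_biproduct_complement[OF idem_idem cocycles_corner[OF g(1)] g(2)] by (simp add: Y(2) Z(2))
  qed (simp_all add: Y(2) Z(2) image_complex(2,3)[OF g] image_complex(2,3)[OF g'])
  then show thesis by (rule that[rotated 2]) (simp_all add: Y(2) Z(2))
qed

lemma dim_corner_less:
  assumes "g \<in> corner e e" "g * g = g" "e * e = e" "g \<noteq> e"
  shows "mat.dim (corner g g) < mat.dim (corner e e)"
proof (rule mat.dim_subspace_less[OF finite_dim_corner mat.subspace_corner])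
  have "x \<in> corner e e" if "x \<in> corner g g" for x
  proof (rule cornerI)
    show "e * x = x" using corner_left[OF that] corner_left_assoc[OF assms(1), of x] by simp
    show "x * e = x" using corner_right_assoc[OF that, of e] corner_right[OF assms(1)]
      corner_right[OF that] by simp
  qed
  moreover have "e \<in> corner e e" "e \<notin> corner g g"
    using assms corner_right[OF assms(1)] by (auto simp: corner_def)
  ultimately show "corner g g \<subset> corner e e" by blast
qed

lemma split_homotopy_idempotent:
  assumes X: "is_complex X"
    and f: "f \<in> cocycles 0 (tot X) (tot X)" "f * f - f \<in> coboundaries 0 (tot X) (tot X)"
  obtains Y Z i1 i2 p1 p2 where "K.biprod X Y Z i1 i2 p1 p2" "i1 * p1 - f \<in> coboundaries 0 (tot X) (tot X)"
    "idem (tot Y) \<in> corner (idem (tot X)) (idem (tot X))"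
    "f \<notin> coboundaries 0 (tot X) (tot X) \<Longrightarrow> idem (tot X) - f \<notin> coboundaries 0 (tot X) (tot X) \<Longrightarrow>
      mat.dim (corner (idem (tot Y)) (idem (tot Y))) < mat.dim (corner (idem (tot X)) (idem (tot X))) \<and>
      mat.dim (corner (idem (tot Z)) (idem (tot Z))) < mat.dim (corner (idem (tot X)) (idem (tot X)))"
proof -
  let ?e = "idem (tot X)" and ?N = "coboundaries 0 (tot X) (tot X)"
  interpret graded_complex "tot X" by (rule graded_complex_tot[OF X])
  obtain g where g: "g \<in> cocycles 0 (tot X) (tot X)" "g * g = g" "g - f \<in> ?N"
    by (rule strict_idempotent[OF graded_complex_axioms f])
  obtain Y Z where YZ: "idem (tot Y) = g" "idem (tot Z) = ?e - g" "K.biprod X Y Z g (?e - g) g (?e - g)"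
    by (rule split_idempotent[OF X g(1,2)])
  note corners = cocycles_corner[OF g(1)] cocycles_corner[OF cocycles_diff[OF idem_cocycle g(1)]]
  have "mat.dim (corner g g) < mat.dim (corner ?e ?e) \<and> mat.dim (corner (?e - g) (?e - g))
    < mat.dim (corner ?e ?e)"
    if "f \<notin> ?N" "?e - f \<notin> ?N"
  proof -
    have "g \<noteq> 0" "g \<noteq> ?e" using g(3) that coboundaries_uminus[OF g(3)] by auto
    moreover have "(?e - g) * (?e - g) = ?e - g"
      using corners(1) by (simp add: algebra_simps idem_idem g(2) corner_left corner_right)
    ultimately show ?thesis using corners g(2) idem_idem by (intro conjI dim_corner_less) auto
  qed
  then show thesis using that[OF YZ(3)] g(2,3) YZ(1,2) corners(1) by simp
qed

sublocale K: krull_schmidt_category "is_complex :: 'a cplx \<Rightarrow> bool" "\<lambda>X Y. cocycles 0 (tot X) (tot Y)"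
  "\<lambda>X Y. coboundaries 0 (tot X) (tot Y)" "\<lambda>X. idem (tot X)" "(\<oplus>\<^sub>K)" zero_cplx
  "\<lambda>X. mat.dim (corner (idem (tot X)) (idem (tot X)))"
proof
  fix X Y :: "'a cplx" and f :: "'a gmat"
  assume X: "is_complex X"
  show "\<exists>i1 i2 p1 p2. K.biprod (X \<oplus>\<^sub>K Y) X Y i1 i2 p1 p2" if "is_complex Y"
    by (rule dsum_biprod[OF X that])
  let ?Z = "cocycles 0 (tot X) (tot X)" and ?N = "coboundaries 0 (tot X) (tot X)" and ?e = "idem (tot X)"
  assume f: "f \<in> ?Z"
  show "\<exists>e\<in>?Z. \<exists>u\<in>?Z. \<exists>v\<in>?Z. e * e - e \<in> ?N \<and> f * u - e \<in> ?N \<and> u * f - e \<in> ?N \<and>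
    (?e - f) * v - (?e - e) \<in> ?N \<and> v * (?e - f) - (?e - e) \<in> ?N"
  proof -
    obtain g u v where "g \<in> ?Z" "u \<in> ?Z" "v \<in> ?Z" "g * g = g" "f * u = g" "u * f = g"
      "(?e - f) * v = ?e - g" "v * (?e - f) = ?e - g"
      by (rule fitting_cocycles[OF graded_complex_tot[OF X] f])
    then show ?thesis by (intro bexI[of _ g] bexI[of _ u] bexI[of _ v]) simp_all
  qed
  show "\<exists>Y Z i1 i2 p1 p2. K.biprod X Y Z i1 i2 p1 p2 \<and> i1 * p1 - f \<in> ?N \<and>
    (f \<notin> ?N \<longrightarrow> ?e - f \<notin> ?N \<longrightarrow>
      mat.dim (corner (idem (tot Y)) (idem (tot Y))) < mat.dim (corner ?e ?e) \<and>
      mat.dim (corner (idem (tot Z)) (idem (tot Z))) < mat.dim (corner ?e ?e))" if "f * f - f \<in> ?N"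
    by (rule split_homotopy_idempotent[OF X f that]) blast
qed (simp_all add: is_complex_zero idem_tot_zero)

lemma htpy_equiv_iff_iso: "X \<simeq>\<^sub>K Y \<longleftrightarrow> K.iso X Y"
  unfolding htpy_equiv_iff htpy_iso_def K.iso_def K.retract_def by blast

lemma iso_class_eq: "iso_class X = K.iso_class_of X"
  unfolding iso_class_def K.iso_class_of_def htpy_equiv_iff_iso ..

lemma indec_iff: "indec X \<longleftrightarrow> K.indec X"
  unfolding indec_def K.indec_def htpy_equiv_iff_iso ..

lemma dsum_list_eq: "dsum_list Xs = K.list_sum Xs"
  by (induction Xs) auto

lemma num_summands_eq:
  assumes X: "is_complex X" shows "num_summands X = card (set_mset (K.summands X))"
proof -
  have "{Y. indec Y \<and> (\<exists>Z. is_complex Z \<and> X \<simeq>\<^sub>K Y \<oplus>\<^sub>K Z)} =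
      {Y. K.indec Y \<and> K.iso_class_of Y \<in># K.summands X}"
    unfolding htpy_equiv_iff_iso indec_iff using K.iso_class_of_in_summands_iff[OF X] by blast
  then have "iso_class ` {Y. indec Y \<and> (\<exists>Z. is_complex Z \<and> X \<simeq>\<^sub>K Y \<oplus>\<^sub>K Z)} =
      K.iso_class_of ` {Y. K.indec Y \<and> K.iso_class_of Y \<in># K.summands X}"
    by (simp add: iso_class_eq)
  also have "\<dots> = set_mset (K.summands X)" using K.summandsE[OF X] by blast
  finally show ?thesis unfolding num_summands_def by simp
qed

lemma distinct_iso_classes_iff:
  assumes "\<forall>Y\<in>set Ts. is_complex Y"
  shows "distinct (map K.iso_class_of Ts) \<longleftrightarrow> (\<forall>i j. i < j \<longrightarrow> j < length Ts \<longrightarrow> \<not> Ts ! i \<simeq>\<^sub>K Ts ! j)"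
proof -
  have eq: "K.iso_class_of (Ts ! i) = K.iso_class_of (Ts ! j) \<longleftrightarrow> Ts ! i \<simeq>\<^sub>K Ts ! j" if "i < length Ts" for i j
    using that assms by (simp add: htpy_equiv_iff_iso K.iso_class_of_eq_iff)
  have "distinct (map K.iso_class_of Ts) \<longleftrightarrow> (\<forall>i j. i < j \<longrightarrow> j < length Ts \<longrightarrow>
      K.iso_class_of (Ts ! i) \<noteq> K.iso_class_of (Ts ! j))"
  proof
    assume "\<forall>i j. i < j \<longrightarrow> j < length Ts \<longrightarrow> K.iso_class_of (Ts ! i) \<noteq> K.iso_class_of (Ts ! j)"
    then show "distinct (map K.iso_class_of Ts)"
      unfolding distinct_conv_nth length_map by (intro allI impI, elim linorder_neqE_nat) force+
  qed (auto simp: distinct_conv_nth)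
  then show ?thesis using eq by (simp cong: imp_cong)
qed

lemma basic_iff: "basic X \<longleftrightarrow> is_complex X \<and> (\<forall>c. count (K.summands X) c \<le> 1)"
proof -
  have "basic X \<longleftrightarrow> (\<exists>Ts. K.iso X (K.list_sum Ts) \<and> (\<forall>Y\<in>set Ts. K.indec Y) \<and> distinct (map K.iso_class_of Ts))"
    unfolding basic_def htpy_equiv_iff_iso[of X] dsum_list_eq indec_iff
    by (intro ex_cong1 conj_cong refl) (simp add: distinct_iso_classes_iff K.indec_ob)
  also have "\<dots> \<longleftrightarrow> is_complex X \<and> (\<forall>c. count (K.summands X) c \<le> 1)"
  proof safe
    fix Ts c assume Ts: "K.iso X (K.list_sum Ts)" "\<forall>Y\<in>set Ts. K.indec Y" "distinct (map K.iso_class_of Ts)"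
    show "is_complex X" by (rule K.iso_ob(1)[OF Ts(1)])
    show "count (K.summands X) c \<le> 1"
      using K.summands_eqI[OF Ts(2,1)] Ts(3) by (simp add: distinct_count_atmost_1)
  next
    assume X: "is_complex X" and count: "\<forall>c. count (K.summands X) c \<le> 1"
    obtain Ts where Ts: "\<forall>Y\<in>set Ts. K.indec Y" "K.iso X (K.list_sum Ts)"
      "K.summands X = mset (map K.iso_class_of Ts)"
      by (rule K.decompositionE[OF X])
    have "count (mset (map K.iso_class_of Ts)) c = (if c \<in> set (map K.iso_class_of Ts) then 1 else 0)" for c
      using count count_greater_zero_iff[of "mset (map K.iso_class_of Ts)" c]
      by (fastforce simp: Ts(3) count_eq_zero_iff le_Suc_eq)
    then have "distinct (map K.iso_class_of Ts)" unfolding distinct_count_atmost_1 by blast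
    then show "\<exists>Ts. K.iso X (K.list_sum Ts) \<and> (\<forall>Y\<in>set Ts. K.indec Y) \<and> distinct (map K.iso_class_of Ts)"
      using Ts by blast
  qed
  finally show ?thesis .
qed

end

section \<open>Degrees and terms of complexes\<close>

definition degrees :: "'a::zero gmat \<Rightarrow> int set" where
  "degrees x = degree ` support x"

lemma in_block_iff_degrees: "homogeneous 0 e \<Longrightarrow> in_block t t e \<longleftrightarrow> degrees e \<subseteq> {t}"
  unfolding in_block_def homogeneous_def degrees_def support_def by fastforce

lemma degrees_zero_iff: "degrees (e :: 'a::ring gmat) = {} \<longleftrightarrow> e = 0"
  unfolding degrees_def support_def by (auto intro!: fmat_eqI)

lemma degrees_corner: "g \<in> corner e e \<Longrightarrow> degrees (g :: 'a::ring gmat) \<subseteq> degrees e"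
  unfolding degrees_def using support_corner by blast

lemma degrees_degree_part:
  fixes e :: "'a::ring gmat"
  assumes "homogeneous 0 e"
  shows "degrees (degree_part t e) = degrees e \<inter> {t}" and "degrees (e - degree_part t e) = degrees e - {t}"
proof -
  have "degree u = degree v" if "entry e u v \<noteq> 0" for u v
    using assms that unfolding homogeneous_def by auto
  then show "degrees (degree_part t e) = degrees e \<inter> {t}" "degrees (e - degree_part t e) = degrees e - {t}"
    unfolding degrees_def support_def by (auto simp: degree_part.rep_eq image_iff split: if_splits) metis+
qed

lemma homs_eq_zero:
  assumes "f \<in> homs k X Y" "\<And>i. i \<in> degrees (idem X) \<Longrightarrow> i + k \<notin> degrees (idem Y)" shows "f = 0"
proof (rule fmat_eqI, rule ccontr)
  fix u v assume "entry f u v \<noteq> entry 0 u v"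
  then have nz: "entry f u v \<noteq> 0" by simp
  have "degree u = degree v + k"
    using homs_homogeneous[OF assms(1)] nz unfolding homogeneous_def by blast
  moreover have "degree v \<in> degrees (idem X)" "degree u \<in> degrees (idem Y)"
    using corner_entry[OF homs_corner[OF assms(1)] nz] unfolding degrees_def by blast+
  ultimately show False using assms(2) by simp
qed

lemma (in extension) degrees_idem: "degrees (idem B) \<subseteq> degrees (idem X) \<union> degrees (idem Y)"
proof -
  have through: "degree u \<in> degrees (idem Z)" if i: "i \<in> homs 0 Z B"
    and nz: "entry (i * p) u v \<noteq> 0" for i p u v Z
  proof -
    obtain w where "entry i u w \<noteq> 0" using nz by (rule entry_mult_nonzeroE)
    then show ?thesis
      using homs_homogeneous[OF i] corner_entry(2)[OF homs_corner[OF i]]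
      unfolding homogeneous_def degrees_def by auto
  qed
  have "degree u \<in> degrees (idem X) \<union> degrees (idem Y)" if nz: "entry (idem B) u v \<noteq> 0" for u v
  proof -
    have "entry (i1 * p1) u v \<noteq> 0 \<or> entry (i2 * p2) u v \<noteq> 0"
      using nz by (auto simp flip: incl_proj_sum)
    then show ?thesis using through incl_homs by blast
  qed
  moreover have "degree u = degree v" if "entry (idem B) u v \<noteq> 0" for u v
    using homogeneous_idem that unfolding homogeneous_def by auto
  ultimately show ?thesis unfolding degrees_def support_def by fastforce
qed

lemma (in graded_complex) subcomplex_extension:
  assumes g: "g \<in> corner (idem X) (idem X)" "g * g = g" "homogeneous 0 g"
    and stable: "g * dif X * g = dif X * g"
  defines "q \<equiv> idem X - g"
  shows "extension X (q, q * dif X) (g, dif X * g) (g * dif X * q) q g q g"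
proof -
  interpret ring_biproduct "idem X" q g q g q g
    unfolding q_def by (rule ring_biproduct.swap[OF ring_biproduct_complement[OF idem_idem g(1,2)]])
  have g_simps: "g * (g * y) = g * y" "g * (dif X * g) = dif X * g" "g * (dif X * (g * y)) = dif X * (g * y)"
    "idem X * (g * y) = g * y" "g * (idem X * y) = g * y" for y
    using g(2) stable corner_left[OF g(1)] corner_right[OF g(1)] by (simp_all flip: mult.assoc)
  note simps = g(2) g_simps complex_simps corner_left[OF g(1)] corner_right[OF g(1)] q_def
  have homogeneous: "homogeneous 0 q" "homogeneous 1 (q * dif X)" "homogeneous 1 (dif X * g)"
    unfolding q_def using homogeneous_diff[OF homogeneous_idem g(3)] g(3) homogeneous_dif
    by (auto intro: homogeneous_mult_degree_0)
  have "g * dif X * q \<in> cocycles 1 (q, q * dif X) (g, dif X * g)"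
    using homogeneous_mult_degree_0(2)[OF homogeneous_mult_degree_0(1)[OF g(3) homogeneous_dif]
      homogeneous(1)]
    by (intro cocyclesI homsI cornerI) (simp_all add: simps algebra_simps)
  then show ?thesis
    by unfold_locales (use homogeneous g(3) in \<open>simp_all add: simps corner_def algebra_simps\<close>)
qed

subsection \<open>Two-term complexes\<close>

lemma two_term_iff: "two_term X \<longleftrightarrow> is_complex X \<and> degrees (idem (tot X)) \<subseteq> {-1, 0}"
proof (cases "is_complex X")
  case X: True
  have entry: "entry (idem (tot X)) u v = (if degree u = degree v \<and> position u < msize X (degree v) \<and>
      position v < msize X (degree v) then id_cmap X (degree v) $$ (position u, position v) else 0)" for u v
    unfolding tot_def by (auto simp: entry_assemble[OF bounded_id_cmap[OF X]])
  have zero_iff: "snd (cobj X i) = 0\<^sub>m (fst (cobj X i)) (fst (cobj X i)) \<longleftrightarrow> i \<notin> degrees (idem (tot X))" for i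
  proof
    assume "snd (cobj X i) = 0\<^sub>m (fst (cobj X i)) (fst (cobj X i))"
    then show "i \<notin> degrees (idem (tot X))"
      by (auto simp: degrees_def support_def entry id_cmap_def msize_def split: if_splits)
  next
    assume i: "i \<notin> degrees (idem (tot X))"
    have zero: "entry (idem (tot X)) (Ix i a) (Ix i b) = 0" for a b
      using i support_entry[of "idem (tot X)" "Ix i a"] unfolding degrees_def by force
    have "snd (cobj X i) $$ (a, b) = 0" if "a < fst (cobj X i)" "b < fst (cobj X i)" for a b
      using zero[of a b] that by (simp add: entry id_cmap_def msize_def)
    moreover have "snd (cobj X i) \<in> carrier_mat (fst (cobj X i)) (fst (cobj X i))"
      using proj_obj_cobj[OF X] unfolding proj_obj_def by blast
    ultimately show "snd (cobj X i) = 0\<^sub>m (fst (cobj X i)) (fst (cobj X i))" by (intro eq_matI) auto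
  qed
  show ?thesis unfolding two_term_def zero_iff using X by blast
qed (simp add: two_term_def)

lemma two_term_complex: "two_term X \<Longrightarrow> is_complex X"
  unfolding two_term_def by blast

lemma two_term_extension:
  assumes "two_term X" "two_term Y" "is_complex B" "extension (tot B) (tot X) (tot Y) F i1 i2 p1 p2"
  shows "two_term B"
proof -
  interpret extension "tot B" "tot X" "tot Y" F i1 i2 p1 p2 by fact
  show ?thesis using assms(1-3) degrees_idem unfolding two_term_iff by blast
qed

lemma two_term_dsum: "two_term X \<Longrightarrow> two_term Y \<Longrightarrow> two_term (X \<oplus>\<^sub>K Y)"
  using dsum_extension[of X Y] two_term_extension two_term_complex by blast

lemma two_term_zero: "two_term (zero_cplx :: 'a::ring_1 cplx)"
  by (simp add: two_term_iff is_complex_zero idem_tot_zero degrees_def support_def)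

lemma is_complex_alg: "is_complex (alg_cplx :: 'a::ring_1 cplx)"
  unfolding is_complex_def alg_cplx_def proj_obj_def phom_def cobj_def cdif_def
  by (auto intro!: exI[of _ 0])

lemma tot_alg: "tot (alg_cplx :: 'a::ring_1 cplx) = (single (Ix 0 0) (Ix 0 0) 1, 0)"
proof -
  have msize: "msize (alg_cplx :: 'a cplx) i = (if i = 0 then 1 else 0)" for i
    by (simp add: msize_def alg_cplx_def cobj_def)
  have "idem (tot (alg_cplx :: 'a cplx)) = single (Ix 0 0) (Ix 0 0) 1"
    unfolding tot_def fst_conv
    by (rule fmat_eqI, unfold entry_assemble[OF bounded_id_cmap[OF is_complex_alg]] msize single.rep_eq)
      (auto simp: id_cmap_def alg_cplx_def cobj_def index.expand)
  moreover have "dif (tot (alg_cplx :: 'a cplx)) = 0"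
    unfolding tot_def snd_conv
    by (rule fmat_eqI, unfold entry_assemble[OF bounded_cdif[OF is_complex_alg]] msize) auto
  ultimately show ?thesis by (simp add: prod_eq_iff)
qed

lemma degrees_alg: "degrees (idem (tot (alg_cplx :: 'a::ring_1 cplx))) \<subseteq> {0}"
  by (auto simp: tot_alg degrees_def support_def single.rep_eq split: if_splits)

lemma two_term_alg: "two_term (alg_cplx :: 'a::ring_1 cplx)"
  using degrees_alg is_complex_alg unfolding two_term_iff by blast

section \<open>Projectives and their summands\<close>

text \<open>Every idempotent matrix is isomorphic to the only term of a complex concentrated in degree zero;
  this defines its multiset of summands.\<close>

definition stalk_of :: "'a::ring_1 gmat \<Rightarrow> 'a cplx \<Rightarrow> bool" where
  "stalk_of P X \<longleftrightarrow> is_complex X \<and> dif (tot X) = 0 \<and> in_block 0 0 (idem (tot X)) \<and>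
     (\<exists>u v. inverse_maps P (idem (tot X)) u v)"

lemma stalk_ofE:
  assumes "stalk_of P X"
  obtains u v where "is_complex X" "dif (tot X) = 0" "in_block 0 0 (idem (tot X))"
    "inverse_maps P (idem (tot X)) u v"
  using assms unfolding stalk_of_def by blast

lemma inverse_maps_refl: "P * P = P \<Longrightarrow> inverse_maps P P P P"
  by unfold_locales (simp_all add: corner_self)

lemma stalk_of_self:
  "is_complex X \<Longrightarrow> dif (tot X) = 0 \<Longrightarrow> in_block 0 0 (idem (tot X)) \<Longrightarrow> stalk_of (idem (tot X)) X"
  unfolding stalk_of_def using inverse_maps_refl graded_complex.idem_idem[OF graded_complex_tot] by blast

lemma stalk_of_inverse_maps: "stalk_of Q X \<Longrightarrow> inverse_maps P Q u v \<Longrightarrow> stalk_of P X"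
  unfolding stalk_of_def using inverse_maps.trans by blast

lemma stalk_exists:
  assumes "in_block t t e" "e * e = (e :: 'a::ring_1 gmat)"
  obtains X where "is_complex X" "tot X = (e, 0)"
proof -
  have "graded_complex (e, 0)" using in_block_homogeneous[OF assms(1)] assms(2) by unfold_locales simp_all
  then show thesis using that by (rule complex_realization)
qed

lemma stalk_of_exists:
  fixes P :: "'a::ring_1 gmat"
  assumes P: "P * P = P" shows "\<exists>X. stalk_of P X"
proof -
  let ?S = "support P"
  obtain f :: "index \<Rightarrow> nat" where f: "inj_on f ?S"
    using finite_imp_inj_to_nat_seg[OF finite_support_entry[of P]] by blast
  define \<phi> where "\<phi> u = Ix 0 (f u)" for u
  define i where "i = (incl ?S \<phi> :: 'a gmat)"
  define p where "p = (proj ?S \<phi> :: 'a gmat)"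
  have "inj_on \<phi> ?S" using f by (simp add: \<phi>_def inj_on_def)
  then have "p * i = diag ?S" unfolding i_def p_def by (simp add: proj_mult_incl finite_support_entry)
  then have proj_incl: "p * (i * P) = P" "p * (i * (P * y)) = P * y" for y
    by (simp_all add: diag_mult finite_support_entry flip: mult.assoc)
  have idem_assoc: "P * (P * y) = P * y" for y using P by (simp flip: mult.assoc)
  have block: "in_block 0 0 (i * P * p)"
    unfolding in_block_def i_def p_def \<phi>_def
    by (auto elim!: entry_mult_nonzeroE simp: entry_incl entry_proj finite_support_entry split: if_splits)
  have "inverse_maps P (i * P * p) (i * P) (P * p)"
    by unfold_locales (simp_all add: corner_def mult.assoc proj_incl P idem_assoc)
  moreover obtain X where "is_complex X" "tot X = (i * P * p, 0)"
    by (rule stalk_exists[OF block]) (simp add: mult.assoc proj_incl P idem_assoc)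
  ultimately show ?thesis unfolding stalk_of_def using block by fastforce
qed

lemma stalk_cocycle:
  assumes "dif X = 0" "dif Y = 0" "in_block t t (idem X)" "in_block t t (idem Y)"
    "f \<in> corner (idem X) (idem Y)"
  shows "f \<in> cocycles 0 X Y"
  using in_block_homogeneous[OF in_block_corner[OF assms(3-5)]] assms by (intro chain_mapI homsI) simp_all

lemma stalk_coboundary: "dif X = 0 \<Longrightarrow> dif Y = 0 \<Longrightarrow> f \<in> coboundaries k X Y \<Longrightarrow> f = 0"
  by (auto elim: coboundariesE)

context fd_algebra_over
begin

lemma stalk_iso_iff:
  fixes X Y :: "'a cplx"
  assumes X: "is_complex X" "dif (tot X) = 0" "in_block t t (idem (tot X))"
    and Y: "is_complex Y" "dif (tot Y) = 0" "in_block t t (idem (tot Y))"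
  shows "K.iso X Y \<longleftrightarrow> (\<exists>u v. inverse_maps (idem (tot X)) (idem (tot Y)) u v)"
proof
  assume "K.iso X Y"
  then obtain f g where fg: "f \<in> cocycles 0 (tot X) (tot Y)" "g \<in> cocycles 0 (tot Y) (tot X)"
    "g * f - idem (tot X) = 0" "f * g - idem (tot Y) = 0"
    unfolding K.iso_def K.retract_def using stalk_coboundary X(2) Y(2) by metis
  have "inverse_maps (idem (tot X)) (idem (tot Y)) f g"
    using fg cocycles_corner[OF fg(1)] cocycles_corner[OF fg(2)] by unfold_locales simp_all
  then show "\<exists>u v. inverse_maps (idem (tot X)) (idem (tot Y)) u v" by blast
next
  assume "\<exists>u v. inverse_maps (idem (tot X)) (idem (tot Y)) u v"
  then obtain u v where "inverse_maps (idem (tot X)) (idem (tot Y)) u v" by blast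
  then interpret inverse_maps "idem (tot X)" "idem (tot Y)" u v .
  show "K.iso X Y"
    unfolding K.iso_def K.retract_def using X Y stalk_cocycle[OF X(2) Y(2) X(3) Y(3) map]
      stalk_cocycle[OF Y(2) X(2) Y(3) X(3) inverse_map]
    by (intro exI[of _ u] exI[of _ v]) (simp add: left_inverse right_inverse)
qed

lemma stalk_biprod:
  fixes B X Y :: "'a cplx"
  assumes "is_complex B" "dif (tot B) = 0" "in_block t t (idem (tot B))"
    and "is_complex X" "dif (tot X) = 0" "in_block t t (idem (tot X))"
    and "is_complex Y" "dif (tot Y) = 0" "in_block t t (idem (tot Y))"
    and "ring_biproduct (idem (tot B)) (idem (tot X)) (idem (tot Y)) i1 i2 p1 p2"
  shows "K.summands B = K.summands X + K.summands Y"
proof -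
  interpret ring_biproduct "idem (tot B)" "idem (tot X)" "idem (tot Y)" i1 i2 p1 p2 by fact
  have "K.biprod B X Y i1 i2 p1 p2"
    using assms incl1 incl2 proj1 proj2 by (intro biprod_of_cocycles stalk_cocycle) auto
  then show ?thesis by (rule K.summands_biprod)
qed

definition proj_summands :: "'a gmat \<Rightarrow> 'a cplx set multiset" where
  "proj_summands P = K.summands (SOME X. stalk_of P X)"

lemma stalk_of_unique:
  fixes P :: "'a gmat"
  assumes "stalk_of P X" "stalk_of P Y" shows "K.iso X Y"
proof -
  obtain u v where X: "is_complex X" "dif (tot X) = 0" "in_block 0 0 (idem (tot X))"
    "inverse_maps P (idem (tot X)) u v" using assms(1) by (rule stalk_ofE)
  obtain u' v' where Y: "is_complex Y" "dif (tot Y) = 0" "in_block 0 0 (idem (tot Y))"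
    "inverse_maps P (idem (tot Y)) u' v'" using assms(2) by (rule stalk_ofE)
  show ?thesis
    unfolding stalk_iso_iff[OF X(1-3) Y(1-3)]
    using inverse_maps.trans[OF inverse_maps.swap[OF X(4)] Y(4)] by blast
qed

lemma proj_summands_eq:
  assumes "stalk_of P X" shows "proj_summands P = K.summands X"
proof -
  have "stalk_of P (SOME X. stalk_of P X)" using assms by (rule someI)
  then have "K.iso (SOME X. stalk_of P X) X" using assms by (rule stalk_of_unique)
  then show ?thesis unfolding proj_summands_def by (rule K.summands_iso)
qed

lemma proj_summands_eq_iff:
  assumes P: "P * P = P" and Q: "Q * Q = Q"
  shows "proj_summands P = proj_summands Q \<longleftrightarrow> (\<exists>u v. inverse_maps P Q u v)"
proof
  assume eq: "proj_summands P = proj_summands Q"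
  obtain X Y where XY: "stalk_of P X" "stalk_of Q Y" using stalk_of_exists P Q by meson
  obtain u v where X: "is_complex X" "dif (tot X) = 0" "in_block 0 0 (idem (tot X))"
    "inverse_maps P (idem (tot X)) u v" using XY(1) by (rule stalk_ofE)
  obtain u' v' where Y: "is_complex Y" "dif (tot Y) = 0" "in_block 0 0 (idem (tot Y))"
    "inverse_maps Q (idem (tot Y)) u' v'" using XY(2) by (rule stalk_ofE)
  have "K.iso X Y" using eq K.iso_iff_summands[OF X(1) Y(1)] XY by (simp add: proj_summands_eq)
  then obtain w w' where "inverse_maps (idem (tot X)) (idem (tot Y)) w w'"
    using stalk_iso_iff[OF X(1-3) Y(1-3)] by blast
  then show "\<exists>u v. inverse_maps P Q u v"
    using inverse_maps.trans[OF X(4)] inverse_maps.trans[OF _ inverse_maps.swap[OF Y(4)]] by blast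
next
  assume "\<exists>u v. inverse_maps P Q u v"
  then obtain u v where uv: "inverse_maps P Q u v" by blast
  obtain X where X: "stalk_of Q X" using stalk_of_exists[OF Q] by blast
  show "proj_summands P = proj_summands Q"
    using proj_summands_eq[OF X] proj_summands_eq[OF stalk_of_inverse_maps[OF X uv]] by simp
qed

lemma proj_summands_biproduct:
  fixes B :: "'a gmat"
  assumes "ring_biproduct B P Q i1 i2 p1 p2" shows "proj_summands B = proj_summands P + proj_summands Q"
proof -
  interpret ring_biproduct B P Q i1 i2 p1 p2 by fact
  obtain Z X Y where Z: "stalk_of B Z" and X: "stalk_of P X" and Y: "stalk_of Q Y"
    using stalk_of_exists idem_sum idem1 idem2 by meson
  obtain t t' u u' v v' where "inverse_maps B (idem (tot Z)) t t'" and
    u: "inverse_maps P (idem (tot X)) u u'" and v: "inverse_maps Q (idem (tot Y)) v v'"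
    using Z X Y unfolding stalk_of_def by blast
  then have "ring_biproduct (idem (tot Z)) P Q (t * i1) (t * i2) (p1 * t') (p2 * t')" by (intro transport)
  from ring_biproduct.precompose_left[OF this inverse_maps.swap[OF u]]
  have "ring_biproduct (idem (tot Z)) (idem (tot X)) Q (t * i1 * u') (t * i2) (u * (p1 * t')) (p2 * t')" .
  from ring_biproduct.precompose_left[OF ring_biproduct.swap[OF this] inverse_maps.swap[OF v]]
  have "ring_biproduct (idem (tot Z)) (idem (tot Y)) (idem (tot X)) (t * i2 * v') (t * i1 * u')
    (v * (p2 * t')) (u * (p1 * t'))" .
  then have "K.summands Z = K.summands Y + K.summands X"
    using Z X Y unfolding stalk_of_def by (intro stalk_biprod[of _ 0]) blast+
  then show ?thesis
    by (simp add: proj_summands_eq[OF Z] proj_summands_eq[OF X] proj_summands_eq[OF Y] add.commute)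
qed

lemma proj_summands_zero: "proj_summands 0 = {#}"
proof -
  have "ring_biproduct 0 0 0 0 0 0 (0 :: 'a gmat)" by unfold_locales (simp_all add: corner_zero)
  from proj_summands_biproduct[OF this] show ?thesis by simp
qed

lemma proj_summands_diag_subset:
  "finite S \<Longrightarrow> set_mset (proj_summands (diag S)) \<subseteq> set_mset (K.summands alg_cplx)"
proof (induction S rule: finite_induct)
  case empty
  show ?case by (simp add: diag_def proj_summands_zero)
next
  case (insert u S)
  have "inverse_maps (diag {u}) (idem (tot alg_cplx)) (single (Ix 0 0) u 1) (single u (Ix 0 0) 1 :: 'a gmat)"
    by unfold_locales (simp_all add: corner_def diag_def tot_alg single_mult_single)
  moreover have "in_block 0 0 (idem (tot (alg_cplx :: 'a cplx)))"
    by (auto simp: in_block_def tot_alg single.rep_eq split: if_splits)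
  ultimately have "stalk_of (diag {u}) (alg_cplx :: 'a cplx)"
    unfolding stalk_of_def using is_complex_alg by (auto simp: tot_alg)
  then have "proj_summands (diag {u}) = K.summands alg_cplx" by (rule proj_summands_eq)
  moreover have "ring_biproduct (diag (insert u S)) (diag {u}) (diag S) (diag {u}) (diag S) (diag {u})
    (diag S :: 'a gmat)"
  proof -
    have support: "support (diag {u} :: 'a gmat) \<subseteq> insert u S" using support_diag[of "{u}"] by auto
    have "diag (insert u S) - diag {u} = (diag S :: 'a gmat)"
      using insert.hyps by (simp add: diag_def)
    then show ?thesis
      using ring_biproduct_complement[of "diag (insert u S)" "diag {u} :: 'a gmat"] insert.hyps(1) support
      by (simp add: diag_idem cornerI diag_mult mult_diag)
  qed
  ultimately show ?case using insert.IH proj_summands_biproduct by auto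
qed

proposition proj_summands_subset:
  assumes P: "P * P = P" shows "set_mset (proj_summands P) \<subseteq> set_mset (K.summands alg_cplx)"
proof -
  let ?E = "diag (support P) :: 'a gmat"
  have "?E * ?E = ?E" "P \<in> corner ?E ?E"
    by (simp_all add: diag_idem finite_support_entry cornerI diag_mult mult_diag)
  from proj_summands_biproduct[OF ring_biproduct_complement[OF this P]]
  have "set_mset (proj_summands P) \<subseteq> set_mset (proj_summands ?E)" by simp
  then show ?thesis using proj_summands_diag_subset[OF finite_support_entry] by blast
qed

subsection \<open>Terms\<close>

definition terms :: "int \<Rightarrow> 'a cplx \<Rightarrow> 'a cplx set multiset" where
  "terms t X = proj_summands (degree_part t (idem (tot X)))"

lemma terms_subset:
  assumes "is_complex X" shows "set_mset (terms t X) \<subseteq> set_mset (K.summands alg_cplx)"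
proof -
  interpret graded_complex "tot X" by (rule graded_complex_tot[OF assms])
  show ?thesis
    unfolding terms_def by (intro proj_summands_subset degree_part_corner homogeneous_idem idem_idem)
qed

lemma terms_dsum:
  assumes "is_complex X" "is_complex Y" shows "terms t (X \<oplus>\<^sub>K Y) = terms t X + terms t Y"
proof -
  obtain i1 i2 p1 p2 where "extension (tot (X \<oplus>\<^sub>K Y)) (tot X) (tot Y) 0 i1 i2 p1 p2"
    using dsum_extension(2)[OF assms] by blast
  then interpret extension "tot (X \<oplus>\<^sub>K Y)" "tot X" "tot Y" 0 i1 i2 p1 p2 .
  let ?P = "degree_part t (idem (tot X))" and ?Q = "degree_part t (idem (tot Y))"
  have "i1 * ?P * p1 + i2 * ?Q * p2 = degree_part t (i1 * p1 + i2 * p2)"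
    by (simp add: mult_degree_part homogeneous_incl degree_part_add mult.assoc biprod_simps flip:
      degree_part_mult)
  then have "i1 * ?P * p1 + i2 * ?Q * p2 = degree_part t (idem (tot (X \<oplus>\<^sub>K Y)))" by (simp only: incl_proj_sum)
  moreover note X_part = degree_part_corner[OF X.homogeneous_idem X.idem_idem, of t]
    and Y_part = degree_part_corner[OF Y.homogeneous_idem Y.idem_idem, of t]
  ultimately have "ring_biproduct (degree_part t (idem (tot (X \<oplus>\<^sub>K Y)))) ?P ?Q (i1 * ?P) (i2 * ?Q)
    (?P * p1) (?Q * p2)"
    using restrict[OF X_part(1,2) Y_part(1,2)] by simp
  then show ?thesis unfolding terms_def by (rule proj_summands_biproduct)
qed

lemma terms_zero: "terms t zero_cplx = {#}"
proof -
  have "degree_part t (0 :: 'a gmat) = 0" by (rule fmat_eqI) (simp add: degree_part.rep_eq)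
  then show ?thesis by (simp add: terms_def idem_tot_zero proj_summands_zero)
qed

end

section \<open>Thick subcategories\<close>

lemma thick_complex: "X \<in> thick S \<Longrightarrow> is_complex X"
proof (induction rule: thick.induct)
  case (iso X Y)
  then show ?case unfolding htpy_equiv_def by blast
qed (auto intro: is_complex_zero is_complex_shift is_complex_cone)

lemma thick_htpy_iso: "X \<in> thick S \<Longrightarrow> is_complex Y \<Longrightarrow> htpy_iso (tot X) (tot Y) \<Longrightarrow> Y \<in> thick S"
  using thick.iso[of X S Y] thick_complex[of X S] htpy_equiv_iff by blast

lemma thick_extension:
  assumes X: "X \<in> thick S" and Y: "Y \<in> thick S" and B: "is_complex B"
    and ext: "extension (tot B) (tot X) (tot Y) F i1 i2 p1 p2"
  shows "B \<in> thick S"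
proof -
  interpret extension "tot B" "tot X" "tot Y" F i1 i2 p1 p2 by fact
  note complexes = thick_complex[OF X] thick_complex[OF Y]
  obtain C j1 j2 q1 q2 where C: "chain_map X (shift 1 Y) C" "is_complex (ext_cplx X Y C)"
    "extension (tot (ext_cplx X Y C)) (tot X) (tot Y) F j1 j2 q1 q2"
    by (rule extension_exists[OF complexes cocycle])
  obtain f where "chain_map (shift (- 1) X) Y f" "ext_cplx X Y C = cone (shift (- 1) X) Y f"
    by (rule ext_cplx_eq_cone[OF complexes C(1)])
  then have "ext_cplx X Y C \<in> thick S" using thick.cne[OF thick.shft[OF X] Y] by simp
  then show ?thesis by (rule thick_htpy_iso[OF _ B extension.unique_up_to_htpy_iso[OF C(3) ext]])
qed

lemma thick_kernel:
  assumes B: "B \<in> thick S" and X: "X \<in> thick S" and Y: "is_complex Y"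
    and "extension (tot B) (tot X) (tot Y) F i1 i2 p1 p2"
  shows "Y \<in> thick S"
proof -
  interpret extension "tot B" "tot X" "tot Y" F i1 i2 p1 p2 by fact
  let ?X = "shift (- 1) X"
  note complexes = thick_complex[OF B] is_complex_shift[OF thick_complex[OF X], of "- 1"]
  obtain s t where st: "s \<in> cocycles (- (- 1)) (tot X) (tot ?X)" "t \<in> cocycles (- 1) (tot ?X) (tot X)"
    "t * s = idem (tot X)" "s * t = idem (tot ?X)"
    by (rule shift_inverse_cocycles[OF thick_complex[OF X], of "- 1"])
  have s: "s \<in> cocycles 1 (tot X) (tot ?X)" using st(1) by simp
  have "s * p1 \<in> cocycles 1 (tot B) (tot ?X)" using cocycles_mult[OF s proj1_cocycle] by simp
  then obtain C j1 j2 q1 q2 where V: "is_complex (ext_cplx B ?X C)"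
    "extension (tot (ext_cplx B ?X C)) (tot B) (tot ?X) (s * p1) j1 j2 q1 q2"
    by (rule extension_exists[OF complexes])
  interpret shifted_cone "tot B" "tot X" "tot Y" F i1 i2 p1 p2 "tot (ext_cplx B ?X C)" "tot ?X"
    s j1 j2 q1 q2 t
    by (intro shifted_cone.intro shifted_cone_axioms.intro extension_axioms V(2) s st(2-4))
  have "htpy_iso (tot (ext_cplx B ?X C)) (tot Y)" using kernel_htpy_iso unfolding htpy_iso_def by blast
  then show ?thesis by (rule thick_htpy_iso[OF thick_extension[OF B thick.shft[OF X] V] Y])
qed

context fd_algebra_over
begin

lemma thick_iso: "X \<in> thick S \<Longrightarrow> K.iso X Y \<Longrightarrow> Y \<in> thick S"
  by (rule thick.iso) (simp_all add: htpy_equiv_iff_iso)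

lemma thick_list_sum: "(\<forall>X\<in>set Xs. X \<in> thick S) \<Longrightarrow> K.list_sum Xs \<in> thick S"
proof (induction Xs)
  case (Cons X Xs)
  then have XY: "X \<in> thick S" "K.list_sum Xs \<in> thick S" by auto
  have "X \<oplus>\<^sub>K K.list_sum Xs \<in> thick S"
    using dsum_extension[OF XY[THEN thick_complex]] thick_extension[OF XY] by blast
  then show ?case by simp
qed (simp add: thick.zero)

lemma thick_summands:
  assumes B: "B \<in> thick S" and X: "is_complex X" "set_mset (K.summands X) \<subseteq> set_mset (K.summands B)"
  shows "X \<in> thick S"
proof -
  obtain Xs where Xs: "\<forall>Y\<in>set Xs. K.indec Y" "K.iso X (K.list_sum Xs)"
    "K.summands X = mset (map K.iso_class_of Xs)"
    by (rule K.decompositionE[OF X(1)])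
  have "Y \<in> thick S" if Y: "Y \<in> set Xs" for Y
  proof -
    have indec: "K.indec Y" and "K.iso_class_of Y \<in># K.summands B" using Y Xs X(2) by auto
    then obtain Z where Z: "is_complex Z" "K.iso B (Y \<oplus>\<^sub>K Z)"
      using K.iso_class_of_in_summands_iff[OF thick_complex[OF B] indec] by blast
    show ?thesis by (rule thick.summand[OF thick_iso[OF B Z(2)] K.indec_ob[OF indec] Z(1)])
  qed
  then show ?thesis using thick_iso[OF thick_list_sum K.iso_sym[OF Xs(2)]] by blast
qed

lemma thick_stalk:
  assumes A: "(alg_cplx :: 'a cplx) \<in> thick S"
    and X: "is_complex X" "dif (tot X) = 0" "in_block t t (idem (tot X))"
  shows "X \<in> thick S"
proof -
  let ?X = "shift t X"
  have X': "is_complex ?X" by (rule is_complex_shift[OF X(1)])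
  interpret X': graded_complex "tot ?X" by (rule graded_complex_tot[OF X'])
  obtain u v where uv: "u \<in> cocycles (- t) (tot X) (tot ?X)" "v \<in> cocycles t (tot ?X) (tot X)"
    "v * u = idem (tot X)" "u * v = idem (tot ?X)"
    by (rule shift_inverse_cocycles[OF X(1)])
  have "koszul (- t) (dif (tot ?X) * u) = 0" using cocycles_dif[OF uv(1)] X(2) by simp
  then have "dif (tot ?X) * u = 0" by (simp add: koszul_def split: if_splits)
  then have "dif (tot ?X) * (u * v) = 0" by (simp flip: mult.assoc)
  then have "dif (tot ?X) = 0" by (simp add: uv(4) X'.dif_idem)
  moreover have "in_block 0 0 (u * (idem (tot X) * v))"
    using in_block_homogeneous_left[OF homs_homogeneous[OF cocycles_homs[OF uv(1)]]
        in_block_homogeneous_right[OF X(3) homs_homogeneous[OF cocycles_homs[OF uv(2)]]]] by simp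
  then have "in_block 0 0 (idem (tot ?X))" using cocycles_corner[OF uv(2)] uv(4) by (simp add: corner_left)
  ultimately have "stalk_of (idem (tot ?X)) ?X" by (intro stalk_of_self X')
  then have "set_mset (K.summands ?X) \<subseteq> set_mset (K.summands alg_cplx)"
    using proj_summands_subset[OF X'.idem_idem] by (simp add: proj_summands_eq)
  then have "?X \<in> thick S" by (rule thick_summands[OF A X'])
  from thick.shft[OF this, of "- t"] show ?thesis by (simp add: shift_shift)
qed

lemma thick_of_bounded_degrees:
  assumes A: "(alg_cplx :: 'a cplx) \<in> thick S"
  shows "is_complex X \<Longrightarrow> degrees (idem (tot X)) \<subseteq> {b..<b + int k} \<Longrightarrow> X \<in> thick S"
proof (induction k arbitrary: X)
  case 0
  then have "idem (tot X) = 0" using degrees_zero_iff by fastforce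
  then have "K.iso X zero_cplx" by (simp add: K.iso_zero_iff[OF 0(1)])
  then show ?case by (rule thick_iso[OF thick.zero K.iso_sym])
next
  case (Suc k)
  interpret graded_complex "tot X" by (rule graded_complex_tot[OF Suc.prems(1)])
  let ?e = "idem (tot X)" and ?d = "dif (tot X)"
  define g where "g = degree_part (b + int k) ?e"
  note g = degree_part_corner[OF homogeneous_idem idem_idem, of "b + int k", folded g_def]
  have top: "?d * g = 0"
  proof (rule fmat_eqI, rule ccontr)
    fix u v assume "entry (?d * g) u v \<noteq> entry 0 u v"
    then have nz: "entry (?d * g) u v \<noteq> 0" by simp
    have "?d * g \<in> corner g ?e" by (simp add: corner_def g(2) mult.assoc complex_simps)
    then have "u \<in> support ?e" using nz by (rule corner_entry)
    then have "degree u \<in> degrees ?e" by (simp add: degrees_def)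
    moreover have "degree u = b + int k + 1"
      using in_block_homogeneous_left[OF homogeneous_dif g(3)] nz unfolding in_block_def by blast
    ultimately show False using Suc.prems(2) by auto
  qed
  have ext: "extension (tot X) (?e - g, (?e - g) * ?d) (g, ?d * g) (g * ?d * (?e - g)) (?e - g) g (?e - g) g"
    using in_block_homogeneous[OF g(3)] by (intro subcomplex_extension g) (simp_all add: top mult.assoc)
  interpret ext: extension "tot X" "(?e - g, (?e - g) * ?d)" "(g, ?d * g)" "g * ?d * (?e - g)"
    "?e - g" g "?e - g" g
    by (rule ext)
  obtain Y where Y: "is_complex Y" "tot Y = (?e - g, (?e - g) * ?d)"
    by (rule complex_realization[OF ext.X.graded_complex_axioms])
  obtain Z where Z: "is_complex Z" "tot Z = (g, ?d * g)"
    by (rule complex_realization[OF ext.Y.graded_complex_axioms])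
  have "degrees (?e - g) \<subseteq> {b..<b + int k}"
    using Suc.prems(2) degrees_degree_part(2)[OF homogeneous_idem] unfolding g_def by fastforce
  then have "Y \<in> thick S" using Y by (intro Suc.IH) simp_all
  moreover have "in_block (b + int k) (b + int k) (idem (tot Z))" using g(3) by (simp add: Z(2))
  then have "Z \<in> thick S" by (rule thick_stalk[OF A Z(1), rotated]) (simp add: Z(2) top)
  ultimately show ?case using thick_extension[OF _ _ Suc.prems(1)] ext Y(2) Z(2) by metis
qed

theorem thick_alg_cplx:
  assumes "(alg_cplx :: 'a cplx) \<in> thick S" "is_complex X" shows "X \<in> thick S"
proof -
  obtain N :: nat where N: "\<forall>u\<in>support (idem (tot X)). \<bar>degree u\<bar> \<le> int N \<and> position u < N"
    using finite_index_bound[OF finite_support_entry] by blast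
  then have "degrees (idem (tot X)) \<subseteq> {- int N..<- int N + int (2 * N + 1)}"
    unfolding degrees_def by fastforce
  with assms show ?thesis by (rule thick_of_bounded_degrees)
qed

end

section \<open>Extensions of two-term complexes\<close>

lemma no_positive_extD:
  "no_positive_ext X Y \<Longrightarrow> l > 0 \<Longrightarrow> F \<in> cocycles (int l) X Y \<Longrightarrow> F \<in> coboundaries (int l) X Y"
  unfolding no_positive_ext_def by blast

lemma no_positive_extI:
  "(\<And>l F. l > 0 \<Longrightarrow> F \<in> cocycles (int l) X Y \<Longrightarrow> F \<in> coboundaries (int l) X Y) \<Longrightarrow> no_positive_ext X Y"
  unfolding no_positive_ext_def by blast

context fd_algebra_over
begin

lemma no_positive_ext_retract:
  assumes X: "K.retract X' X i p" and Y: "K.retract Y' Y j q" and ext: "no_positive_ext (tot X) (tot Y)"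
  shows "no_positive_ext (tot X') (tot Y')"
proof (rule no_positive_extI)
  fix l :: nat and F assume l: "l > 0" and F: "F \<in> cocycles (int l) (tot X') (tot Y')"
  note X = K.retractD[OF X] and Y = K.retractD[OF Y]
  let ?N = "coboundaries (int l) (tot X') (tot Y')"
  have "j * F * p \<in> cocycles (int l) (tot X) (tot Y)"
    using cocycles_mult[OF cocycles_mult[OF Y(3) F] X(4)] by simp
  then have "j * F * p \<in> coboundaries (int l) (tot X) (tot Y)" by (rule no_positive_extD[OF ext l])
  then have "q * (j * F * p) * i \<in> ?N"
    using coboundaries_mult_right[OF coboundaries_mult_left[OF Y(4)] X(3)] by simp
  moreover have "(q * j - idem (tot Y')) * (F * (p * i)) \<in> ?N"
    using coboundaries_mult_right[OF Y(5) cocycles_mult[OF F cocycles_mult[OF X(4,3)]]] by simp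
  moreover have "F * (p * i - idem (tot X')) \<in> ?N" using coboundaries_mult_left[OF F X(5)] by simp
  moreover have "F = q * (j * F * p) * i - (q * j - idem (tot Y')) * (F * (p * i)) - F
    * (p * i - idem (tot X'))"
    using corner_left_assoc[OF cocycles_corner[OF F]] corner_right[OF cocycles_corner[OF F]]
    by (simp add: left_diff_distrib right_diff_distrib mult.assoc)
  ultimately show "F \<in> ?N" using coboundaries_diff by metis
qed

lemma no_positive_ext_iso:
  "K.iso X X' \<Longrightarrow> K.iso Y Y' \<Longrightarrow> no_positive_ext (tot X) (tot Y) \<longleftrightarrow> no_positive_ext (tot X') (tot Y')"
  unfolding K.iso_def using no_positive_ext_retract by blast

lemma no_positive_ext_biprod_from:
  assumes BXY: "K.biprod B X Y i1 i2 p1 p2" and Z: "is_complex Z"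
  shows "no_positive_ext (tot B) (tot Z) \<longleftrightarrow> no_positive_ext (tot X) (tot Z) \<and> no_positive_ext (tot Y) (tot Z)"
proof
  note B = K.biprodD[OF BXY]
  assume ext: "no_positive_ext (tot X) (tot Z) \<and> no_positive_ext (tot Y) (tot Z)"
  show "no_positive_ext (tot B) (tot Z)"
  proof (rule no_positive_extI)
    fix l :: nat and F assume l: "l > 0" and F: "F \<in> cocycles (int l) (tot B) (tot Z)"
    have parts: "F * i1 \<in> coboundaries (int l) (tot X) (tot Z)" "F * i2 \<in> coboundaries (int l) (tot Y) (tot Z)"
      using cocycles_mult[OF F B(4)] cocycles_mult[OF F B(5)]
      by (simp_all add: no_positive_extD[OF conjunct1[OF ext] l] no_positive_extD[OF conjunct2[OF ext] l])
    have "F * i1 * p1 + F * i2 * p2 - F * (i1 * p1 + i2 * p2 - idem (tot B))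
        \<in> coboundaries (int l) (tot B) (tot Z)"
      using coboundaries_mult_right[OF parts(1) B(6)] coboundaries_mult_right[OF parts(2) B(7)]
        coboundaries_mult_left[OF F B(12)] by (intro coboundaries_diff coboundaries_add) simp_all
    then show "F \<in> coboundaries (int l) (tot B) (tot Z)"
      using corner_right[OF cocycles_corner[OF F]] by (simp add: algebra_simps)
  qed
qed (use no_positive_ext_retract[OF _ K.retract_refl[OF Z]] K.biprod_retract[OF BXY]
      K.biprod_retract[OF K.biprod_swap[OF BXY]] in blast)

lemma no_positive_ext_biprod_to:
  assumes BXY: "K.biprod B X Y i1 i2 p1 p2" and Z: "is_complex Z"
  shows "no_positive_ext (tot Z) (tot B) \<longleftrightarrow> no_positive_ext (tot Z) (tot X) \<and> no_positive_ext (tot Z) (tot Y)"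
proof
  note B = K.biprodD[OF BXY]
  assume ext: "no_positive_ext (tot Z) (tot X) \<and> no_positive_ext (tot Z) (tot Y)"
  show "no_positive_ext (tot Z) (tot B)"
  proof (rule no_positive_extI)
    fix l :: nat and F assume l: "l > 0" and F: "F \<in> cocycles (int l) (tot Z) (tot B)"
    have parts: "p1 * F \<in> coboundaries (int l) (tot Z) (tot X)" "p2 * F \<in> coboundaries (int l) (tot Z) (tot Y)"
      using cocycles_mult[OF B(6) F] cocycles_mult[OF B(7) F]
      by (simp_all add: no_positive_extD[OF conjunct1[OF ext] l] no_positive_extD[OF conjunct2[OF ext] l])
    have "i1 * (p1 * F) + i2 * (p2 * F) - (i1 * p1 + i2 * p2 - idem (tot B)) * F
        \<in> coboundaries (int l) (tot Z) (tot B)"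
      using coboundaries_mult_left[OF B(4) parts(1)] coboundaries_mult_left[OF B(5) parts(2)]
        coboundaries_mult_right[OF B(12) F] by (intro coboundaries_diff coboundaries_add) simp_all
    then show "F \<in> coboundaries (int l) (tot Z) (tot B)"
      using corner_left[OF cocycles_corner[OF F]] by (simp add: algebra_simps)
  qed
qed (use no_positive_ext_retract[OF K.retract_refl[OF Z]] K.biprod_retract[OF BXY]
      K.biprod_retract[OF K.biprod_swap[OF BXY]] in blast)

lemma no_positive_ext_zero:
  fixes Z :: "'a gcplx"
  shows "no_positive_ext (tot zero_cplx) Z" "no_positive_ext Z (tot zero_cplx)"
proof -
  have left: "F = 0" if "F \<in> cocycles l (tot zero_cplx) Z" for l and F :: "'a gmat"
    using corner_right[OF cocycles_corner[OF that]] by (simp add: idem_tot_zero)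
  have right: "F = 0" if "F \<in> cocycles l Z (tot zero_cplx)" for l and F :: "'a gmat"
    using corner_left[OF cocycles_corner[OF that]] by (simp add: idem_tot_zero)
  show "no_positive_ext (tot zero_cplx) Z" by (rule no_positive_extI) (drule left, simp)
  show "no_positive_ext Z (tot zero_cplx)" by (rule no_positive_extI) (drule right, simp)
qed

lemma no_positive_ext_list_sum:
  assumes Z: "is_complex Z"
  shows "\<forall>X\<in>set Xs. is_complex X \<Longrightarrow>
      no_positive_ext (tot (K.list_sum Xs)) (tot Z) \<longleftrightarrow> (\<forall>X\<in>set Xs. no_positive_ext (tot X) (tot Z))"
    and "\<forall>X\<in>set Xs. is_complex X \<Longrightarrow>
      no_positive_ext (tot Z) (tot (K.list_sum Xs)) \<longleftrightarrow> (\<forall>X\<in>set Xs. no_positive_ext (tot Z) (tot X))"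
proof (induction Xs)
  case (Cons X Xs)
  have biprod: "\<exists>i1 i2 p1 p2. K.biprod (K.list_sum (X # Xs)) X (K.list_sum Xs) i1 i2 p1 p2"
    if "\<forall>X\<in>set (X # Xs). is_complex X"
    using dsum_biprod[of X "K.list_sum Xs"] K.ob_list_sum[of Xs] that by simp
  {
    case 1
    then obtain i1 i2 p1 p2 where "K.biprod (K.list_sum (X # Xs)) X (K.list_sum Xs) i1 i2 p1 p2"
      using biprod by blast
    from no_positive_ext_biprod_from[OF this Z] show ?case using Cons.IH(1) 1 by simp
  next
    case 2
    then obtain i1 i2 p1 p2 where "K.biprod (K.list_sum (X # Xs)) X (K.list_sum Xs) i1 i2 p1 p2"
      using biprod by blast
    from no_positive_ext_biprod_to[OF this Z] show ?case using Cons.IH(2) 2 by simp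
  }
qed (simp_all add: no_positive_ext_zero)

definition compatible :: "'a cplx set \<Rightarrow> 'a cplx set \<Rightarrow> bool" where
  "compatible c d \<longleftrightarrow> (\<exists>X\<in>c. \<exists>Y\<in>d. no_positive_ext (tot X) (tot Y))"

lemma compatible_iso_class_of:
  assumes "is_complex X" "is_complex Y"
  shows "compatible (K.iso_class_of X) (K.iso_class_of Y) \<longleftrightarrow> no_positive_ext (tot X) (tot Y)"
  unfolding compatible_def K.iso_class_of_def using no_positive_ext_iso K.iso_refl assms by blast

lemma no_positive_ext_iff_summands:
  assumes X: "is_complex X" and Y: "is_complex Y"
  shows "no_positive_ext (tot X) (tot Y) \<longleftrightarrow> (\<forall>c\<in>#K.summands X. \<forall>d\<in>#K.summands Y. compatible c d)"
proof -
  obtain Xs where Xs: "\<forall>Y\<in>set Xs. K.indec Y" "K.iso X (K.list_sum Xs)"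
    "K.summands X = mset (map K.iso_class_of Xs)"
    by (rule K.decompositionE[OF X])
  obtain Ys where Ys: "\<forall>Y\<in>set Ys. K.indec Y" "K.iso Y (K.list_sum Ys)"
    "K.summands Y = mset (map K.iso_class_of Ys)"
    by (rule K.decompositionE[OF Y])
  have complexes: "\<forall>X\<in>set Xs. is_complex X" "\<forall>Y\<in>set Ys. is_complex Y" using Xs(1) Ys(1) K.indec_ob by blast+
  have "no_positive_ext (tot X) (tot Y) \<longleftrightarrow> no_positive_ext (tot (K.list_sum Xs)) (tot (K.list_sum Ys))"
    by (rule no_positive_ext_iso[OF Xs(2) Ys(2)])
  also have "\<dots> \<longleftrightarrow> (\<forall>X\<in>set Xs. no_positive_ext (tot X) (tot (K.list_sum Ys)))"
    by (rule no_positive_ext_list_sum(1)[OF K.ob_list_sum]) (use complexes in auto)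
  also have "\<dots> \<longleftrightarrow> (\<forall>X\<in>set Xs. \<forall>Y\<in>set Ys. compatible (K.iso_class_of X) (K.iso_class_of Y))"
    using complexes by (simp add: no_positive_ext_list_sum(2) compatible_iso_class_of)
  finally show ?thesis unfolding Xs(3) Ys(3) by simp
qed

subsection \<open>Two-term summands\<close>

definition two_term_class :: "'a cplx set \<Rightarrow> bool" where
  "two_term_class c \<longleftrightarrow> (\<exists>X\<in>c. two_term X)"

lemma two_term_class_retract:
  assumes T: "two_term T" and retract: "K.retract Y T i p" shows "two_term_class (K.iso_class_of Y)"
proof -
  note complex = two_term_complex[OF T]
  obtain Z W j1 j2 q1 q2 where TZW: "K.biprod T Z W j1 j2 q1 q2"
    "j1 * q1 - i * p \<in> coboundaries 0 (tot T) (tot T)"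
    "idem (tot Z) \<in> corner (idem (tot T)) (idem (tot T))"
    by (rule split_homotopy_idempotent[OF complex
      K.Hom_mult[OF K.retract_incl[OF retract] K.retract_proj[OF retract]]
          K.retract_idempotent[OF retract]])
  have "two_term Z"
    using T degrees_corner[OF TZW(3)] K.biprod_ob(2)[OF TZW(1)] unfolding two_term_iff by blast
  moreover have "K.iso Z Y"
    by (rule K.iso_sym[OF K.retract_unique[OF retract K.biprod_retract[OF TZW(1)] TZW(2)]])
  ultimately show ?thesis unfolding two_term_class_def K.iso_class_of_def by blast
qed

lemma two_term_class_iff_summands:
  assumes X: "is_complex X"
  shows "two_term_class (K.iso_class_of X) \<longleftrightarrow> (\<forall>c\<in>#K.summands X. two_term_class c)"
proof
  assume "two_term_class (K.iso_class_of X)"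
  then obtain T where T: "K.iso T X" "two_term T" unfolding two_term_class_def K.iso_class_of_def by blast
  show "\<forall>c\<in>#K.summands X. two_term_class c"
  proof
    fix c assume c: "c \<in># K.summands X"
    obtain Y where Y: "K.indec Y" "c = K.iso_class_of Y" by (rule K.summandsE[OF X c])
    have "c \<in># K.summands T" using c K.summands_iso[OF T(1)] by simp
    then obtain Z where "is_complex Z" "K.iso T (Y \<oplus>\<^sub>K Z)"
      using K.iso_class_of_in_summands_iff[OF two_term_complex[OF T(2)] Y(1)] Y(2) by blast
    then obtain i1 i2 p1 p2 where "K.biprod T Y Z i1 i2 p1 p2"
      using K.iso_sum_biprod K.indec_ob[OF Y(1)] by blast
    then show "two_term_class c" unfolding Y(2) by (rule two_term_class_retract[OF T(2) K.biprod_retract])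
  qed
next
  assume summands: "\<forall>c\<in>#K.summands X. two_term_class c"
  obtain Xs where Xs: "\<forall>Y\<in>set Xs. K.indec Y" "K.iso X (K.list_sum Xs)"
    "K.summands X = mset (map K.iso_class_of Xs)"
    by (rule K.decompositionE[OF X])
  have "\<exists>T. two_term T \<and> K.iso T (K.list_sum Ys)" if "\<forall>Y\<in>set Ys. two_term_class (K.iso_class_of Y)" for Ys
    using that
  proof (induction Ys)
    case Nil
    then show ?case using two_term_zero K.iso_refl[OF K.ob_zero] by (intro exI[of _ zero_cplx]) simp
  next
    case (Cons Y Ys)
    then obtain T T' where "two_term T" "K.iso T Y" "two_term T'" "K.iso T' (K.list_sum Ys)"
      unfolding two_term_class_def K.iso_class_of_def by auto
    then show ?case
      using two_term_dsum[of T T'] K.sum_cong[of T Y T' "K.list_sum Ys"] by (intro exI[of _ "T \<oplus>\<^sub>K T'"]) simp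
  qed
  from this[of Xs] obtain T where T: "two_term T" "K.iso T (K.list_sum Xs)" using summands Xs(3) by auto
  then show "two_term_class (K.iso_class_of X)"
    unfolding two_term_class_def K.iso_class_of_def using K.iso_trans[OF T(2) K.iso_sym[OF Xs(2)]] by blast
qed

end

section \<open>The Bongartz completion\<close>

definition ext1_zero :: "'a::ring gcplx \<Rightarrow> 'a gcplx \<Rightarrow> bool" where
  "ext1_zero X Y \<longleftrightarrow> (\<forall>F\<in>homs 1 X Y. \<exists>h\<in>homs 0 X Y. F = h * dif X - dif Y * h)"

lemma two_term_homs_zero:
  assumes X: "two_term X" and Y: "two_term Y" and f: "f \<in> homs k (tot X) (tot Y)" and k: "k \<ge> 2"
  shows "f = 0"
proof (rule homs_eq_zero[OF f])
  fix i assume "i \<in> degrees (idem (tot X))"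
  then have "i = -1 \<or> i = 0" using X unfolding two_term_iff by blast
  then have "i + k \<notin> {-1, 0}" using k by auto
  then show "i + k \<notin> degrees (idem (tot Y))" using Y unfolding two_term_iff by blast
qed

lemma two_term_cocycles_1:
  assumes X: "two_term X" and Y: "two_term Y" shows "cocycles 1 (tot X) (tot Y) = homs 1 (tot X) (tot Y)"
proof -
  interpret X: graded_complex "tot X" by (rule graded_complex_tot[OF two_term_complex[OF X]])
  interpret Y: graded_complex "tot Y" by (rule graded_complex_tot[OF two_term_complex[OF Y]])
  have "f \<in> cocycles 1 (tot X) (tot Y)" if f: "f \<in> homs 1 (tot X) (tot Y)" for f
  proof -
    have dif: "dif (tot X) \<in> homs 1 (tot X) (tot X)" "dif (tot Y) \<in> homs 1 (tot Y) (tot Y)"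
      by (auto intro!: homsI cornerI simp: X.complex_simps Y.complex_simps X.homogeneous_dif
        Y.homogeneous_dif)
    then have "dif (tot Y) * f \<in> homs 2 (tot X) (tot Y)" "f * dif (tot X) \<in> homs 2 (tot X) (tot Y)"
      using homs_mult[OF dif(2) f] homs_mult[OF f dif(1)] by simp_all
    then have "dif (tot Y) * f = 0" "f * dif (tot X) = 0" by (simp_all add: two_term_homs_zero[OF X Y])
    then show ?thesis using f by (intro cocyclesI) simp_all
  qed
  then show ?thesis using cocycles_homs by blast
qed

lemma two_term_no_positive_ext_iff:
  assumes X: "two_term X" and Y: "two_term Y"
  shows "no_positive_ext (tot X) (tot Y) \<longleftrightarrow> ext1_zero (tot X) (tot Y)"
proof -
  have "F \<in> coboundaries 1 (tot X) (tot Y) \<longleftrightarrow> (\<exists>h\<in>homs 0 (tot X) (tot Y). F = h * dif (tot X)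
    - dif (tot Y) * h)" for F
    unfolding coboundaries_def by auto
  then have degree_1: "cocycles 1 (tot X) (tot Y) \<subseteq> coboundaries 1 (tot X) (tot Y) \<longleftrightarrow> ext1_zero (tot X)
    (tot Y)"
    unfolding two_term_cocycles_1[OF X Y] ext1_zero_def by blast
  have higher: "cocycles (int l) (tot X) (tot Y) \<subseteq> coboundaries (int l) (tot X) (tot Y)" if "l \<ge> 2" for l
  proof
    fix F assume F: "F \<in> cocycles (int l) (tot X) (tot Y)"
    have "int l \<ge> 2" using that by linarith
    then have "F = 0" by (rule two_term_homs_zero[OF X Y cocycles_homs[OF F]])
    then show "F \<in> coboundaries (int l) (tot X) (tot Y)" by simp
  qed
  show ?thesis
  proof
    assume "no_positive_ext (tot X) (tot Y)"
    then show "ext1_zero (tot X) (tot Y)" using degree_1 no_positive_extD[of _ _ 1] by fastforce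
  next
    assume "ext1_zero (tot X) (tot Y)"
    then have "cocycles (int l) (tot X) (tot Y) \<subseteq> coboundaries (int l) (tot X) (tot Y)" if "l > 0" for l
      using that degree_1 higher[of l] by (cases "l = 1") auto
    then show "no_positive_ext (tot X) (tot Y)" unfolding no_positive_ext_def by blast
  qed
qed

lemma (in extension) ext1_zero_from_extension:
  assumes Y: "homs 1 Y Z = {0}" and X: "ext1_zero X Z" shows "ext1_zero B Z"
  unfolding ext1_zero_def
proof
  fix G assume G: "G \<in> homs 1 B Z"
  obtain h where h: "h \<in> homs 0 X Z" "G * i1 = h * dif X - dif Z * h"
    using X homs_mult[OF G incl_homs(1)] unfolding ext1_zero_def by auto
  have "G * i2 = 0" using homs_mult[OF G incl_homs(2)] Y by simp
  then have "G * i1 * p1 = G * (i1 * p1 + i2 * p2)" by (simp add: distrib_left flip: mult.assoc)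
  also have "\<dots> = G" using corner_right[OF homs_corner[OF G]] incl_proj_sum by simp
  finally have "G = h * (dif X * p1) - dif Z * (h * p1)" by (simp add: h(2) left_diff_distrib mult.assoc)
  then have "G = (h * p1) * dif B - dif Z * (h * p1)" by (simp add: mult.assoc flip: proj1_dif)
  moreover have "h * p1 \<in> homs 0 B Z" using homs_mult[OF h(1) proj_homs(1)] by simp
  ultimately show "\<exists>h\<in>homs 0 B Z. G = h * dif B - dif Z * h" by blast
qed

lemma (in extension) ext1_zero_to_universal_extension:
  assumes universal: "\<forall>G\<in>homs 1 T Y. \<exists>c\<in>cocycles 0 T X. G = F * c" and X: "ext1_zero T X"
  shows "ext1_zero T B"
  unfolding ext1_zero_def
proof
  fix G assume G: "G \<in> homs 1 T B"
  obtain h where h: "h \<in> homs 0 T X" "p1 * G = h * dif T - dif X * h"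
    using X homs_mult[OF proj_homs(1) G] unfolding ext1_zero_def by auto
  have "p2 * G + F * h \<in> homs 1 T Y"
    using homs_mult[OF proj_homs(2) G] homs_mult[OF cocycles_homs[OF cocycle] h(1)] by (simp add: homs_add)
  then obtain c where c: "c \<in> cocycles 0 T X" "p2 * G + F * h = F * c" using universal by blast
  define k where "k = i1 * h - i1 * c"
  have "k \<in> homs 0 T B"
    unfolding k_def using homs_mult[OF incl_homs(1) h(1)] homs_mult[OF incl_homs(1) cocycles_homs[OF c(1)]]
    by (simp add: homs_diff)
  moreover have "dif B * k = i1 * dif X * h - i1 * dif X * c + i2 * F * h - i2 * F * c"
    unfolding k_def right_diff_distrib mult.assoc[of _ i1, symmetric] dif_incl1 by (simp add: algebra_simps)
  then have "k * dif T - dif B * k = i1 * (h * dif T - dif X * h) + i2 * (F * c - F * h)"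
    unfolding k_def using chain_map_dif[OF c(1)] by (simp add: algebra_simps)
  moreover have "F * c - F * h = p2 * G" using c(2) by (simp add: algebra_simps)
  moreover have "i1 * (p1 * G) + i2 * (p2 * G) = G"
    using corner_left[OF homs_corner[OF G]] by (simp add: incl_proj_sum flip: distrib_right mult.assoc)
  ultimately have "k \<in> homs 0 T B" "G = k * dif T - dif B * k" by (simp_all add: h(2))
  then show "\<exists>h\<in>homs 0 T B. G = h * dif T - dif B * h" by blast
qed

context fd_algebra_over
begin

lemma universal_class_of_list:
  assumes T: "is_complex T"
  shows "set Gs \<subseteq> cocycles 1 (tot T) (tot A) \<Longrightarrow>
    \<exists>F\<in>cocycles 1 (tot (K.list_sum (replicate (length Gs) T))) (tot A).
      set Gs \<subseteq> (*) F ` cocycles 0 (tot T) (tot (K.list_sum (replicate (length Gs) T)))"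
proof (induction Gs)
  case Nil
  show ?case by (rule bexI[of _ 0]) simp_all
next
  case (Cons G Gs)
  let ?S = "K.list_sum (replicate (length Gs) T)"
  have S: "is_complex ?S" using T by (intro K.ob_list_sum) simp
  obtain F where F: "F \<in> cocycles 1 (tot ?S) (tot A)" "set Gs \<subseteq> (*) F ` cocycles 0 (tot T) (tot ?S)"
    using Cons by auto
  have G: "G \<in> cocycles 1 (tot T) (tot A)" using Cons.prems by simp
  obtain i1 i2 p1 p2 where "extension (tot (T \<oplus>\<^sub>K ?S)) (tot T) (tot ?S) 0 i1 i2 p1 p2"
    using dsum_extension(2)[OF T S] by blast
  then interpret extension "tot (T \<oplus>\<^sub>K ?S)" "tot T" "tot ?S" 0 i1 i2 p1 p2 .
  note i1 = split_cocycles(1)[OF refl] and p2 = split_cocycles(2)[OF refl]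
  let ?F = "G * p1 + F * p2"
  have "?F \<in> cocycles 1 (tot (T \<oplus>\<^sub>K ?S)) (tot A)"
    using cocycles_mult[OF G proj1_cocycle] cocycles_mult[OF F(1) p2] by (simp add: cocycles_add)
  moreover have "?F * i1 = G" "?F * (i2 * c) = F * c" for c
    using corner_right[OF cocycles_corner[OF G]] corner_right_assoc[OF cocycles_corner[OF F(1)]]
    by (simp_all add: distrib_right mult.assoc biprod_simps)
  then have "G \<in> (*) ?F ` cocycles 0 (tot T) (tot (T \<oplus>\<^sub>K ?S))"
    and "\<And>c. c \<in> cocycles 0 (tot T) (tot ?S) \<Longrightarrow> F * c \<in> (*) ?F ` cocycles 0 (tot T) (tot (T \<oplus>\<^sub>K ?S))"
    using i1 cocycles_mult[OF incl2_cocycle] by (metis image_eqI add_0)+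
  ultimately show ?case using F(2) by (intro bexI[of _ ?F]) auto
qed

lemma universal_class:
  assumes T: "is_complex T"
  obtains n F where "F \<in> cocycles 1 (tot (K.list_sum (replicate n T))) (tot A)"
    "\<forall>G\<in>cocycles 1 (tot T) (tot A). \<exists>c\<in>cocycles 0 (tot T) (tot (K.list_sum (replicate n T))). G = F * c"
proof -
  let ?V = "cocycles 1 (tot T) (tot A)"
  have "mat.finite_dim ?V"
    using cocycles_corner by (intro mat.finite_dim_subset[OF finite_dim_corner]) blast
  then obtain C where C: "C \<subseteq> ?V" "?V \<subseteq> mat.span C" "finite C" by (rule mat.finite_dim_basis)
  obtain Gs where Gs: "set Gs = C" using finite_list[OF C(3)] by blast
  let ?T = "K.list_sum (replicate (length Gs) T)"
  obtain F where F: "F \<in> cocycles 1 (tot ?T) (tot A)" "C \<subseteq> (*) F ` cocycles 0 (tot T) (tot ?T)"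
    using universal_class_of_list[OF T, of Gs] Gs C(1) by blast
  have "mat.span C \<subseteq> (*) F ` cocycles 0 (tot T) (tot ?T)"
    by (rule mat.span_minimal[OF F(2) mat.subspace_mult_image[OF subspace_cocycles]])
  then show thesis using C(2) by (intro that[OF F(1)]) blast
qed

lemma two_term_list_sum: "\<forall>X\<in>set Xs. two_term X \<Longrightarrow> two_term (K.list_sum Xs)"
  by (induction Xs) (auto simp: two_term_zero two_term_dsum)

lemma homs_1_alg:
  assumes "two_term Z" shows "homs 1 (tot alg_cplx) (tot Z) = {0}"
proof -
  have "f = 0" if "f \<in> homs 1 (tot alg_cplx) (tot Z)" for f
    by (rule homs_eq_zero[OF that]) (use degrees_alg assms in \<open>auto simp: two_term_iff\<close>)
  then show ?thesis by auto
qed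

lemma universal_extension_exists:
  assumes T: "two_term T" and A: "two_term A"
  obtains U n F i1 i2 p1 p2 where "two_term U"
    "extension (tot U) (tot (K.list_sum (replicate n T))) (tot A) F i1 i2 p1 p2"
    "\<forall>G\<in>homs 1 (tot T) (tot A). \<exists>c\<in>cocycles 0 (tot T) (tot (K.list_sum (replicate n T))). G = F * c"
proof -
  note complexes = two_term_complex[OF T] two_term_complex[OF A]
  obtain n F where F: "F \<in> cocycles 1 (tot (K.list_sum (replicate n T))) (tot A)"
    "\<forall>G\<in>cocycles 1 (tot T) (tot A). \<exists>c\<in>cocycles 0 (tot T) (tot (K.list_sum (replicate n T))). G = F * c"
    by (rule universal_class[OF complexes(1)])
  let ?T = "K.list_sum (replicate n T)"
  have T': "two_term ?T" using T by (intro two_term_list_sum) simp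
  obtain C i1 i2 p1 p2 where U: "is_complex (ext_cplx ?T A C)"
    "extension (tot (ext_cplx ?T A C)) (tot ?T) (tot A) F i1 i2 p1 p2"
    by (rule extension_exists[OF two_term_complex[OF T'] complexes(2) F(1)])
  show thesis
    using that[OF two_term_extension[OF T' A U] U(2)] F(2) unfolding two_term_cocycles_1[OF T A] by blast
qed

theorem bongartz_completion:
  assumes T: "two_term T" "presilting T"
  obtains U n F i1 i2 p1 p2 where "two_term U" "presilting (T \<oplus>\<^sub>K U)"
    "extension (tot U) (tot (K.list_sum (replicate n T))) (tot alg_cplx) F i1 i2 p1 p2"
proof -
  obtain U n F i1 i2 p1 p2 where U: "two_term U"
    "extension (tot U) (tot (K.list_sum (replicate n T))) (tot alg_cplx) F i1 i2 p1 p2"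
    and universal: "\<forall>G\<in>homs 1 (tot T) (tot alg_cplx).
      \<exists>c\<in>cocycles 0 (tot T) (tot (K.list_sum (replicate n T))). G = F * c"
    by (rule universal_extension_exists[OF T(1) two_term_alg])
  let ?T = "K.list_sum (replicate n T)"
  interpret extension "tot U" "tot ?T" "tot alg_cplx" F i1 i2 p1 p2 by (rule U(2))
  note complexes = two_term_complex[OF T(1)] two_term_complex[OF U(1)]
  have T': "two_term ?T" using T(1) by (intro two_term_list_sum) simp
  have copies: "no_positive_ext (tot T) (tot Z) \<Longrightarrow> no_positive_ext (tot ?T) (tot Z)"
    "no_positive_ext (tot Z) (tot T) \<Longrightarrow> no_positive_ext (tot Z) (tot ?T)" if "is_complex Z" for Z
    using no_positive_ext_list_sum[OF that, of "replicate n T"] complexes(1) by auto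
  have TT: "no_positive_ext (tot T) (tot T)" using T(2) unfolding presilting_iff by blast
  then have "ext1_zero (tot T) (tot ?T)"
    using copies(2)[OF complexes(1)] two_term_no_positive_ext_iff[OF T(1) T'] by blast
  from ext1_zero_to_universal_extension[OF universal this] have TU: "no_positive_ext (tot T) (tot U)"
    using two_term_no_positive_ext_iff[OF T(1) U(1)] by blast
  have from_U: "no_positive_ext (tot U) (tot Z)" if Z: "two_term Z" "no_positive_ext (tot T) (tot Z)" for Z
    using ext1_zero_from_extension[OF homs_1_alg[OF Z(1)]] copies(1)[OF two_term_complex[OF Z(1)] Z(2)]
      two_term_no_positive_ext_iff[OF T' Z(1)] two_term_no_positive_ext_iff[OF U(1) Z(1)] by blast
  obtain j1 j2 q1 q2 where sum_TU: "K.biprod (T \<oplus>\<^sub>K U) T U j1 j2 q1 q2"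
    using dsum_biprod[OF complexes] by blast
  have "presilting (T \<oplus>\<^sub>K U)"
    unfolding presilting_iff
    using TT TU from_U[OF T(1) TT] from_U[OF U(1) TU] K.biprod_ob[OF sum_TU]
      no_positive_ext_biprod_from[OF sum_TU]
      no_positive_ext_biprod_to[OF sum_TU] by blast
  then show thesis using that U by blast
qed

section \<open>Faces\<close>

text \<open>A basic presilting complex, that is, a simplex of \<open>\<Delta>(A)\<close>, is recorded by the set of
  isomorphism classes of its indecomposable summands.\<close>

definition face :: "'a cplx set set \<Rightarrow> bool" where
  "face C \<longleftrightarrow> finite C \<and> (\<forall>c\<in>C. (\<exists>Y. K.indec Y \<and> c = K.iso_class_of Y) \<and> two_term_class c \<and>
     (\<forall>d\<in>C. compatible c d))"

lemma face_subset: "face C \<Longrightarrow> D \<subseteq> C \<Longrightarrow> face D"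
  unfolding face_def by (meson finite_subset subsetD)

lemma two_term_presilting_face:
  assumes "two_term T" "presilting T" shows "face (set_mset (K.summands T))"
proof -
  have T: "is_complex T" by (rule two_term_complex[OF assms(1)])
  have "two_term_class (K.iso_class_of T)"
    unfolding two_term_class_def K.iso_class_of_def using assms(1) K.iso_refl[OF T] by blast
  then have "\<forall>c\<in>#K.summands T. two_term_class c" using two_term_class_iff_summands[OF T] by blast
  moreover have "\<forall>c\<in>#K.summands T. \<forall>d\<in>#K.summands T. compatible c d"
    using assms(2) no_positive_ext_iff_summands[OF T T] unfolding presilting_iff by blast
  moreover have "\<exists>Y. K.indec Y \<and> c = K.iso_class_of Y" if "c \<in># K.summands T" for c
    using K.summandsE[OF T that] by metis
  ultimately show ?thesis unfolding face_def by simp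
qed

lemma face_two_term_presilting:
  assumes M: "face (set_mset M)" obtains T where "two_term T" "presilting T" "K.summands T = M"
proof -
  obtain X where X: "is_complex X" "K.summands X = M"
    using K.summands_surj[of M] M unfolding face_def by blast
  have "two_term_class (K.iso_class_of X)"
    using two_term_class_iff_summands[OF X(1)] X(2) M unfolding face_def by blast
  then obtain T where T: "K.iso T X" "two_term T" unfolding two_term_class_def K.iso_class_of_def by blast
  have summands: "K.summands T = M" using K.summands_iso[OF T(1)] X(2) by simp
  have complex: "is_complex T" by (rule two_term_complex[OF T(2)])
  then have "presilting T"
    unfolding presilting_iff no_positive_ext_iff_summands[OF complex complex] summands
    using M unfolding face_def by blast
  then show thesis using that T(2) summands by blast
qed

lemma basic_of_support:
  assumes "two_term T" "presilting T"
  obtains S where "two_term S" "presilting S" "basic S" "set_mset (K.summands S) = set_mset (K.summands T)"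
proof -
  let ?M = "mset_set (set_mset (K.summands T))"
  have "face (set_mset ?M)" using two_term_presilting_face[OF assms] by simp
  then obtain S where S: "two_term S" "presilting S" "K.summands S = ?M" by (rule face_two_term_presilting)
  moreover have "basic S" unfolding basic_iff S(3) using two_term_complex[OF S(1)]
    by (simp add: count_mset_set')
  ultimately show thesis using that by simp
qed

lemma summands_replicate_subset:
  assumes "is_complex T" shows "set_mset (K.summands (K.list_sum (replicate n T))) \<subseteq> set_mset (K.summands T)"
proof (induction n)
  case (Suc n)
  have "is_complex (K.list_sum (replicate n T))" using assms by (intro K.ob_list_sum) simp
  then show ?case using Suc by (simp add: K.summands_sum[OF assms])
qed (simp add: K.summands_zero)

proposition presilting_in_silting:
  assumes "two_term T" "presilting T"
  obtains S where "two_term S" "silting S" "basic S" "set_mset (K.summands T) \<subseteq> set_mset (K.summands S)"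
proof -
  obtain U n F i1 i2 p1 p2 where U: "two_term U" "presilting (T \<oplus>\<^sub>K U)"
    "extension (tot U) (tot (K.list_sum (replicate n T))) (tot alg_cplx) F i1 i2 p1 p2"
    by (rule bongartz_completion[OF assms])
  let ?T = "K.list_sum (replicate n T)"
  note complexes = two_term_complex[OF assms(1)] two_term_complex[OF U(1)]
  obtain S where S: "two_term S" "presilting S" "basic S"
    "set_mset (K.summands S) = set_mset (K.summands (T \<oplus>\<^sub>K U))"
    by (rule basic_of_support[OF two_term_dsum[OF assms(1) U(1)] U(2)])
  then have support: "set_mset (K.summands S) = set_mset (K.summands T) \<union> set_mset (K.summands U)"
    by (simp add: K.summands_sum[OF complexes])
  have S_thick: "S \<in> thick {S}" using two_term_complex[OF S(1)] by (simp add: thick.base)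
  have "is_complex ?T" using complexes(1) by (intro K.ob_list_sum) simp
  then have "?T \<in> thick {S}"
    using summands_replicate_subset[OF complexes(1)] support by (intro thick_summands[OF S_thick]) blast+
  moreover have "U \<in> thick {S}" using support by (intro thick_summands[OF S_thick complexes(2)]) blast
  ultimately have "(alg_cplx :: 'a cplx) \<in> thick {S}" using thick_kernel[OF _ _ is_complex_alg U(3)] by blast
  then have "silting S" unfolding silting_def using S(2) thick_alg_cplx by blast
  then show thesis using that S(1,3) support by blast
qed

proposition finite_vertices:
  assumes "g_finite TYPE('a)" shows "finite {c. face {c}}"
proof -
  let ?silting = "{T :: 'a cplx. two_term T \<and> silting T \<and> basic T}"
  define support where "support c = set_mset (K.summands (SOME X. X \<in> c))" for c
  have support: "support (iso_class S) = set_mset (K.summands S)" if "is_complex S" for S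
  proof -
    have "S \<in> iso_class S" using K.iso_refl[OF that] by (simp add: iso_class_eq K.iso_class_of_def)
    then have "(SOME X. X \<in> iso_class S) \<in> iso_class S" by (rule someI[of "\<lambda>X. X \<in> iso_class S"])
    then have "K.iso (SOME X. X \<in> iso_class S) S" unfolding iso_class_eq K.iso_class_of_def by simp
    then show ?thesis unfolding support_def by (simp add: K.summands_iso)
  qed
  have "{c. face {c}} \<subseteq> \<Union> (support ` iso_class ` ?silting)"
  proof
    fix c assume c: "c \<in> {c. face {c}}"
    obtain T where T: "two_term T" "presilting T" "K.summands T = {#c#}"
      using face_two_term_presilting[of "{#c#}"] c by auto
    obtain S where S: "two_term S" "silting S" "basic S" "set_mset (K.summands T) \<subseteq> set_mset (K.summands S)"
      by (rule presilting_in_silting[OF T(1,2)])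
    have "c \<in> support (iso_class S)" using S(4) support[OF two_term_complex[OF S(1)]] T(3) by simp
    moreover have "iso_class S \<in> iso_class ` ?silting" using S(1-3) by (intro imageI) simp
    ultimately show "c \<in> \<Union> (support ` iso_class ` ?silting)" by (rule UN_I[rotated])
  qed
  moreover have "finite (\<Union> (support ` iso_class ` ?silting))"
    using assms unfolding g_finite_def by (intro finite_UN_I) (simp_all add: support_def)
  ultimately show ?thesis by (rule finite_subset)
qed

end

section \<open>Two-term complexes as maps of projectives\<close>

locale two_term_blocks =
  fixes P Q :: "'a::ring gmat"
  assumes block_P: "in_block (-1) (-1) P" and block_Q: "in_block 0 0 Q"
    and idem_P: "P * P = P" and idem_Q: "Q * Q = Q"
begin

lemma P_mult_Q: "P * Q = 0" and Q_mult_P: "Q * P = 0"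
  using in_block_mult_zero[OF block_P block_Q] in_block_mult_zero[OF block_Q block_P] by simp_all

lemma corner_cross_zero:
  "x \<in> corner Z Q \<Longrightarrow> P * x = 0" "x \<in> corner Z P \<Longrightarrow> Q * x = 0"
  "x \<in> corner P Z \<Longrightarrow> x * Q = 0" "x \<in> corner Q Z \<Longrightarrow> x * P = 0"
  using corner_orthogonal[OF corner_self[OF idem_P]] corner_orthogonal[OF corner_self[OF idem_Q]]
    corner_orthogonal[OF _ corner_self[OF idem_P]] corner_orthogonal[OF _ corner_self[OF idem_Q]]
    P_mult_Q Q_mult_P by blast+

lemma corner_sum:
  assumes "x \<in> corner Y Z" "Y = P \<or> Y = Q" "Z = P \<or> Z = Q" shows "x \<in> corner (P + Q) (P + Q)"
  using assms corner_cross_zero corner_left[OF assms(1)] corner_right[OF assms(1)]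
  by (auto simp: corner_def distrib_left distrib_right)

lemma corner_homs_1: "b \<in> corner P Q \<Longrightarrow> b \<in> homs 1 (P + Q, d) (P + Q, d')"
  and corner_homs_neg1: "c \<in> corner Q P \<Longrightarrow> c \<in> homs (-1) (P + Q, d) (P + Q, d')"
  using in_block_homogeneous[OF in_block_corner[OF block_P block_Q]]
    in_block_homogeneous[OF in_block_corner[OF block_Q block_P]]
  by (auto intro!: homsI corner_sum)

lemma corner_homs_0: "\<phi> \<in> corner Q Q \<Longrightarrow> \<rho> \<in> corner P P \<Longrightarrow> \<phi> + \<rho> \<in> homs 0 (P + Q, d) (P + Q, d')"
  using in_block_homogeneous[OF in_block_corner[OF block_P block_P]]
    in_block_homogeneous[OF in_block_corner[OF block_Q block_Q]]
  by (intro homs_add homsI) (simp_all add: corner_sum[of \<phi> Q Q] corner_sum[of \<rho> P P])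

lemma graded_complex_map:
  assumes d: "d \<in> corner P Q" shows "graded_complex (P + Q, d)"
proof
  show "homogeneous 0 (idem (P + Q, d))"
    using in_block_homogeneous[OF block_P] in_block_homogeneous[OF block_Q] by (simp add: homogeneous_add)
  show "homogeneous 1 (dif (P + Q, d))" using homs_homogeneous[OF corner_homs_1[OF d]] by simp
  show "dif (P + Q, d) * dif (P + Q, d) = 0" using corner_orthogonal[OF d d P_mult_Q] by simp
qed (use corner_cross_zero d in \<open>simp_all add: corner_left corner_right distrib_left distrib_right
      idem_P idem_Q P_mult_Q Q_mult_P\<close>)

lemma compress_corner: "P * x * P \<in> corner P P" "Q * x * Q \<in> corner Q Q" "P * x * Q \<in> corner Q P"
  by (auto intro!: cornerI simp: mult.assoc idem_P idem_Q) (simp_all add: idem_P idem_Q flip: mult.assoc)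

lemma homs_neg1_corner:
  assumes f: "f \<in> homs (-1) (P + Q, d) (P + Q, d')" shows "f \<in> corner Q P"
proof -
  have "P * f * P = 0" "Q * f * P = 0" "Q * f * Q = 0"
    using in_block_mult_homogeneous_zero[OF block_P block_P homs_homogeneous[OF f]]
      in_block_mult_homogeneous_zero[OF block_Q block_P homs_homogeneous[OF f]]
      in_block_mult_homogeneous_zero[OF block_Q block_Q homs_homogeneous[OF f]] by simp_all
  moreover have "(P + Q) * f * (P + Q) = f"
    by (simp only: corner_left[OF homs_corner[OF f], simplified]
      corner_right[OF homs_corner[OF f], simplified])
  ultimately have "P * f * Q = f" by (simp add: distrib_left distrib_right)
  then show ?thesis using compress_corner(3) by metis
qed

lemma compress_homs_0:
  assumes f: "f \<in> homs 0 (P + Q, d) (P + Q, d')"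
  shows "Q * f = Q * f * Q" "P * f = P * f * P" "f * Q = Q * f * Q"
proof -
  have "P * f * Q = 0" "Q * f * P = 0"
    using in_block_mult_homogeneous_zero[OF block_P block_Q homs_homogeneous[OF f]]
      in_block_mult_homogeneous_zero[OF block_Q block_P homs_homogeneous[OF f]] by simp_all
  moreover have "Q * f * (P + Q) = Q * f" "P * f * (P + Q) = P * f" "(P + Q) * f * Q = f * Q"
    using corner_left[OF homs_corner[OF f]] corner_right[OF homs_corner[OF f]] by (simp_all add: mult.assoc)
  ultimately show "Q * f = Q * f * Q" "P * f = P * f * P" "f * Q = Q * f * Q"
    by (simp_all add: distrib_left distrib_right)
qed

lemma compress_mult:
  assumes "f \<in> homs 0 (P + Q, d) (P + Q, d')"
  shows "Q * (g * f) * Q = (Q * g * Q) * (Q * f * Q)"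
proof -
  have "Q * (g * f) * Q = Q * g * (f * Q)" by (simp add: mult.assoc)
  also have "\<dots> = Q * g * (Q * (Q * f * Q))"
    using compress_homs_0(3)[OF assms] corner_left[OF compress_corner(2)[of f]] by simp
  finally show ?thesis by (simp add: mult.assoc)
qed

lemma chain_map_of_square:
  assumes d: "d \<in> corner P Q" "d' \<in> corner P Q" and \<phi>: "\<phi> \<in> corner Q Q" and \<rho>: "\<rho> \<in> corner P P"
    and square: "\<phi> * d = d' * \<rho>"
  shows "\<phi> + \<rho> \<in> cocycles 0 (P + Q, d) (P + Q, d')"
proof (rule chain_mapI[OF corner_homs_0[OF \<phi> \<rho>]])
  have "d' * \<phi> = 0" "\<rho> * d = 0" using corner_orthogonal[OF d(2) \<phi> P_mult_Q]
    corner_orthogonal[OF \<rho> d(1) P_mult_Q] .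
  then show "dif (P + Q, d') * (\<phi> + \<rho>) = (\<phi> + \<rho>) * dif (P + Q, d)" using square
    by (simp add: distrib_left distrib_right)
qed

lemma square_of_chain_map:
  assumes d: "d \<in> corner P Q" "d' \<in> corner P Q" and f: "f \<in> cocycles 0 (P + Q, d) (P + Q, d')"
  shows "Q * f * Q \<in> square_maps P Q d d'"
proof -
  note f_homs = cocycles_homs[OF f]
  have "Q * f * Q * d = Q * (f * d)" using corner_left[OF d(1)] by (simp add: mult.assoc)
  also have "f * d = d' * f" using chain_map_dif[OF f] by simp
  also have "Q * (d' * f) = d' * (P * f)"
    by (simp only: corner_left_assoc[OF d(2)] corner_right_assoc[OF d(2)])
  finally have "Q * f * Q * d = d' * (P * f * P)" using compress_homs_0(2)[OF f_homs] by simp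
  then show ?thesis unfolding square_maps_def using compress_corner by blast
qed

lemma jointly_generate_of_ext1_zero:
  assumes d: "d \<in> corner P Q" "d' \<in> corner P Q" and ext: "ext1_zero (P + Q, d) (P + Q, d')"
  shows "jointly_generate P Q d d'"
  unfolding jointly_generate_def
proof
  fix b assume "b \<in> corner P Q"
  then obtain h where h: "h \<in> homs 0 (P + Q, d) (P + Q, d')" "b = h * d - d' * h"
    using ext corner_homs_1 unfolding ext1_zero_def by fastforce
  have "h * d = (h * Q) * d" "d' * h = d' * (P * h)"
    using corner_left[OF d(1)] corner_right[OF d(2)] by (simp_all add: mult.assoc) (simp flip: mult.assoc)
  then have "b = (Q * h * Q) * d + d' * (- (P * h * P))"
    using h(2) compress_homs_0(2,3)[OF h(1)] by simp
  then show "\<exists>k\<in>corner P P. \<exists>k'\<in>corner Q Q. b = k' * d + d' * k"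
    using compress_corner corner_uminus by blast
qed

end

subsection \<open>Split surjections\<close>

context fd_algebra_over
begin

definition endos_through :: "'a cplx \<Rightarrow> 'a cplx \<Rightarrow> 'a gmat set" where
  "endos_through Y X = {F * G | F G W. is_complex W \<and> set_mset (K.summands W) \<subseteq> set_mset (K.summands Y) \<and>
     F \<in> cocycles 0 (tot W) (tot X) \<and> G \<in> cocycles 0 (tot X) (tot W)}"

lemma endos_throughI:
  "is_complex W \<Longrightarrow> set_mset (K.summands W) \<subseteq> set_mset (K.summands Y) \<Longrightarrow>
    F \<in> cocycles 0 (tot W) (tot X) \<Longrightarrow> G \<in> cocycles 0 (tot X) (tot W) \<Longrightarrow> F * G \<in> endos_through Y X"
  unfolding endos_through_def by blast

lemma endos_throughE:
  assumes "f \<in> endos_through Y X"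
  obtains F G W where "f = F * G" "is_complex W" "set_mset (K.summands W) \<subseteq> set_mset (K.summands Y)"
    "F \<in> cocycles 0 (tot W) (tot X)" "G \<in> cocycles 0 (tot X) (tot W)"
  using assms unfolding endos_through_def by blast

lemma endos_through_cocycles: "f \<in> endos_through Y X \<Longrightarrow> f \<in> cocycles 0 (tot X) (tot X)"
  by (erule endos_throughE) (simp add: K.Hom_mult)

lemma endos_through_add:
  assumes f: "f \<in> endos_through Y X" and f': "f' \<in> endos_through Y X" shows "f + f' \<in> endos_through Y X"
proof -
  obtain F G W where FG: "f = F * G" "is_complex W" "set_mset (K.summands W) \<subseteq> set_mset (K.summands Y)"
    "F \<in> cocycles 0 (tot W) (tot X)" "G \<in> cocycles 0 (tot X) (tot W)" using f by (rule endos_throughE)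
  obtain F' G' W' where FG': "f' = F' * G'" "is_complex W'"
    "set_mset (K.summands W') \<subseteq> set_mset (K.summands Y)"
    "F' \<in> cocycles 0 (tot W') (tot X)" "G' \<in> cocycles 0 (tot X) (tot W')" using f' by (rule endos_throughE)
  obtain i1 i2 p1 p2 where "extension (tot (W \<oplus>\<^sub>K W')) (tot W) (tot W') 0 i1 i2 p1 p2"
    using dsum_extension(2)[OF FG(2) FG'(2)] by blast
  then interpret extension "tot (W \<oplus>\<^sub>K W')" "tot W" "tot W'" 0 i1 i2 p1 p2 .
  note maps = incl2_cocycle proj1_cocycle split_cocycles[OF refl]
  have "(F * p1 + F' * p2) * (i1 * G + i2 * G') \<in> endos_through Y X"
  proof (rule endos_throughI)
    show "is_complex (W \<oplus>\<^sub>K W')" by (rule K.ob_sum[OF FG(2) FG'(2)])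
    show "set_mset (K.summands (W \<oplus>\<^sub>K W')) \<subseteq> set_mset (K.summands Y)"
      using FG(3) FG'(3) by (simp add: K.summands_sum[OF FG(2) FG'(2)])
    show "F * p1 + F' * p2 \<in> cocycles 0 (tot (W \<oplus>\<^sub>K W')) (tot X)"
      by (rule K.Hom_add[OF K.Hom_mult[OF FG(4) maps(2)] K.Hom_mult[OF FG'(4) maps(4)]])
    show "i1 * G + i2 * G' \<in> cocycles 0 (tot X) (tot (W \<oplus>\<^sub>K W'))"
      by (rule K.Hom_add[OF K.Hom_mult[OF maps(3) FG(5)] K.Hom_mult[OF maps(1) FG'(5)]])
  qed
  moreover have "(F * p1 + F' * p2) * (i1 * G + i2 * G') = F * G + F' * G'"
    using corner_left[OF cocycles_corner[OF FG(5)]] corner_left[OF cocycles_corner[OF FG'(5)]]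
    by (simp add: distrib_left distrib_right mult.assoc biprod_simps)
  ultimately show ?thesis by (simp add: FG(1) FG'(1))
qed

lemma subspace_endos_through: "mat.subspace (endos_through Y X)"
proof (rule mat.subspaceI)
  have "0 * 0 \<in> endos_through Y X" by (rule endos_throughI[OF K.ob_zero]) (simp_all add: K.summands_zero)
  then show "0 \<in> endos_through Y X" by simp
  fix c f assume "f \<in> endos_through Y X"
  then obtain F G W where "f = F * G" "is_complex W" "set_mset (K.summands W) \<subseteq> set_mset (K.summands Y)"
    "F \<in> cocycles 0 (tot W) (tot X)" "G \<in> cocycles 0 (tot X) (tot W)" by (rule endos_throughE)
  then have "scale_mat c F * G \<in> endos_through Y X"
    by (intro endos_throughI mat.subspace_scale[OF subspace_cocycles])
  then show "scale_mat c f \<in> endos_through Y X" using \<open>f = F * G\<close> by (simp add: mat.scale_mult_left)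
qed (rule endos_through_add)

end

locale two_term_map = fd_algebra_over scale + two_term_blocks P Q
  for scale :: "'k::field \<Rightarrow> 'a::ring_1 \<Rightarrow> 'a" and P Q :: "'a gmat" +
  fixes d :: "'a gmat" and X :: "'a cplx"
  assumes map: "d \<in> corner P Q" and complex: "is_complex X" and tot: "tot X = (P + Q, d)"
begin

lemma split_surjection_inverse_maps:
  assumes c: "c \<in> corner Q P" "d * c = Q" shows "inverse_maps (c * d) Q d c"
proof
  show "d \<in> corner (c * d) Q"
    using corner_left[OF map] c(2) by (intro cornerI) (simp_all flip: mult.assoc)
  show "c \<in> corner Q (c * d)"
    using corner_right[OF c(1)] c(2) by (intro cornerI) (simp_all add: mult.assoc)
qed (simp_all add: c(2))

lemma split_surjection_kernel:
  assumes c: "c \<in> corner Q P" "d * c = Q" and S: "is_complex S" "tot S = (P, 0)"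
    and V: "is_complex V" "tot V = (c * d, 0)"
  shows "K.summands S = K.summands X + K.summands V"
proof -
  let ?v = "c * d"
  define w where "w = P - ?v"
  interpret graded_complex "(P + Q, d)" by (rule graded_complex_map[OF map])
  have v: "?v \<in> corner P P" "?v * ?v = ?v" "d * ?v = d"
    using corner_mult[OF c(1) map] corner_right[OF c(1)] corner_left[OF map] c(2)
    by (simp_all add: mult.assoc) (metis mult.assoc)+
  have w: "w \<in> corner P P" unfolding w_def by (rule corner_diff[OF corner_self[OF idem_P] v(1)])
  have products: "w * w = w" "w * ?v = 0" "?v * w = 0" "d * w = 0" "w * d = 0"
    using v corner_left[OF v(1)] corner_right[OF v(1)] corner_right[OF map]
      corner_orthogonal[OF w map P_mult_Q] idem_P
    by (simp_all add: w_def left_diff_distrib right_diff_distrib)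
  have homogeneous: "homogeneous 0 w" "homogeneous 0 ?v"
    using in_block_homogeneous[OF in_block_corner[OF block_P block_P]] w v(1) by fastforce+
  have "K.biprod S X V w ?v w ?v"
    unfolding K.biprod_def
  proof (intro conjI)
    show "w \<in> cocycles 0 (tot X) (tot S)" "w \<in> cocycles 0 (tot S) (tot X)"
      unfolding tot S(2) using homogeneous(1) w products corner_cross_zero[of w]
      by (auto intro!: chain_mapI homsI cornerI simp: distrib_left distrib_right corner_left corner_right)
    show "?v \<in> cocycles 0 (tot V) (tot S)" "?v \<in> cocycles 0 (tot S) (tot V)"
      unfolding V(2) S(2) using homogeneous(2) v
      by (auto intro!: chain_mapI homsI cornerI simp: corner_left corner_right)
    have "- c \<in> homs (0 - 1) (P + Q, d) (P + Q, d)" using corner_homs_neg1[OF corner_uminus[OF c(1)]] by simp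
    from coboundariesI[OF this] show "w * w - idem (tot X) \<in> coboundaries 0 (tot X) (tot X)"
      unfolding tot products(1) by (simp add: w_def c(2) algebra_simps)
  qed (simp_all add: S V complex products v(2), simp add: w_def)
  then show ?thesis by (rule K.summands_biprod)
qed

end

locale two_term_map_pair = fd_algebra_over scale + two_term_blocks P Q +
  X: two_term_map scale P Q d X + Y: two_term_map scale P Q d' Y
  for scale :: "'k::field \<Rightarrow> 'a::ring_1 \<Rightarrow> 'a" and P Q d d' :: "'a gmat" and X Y :: "'a cplx"
begin

lemma square_span_endos_through:
  "mat.mult_span (square_maps P Q d' d) (square_maps P Q d d') \<subseteq> (\<lambda>x. Q * x * Q) ` endos_through Y X"
proof (rule mat.mult_span_minimal)
  interpret left: Vector_Spaces.linear scale_mat scale_mat "(*) Q" by (rule mat.linear_mult_left)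
  interpret right: Vector_Spaces.linear scale_mat scale_mat "\<lambda>x. x * Q" by (rule mat.linear_mult_right)
  have "(\<lambda>x. Q * x * Q) ` endos_through Y X = (\<lambda>x. x * Q) ` (*) Q ` endos_through Y X"
    by (simp add: image_image)
  then show "mat.subspace ((\<lambda>x. Q * x * Q) ` endos_through Y X)"
    by (simp only: right.subspace_image left.subspace_image subspace_endos_through)
next
  fix \<phi> \<psi> assume \<phi>: "\<phi> \<in> square_maps P Q d' d" and \<psi>: "\<psi> \<in> square_maps P Q d d'"
  obtain \<rho> where \<rho>: "\<rho> \<in> corner P P" "\<phi> * d' = d * \<rho>" using square_maps_lift[OF \<phi>] by blast
  obtain \<sigma> where \<sigma>: "\<sigma> \<in> corner P P" "\<psi> * d = d' * \<sigma>" using square_maps_lift[OF \<psi>] by blast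
  note corners = square_maps_corner[OF \<phi>] square_maps_corner[OF \<psi>]
  have "(\<phi> + \<rho>) * (\<psi> + \<sigma>) \<in> endos_through Y X"
    using chain_map_of_square[OF Y.map X.map corners(1) \<rho>] chain_map_of_square[OF X.map Y.map corners(2) \<sigma>]
    by (intro endos_throughI[OF Y.complex]) (simp_all add: X.tot Y.tot)
  moreover have "Q * (\<phi> + \<rho>) = \<phi>" "(\<psi> + \<sigma>) * Q = \<psi>"
    using corner_cross_zero(2)[OF \<rho>(1)] corner_cross_zero(3)[OF \<sigma>(1)] corner_left[OF corners(1)]
      corner_right[OF corners(2)]
    by (simp_all add: distrib_left distrib_right)
  then have "Q * ((\<phi> + \<rho>) * (\<psi> + \<sigma>)) * Q = \<phi> * \<psi>" by (metis mult.assoc)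
  ultimately show "\<phi> * \<psi> \<in> (\<lambda>x. Q * x * Q) ` endos_through Y X" by (metis image_eqI)
qed

lemma split_surjection:
  assumes gen: "jointly_generate P Q d d" "jointly_generate P Q d' d'"
    and disjoint: "set_mset (K.summands X) \<inter> set_mset (K.summands Y) = {}"
  shows "\<exists>c\<in>corner Q P. Q = d * c"
proof (rule mat.split_surjection_of_radical_loops[OF idem_P idem_Q X.map Y.map gen finite_dim_corner
  finite_dim_corner])
  let ?E = "P + Q"
  fix a assume "a \<in> mat.mult_span (square_maps P Q d' d) (square_maps P Q d d')"
  then obtain x where x: "x \<in> endos_through Y X" "a = Q * x * Q" using square_span_endos_through by blast
  note x_cocycle = endos_through_cocycles[OF x(1)]
  obtain F G W where FG: "x = F * G" "is_complex W" "set_mset (K.summands W) \<subseteq> set_mset (K.summands Y)"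
    "F \<in> cocycles 0 (tot W) (tot X)" "G \<in> cocycles 0 (tot X) (tot W)" using x(1) by (rule endos_throughE)
  have "set_mset (K.summands X) \<inter> set_mset (K.summands W) = {}" using disjoint FG(3) by blast
  from K.factoring_endo_quasi_invertible[OF X.complex FG(2) this FG(4,5)]
  obtain v where v: "v \<in> cocycles 0 (?E, d) (?E, d)" "v * (?E - x) - ?E \<in> coboundaries 0 (?E, d) (?E, d)"
    by (auto simp: FG(1) X.tot)
  from v(2) obtain c where c: "c \<in> homs (-1) (?E, d) (?E, d)" "v * (?E - x) - ?E = d * c + c * d"
    by (auto elim!: coboundariesE)
  have c_corner: "c \<in> corner Q P" by (rule homs_neg1_corner[OF c(1)])
  interpret graded_complex "(?E, d)" by (rule graded_complex_map[OF X.map])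
  have "?E - x \<in> homs 0 (?E, d) (?E, d)"
    using homs_diff[OF cocycles_homs[OF idem_cocycle] cocycles_homs[OF x_cocycle[unfolded X.tot]]] by simp
  from compress_mult[OF this] have "Q * (v * (?E - x)) * Q = (Q * v * Q) * (Q * (?E - x) * Q)" .
  moreover have "Q * ?E * Q = Q" by (simp add: distrib_left distrib_right idem_Q Q_mult_P)
  ultimately have "Q * (v * (?E - x) - ?E) * Q = (Q * v * Q) * (Q - a) - Q"
    by (simp add: x(2) left_diff_distrib right_diff_distrib)
  moreover have "Q * (d * c + c * d) * Q = d * c"
    using corner_left_assoc[OF X.map] corner_right[OF c_corner] corner_cross_zero(2)[OF c_corner]
    by (simp add: distrib_left distrib_right mult.assoc) (simp flip: mult.assoc)
  ultimately have "(Q * v * Q) * (Q - a) - Q = d * c" using c(2) by simp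
  then show "\<exists>v\<in>square_maps P Q d d. \<exists>c\<in>corner Q P. v * (Q - a) - Q = d * c"
    using square_of_chain_map[OF X.map X.map v(1)] c_corner by blast
qed

lemma summands_eq_of_split_surjections:
  assumes c: "c \<in> corner Q P" "d * c = Q" and c': "c' \<in> corner Q P" "d' * c' = Q"
  shows "K.summands X = K.summands Y"
proof -
  note X_inverse = X.split_surjection_inverse_maps[OF c]
    and Y_inverse = Y.split_surjection_inverse_maps[OF c']
  have blocks: "in_block (-1) (-1) (c * d)" "in_block (-1) (-1) (c' * d')"
    using in_block_corner[OF block_P block_P] corner_mult[OF c(1) X.map] corner_mult[OF c'(1) Y.map] by blast+
  have idempotents: "c * d * (c * d) = c * d" "c' * d' * (c' * d') = c' * d'"
    using corner_left[OF X.map] corner_left[OF Y.map] c(2) c'(2) by (metis mult.assoc)+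
  obtain S where S: "is_complex S" "tot S = (P, 0)" by (rule stalk_exists[OF block_P idem_P])
  obtain V where V: "is_complex V" "tot V = (c * d, 0)" by (rule stalk_exists[OF blocks(1) idempotents(1)])
  obtain W where W: "is_complex W" "tot W = (c' * d', 0)" by (rule stalk_exists[OF blocks(2) idempotents(2)])
  have "\<exists>u v. inverse_maps (c * d) (c' * d') u v"
    using inverse_maps.trans[OF X_inverse inverse_maps.swap[OF Y_inverse]] by blast
  then have "K.iso V W" using stalk_iso_iff[of V "-1" W] V W blocks by simp
  then show ?thesis
    using X.split_surjection_kernel[OF c S V] Y.split_surjection_kernel[OF c' S W] K.summands_iso by fastforce
qed

end

subsection \<open>Complexes with equal terms\<close>

text \<open>Adding the contractible complex \<open>R \<rightarrow> R\<close> to \<open>d : P \<rightarrow> Q\<close>.\<close>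

locale contractible_sum = two_term_blocks P Q + sum: two_term_blocks P' Q' +
  source: ring_biproduct P' P R k1 k2 r1 r2 + target: ring_biproduct Q' Q R i1 i2 p1 p2
  for P Q P' Q' R k1 k2 r1 r2 i1 i2 p1 p2 :: "'a::ring gmat" +
  fixes d :: "'a gmat"
  assumes map: "d \<in> corner P Q"
begin

definition sum_map :: "'a gmat" where
  "sum_map = i1 * d * r1 + i2 * r2"

lemma sum_map_corner: "sum_map \<in> corner P' Q'"
  unfolding sum_map_def
  by (intro corner_add corner_mult[OF target.incl2 source.proj2]
      corner_mult[OF corner_mult[OF target.incl1 map] source.proj1])

lemma cross_products:
  "p1 * k1 = 0" "r1 * i1 = 0" "i1 * r1 = 0" "k1 * p1 = 0" "k1 * d = 0" "d * p1 = 0"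
  "sum_map * i1 = 0" "r1 * sum_map = 0"
  using corner_orthogonal[OF target.proj1 source.incl1 sum.Q_mult_P]
    corner_orthogonal[OF source.proj1 target.incl1 sum.P_mult_Q]
    corner_orthogonal[OF target.incl1 source.proj1 Q_mult_P]
    corner_orthogonal[OF source.incl1 target.proj1 P_mult_Q]
    corner_orthogonal[OF source.incl1 map P_mult_Q] corner_orthogonal[OF map target.proj1 P_mult_Q]
    corner_orthogonal[OF sum_map_corner target.incl1 sum.P_mult_Q]
    corner_orthogonal[OF source.proj1 sum_map_corner sum.P_mult_Q]
  by simp_all

lemma sum_map_incl: "sum_map * k1 = i1 * d" and proj_sum_map: "p1 * sum_map = d * r1"
  by (simp_all add: sum_map_def distrib_left distrib_right mult.assoc source.biprod_simps
      target.biprod_simps corner_left_assoc[OF map] corner_right[OF map])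

lemma incl_chain_map: "i1 + k1 \<in> cocycles 0 (P + Q, d) (P' + Q', sum_map)"
proof (intro chain_mapI homsI)
  show "i1 + k1 \<in> corner (idem (P + Q, d)) (idem (P' + Q', sum_map))"
    using corner_cross_zero(4)[OF target.incl1] corner_cross_zero(3)[OF source.incl1]
      sum.corner_cross_zero(1)[OF target.incl1] sum.corner_cross_zero(2)[OF source.incl1]
    by (simp add: corner_def distrib_left distrib_right source.biprod_simps target.biprod_simps)
  show "homogeneous 0 (i1 + k1)"
    using in_block_homogeneous[OF in_block_corner[OF block_Q sum.block_Q target.incl1]]
      in_block_homogeneous[OF in_block_corner[OF block_P sum.block_P source.incl1]]
    by (simp add: homogeneous_add)
qed (simp add: distrib_left distrib_right cross_products sum_map_incl)

lemma proj_chain_map: "p1 + r1 \<in> cocycles 0 (P' + Q', sum_map) (P + Q, d)"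
proof (intro chain_mapI homsI)
  show "p1 + r1 \<in> corner (idem (P' + Q', sum_map)) (idem (P + Q, d))"
    using corner_cross_zero(1)[OF target.proj1] corner_cross_zero(2)[OF source.proj1]
      sum.corner_cross_zero(4)[OF target.proj1] sum.corner_cross_zero(3)[OF source.proj1]
    by (simp add: corner_def distrib_left distrib_right source.biprod_simps target.biprod_simps)
  show "homogeneous 0 (p1 + r1)"
    using in_block_homogeneous[OF in_block_corner[OF sum.block_Q block_Q target.proj1]]
      in_block_homogeneous[OF in_block_corner[OF sum.block_P block_P source.proj1]]
    by (simp add: homogeneous_add)
qed (simp add: distrib_left distrib_right cross_products proj_sum_map)

lemma sum_htpy_iso: "htpy_iso (P + Q, d) (P' + Q', sum_map)"
proof -
  let ?h = "- (k2 * p2)"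
  have "?h \<in> homs (0 - 1) (P' + Q', sum_map) (P' + Q', sum_map)"
    using sum.corner_homs_neg1[OF corner_uminus[OF corner_mult[OF source.incl2 target.proj2]]] by simp
  from coboundariesI[OF this]
  have "sum_map * ?h + ?h * sum_map \<in> coboundaries 0 (P' + Q', sum_map) (P' + Q', sum_map)" by simp
  moreover have "sum_map * ?h + ?h * sum_map = - (i2 * p2) - k2 * r2"
    by (simp add: sum_map_def distrib_left distrib_right mult.assoc source.biprod_simps target.biprod_simps)
  moreover have "(i1 + k1) * (p1 + r1) - (P' + Q') = - (i2 * p2) - k2 * r2"
    by (simp add: distrib_left distrib_right cross_products flip: source.incl_proj_sum target.incl_proj_sum)
  moreover have "(p1 + r1) * (i1 + k1) - (P + Q) = 0"
    by (simp add: distrib_left distrib_right cross_products source.proj1_incl1 target.proj1_incl1)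
  ultimately show ?thesis
    unfolding htpy_iso_def using incl_chain_map proj_chain_map
    by (intro bexI[of _ "i1 + k1"] bexI[of _ "p1 + r1"]) simp_all
qed

end

lemma two_term_tot:
  assumes X: "two_term X"
  defines "P \<equiv> degree_part (-1) (idem (tot X))" and "Q \<equiv> degree_part 0 (idem (tot X))"
  shows "two_term_blocks P Q" and "dif (tot X) \<in> corner P Q" and "tot X = (P + Q, dif (tot X))"
proof -
  interpret graded_complex "tot X" by (rule graded_complex_tot[OF two_term_complex[OF X]])
  note P = degree_part_corner[OF homogeneous_idem idem_idem, of "-1", folded P_def]
    and Q = degree_part_corner[OF homogeneous_idem idem_idem, of 0, folded Q_def]
  show "two_term_blocks P Q" using P(2,3) Q(2,3) by unfold_locales
  have sum: "idem (tot X) = P + Q"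
  proof (rule fmat_eqI)
    fix u v
    have "degree u = -1 \<or> degree u = 0" if "entry (idem (tot X)) u v \<noteq> 0"
      using X that unfolding two_term_iff degrees_def support_def by blast
    then show "entry (idem (tot X)) u v = entry (P + Q) u v"
      by (auto simp: P_def Q_def degree_part.rep_eq)
  qed
  then show "tot X = (P + Q, dif (tot X))" by (simp add: prod_eq_iff)
  let ?d = "dif (tot X)"
  have "P * ?d * P = 0" "P * ?d * Q = 0" "Q * ?d * Q = 0"
    using in_block_mult_homogeneous_zero[OF P(3) P(3) homogeneous_dif]
      in_block_mult_homogeneous_zero[OF P(3) Q(3) homogeneous_dif]
      in_block_mult_homogeneous_zero[OF Q(3) Q(3) homogeneous_dif] by simp_all
  moreover have "P * (?d * (P + Q)) = P * ?d" "(P + Q) * ?d * Q = ?d * Q"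
    using idem_dif dif_idem by (simp_all flip: sum)
  ultimately have "P * ?d = 0" "?d * Q = 0" by (simp_all add: distrib_left distrib_right mult.assoc)
  then show "?d \<in> corner P Q"
    using idem_dif dif_idem unfolding sum by (simp add: corner_def distrib_left distrib_right)
qed

lemma block_biproduct_exists:
  fixes P Q :: "'a::ring_1 gmat"
  assumes P: "in_block t t P" "P * P = P" and Q: "in_block t t Q" "Q * Q = Q"
  obtains B i1 i2 p1 p2 where "in_block t t B" "ring_biproduct B P Q i1 i2 p1 p2"
proof -
  obtain X where X: "is_complex X" "tot X = (P, 0)" by (rule stalk_exists[OF P])
  obtain Y where Y: "is_complex Y" "tot Y = (Q, 0)" by (rule stalk_exists[OF Q])
  obtain i1 i2 p1 p2 where "extension (tot (X \<oplus>\<^sub>K Y)) (tot X) (tot Y) 0 i1 i2 p1 p2"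
    using dsum_extension(2)[OF X(1) Y(1)] by blast
  then interpret extension "tot (X \<oplus>\<^sub>K Y)" "tot X" "tot Y" 0 i1 i2 p1 p2 .
  have "homogeneous 0 P" "homogeneous 0 Q" using P(1) Q(1) in_block_homogeneous by fastforce+
  then have "degrees (idem (tot (X \<oplus>\<^sub>K Y))) \<subseteq> {t}"
    using degrees_idem P(1) Q(1) by (auto simp: X(2) Y(2) in_block_iff_degrees)
  then have "in_block t t (idem (tot (X \<oplus>\<^sub>K Y)))" using homogeneous_idem by (simp add: in_block_iff_degrees)
  then show thesis using that ring_biproduct_axioms by (simp add: X(2) Y(2))
qed

context fd_algebra_over
begin

lemma block_zero_biproduct_exists:
  fixes P Q :: "'a gmat"
  assumes Q: "in_block 0 0 Q" "Q * Q = Q" and P: "P * P = P"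
  obtains B i1 i2 p1 p2 where "in_block 0 0 B" "ring_biproduct B Q P i1 i2 p1 p2"
proof -
  obtain X u v where X: "is_complex X" "in_block 0 0 (idem (tot X))" "inverse_maps P (idem (tot X)) u v"
    using stalk_of_exists[OF P] unfolding stalk_of_def by blast
  have "idem (tot X) * idem (tot X) = idem (tot X)"
    by (rule graded_complex.idem_idem[OF graded_complex_tot[OF X(1)]])
  from block_biproduct_exists[OF X(2) this Q] obtain B i1 i2 p1 p2
    where B: "in_block 0 0 B" "ring_biproduct B (idem (tot X)) Q i1 i2 p1 p2" .
  show thesis
    using that[OF B(1)] ring_biproduct.swap[OF ring_biproduct.precompose_left[OF B(2) X(3)]] by blast
qed

lemma common_terms:
  fixes P Q P' Q' :: "'a gmat"
  assumes "two_term_blocks P Q" "two_term_blocks P' Q'"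
    and eq: "proj_summands Q + proj_summands P' = proj_summands Q' + proj_summands P"
  obtains p q k1 k2 r1 r2 i1 i2 p1 p2 j1 j2 q1 q2 where "two_term_blocks p q"
    "ring_biproduct p P P' k1 k2 r1 r2" "ring_biproduct q Q P' i1 i2 p1 p2"
      "ring_biproduct q Q' P j1 j2 q1 q2"
proof -
  interpret X: two_term_blocks P Q by fact
  interpret Y: two_term_blocks P' Q' by fact
  obtain p k1 k2 r1 r2 where p: "in_block (-1) (-1) p" "ring_biproduct p P P' k1 k2 r1 r2"
    by (rule block_biproduct_exists[OF X.block_P X.idem_P Y.block_P Y.idem_P])
  obtain q i1 i2 p1 p2 where q: "in_block 0 0 q" "ring_biproduct q Q P' i1 i2 p1 p2"
    by (rule block_zero_biproduct_exists[OF X.block_Q X.idem_Q Y.idem_P])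
  obtain q' j1 j2 q1 q2 where q': "in_block 0 0 q'" "ring_biproduct q' Q' P j1 j2 q1 q2"
    by (rule block_zero_biproduct_exists[OF Y.block_Q Y.idem_Q X.idem_P])
  note idem = ring_biproduct.idem_sum[OF p(2)] ring_biproduct.idem_sum[OF q(2)]
    ring_biproduct.idem_sum[OF q'(2)]
  have "proj_summands q' = proj_summands q"
    using eq by (simp add: proj_summands_biproduct[OF q(2)] proj_summands_biproduct[OF q'(2)])
  then obtain u v where "inverse_maps q' q u v" using proj_summands_eq_iff[OF idem(3,2)] by blast
  from ring_biproduct.transport[OF q'(2) this]
  have "ring_biproduct q Q' P (u * j1) (u * j2) (q1 * v) (q2 * v)" .
  moreover have "two_term_blocks p q" using p(1) q(1) idem by unfold_locales
  ultimately show thesis using that p(2) q(2) by blast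
qed

lemma enlarge_terms:
  assumes X: "two_term X" and blocks: "two_term_blocks p q"
    and p: "ring_biproduct p (degree_part (-1) (idem (tot X))) R k1 k2 r1 r2"
    and q: "ring_biproduct q (degree_part 0 (idem (tot X))) R i1 i2 p1 p2"
  obtains a V where "two_term_map scale p q a V" "K.iso X V"
proof -
  let ?P = "degree_part (-1) (idem (tot X))" and ?Q = "degree_part 0 (idem (tot X))"
  note X_tot = two_term_tot[OF X]
  interpret contractible_sum ?P ?Q p q R k1 k2 r1 r2 i1 i2 p1 p2 "dif (tot X)"
    by (rule contractible_sum.intro[OF X_tot(1) blocks p q]) (unfold_locales, rule X_tot(2))
  obtain V where V: "is_complex V" "tot V = (p + q, sum_map)"
    by (rule complex_realization[OF sum.graded_complex_map[OF sum_map_corner]])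
  have "htpy_iso (tot X) (tot V)" using sum_htpy_iso unfolding V(2) X_tot(3)[symmetric] .
  then have "K.iso X V"
    using V(1) two_term_complex[OF X] by (simp add: htpy_equiv_iff flip: htpy_equiv_iff_iso)
  moreover have "two_term_map scale p q sum_map V" using V sum_map_corner by unfold_locales
  ultimately show thesis using that by blast
qed

end

lemma (in two_term_map) two_term: "two_term X"
proof -
  have "degrees P \<subseteq> {-1}" "degrees Q \<subseteq> {0}"
    using in_block_iff_degrees[of P "-1"] in_block_iff_degrees[of Q 0]
      in_block_homogeneous[OF block_P] in_block_homogeneous[OF block_Q] block_P block_Q by simp_all
  moreover have "degrees (P + Q) \<subseteq> degrees P \<union> degrees Q"
    unfolding degrees_def support_def by fastforce
  ultimately show ?thesis using complex by (auto simp: two_term_iff tot)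
qed

lemma (in two_term_map) jointly_generate_of_rigid:
  assumes "no_positive_ext (tot X) (tot X)" shows "jointly_generate P Q d d"
  using jointly_generate_of_ext1_zero[OF map map] assms
  unfolding two_term_no_positive_ext_iff[OF two_term two_term] by (simp add: tot)

subsection \<open>g-vectors\<close>

context fd_algebra_over
begin

definition g_vector :: "'a cplx \<Rightarrow> 'a cplx set \<Rightarrow> int" where
  "g_vector X s = int (count (terms 0 X) s) - int (count (terms (-1) X) s)"

lemma g_vector_eq_iff: "g_vector X = g_vector Y \<longleftrightarrow> terms 0 X + terms (-1) Y = terms 0 Y + terms (-1) X"
proof -
  have "g_vector X s = g_vector Y s \<longleftrightarrow>
      count (terms 0 X + terms (-1) Y) s = count (terms 0 Y + terms (-1) X) s" for s
    unfolding g_vector_def by auto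
  then show ?thesis by (simp add: fun_eq_iff multiset_eq_iff)
qed

lemma g_vector_zero: "g_vector zero_cplx s = 0"
  and g_vector_dsum: "is_complex X \<Longrightarrow> is_complex Y \<Longrightarrow> g_vector (X \<oplus>\<^sub>K Y) s = g_vector X s + g_vector Y s"
  by (simp_all add: g_vector_def terms_zero terms_dsum)

lemma g_vector_outside:
  assumes "is_complex X" "s \<notin># K.summands alg_cplx" shows "g_vector X s = 0"
proof -
  have "s \<notin># terms t X" for t using terms_subset[OF assms(1)] assms(2) by blast
  then have "count (terms t X) s = 0" for t unfolding count_eq_zero_iff .
  then show ?thesis unfolding g_vector_def by simp
qed

proposition rigid_eq_g_vectors_disjoint_zero:
  assumes X: "two_term X" "no_positive_ext (tot X) (tot X)"
    and Y: "two_term Y" "no_positive_ext (tot Y) (tot Y)"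
    and eq: "g_vector X = g_vector Y"
    and disjoint: "set_mset (K.summands X) \<inter> set_mset (K.summands Y) = {}"
  shows "K.summands X = {#}" and "K.summands Y = {#}"
proof -
  obtain p q k1 k2 r1 r2 i1 i2 p1 p2 j1 j2 q1 q2 where blocks: "two_term_blocks p q"
    and p: "ring_biproduct p (degree_part (-1) (idem (tot X))) (degree_part (-1) (idem (tot Y))) k1 k2 r1 r2"
    and q: "ring_biproduct q (degree_part 0 (idem (tot X))) (degree_part (-1) (idem (tot Y))) i1 i2 p1 p2"
      "ring_biproduct q (degree_part 0 (idem (tot Y))) (degree_part (-1) (idem (tot X))) j1 j2 q1 q2"
    by (rule common_terms[OF two_term_tot(1)[OF X(1)] two_term_tot(1)[OF Y(1)]
          eq[unfolded g_vector_eq_iff terms_def]])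
  obtain a V where a: "two_term_map scale p q a V" and XV: "K.iso X V"
    by (rule enlarge_terms[OF X(1) blocks p q(1)])
  obtain b W where b: "two_term_map scale p q b W" and YW: "K.iso Y W"
    by (rule enlarge_terms[OF Y(1) blocks ring_biproduct.swap[OF p] q(2)])
  interpret VW: two_term_map_pair scale p q a b V W
    using a b unfolding two_term_map_pair_def two_term_map_def by blast
  interpret WV: two_term_map_pair scale p q b a W V
    using a b unfolding two_term_map_pair_def two_term_map_def by blast
  have summands: "K.summands V = K.summands X" "K.summands W = K.summands Y"
    using K.summands_iso[OF XV] K.summands_iso[OF YW] by simp_all
  have "jointly_generate p q a a" "jointly_generate p q b b"
    using VW.X.jointly_generate_of_rigid VW.Y.jointly_generate_of_rigid X(2) Y(2)
      no_positive_ext_iso[OF XV XV] no_positive_ext_iso[OF YW YW] by blast+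
  then obtain c c' where "c \<in> corner q p" "q = a * c" "c' \<in> corner q p" "q = b * c'"
    using VW.split_surjection WV.split_surjection disjoint unfolding summands by (metis inf_commute)
  then have "K.summands X = K.summands Y" using VW.summands_eq_of_split_surjections summands by simp
  then show "K.summands X = {#}" "K.summands Y = {#}" using disjoint by simp_all
qed

end

subsection \<open>Linear independence of g-vectors\<close>

lemma sum_eliminate_pivot:
  fixes v :: "'c \<Rightarrow> 's \<Rightarrow> int"
  assumes "finite D" "p \<notin> D"
  shows "(\<Sum>c\<in>insert p D. (if c = p then - (\<Sum>c\<in>D. a c * v c s) else v p s * a c) * v c t) =
    (\<Sum>c\<in>D. a c * (v p s * v c t - v c s * v p t))"
proof -
  have "(\<Sum>c\<in>D. (if c = p then - (\<Sum>c\<in>D. a c * v c s) else v p s * a c) * v c t) = (\<Sum>c\<in>D. v p s * a c * v c t)"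
    using assms(2) by (intro sum.cong) auto
  then have "(\<Sum>c\<in>insert p D. (if c = p then - (\<Sum>c\<in>D. a c * v c s) else v p s * a c) * v c t) =
      (\<Sum>c\<in>D. v p s * a c * v c t) - (\<Sum>c\<in>D. a c * v c s) * v p t"
    using assms by simp
  also have "\<dots> = (\<Sum>c\<in>D. a c * (v p s * v c t - v c s * v p t))"
    unfolding sum_distrib_right sum_subtractf[symmetric] by (intro sum.cong) (simp_all add: algebra_simps)
  finally show ?thesis .
qed

lemma integer_relation_exists:
  fixes v :: "'c \<Rightarrow> 's \<Rightarrow> int"
  assumes "finite S" "finite C" "card S < card C"
  shows "\<exists>a. (\<exists>c\<in>C. a c \<noteq> 0) \<and> (\<forall>s\<in>S. (\<Sum>c\<in>C. a c * v c s) = 0)"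
  using assms
proof (induction S arbitrary: C v rule: finite_induct)
  case empty
  then have "C \<noteq> {}" by auto
  then show ?case by (intro exI[of _ "\<lambda>_. 1"]) auto
next
  case (insert s S)
  show ?case
  proof (cases "\<forall>c\<in>C. v c s = 0")
    case True
    have "card S < card C" using insert.hyps insert.prems by simp
    from insert.IH[OF insert.prems(1) this, of v] obtain a where
      "\<exists>c\<in>C. a c \<noteq> 0" "\<forall>s\<in>S. (\<Sum>c\<in>C. a c * v c s) = 0" by blast
    then show ?thesis using True by (intro exI[of _ a]) simp
  next
    case False
    then obtain p where p: "p \<in> C" "v p s \<noteq> 0" by blast
    define D where "D = C - {p}"
    have C: "C = insert p D" "finite D" "p \<notin> D" unfolding D_def using p insert.prems(1) by auto
    have "card S < card D" using insert.hyps insert.prems(2) C by simp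
    from insert.IH[OF C(2) this, of "\<lambda>c t. v p s * v c t - v c s * v p t"] obtain a where
      a: "\<exists>c\<in>D. a c \<noteq> 0" "\<forall>t\<in>S. (\<Sum>c\<in>D. a c * (v p s * v c t - v c s * v p t)) = 0" by blast
    let ?b = "\<lambda>c. if c = p then - (\<Sum>c\<in>D. a c * v c s) else v p s * a c"
    have "(\<Sum>c\<in>C. ?b c * v c t) = 0" if "t \<in> insert s S" for t
      unfolding C(1) sum_eliminate_pivot[OF C(2,3)] using that a(2) by (auto simp: mult.commute)
    moreover have "\<exists>c\<in>C. ?b c \<noteq> 0"
    proof -
      obtain c where "c \<in> D" "a c \<noteq> 0" using a(1) by blast
      then have "c \<in> C" "?b c \<noteq> 0" using C p(2) by auto
      then show ?thesis by blast
    qed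
    ultimately show ?thesis by (intro exI[of _ ?b]) blast
  qed
qed

context fd_algebra_over
begin

lemma list_sum_replicate:
  assumes "is_complex T"
  shows "K.summands (K.list_sum (replicate n T)) = repeat_mset n (K.summands T)"
    and "g_vector (K.list_sum (replicate n T)) s = int n * g_vector T s"
proof -
  have "is_complex (K.list_sum (replicate n T))" for n using assms by (intro K.ob_list_sum) simp
  note complexes = assms this
  show "K.summands (K.list_sum (replicate n T)) = repeat_mset n (K.summands T)"
    by (induction n) (simp_all add: K.summands_zero K.summands_sum[OF complexes])
  show "g_vector (K.list_sum (replicate n T)) s = int n * g_vector T s"
    by (induction n) (simp_all add: g_vector_zero g_vector_dsum[OF complexes] distrib_right)
qed

lemma two_term_combination_exists:
  assumes "finite I" "\<forall>i\<in>I. two_term (T i)"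
  shows "\<exists>X. two_term X \<and> K.summands X = (\<Sum>i\<in>I. repeat_mset (n i) (K.summands (T i))) \<and>
    (\<forall>s. g_vector X s = (\<Sum>i\<in>I. int (n i) * g_vector (T i) s))"
  using assms
proof (induction I rule: finite_induct)
  case empty
  then show ?case using two_term_zero K.summands_zero g_vector_zero by (intro exI[of _ zero_cplx]) simp
next
  case (insert i I)
  then obtain X where X: "two_term X" "K.summands X = (\<Sum>i\<in>I. repeat_mset (n i) (K.summands (T i)))"
    "\<forall>s. g_vector X s = (\<Sum>i\<in>I. int (n i) * g_vector (T i) s)" by auto
  let ?Y = "K.list_sum (replicate (n i) (T i))"
  have T: "two_term (T i)" using insert.prems by simp
  then have Y: "two_term ?Y" by (intro two_term_list_sum) simp
  note complexes = two_term_complex[OF Y] two_term_complex[OF X(1)]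
  have "two_term (?Y \<oplus>\<^sub>K X)" by (rule two_term_dsum[OF Y X(1)])
  moreover have "K.summands (?Y \<oplus>\<^sub>K X) = (\<Sum>i\<in>insert i I. repeat_mset (n i) (K.summands (T i)))"
    using insert.hyps list_sum_replicate(1)[OF two_term_complex[OF T]] X(2)
    by (simp add: K.summands_sum[OF complexes])
  moreover have "g_vector (?Y \<oplus>\<^sub>K X) s = (\<Sum>i\<in>insert i I. int (n i) * g_vector (T i) s)" for s
    using insert.hyps list_sum_replicate(2)[OF two_term_complex[OF T]] X(3)
    by (simp add: g_vector_dsum[OF complexes])
  ultimately show ?case by blast
qed

lemma face_vertex_complex:
  assumes "face C" "c \<in> C" obtains T where "two_term T" "K.summands T = {#c#}"
proof -
  have "face (set_mset {#c#})" using face_subset[OF assms(1), of "{c}"] assms(2) by simp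
  then show thesis using that by (rule face_two_term_presilting)
qed

lemma no_positive_ext_of_face:
  assumes "face C" "two_term X" "set_mset (K.summands X) \<subseteq> C" shows "no_positive_ext (tot X) (tot X)"
  using assms two_term_complex[OF assms(2)] unfolding face_def
  by (simp add: no_positive_ext_iff_summands) blast

theorem face_g_vectors_independent:
  assumes C: "face C" and T: "\<And>c. c \<in> C \<Longrightarrow> two_term (T c) \<and> K.summands (T c) = {#c#}"
    and relation: "\<And>s. (\<Sum>c\<in>C. a c * g_vector (T c) s) = 0" and c: "c \<in> C"
  shows "a c = 0"
proof -
  have "finite C" "\<forall>c\<in>C. two_term (T c)" using C T unfolding face_def by blast+
  note combination = two_term_combination_exists[OF this]
  obtain X where X: "two_term X" "K.summands X = (\<Sum>c\<in>C. repeat_mset (nat (a c)) (K.summands (T c)))"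
    "\<forall>s. g_vector X s = (\<Sum>c\<in>C. int (nat (a c)) * g_vector (T c) s)"
    using combination[where n = "\<lambda>c. nat (a c)"] by blast
  obtain Y where Y: "two_term Y" "K.summands Y = (\<Sum>c\<in>C. repeat_mset (nat (- a c)) (K.summands (T c)))"
    "\<forall>s. g_vector Y s = (\<Sum>c\<in>C. int (nat (- a c)) * g_vector (T c) s)"
    using combination[where n = "\<lambda>c. nat (- a c)"] by blast
  have count: "count (\<Sum>c\<in>C. repeat_mset (n c) (K.summands (T c))) d = (if d \<in> C then n d else 0)" for n d
  proof -
    have "count (\<Sum>c\<in>C. repeat_mset (n c) (K.summands (T c))) d = (\<Sum>c\<in>C. if c = d then n c else 0)"
      unfolding count_sum using T by (intro sum.cong) auto
    then show ?thesis using \<open>finite C\<close> by simp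
  qed
  have "g_vector X s - g_vector Y s = (\<Sum>c\<in>C. (int (nat (a c)) - int (nat (- a c))) * g_vector (T c) s)" for s
    by (simp add: X(3) Y(3) left_diff_distrib sum_subtractf)
  also have "\<dots> s = (\<Sum>c\<in>C. a c * g_vector (T c) s)" for s by (intro sum.cong) auto
  finally have "g_vector X = g_vector Y" by (simp add: relation fun_eq_iff)
  moreover have "set_mset (K.summands X) \<subseteq> C" "set_mset (K.summands Y) \<subseteq> C"
    and "set_mset (K.summands X) \<inter> set_mset (K.summands Y) = {}"
    unfolding X(2) Y(2) by (auto simp: set_mset_def count split: if_splits)
  ultimately have "K.summands X = {#}" "K.summands Y = {#}"
    using rigid_eq_g_vectors_disjoint_zero[OF X(1) _ Y(1)] no_positive_ext_of_face[OF C X(1)]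
      no_positive_ext_of_face[OF C Y(1)] by blast+
  then have "nat (a c) = 0" "nat (- a c) = 0"
    using X(2) Y(2) count[of "\<lambda>c. nat (a c)" c] count[of "\<lambda>c. nat (- a c)" c] c by simp_all
  then show ?thesis by simp
qed

corollary card_face_le:
  assumes C: "face C" shows "card C \<le> num_summands (alg_cplx :: 'a cplx)"
proof (rule ccontr)
  let ?S = "set_mset (K.summands alg_cplx)"
  assume "\<not> card C \<le> num_summands (alg_cplx :: 'a cplx)"
  then have less: "card ?S < card C" using num_summands_eq[OF is_complex_alg] by simp
  have "finite C" using C unfolding face_def by blast
  have "\<forall>c\<in>C. \<exists>T. two_term T \<and> K.summands T = {#c#}" using face_vertex_complex[OF C] by metis
  from bchoice[OF this] obtain T where T: "\<forall>c\<in>C. two_term (T c) \<and> K.summands (T c) = {#c#}" ..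
  obtain a :: "'a cplx set \<Rightarrow> int" where a: "\<exists>c\<in>C. a c \<noteq> 0"
    "\<forall>s\<in>?S. (\<Sum>c\<in>C. a c * g_vector (T c) s) = 0"
    using integer_relation_exists[OF finite_set_mset \<open>finite C\<close> less, of "\<lambda>c. g_vector (T c)"] by blast
  have "(\<Sum>c\<in>C. a c * g_vector (T c) s) = 0" for s
  proof (cases "s \<in> ?S")
    case False
    then have "g_vector (T c) s = 0" if "c \<in> C" for c
      using g_vector_outside[OF two_term_complex] T that by blast
    then show ?thesis by simp
  qed (use a(2) in blast)
  then have "a c = 0" if "c \<in> C" for c using face_g_vectors_independent[OF C _ _ that] T by blast
  then show False using a(1) by blast
qed

end

section \<open>Counting\<close>

lemma card_image_cong_kernel:
  assumes kernel: "\<And>x y. x \<in> S \<Longrightarrow> y \<in> S \<Longrightarrow> f x = f y \<longleftrightarrow> g x = g y"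
  shows "card (f ` S) = card (g ` S)"
proof -
  define h where "h c = g (SOME x. x \<in> S \<and> f x = c)" for c
  have h: "h (f x) = g x" if "x \<in> S" for x
  proof -
    have "\<exists>y. y \<in> S \<and> f y = f x" using that by blast
    from someI_ex[OF this] show ?thesis unfolding h_def using kernel that by blast
  qed
  have "inj_on h (f ` S)" using kernel h by (auto intro!: inj_onI)
  moreover have "h ` f ` S = g ` S" using h by (auto simp: image_image)
  ultimately show ?thesis using card_image by metis
qed

lemma multisets_of_support_eq:
  assumes S: "finite S"
  shows "{M. set_mset M = S \<and> size M \<le> l} =
    (+) (mset_set S) ` (\<Union>k\<in>{k. card S + k \<le> l}. multisets_of_size S k)"
proof (intro equalityI subsetI)
  fix M assume M: "M \<in> {M. set_mset M = S \<and> size M \<le> l}"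
  then have "mset_set S \<subseteq># M" using mset_set_set_mset_msubset[of M] by simp
  then obtain K where K: "M = mset_set S + K" by (auto simp: mset_subset_eq_exists_conv)
  then have "K \<in> multisets_of_size S (size K)" "card S + size K \<le> l"
    using M by (auto simp: multisets_of_size_def)
  then show "M \<in> (+) (mset_set S) ` (\<Union>k\<in>{k. card S + k \<le> l}. multisets_of_size S k)" using K by blast
qed (use S in \<open>auto simp: multisets_of_size_def\<close>)

lemma finite_multisets_of_support:
  assumes "finite S" shows "finite {M. set_mset M = S \<and> size M \<le> l}"
proof -
  have "{k. card S + k \<le> l} \<subseteq> {..l}" by auto
  then show ?thesis
    unfolding multisets_of_support_eq[OF assms]
    using finite_subset finite_multisets_of_size[OF assms] by blast
qed

lemma card_multisets_of_support:
  assumes S: "finite S" shows "card {M. set_mset M = S \<and> size M \<le> l} = l choose card S"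
proof (cases "card S \<le> l")
  case True
  have "{k. card S + k \<le> l} = {..l - card S}" using True by auto
  then have "card {M. set_mset M = S \<and> size M \<le> l} = card (\<Union>k\<le>l - card S. multisets_of_size S k)"
    unfolding multisets_of_support_eq[OF S] by (simp add: card_image)
  also have "\<dots> = (\<Sum>k\<le>l - card S. (card S + k - 1) choose k)"
    using S by (subst card_UN_disjoint) (auto simp: card_multisets_of_size, auto simp: multisets_of_size_def)
  also have "\<dots> = l choose card S"
  proof (cases "card S")
    case 0
    have "(\<Sum>k\<le>l. (k - 1) choose k) = (\<Sum>k\<in>{0}. (k - 1) choose k)"
      by (rule sum.mono_neutral_right) auto
    then show ?thesis using 0 by simp
  next
    case (Suc r)
    then have "(\<Sum>k\<le>l - card S. (card S + k - 1) choose k) = Suc (r + (l - card S)) choose (l - card S)"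
      by (simp add: sum_choose_lower)
    then show ?thesis using True Suc binomial_symmetric[OF True] by simp
  qed
  finally show ?thesis .
next
  case False
  then have "{k. card S + k \<le> l} = {}" by auto
  then show ?thesis unfolding multisets_of_support_eq[OF S] using False by simp
qed

lemma alternating_binomial_Suc:
  fixes g :: "nat \<Rightarrow> int"
  shows "(\<Sum>k\<le>Suc m. (-1) ^ k * int (Suc m choose k) * g k) =
    (\<Sum>k\<le>m. (-1) ^ k * int (m choose k) * (g k - g (Suc k)))"
proof -
  have "(\<Sum>k\<le>m. (-1) ^ k * int (m choose k) * g k) = (\<Sum>k\<le>Suc m. (-1) ^ k * int (m choose k) * g k)" by simp
  also have "\<dots> = g 0 + (\<Sum>k\<le>m. (-1) ^ Suc k * int (m choose Suc k) * g (Suc k))"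
    by (subst sum.atMost_Suc_shift) simp
  finally have shifted: "(\<Sum>k\<le>m. (-1) ^ k * int (m choose k) * g k) =
    g 0 + (\<Sum>k\<le>m. (-1) ^ Suc k * int (m choose Suc k) * g (Suc k))" .
  have "(\<Sum>k\<le>Suc m. (-1) ^ k * int (Suc m choose k) * g k) =
    g 0 + (\<Sum>k\<le>m. (-1) ^ Suc k * int (Suc m choose Suc k) * g (Suc k))"
    by (subst sum.atMost_Suc_shift) simp
  also have "(\<Sum>k\<le>m. (-1) ^ Suc k * int (Suc m choose Suc k) * g (Suc k)) =
    (\<Sum>k\<le>m. (-1) ^ Suc k * int (m choose Suc k) * g (Suc k) - (-1) ^ k * int (m choose k) * g (Suc k))"
    by (intro sum.cong) (auto simp: algebra_simps)
  also have "g 0 + \<dots> = (\<Sum>k\<le>m. (-1) ^ k * int (m choose k) * g k)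
    - (\<Sum>k\<le>m. (-1) ^ k * int (m choose k) * g (Suc k))"
    unfolding shifted sum_subtractf by simp
  also have "\<dots> = (\<Sum>k\<le>m. (-1) ^ k * int (m choose k) * (g k - g (Suc k)))"
    by (simp add: right_diff_distrib flip: sum_subtractf)
  finally show ?thesis .
qed

lemma alternating_binomial_sum:
  "(\<Sum>k\<le>m. (-1) ^ k * int (m choose k) * int ((N + m - k) choose (r + m))) = int (N choose r)"
proof (induction m)
  case (Suc m)
  have "(\<Sum>k\<le>Suc m. (-1) ^ k * int (Suc m choose k) * int ((N + Suc m - k) choose (r + Suc m))) =
    (\<Sum>k\<le>m. (-1) ^ k * int (m choose k) *
      (int ((N + Suc m - k) choose (r + Suc m)) - int ((N + Suc m - Suc k) choose (r + Suc m))))"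
    by (rule alternating_binomial_Suc)
  also have "\<dots> = (\<Sum>k\<le>m. (-1) ^ k * int (m choose k) * int ((N + m - k) choose (r + m)))"
    by (intro sum.cong) (auto simp: Suc_diff_le)
  finally show ?case using Suc by simp
qed simp

lemma sum_triangle_swap:
  fixes a :: "nat \<Rightarrow> nat \<Rightarrow> 'a::comm_monoid_add"
  shows "(\<Sum>j = 0..n. \<Sum>i = 0..j. a i j) = (\<Sum>i = 0..n. \<Sum>j = i..n. a i j)"
  by (induction n) (simp_all add: sum.distrib add.assoc)

lemma h_vector_transform_coefficient:
  assumes "i \<le> n"
  shows "(\<Sum>j = i..n. int ((n + l - j) choose n) * ((-1) ^ (j - i) * int ((n - i) choose (j - i)))) =
    int (l choose i)"
proof -
  obtain m where n: "n = i + m" using assms le_Suc_ex by blast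
  let ?t = "\<lambda>j. int ((n + l - j) choose n) * ((-1) ^ (j - i) * int ((n - i) choose (j - i)))"
  have "sum ?t {i..n} = sum ?t {0 + i..m + i}" by (simp add: n add.commute)
  also have "\<dots> = (\<Sum>k = 0..m. ?t (k + i))" by (rule sum.shift_bounds_cl_nat_ivl)
  also have "\<dots> = (\<Sum>k\<le>m. (-1) ^ k * int (m choose k) * int ((l + m - k) choose (i + m)))"
    unfolding atMost_atLeast0 by (intro sum.cong) (auto simp: n algebra_simps)
  finally show ?thesis by (simp only: alternating_binomial_sum)
qed

lemma h_vector_transform:
  fixes f :: "nat \<Rightarrow> int"
  shows "(\<Sum>j = 0..n. int ((n + l - j) choose n) *
    (\<Sum>i = 0..j. (-1) ^ (j - i) * int ((n - i) choose (j - i)) * f i)) =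
    (\<Sum>i = 0..n. int (l choose i) * f i)"
proof -
  let ?t = "\<lambda>i j. int ((n + l - j) choose n) * ((-1) ^ (j - i) * int ((n - i) choose (j - i)))"
  have "(\<Sum>j = 0..n. int ((n + l - j) choose n) * (\<Sum>i = 0..j. (-1) ^ (j - i)
    * int ((n - i) choose (j - i)) * f i)) =
      (\<Sum>j = 0..n. \<Sum>i = 0..j. ?t i j * f i)"
    by (simp add: sum_distrib_left mult.assoc)
  also have "\<dots> = (\<Sum>i = 0..n. \<Sum>j = i..n. ?t i j * f i)" by (rule sum_triangle_swap)
  also have "\<dots> = (\<Sum>i = 0..n. int (l choose i) * f i)"
    by (intro sum.cong) (simp_all add: h_vector_transform_coefficient flip: sum_distrib_right)
  finally show ?thesis .
qed

context fd_algebra_over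
begin

lemma card_iso_classes:
  assumes "\<And>X. X \<in> S \<Longrightarrow> is_complex X" shows "card (iso_class ` S) = card (K.summands ` S)"
  by (rule card_image_cong_kernel)
    (use assms in \<open>simp add: iso_class_eq K.iso_class_of_eq_iff K.iso_iff_summands\<close>)

lemma summands_basic_presilting:
  "K.summands ` {T :: 'a cplx. two_term T \<and> presilting T \<and> basic T \<and> num_summands T = j} =
    mset_set ` {C. face C \<and> card C = j}" (is "K.summands ` ?S = mset_set ` ?F")
proof (intro equalityI subsetI)
  fix M assume "M \<in> K.summands ` ?S"
  then obtain T where T: "M = K.summands T" "two_term T" "presilting T" "basic T"
    "num_summands T = j" by blast
  have count: "count M c \<le> 1" for c using T(1,4) unfolding basic_iff by blast
  have "count M c = (if c \<in># M then 1 else 0)" for c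
    using count[of c] by (cases "c \<in># M") (simp_all add: le_Suc_eq count_eq_zero_iff)
  then have "M = mset_set (set_mset M)" by (intro multiset_eqI) (simp add: count_mset_set')
  moreover have "set_mset M \<in> ?F"
    using two_term_presilting_face[OF T(2,3)] num_summands_eq[OF two_term_complex[OF T(2)]] T(1,5) by simp
  ultimately show "M \<in> mset_set ` ?F" by (rule image_eqI)
next
  fix M assume "M \<in> mset_set ` ?F"
  then obtain C where C: "M = mset_set C" "face C" "card C = j" by blast
  have "finite C" using C(2) unfolding face_def by blast
  then have "face (set_mset M)" using C by simp
  then obtain T where T: "two_term T" "presilting T" "K.summands T = M" by (rule face_two_term_presilting)
  have "basic T" "num_summands T = j"
    using two_term_complex[OF T(1)] C(3) \<open>finite C\<close> unfolding basic_iff T(3) C(1)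
    by (simp_all add: count_mset_set' num_summands_eq T(3) C(1))
  then have "T \<in> ?S" using T(1,2) by simp
  then show "M \<in> K.summands ` ?S" using T(3) by (intro image_eqI) simp_all
qed

lemma psilt_count_eq: "psilt_count TYPE('a) j = card {C. face C \<and> card C = j}"
proof -
  have "inj_on mset_set {C. face C \<and> card C = j}"
    by (rule inj_on_inverseI[of _ set_mset]) (simp add: face_def)
  then have "card (K.summands ` {T :: 'a cplx. two_term T \<and> presilting T \<and> basic T \<and> num_summands T = j}) =
      card {C. face C \<and> card C = j}"
    unfolding summands_basic_presilting by (rule card_image)
  then show ?thesis unfolding psilt_count_def by (subst card_iso_classes) (simp_all add: two_term_complex)
qed

lemma length_decomposition_iff:
  assumes "is_complex X"
  shows "(\<exists>Xs. length Xs \<le> l \<and> (\<forall>Y\<in>set Xs. indec Y) \<and> X \<simeq>\<^sub>K dsum_list Xs) \<longleftrightarrow> size (K.summands X) \<le> l"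
proof
  assume "\<exists>Xs. length Xs \<le> l \<and> (\<forall>Y\<in>set Xs. indec Y) \<and> X \<simeq>\<^sub>K dsum_list Xs"
  then obtain Xs where Xs: "length Xs \<le> l" "\<forall>Y\<in>set Xs. K.indec Y" "K.iso X (K.list_sum Xs)"
    unfolding indec_iff htpy_equiv_iff_iso dsum_list_eq by blast
  then show "size (K.summands X) \<le> l" using K.summands_eqI[OF Xs(2,3)] by simp
next
  assume size: "size (K.summands X) \<le> l"
  obtain Xs where Xs: "\<forall>Y\<in>set Xs. K.indec Y" "K.iso X (K.list_sum Xs)"
    "K.summands X = mset (map K.iso_class_of Xs)"
    by (rule K.decompositionE[OF assms])
  then have "length Xs \<le> l" using size by simp
  then show "\<exists>Xs. length Xs \<le> l \<and> (\<forall>Y\<in>set Xs. indec Y) \<and> X \<simeq>\<^sub>K dsum_list Xs"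
    unfolding indec_iff htpy_equiv_iff_iso dsum_list_eq using Xs(1,2) by blast
qed

lemma psilt_oplus_le_count_eq: "psilt_oplus_le_count TYPE('a) l = card {M. face (set_mset M) \<and> size M \<le> l}"
proof -
  let ?S = "{T :: 'a cplx. two_term T \<and> presilting T \<and> size (K.summands T) \<le> l}"
  have "K.summands ` ?S \<subseteq> {M. face (set_mset M) \<and> size M \<le> l}" using two_term_presilting_face by blast
  moreover have "M \<in> K.summands ` ?S" if M: "face (set_mset M)" "size M \<le> l" for M
  proof -
    obtain T where "two_term T" "presilting T" "K.summands T = M" by (rule face_two_term_presilting[OF M(1)])
    then show ?thesis using M(2) by (intro image_eqI[of _ _ T]) simp_all
  qed
  ultimately have "K.summands ` ?S = {M. face (set_mset M) \<and> size M \<le> l}" by blast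
  moreover have "{T :: 'a cplx. two_term T \<and> presilting T \<and>
      (\<exists>Ts. length Ts \<le> l \<and> (\<forall>Y\<in>set Ts. indec Y) \<and> T \<simeq>\<^sub>K dsum_list Ts)} = ?S"
    using length_decomposition_iff[OF two_term_complex] by blast
  ultimately show ?thesis
    unfolding psilt_oplus_le_count_def by (subst card_iso_classes) (simp_all add: two_term_complex)
qed

lemma finite_faces:
  assumes "g_finite TYPE('a)" shows "finite {C. face C}"
proof (rule finite_subset)
  show "{C. face C} \<subseteq> Pow {c. face {c}}" using face_subset by blast
qed (simp add: finite_vertices[OF assms])

lemma fvec_eq: "fvec TYPE('a) i = int (card {C. face C \<and> card C = i})"
proof (cases "i = 0")
  case True
  have "{C. face C \<and> card C = 0} = {{}}" unfolding face_def by (auto simp: card_eq_0_iff)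
  then show ?thesis using True by (simp add: fvec_def)
qed (simp add: fvec_def psilt_count_eq)

proposition psilt_oplus_le_count_binomial:
  assumes "g_finite TYPE('a)"
  shows "int (psilt_oplus_le_count TYPE('a) l) =
    (\<Sum>i = 0..num_summands (alg_cplx :: 'a cplx). int (l choose i) * fvec TYPE('a) i)"
proof -
  let ?n = "num_summands (alg_cplx :: 'a cplx)"
  let ?M = "\<lambda>C :: 'a cplx set set. {M. set_mset M = C \<and> size M \<le> l}"
  note finite = finite_faces[OF assms]
  have finite_face: "finite C" if "face C" for C using that unfolding face_def by blast
  have "{M. face (set_mset M) \<and> size M \<le> l} = (\<Union>C\<in>{C. face C}. ?M C)" by blast
  then have "psilt_oplus_le_count TYPE('a) l = (\<Sum>C\<in>{C. face C}. card (?M C))"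
    unfolding psilt_oplus_le_count_eq
    using finite_face by (simp add: finite card_UN_disjoint finite_multisets_of_support disjoint_iff)
  also have "\<dots> = (\<Sum>C\<in>{C. face C}. l choose card C)"
    using finite_face by (intro sum.cong) (simp_all add: card_multisets_of_support)
  also have "\<dots> = (\<Sum>i = 0..?n. \<Sum>C\<in>{C \<in> {C. face C}. card C = i}. l choose card C)"
    using card_face_le by (intro sum.group[symmetric] finite) auto
  also have "\<dots> = (\<Sum>i = 0..?n. (l choose i) * card {C. face C \<and> card C = i})"
    by (intro sum.cong) (simp_all add: mult.commute)
  finally show ?thesis by (simp add: fvec_eq)
qed

end

theorem theorem5p5:
  fixes scale :: "'k::field \<Rightarrow> 'a::ring_1 \<Rightarrow> 'a"
  assumes "fd_algebra scale"
    and "g_finite TYPE('a)"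
  shows "\<forall>l::nat. int (psilt_oplus_le_count TYPE('a) l) =
           (\<Sum>j = 0..num_summands (alg_cplx :: 'a cplx).
              int ((num_summands (alg_cplx :: 'a cplx) + l - j) choose
                   (num_summands (alg_cplx :: 'a cplx)))
              * hvec TYPE('a) (num_summands (alg_cplx :: 'a cplx)) j)"
proof -
  interpret fd_algebra_over scale by unfold_locales (rule assms(1))
  show ?thesis unfolding hvec_def h_vector_transform using psilt_oplus_le_count_binomial[OF assms(2)] by blast
qed

end
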